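(* Let $n,p$ be positive integers and let $\alpha,\beta\in\mathbb{R}$ with $n+\alpha>0$ and $\beta>-1$. The polyharmonic weighted Bergman kernel $R_{p,\alpha,\beta}$ is given by $$R_{p,\alpha,\beta}(x,y)=\frac{1}{n\Omega_n}\sum_{m=0}^{\infty}\frac{2\Gamma\left(m+\frac{n+\alpha}{2}+\beta+1\right)}{ \Gamma(\beta+1)\Gamma\left(m+\frac{n+\alpha}{2}\right)}\, Z^p_m(x,y)\qquad(x,y\in\widehat{B}_p),$$ where the series converges absolutely and uniformly on $K\times \widehat{B}_p$ for every compact subset $K\subset \widehat{B}_p$.
   Context: Sets: $B$ and $S$ are the open unit ball and the unit sphere of $\mathbb{R}^n$ centred at $0$; $\widehat{B}_p=\bigcup_{k=0}^{p-1}e^{k\pi i/p}B\subset\mathbb{C}^n$, $\widehat{S}_p=\bigcup_{k=0}^{p-1}e^{k\pi i/p}S\subset\mathbb{C}^n$. $\Omega_n=\pi^{n/2}/\Gamma(n/2+1)$ is the volume of $B$, and $\sigma$ is the normalized surface measure on $S$. For $y\in B$, $|y|$ is the Euclidean norm. Polyharmonic functions: a complex-valued analytic function $u$ on $B$ is polyharmonic of order $p$ if $\Delta^p u=0$ on $B$; the space of these is $\mathcal{A}_{\Delta^p}(B)$. Each such $u$ has an expansion $u=\sum_{m\ge 0} q_m$ into homogeneous polynomials $q_m$ of degree $m$, converging on $B$, and is extended holomorphically to rotated balls by $u(e^{i\psi}x)=\sum_m e^{im\psi}q_m(x)$ ($\psi\in\mathbb{R}$, $x\in B$). In this way $u$ is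 regarded as a function on $\widehat{B}_p$. Weighted Bergman space: $b_{p,\alpha,\beta}^2(\widehat{B}_p)$ is the space of $u\in\mathcal{A}_{\Delta^p}(B)$ (extended to $\widehat{B}_p$) with $\langle u,u\rangle_{b_{p,\alpha,\beta}^2}<\infty$, where $\langle u,v\rangle_{b_{p,\alpha,\beta}^2}=\frac1p\sum_{k=0}^{p-1}\int_B u(e^{k\pi i/p}y)\overline{v(e^{k\pi i/p}y)}\,|y|^\alpha(1-|y|^2)^\beta dy$. It is a Hilbert space on which point evaluations at points of $\widehat{B}_p$ are bounded. Weighted Bergman kernel: for each $x\in\widehat{B}_p$, $R_{p,\alpha,\beta}(x,\cdot)\in b_{p,\alpha,\beta}^2(\widehat{B}_p)$ is the function given by the Riesz theorem such that $u(x)=\langle u,R_{p,\alpha,\beta}(x,\cdot)\rangle_{b_{p,\alpha,\beta}^2}=\frac1p\sum_{k=0}^{p-1}\int_B u(e^{k\pi i/p}y)\overline{R_{p,\alpha,\beta}(x,e^{k\pi i/p}y)}\,|y|^\alpha(1-|y|^2)^\beta dy$ for all $u\in b_{p,\alpha,\beta}^2(\widehat{B}_p)$. Zonal polyharmonics: $\mathcal{H}_m^p(\mathbb{C}^n)$ is the space of polynomials $q$ on $\mathbb{C}^n$ that are homogeneous of degree $m$ ($q(az)=a^mq(z)$ for $a\in\mathbb{C}$) and polyharmonic of order $p$ (i.e. $\Delta^pq=0$), and $\mathcal{H}_m^p(\widehat{S}_p)$ is the space of restrictions of its elements to $\widehat{S}_p$, with inner product $\langle f,g\rangle_{\widehat{S}_p}=\frac1p\int_S\sum_{j=0}^{p-1}f(e^{j\pi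 i/p}\zeta)\overline{g(e^{j\pi i/p}\zeta)}\,d\sigma(\zeta)$. For $\eta\in\widehat{S}_p$, $Z_m^p(\cdot,\eta)$ is the unique element of $\mathcal{H}_m^p(\widehat{S}_p)$ with $q(\eta)=\langle q,Z_m^p(\cdot,\eta)\rangle_{\widehat{S}_p}$ for all $q\in\mathcal{H}_m^p(\widehat{S}_p)$. It is extended to $\widehat{B}_p\times\widehat{B}_p$ by homogeneity: $Z_m^p(r\zeta,s\eta)=r^ms^mZ_m^p(\zeta,\eta)$ for $r,s\in[0,1)$, $\zeta,\eta\in\widehat{S}_p$ (with $0^0=1$).
   Formalization: The series is proved with Z_m^p(y,x) in place of Z_m^p(x,y): under the stated conventions R(x,y) is the complex conjugate of the printed sum, which fails e.g. for n=1, p=2, α=β=0, x=i/2, y=1/2; for p=1 the two orders agree. *)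

theory Defs
  imports "HOL-Analysis.Analysis"
begin

section \<open>Rotated balls and spheres\<close>

definition cvec :: "real^'n \<Rightarrow> complex^'n" where
  "cvec x = (\<chi> i. complex_of_real (x $ i))"

definition hat_ball :: "nat \<Rightarrow> (complex^'n) set" where
  "hat_ball p = (\<Union>k<p. (\<lambda>x. cis (real k * pi / real p) *s cvec x) ` ball 0 1)"

definition hat_sphere :: "nat \<Rightarrow> (complex^'n) set" where
  "hat_sphere p = (\<Union>k<p. (\<lambda>x. cis (real k * pi / real p) *s cvec x) ` sphere 0 1)"

text \<open>
  Normalized surface measure: the measure of a subset \<open>E\<close> of the sphere is the proportion of the
  unit ball occupied by the cone over \<open>E\<close>. It is a Borel measure on the whole space,
  concentrated on the unit sphere (the value \<open>sgn 0 = 0\<close> only concerns a null set).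
\<close>
definition sphere_measure :: "(real^'n) measure" where
  "sphere_measure = distr (uniform_measure lborel (ball 0 1)) borel sgn"


section \<open>Polyharmonic functions on the unit ball\<close>

definition real_analytic_on :: "(real^'n \<Rightarrow> complex) \<Rightarrow> (real^'n) set \<Rightarrow> bool" where
  "real_analytic_on f U \<longleftrightarrow>
     (\<forall>a\<in>U. \<exists>r>0. \<exists>c :: ('n \<Rightarrow> nat) \<Rightarrow> complex. \<forall>x\<in>ball a r.
        ((\<lambda>k. c k * complex_of_real (\<Prod>i\<in>UNIV. (x $ i - a $ i) ^ k i)) has_sum f x) UNIV)"

definition partial_deriv :: "'n \<Rightarrow> (real^'n \<Rightarrow> complex) \<Rightarrow> real^'n \<Rightarrow> complex" where
  "partial_deriv i f x = vector_derivative (\<lambda>t. f (x + t *\<^sub>R axis i 1)) (at 0)"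

definition laplacian :: "(real^'n \<Rightarrow> complex) \<Rightarrow> real^'n \<Rightarrow> complex" where
  "laplacian f x = (\<Sum>i\<in>UNIV. partial_deriv i (partial_deriv i f) x)"

definition polyharmonic_ball :: "nat \<Rightarrow> (real^'n \<Rightarrow> complex) set" where
  "polyharmonic_ball p =
     {u. real_analytic_on u (ball 0 1) \<and> (\<forall>x\<in>ball 0 1. (laplacian ^^ p) u x = 0)}"


section \<open>Homogeneous polynomials and the extension to rotated balls\<close>

definition complex_polynomial :: "(complex^'n \<Rightarrow> complex) \<Rightarrow> bool" where
  "complex_polynomial q \<longleftrightarrow>
     (\<exists>(A :: ('n \<Rightarrow> nat) set) c. finite A \<and>
        (\<forall>z. q z = (\<Sum>k\<in>A. c k * (\<Prod>i\<in>UNIV. (z $ i) ^ k i))))"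

definition homogeneous_polynomial :: "nat \<Rightarrow> (complex^'n \<Rightarrow> complex) \<Rightarrow> bool" where
  "homogeneous_polynomial m q \<longleftrightarrow>
     complex_polynomial q \<and> (\<forall>a z. q (a *s z) = a ^ m * q z)"

text \<open>
  Homogeneous polynomials on real space with complex coefficients are represented by the
  polynomials on complex space with the same coefficients.
\<close>
definition homogeneous_expansion ::
  "(real^'n \<Rightarrow> complex) \<Rightarrow> (nat \<Rightarrow> complex^'n \<Rightarrow> complex) \<Rightarrow> bool" where
  "homogeneous_expansion u q \<longleftrightarrow>
     (\<forall>m. homogeneous_polynomial m (q m)) \<and>
     (\<forall>x\<in>ball 0 1. (\<lambda>m. q m (cvec x)) sums u x)"

text \<open>
  The value at \<open>cis \<psi> *s cvec x\<close>. The description is unique because the expansion is unique and,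
  by homogeneity, each term of the series only depends on the point \<open>cis \<psi> *s cvec x\<close>.
\<close>
definition rot_ext :: "(real^'n \<Rightarrow> complex) \<Rightarrow> complex^'n \<Rightarrow> complex" where
  "rot_ext u z =
     (THE w. \<exists>q \<psi> x. homogeneous_expansion u q \<and> x \<in> ball 0 1 \<and> z = cis \<psi> *s cvec x \<and>
        (\<lambda>m. cis (real m * \<psi>) * q m (cvec x)) sums w)"


section \<open>The weighted Bergman space and its kernel\<close>

definition bergman_weight :: "real \<Rightarrow> real \<Rightarrow> real^'n \<Rightarrow> real" where
  "bergman_weight \<alpha> \<beta> y = norm y powr \<alpha> * (1 - (norm y)\<^sup>2) powr \<beta>"

definition bergman_inner ::
  "nat \<Rightarrow> real \<Rightarrow> real \<Rightarrow> (complex^'n \<Rightarrow> complex) \<Rightarrow> (complex^'n \<Rightarrow> complex) \<Rightarrow> complex" where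
  "bergman_inner p \<alpha> \<beta> u v =
     1 / of_nat p * (\<Sum>k<p. LINT y:ball 0 1|lborel.
        u (cis (real k * pi / real p) *s cvec y) * cnj (v (cis (real k * pi / real p) *s cvec y))
          * complex_of_real (bergman_weight \<alpha> \<beta> y))"

text \<open>
  Elements are functions on \<^term>\<open>hat_ball p\<close>, made extensional by \<^const>\<open>restrict\<close> so that
  equality is equality on \<^term>\<open>hat_ball p\<close>. Integrability of the nonnegative functions
  \<open>|u|\<^sup>2\<close> times the weight expresses finiteness of the norm.
\<close>
definition bergman_space :: "nat \<Rightarrow> real \<Rightarrow> real \<Rightarrow> (complex^'n \<Rightarrow> complex) set" where
  "bergman_space p \<alpha> \<beta> =
     {restrict (rot_ext u) (hat_ball p) | u. u \<in> polyharmonic_ball p \<and>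
        (\<forall>k<p. set_integrable lborel (ball 0 1)
           (\<lambda>y. (cmod (rot_ext u (cis (real k * pi / real p) *s cvec y)))\<^sup>2 * bergman_weight \<alpha> \<beta> y))}"

definition bergman_kernel ::
  "nat \<Rightarrow> real \<Rightarrow> real \<Rightarrow> complex^'n \<Rightarrow> complex^'n \<Rightarrow> complex" where
  "bergman_kernel p \<alpha> \<beta> x =
     (THE v. v \<in> bergman_space p \<alpha> \<beta> \<and>
        (\<forall>u\<in>bergman_space p \<alpha> \<beta>. u x = bergman_inner p \<alpha> \<beta> u v))"


section \<open>Zonal polyharmonics\<close>

definition cpartial_deriv :: "'n \<Rightarrow> (complex^'n \<Rightarrow> complex) \<Rightarrow> complex^'n \<Rightarrow> complex" where
  "cpartial_deriv i f z = deriv (\<lambda>t. f (z + t *s axis i 1)) 0"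

definition claplacian :: "(complex^'n \<Rightarrow> complex) \<Rightarrow> complex^'n \<Rightarrow> complex" where
  "claplacian f z = (\<Sum>i\<in>UNIV. cpartial_deriv i (cpartial_deriv i f) z)"

definition polyharmonic_polys :: "nat \<Rightarrow> nat \<Rightarrow> (complex^'n \<Rightarrow> complex) set" where
  "polyharmonic_polys p m =
     {q. homogeneous_polynomial m q \<and> (\<forall>z. (claplacian ^^ p) q z = 0)}"

definition spherical_polyharmonics :: "nat \<Rightarrow> nat \<Rightarrow> (complex^'n \<Rightarrow> complex) set" where
  "spherical_polyharmonics p m = (\<lambda>q. restrict q (hat_sphere p)) ` polyharmonic_polys p m"

definition hat_sphere_inner ::
  "nat \<Rightarrow> (complex^'n \<Rightarrow> complex) \<Rightarrow> (complex^'n \<Rightarrow> complex) \<Rightarrow> complex" where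
  "hat_sphere_inner p f g =
     1 / of_nat p * (LINT \<zeta>:sphere 0 1|sphere_measure. (\<Sum>j<p.
        f (cis (real j * pi / real p) *s cvec \<zeta>) * cnj (g (cis (real j * pi / real p) *s cvec \<zeta>))))"

text \<open>
  \<open>zonal_sphere p m \<zeta> \<eta>\<close> represents evaluation at its second argument, whereas
  \<^term>\<open>bergman_kernel p \<alpha> \<beta> x y\<close> represents evaluation at its first one. Both are
  conjugate-symmetric and in general not real, so an expansion of \<^term>\<open>bergman_kernel p \<alpha> \<beta> x y\<close>
  has to use zonal polyharmonics at \<open>(y, x)\<close>, which are the conjugates of those at \<open>(x, y)\<close>.
\<close>
definition zonal_sphere :: "nat \<Rightarrow> nat \<Rightarrow> complex^'n \<Rightarrow> complex^'n \<Rightarrow> complex" where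
  "zonal_sphere p m \<zeta> \<eta> =
     (THE f. f \<in> spherical_polyharmonics p m \<and>
        (\<forall>q\<in>spherical_polyharmonics p m. q \<eta> = hat_sphere_inner p q f)) \<zeta>"

text \<open>
  Homogeneous extension to the rotated ball. At the origin the value does not depend on the chosen
  point of the rotated sphere, since \<open>0 ^ m = 0\<close> for \<open>m > 0\<close> and \<open>zonal_sphere p 0\<close> is constant there.
\<close>
definition zonal :: "nat \<Rightarrow> nat \<Rightarrow> complex^'n \<Rightarrow> complex^'n \<Rightarrow> complex" where
  "zonal p m x y =
     (THE w. \<exists>r\<in>{0..<1::real}. \<exists>s\<in>{0..<1::real}. \<exists>\<zeta>\<in>hat_sphere p. \<exists>\<eta>\<in>hat_sphere p.
        x = r *\<^sub>R \<zeta> \<and> y = s *\<^sub>R \<eta> \<and>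
        w = complex_of_real (r ^ m * s ^ m) * zonal_sphere p m \<zeta> \<eta>)"


section \<open>Coefficients of the kernel series\<close>

definition bergman_coeff :: "real \<Rightarrow> real \<Rightarrow> real \<Rightarrow> nat \<Rightarrow> real" where
  "bergman_coeff n \<alpha> \<beta> m =
     2 * Gamma (real m + (n + \<alpha>) / 2 + \<beta> + 1) / (Gamma (\<beta> + 1) * Gamma (real m + (n + \<alpha>) / 2))"

end

theory Submission
  imports Defs "HOL-Complex_Analysis.Complex_Analysis" "HOL-Probability.Probability_Measure"
begin

text \<open>
The kernel is a sum over degrees because, for the averaged inner product, homogeneous polyharmonic
polynomials of different degrees are orthogonal. On the real sphere alone this fails, as \<open>|x|\<^sup>2\<close>
times a harmonic polynomial has the same restriction as the polynomial itself. Green's identity shows,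
however, that two polyharmonic polynomials of order \<open>p\<close> can only fail to be orthogonal on the sphere
if their degrees \<open>l\<close> and \<open>m\<close> differ by an even number less than \<open>2p\<close> in absolute value
(\<open>sphere_pair_orthogonal\<close>). Averaging over the \<open>p\<close> rotations multiplies their inner product by the sum
of the powers of \<open>exp ((l - m) \<pi> i / p)\<close>, which for such \<open>l \<noteq> m\<close> is a root of unity of order dividing \<open>p\<close>
and different from \<open>1\<close>, so that the sum vanishes (\<open>rotation_average_orthogonal\<close>). Within one degree \<open>m\<close> the
rotations cancel, the average is the inner product of the real sphere, and in polar coordinates the
weighted integral over the ball is that inner product times a Beta integral in the squared radius.
Hence the degree \<open>m\<close> part of the kernel is the zonal polyharmonic divided by this Beta integral, up to
the factor from polar coordinates, and the Beta integral is the quotient of Gamma values in the series.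

Turning this computation into a proof requires three analytic facts.

The zonal polyharmonics grow polynomially in \<open>m\<close> on the sphere. This follows from a Nikolskii
inequality, the sup norm of a homogeneous polynomial of degree \<open>m\<close> on the sphere being at most a constant times a
power of \<open>m + 1\<close> times its \<open>L\<^sup>2\<close> norm (\<open>nikolskii\<close>, \<open>zonal_kernel_exists\<close>). As the coefficients of the series
also grow polynomially, the series is dominated by a geometric one, uniformly for \<open>x\<close> in a compact set
and \<open>y\<close> in the whole rotated ball. For fixed \<open>x\<close> its sum is polyharmonic (\<open>series_polyharmonic\<close>) and
bounded, so it belongs to the Bergman space (\<open>kernel_elem_in_space\<close>).

A polyharmonic function \<open>u\<close> is the sum of its homogeneous Taylor polynomials \<open>q\<^sub>m\<close> on the whole ball, not
only near \<open>0\<close> (\<open>polyharmonic_expansion\<close>). The reason is again near-orthogonality. The spherical mean of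
\<open>u(r\<zeta>)\<close> against the conjugate of \<open>q\<^sub>l\<close> is for small \<open>r\<close> a finite combination of the powers \<open>r\<^sup>m\<close> with
\<open>|m - l| < 2p\<close>. Being real analytic in \<open>r\<close>, it is the same combination for all \<open>r < 1\<close>. Since \<open>u\<close> is
bounded on smaller balls, this bounds the \<open>L\<^sup>2\<close> norm of \<open>q\<^sub>l\<close>, and the Nikolskii inequality its sup norm.

The reproducing property follows by integrating these expansions (\<open>kernel_elem_reproducing\<close>). On a
sphere of radius less than \<open>1\<close> the expansion of \<open>u\<close> converges uniformly, so integrating \<open>u\<close> against
the degree \<open>m\<close> part of the kernel leaves only the contribution of \<open>q\<^sub>m\<close>; integration over the radius then
gives \<open>q\<^sub>m(x)\<close> (\<open>inner_kernel_term\<close>), and the sum over \<open>m\<close> may be taken under the integral because the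
kernel series has a summable bound. An element with the reproducing property is unique, since two of
them, \<open>v\<close> and \<open>w\<close>, at the points \<open>x\<close> and \<open>z\<close> satisfy that \<open>v(z)\<close> is the conjugate of \<open>w(x)\<close>.
\<close>

no_notation fps_nth (infixl "$" 75)

section \<open>Homogeneous polynomials and the Laplacian\<close>

definition mpow :: "'a::comm_semiring_1^'n::finite \<Rightarrow> ('n \<Rightarrow> nat) \<Rightarrow> 'a" where
  "mpow z k = (\<Prod>i\<in>UNIV. (z $ i) ^ k i)"

definition multi_indices :: "nat \<Rightarrow> ('n::finite \<Rightarrow> nat) set" where
  "multi_indices m = {k. sum k UNIV = m}"

text \<open>
Real analyticity is a statement about coefficients of power series. Giving homogeneous polynomials by their
coefficients makes the two comparable.
\<close>
definition hpoly :: "nat \<Rightarrow> (('n::finite \<Rightarrow> nat) \<Rightarrow> complex) \<Rightarrow> complex^'n \<Rightarrow> complex" where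
  "hpoly m c z = (\<Sum>k\<in>multi_indices m. c k * mpow z k)"

text \<open>
The action of a partial derivative on the coefficients of a polynomial or power series.
\<close>
definition coeff_partial :: "'n \<Rightarrow> (('n::finite \<Rightarrow> nat) \<Rightarrow> complex) \<Rightarrow> ('n \<Rightarrow> nat) \<Rightarrow> complex" where
  "coeff_partial i c k = of_nat (k i + 1) * c (k(i := k i + 1))"

lemma finite_multi_indices [simp]: "finite (multi_indices m :: ('n::finite \<Rightarrow> nat) set)"
proof (rule finite_subset)
  show "multi_indices m \<subseteq> PiE (UNIV :: 'n set) (\<lambda>_. {..m})"
    using member_le_sum[of _ "UNIV :: 'n set"] by (fastforce simp: multi_indices_def)
  show "finite (PiE (UNIV :: 'n set) (\<lambda>_. {..m}))"
    by (intro finite_PiE) auto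
qed

lemma mpow_split: "mpow z k = (z $ i) ^ k i * (\<Prod>j\<in>UNIV-{i}. (z $ j) ^ k j)"
  unfolding mpow_def by (subst prod.remove[of _ i]) auto

lemma mpow_scale: "mpow (a *s z) k = a ^ (sum k UNIV) * mpow z k"
  by (simp add: mpow_def power_mult_distrib prod.distrib power_sum)

lemma mpow_cvec: "mpow (cvec x) k = complex_of_real (mpow x k)"
  by (simp add: mpow_def cvec_def)

lemma mpow_0: "mpow 0 k = (if k = (\<lambda>_. 0) then 1 else 0)"
proof (cases "k = (\<lambda>_. 0)")
  case False
  then obtain i where "k i \<noteq> 0" by (auto simp: fun_eq_iff)
  then have "(\<Prod>i\<in>UNIV. (0 $ i) ^ k i) = (0::'a)"
    by (intro prod_zero bexI[of _ i]) (auto simp: power_0_left)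
  then show ?thesis using False by (simp add: mpow_def)
qed (simp add: mpow_def)

lemma sum_upd: "sum (k(i := v)) UNIV = v + sum k (UNIV - {i})" for k :: "'n::finite \<Rightarrow> nat"
  by (subst sum.remove[of _ i]) (auto intro!: sum.cong)

lemma sum_upd_Suc: "sum (k(i := Suc (k i))) UNIV = Suc (sum k UNIV)" for k :: "'n::finite \<Rightarrow> nat"
  unfolding sum_upd by (subst (2) sum.remove[of _ i]) auto

lemma homogeneous_hpoly: "homogeneous_polynomial m (hpoly m c)"
  unfolding homogeneous_polynomial_def complex_polynomial_def
proof (intro conjI allI)
  show "\<exists>(A::('a \<Rightarrow> nat) set) c'. finite A \<and> (\<forall>z. hpoly m c z = (\<Sum>k\<in>A. c' k * (\<Prod>i\<in>UNIV. z $ i ^ k i)))"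
    by (intro exI[of _ "multi_indices m"] exI[of _ c]) (simp add: hpoly_def mpow_def)
  show "hpoly m c (a *s z) = a ^ m * hpoly m c z" for a z
    by (auto simp: hpoly_def mpow_scale multi_indices_def sum_distrib_left intro!: sum.cong)
qed

text \<open>
Of an arbitrary polynomial expression only the part of total degree \<open>m\<close> contributes: restricted to a
complex line through \<open>0\<close> it is a polynomial in one variable that is a multiple of \<open>t ^ m\<close>.
\<close>
lemma homogeneous_imp_hpoly:
  assumes "homogeneous_polynomial m q"
  obtains c where "q = hpoly m c"
proof -
  from assms obtain A :: "('a \<Rightarrow> nat) set" and c where A: "finite A"
    and q: "\<And>z. q z = (\<Sum>k\<in>A. c k * mpow z k)" and h: "\<And>a z. q (a *s z) = a ^ m * q z"
    unfolding homogeneous_polynomial_def complex_polynomial_def mpow_def by blast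
  define D where "D = Max (insert m ((\<lambda>k. sum k UNIV) ` A))"
  have D: "m \<le> D" "\<And>k. k \<in> A \<Longrightarrow> sum k UNIV \<le> D" using A by (auto simp: D_def)
  have "q z = hpoly m (\<lambda>k. if k \<in> A then c k else 0) z" for z
  proof -
    define e where "e j = (\<Sum>k | k \<in> A \<and> sum k UNIV = j. c k * mpow z k)" for j
    have "(\<Sum>j\<le>D. e j * t ^ j) = (\<Sum>j\<le>D. (if j = m then q z else 0) * t ^ j)" for t
    proof -
      have "(\<Sum>j\<le>D. e j * t ^ j) = (\<Sum>j\<le>D. \<Sum>k | k \<in> A \<and> sum k UNIV = j. c k * mpow (t *s z) k)"
        unfolding e_def sum_distrib_right by (intro sum.cong) (auto simp: mpow_scale)
      also have "\<dots> = q (t *s z)" unfolding q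
        by (rule sum.group) (use A D in auto)
      also have "\<dots> = (\<Sum>j\<le>D. (if j = m then q z else 0) * t ^ j)"
        using D(1) by (simp add: h if_distrib[of "\<lambda>x. x * _"] sum.delta cong: if_cong)
      finally show ?thesis .
    qed
    then have "\<forall>j\<le>D. e j = (if j = m then q z else 0)"
      by (subst polyfun_eq_coeffs[symmetric]) blast
    then have "e m = q z" using D(1) by auto
    then have "q z = (\<Sum>k | k \<in> A \<and> sum k UNIV = m. c k * mpow z k)" by (simp add: e_def)
    also have "\<dots> = hpoly m (\<lambda>k. if k \<in> A then c k else 0) z"
      unfolding hpoly_def
      by (rule sum.mono_neutral_cong_left[OF finite_multi_indices]) (auto simp: multi_indices_def)
    finally show ?thesis .
  qed
  then show ?thesis using that[of "\<lambda>k. if k \<in> A then c k else 0"] by blast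
qed

lemma mpow_line_deriv:
  fixes z :: "complex^'n::finite"
  shows "((\<lambda>t. mpow (z + t *s axis i 1) k) has_field_derivative
          of_nat (k i) * mpow (z + t *s axis i 1) (k(i := k i - 1))) (at t)"
proof -
  have eq: "mpow (z + t *s axis i 1) l = (z $ i + t) ^ l i * (\<Prod>j\<in>UNIV-{i}. (z $ j) ^ l j)" for t l
    by (subst mpow_split[of _ _ i]) (auto simp: axis_def intro!: prod.cong)
  show ?thesis unfolding eq
    by (auto intro!: derivative_eq_intros prod.cong)
qed

lemma hpoly_line_deriv:
  fixes z :: "complex^'n::finite"
  shows "((\<lambda>t. hpoly m c (z + t *s axis i 1)) has_field_derivative
          (if m = 0 then 0 else hpoly (m - 1) (coeff_partial i c) (z + t *s axis i 1))) (at t)"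
proof -
  have upd: "sum (k(i := v)) UNIV = v + sum k (UNIV - {i})" for v and k :: "'n \<Rightarrow> nat"
    by (rule sum_upd)
  let ?w = "z + t *s axis i 1"
  have "((\<lambda>t. hpoly m c (z + t *s axis i 1)) has_field_derivative
          (\<Sum>k\<in>multi_indices m. c k * (of_nat (k i) * mpow ?w (k(i := k i - 1))))) (at t)"
    unfolding hpoly_def
    by (intro DERIV_sum DERIV_cmult mpow_line_deriv)
  also have "(\<Sum>k\<in>multi_indices m. c k * (of_nat (k i) * mpow ?w (k(i := k i - 1))))
     = (\<Sum>k | k \<in> multi_indices m \<and> k i \<noteq> 0. c k * (of_nat (k i) * mpow ?w (k(i := k i - 1))))"
    by (intro sum.mono_neutral_right) auto
  also have "\<dots> = (if m = 0 then 0 else hpoly (m - 1) (coeff_partial i c) ?w)"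
  proof (cases m)
    case 0
    then show ?thesis by (auto simp: multi_indices_def intro!: sum.neutral)
  next
    case (Suc l)
    have "(\<Sum>k | k \<in> multi_indices m \<and> k i \<noteq> 0. c k * (of_nat (k i) * mpow ?w (k(i := k i - 1))))
        = hpoly l (coeff_partial i c) ?w"
      unfolding hpoly_def
    proof (rule sum.reindex_bij_witness[where i = "\<lambda>k. k(i := Suc (k i))" and j = "\<lambda>k. k(i := k i - 1)"])
      fix k :: "'n \<Rightarrow> nat" assume k: "k \<in> {k \<in> multi_indices m. k i \<noteq> 0}"
      have "sum (k(i := k i - 1)) UNIV = l"
        using upd[of k "k i - 1"] upd[of k "k i"] k Suc
        by (simp add: multi_indices_def)
      then show "k(i := k i - 1) \<in> multi_indices l" by (simp add: multi_indices_def)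
      show "coeff_partial i c (k(i := k i - 1)) * mpow ?w (k(i := k i - 1))
          = c k * (of_nat (k i) * mpow ?w (k(i := k i - 1)))"
        using k by (auto simp: coeff_partial_def fun_upd_idem)
    next
      fix k :: "'n \<Rightarrow> nat" assume "k \<in> multi_indices l"
      then show "k(i := Suc (k i)) \<in> {k \<in> multi_indices m. k i \<noteq> 0}"
        using Suc sum_upd_Suc[of k i] by (simp add: multi_indices_def del: sum.delta')
    qed auto
    then show ?thesis using Suc by simp
  qed
  finally show ?thesis .
qed

lemma cpartial_hpoly:
  "cpartial_deriv i (hpoly m c) = (if m = 0 then (\<lambda>_. 0) else hpoly (m - 1) (coeff_partial i c))"
proof
  fix z :: "complex^'a"
  show "cpartial_deriv i (hpoly m c) z = (if m = 0 then (\<lambda>_. 0) else hpoly (m - 1) (coeff_partial i c)) z"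
    unfolding cpartial_deriv_def
    by (rule DERIV_imp_deriv) (use hpoly_line_deriv[of m c z i 0] in \<open>auto split: if_splits\<close>)
qed

lemma hpoly_zero [simp]: "hpoly m (\<lambda>_. 0) = (\<lambda>_. 0)"
  by (simp add: hpoly_def fun_eq_iff)

lemma homogeneous_zero: "homogeneous_polynomial m (\<lambda>_. 0)"
  using homogeneous_hpoly[of m "\<lambda>_. 0"] by simp

lemma homogeneous_cpartial:
  assumes "homogeneous_polynomial m q"
  shows "homogeneous_polynomial (m - 1) (cpartial_deriv i q)"
  using assms by (auto elim!: homogeneous_imp_hpoly simp: cpartial_hpoly homogeneous_hpoly homogeneous_zero)

lemma homogeneous_line_deriv:
  assumes "homogeneous_polynomial m q"
  shows "((\<lambda>t. q (z + t *s axis i 1)) has_field_derivative cpartial_deriv i q (z + t *s axis i 1)) (at t)"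
proof -
  obtain c where q: "q = hpoly m c" using homogeneous_imp_hpoly[OF assms] .
  show ?thesis unfolding q cpartial_hpoly using hpoly_line_deriv[of m c z i t]
    by (cases "m = 0") simp_all
qed

lemma homogeneous_add:
  assumes "homogeneous_polynomial m q" "homogeneous_polynomial m r"
  shows "homogeneous_polynomial m (\<lambda>z. q z + r z)"
proof -
  from assms obtain c d where "q = hpoly m c" "r = hpoly m d" by (metis homogeneous_imp_hpoly)
  then have "(\<lambda>z. q z + r z) = hpoly m (\<lambda>k. c k + d k)"
    by (simp add: hpoly_def fun_eq_iff ring_distribs sum.distrib)
  then show ?thesis by (simp add: homogeneous_hpoly)
qed

lemma homogeneous_scale:
  assumes "homogeneous_polynomial m q"
  shows "homogeneous_polynomial m (\<lambda>z. a * q z)"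
proof -
  from assms obtain c where "q = hpoly m c" by (metis homogeneous_imp_hpoly)
  then have "(\<lambda>z. a * q z) = hpoly m (\<lambda>k. a * c k)"
    by (simp add: hpoly_def fun_eq_iff sum_distrib_left mult.assoc)
  then show ?thesis by (simp add: homogeneous_hpoly)
qed

lemma homogeneous_sum:
  assumes "\<And>i. i \<in> I \<Longrightarrow> homogeneous_polynomial m (q i)"
  shows "homogeneous_polynomial m (\<lambda>z. \<Sum>i\<in>I. q i z)"
  using assms by (induction I rule: infinite_finite_induct) (auto intro: homogeneous_zero homogeneous_add)

lemma cpartial_add:
  assumes "homogeneous_polynomial m q" "homogeneous_polynomial m r"
  shows "cpartial_deriv i (\<lambda>z. q z + r z) = (\<lambda>z. cpartial_deriv i q z + cpartial_deriv i r z)"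
proof
  fix z show "cpartial_deriv i (\<lambda>z. q z + r z) z = cpartial_deriv i q z + cpartial_deriv i r z"
    unfolding cpartial_deriv_def[of _ "\<lambda>z. q z + r z"]
    using homogeneous_line_deriv[OF assms(1), of z i 0] homogeneous_line_deriv[OF assms(2), of z i 0]
    by (intro DERIV_imp_deriv DERIV_add) simp_all
qed

lemma cpartial_scale:
  assumes "homogeneous_polynomial m q"
  shows "cpartial_deriv i (\<lambda>z. a * q z) = (\<lambda>z. a * cpartial_deriv i q z)"
proof
  fix z show "cpartial_deriv i (\<lambda>z. a * q z) z = a * cpartial_deriv i q z"
    unfolding cpartial_deriv_def[of _ "\<lambda>z. a * q z"]
    using homogeneous_line_deriv[OF assms(1), of z i 0]
    by (intro DERIV_imp_deriv DERIV_cmult) simp_all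
qed

lemma homogeneous_claplacian:
  assumes "homogeneous_polynomial m q"
  shows "homogeneous_polynomial (m - 2) (claplacian q)"
proof -
  have "homogeneous_polynomial (m - 2) (cpartial_deriv i (cpartial_deriv i q))" for i
    using homogeneous_cpartial[OF homogeneous_cpartial[OF assms, of i], of i] by (simp add: diff_diff_left numeral_2_eq_2)
  then show ?thesis unfolding claplacian_def[abs_def] by (intro homogeneous_sum)
qed

lemma claplacian_add:
  assumes "homogeneous_polynomial m q" "homogeneous_polynomial m r"
  shows "claplacian (\<lambda>z. q z + r z) = (\<lambda>z. claplacian q z + claplacian r z)"
  unfolding claplacian_def[abs_def] using assms
  by (simp add: cpartial_add[OF assms] cpartial_add[OF homogeneous_cpartial homogeneous_cpartial, OF assms] sum.distrib)

lemma claplacian_scale: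
  assumes "homogeneous_polynomial m q"
  shows "claplacian (\<lambda>z. a * q z) = (\<lambda>z. a * claplacian q z)"
  unfolding claplacian_def[abs_def] using assms
  by (simp add: cpartial_scale[OF assms] cpartial_scale[OF homogeneous_cpartial, OF assms] sum_distrib_left)

lemma claplacian_pow_hom:
  "homogeneous_polynomial m q \<Longrightarrow> homogeneous_polynomial (m - 2 * p) ((claplacian ^^ p) q)"
proof (induction p)
  case (Suc p)
  then show ?case using homogeneous_claplacian[of "m - 2 * p" "(claplacian ^^ p) q"]
    by (simp add: diff_diff_left)
qed auto

lemma claplacian_pow_add:
  assumes "homogeneous_polynomial m q" "homogeneous_polynomial m r"
  shows "(claplacian ^^ p) (\<lambda>z. q z + r z) = (\<lambda>z. (claplacian ^^ p) q z + (claplacian ^^ p) r z)"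
  by (induction p) (simp_all add: claplacian_add[OF claplacian_pow_hom claplacian_pow_hom, OF assms])

lemma claplacian_pow_scale:
  assumes "homogeneous_polynomial m q"
  shows "(claplacian ^^ p) (\<lambda>z. a * q z) = (\<lambda>z. a * (claplacian ^^ p) q z)"
  by (induction p) (simp_all add: claplacian_scale[OF claplacian_pow_hom, OF assms])

lemma claplacian_zero [simp]: "claplacian (\<lambda>_. 0) = (\<lambda>_. 0)"
  by (simp add: claplacian_def[abs_def] cpartial_deriv_def)

lemma claplacian_pow_zero [simp]: "(claplacian ^^ p) (\<lambda>_. 0) = (\<lambda>_. 0)"
  by (induction p) auto

text \<open>
Euler's identity, monomial by monomial. It is what turns the radial derivative in Green's identity into
multiplication by the degree.
\<close>
lemma euler_homogeneous:
  fixes q :: "complex^'n::finite \<Rightarrow> complex"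
  assumes "homogeneous_polynomial m q"
  shows "(\<Sum>i\<in>UNIV. z $ i * cpartial_deriv i q z) = of_nat m * q z"
proof -
  obtain c where q: "q = hpoly m c" using homogeneous_imp_hpoly[OF assms] .
  have "cpartial_deriv i q z = (\<Sum>k\<in>multi_indices m. c k * (of_nat (k i) * mpow z (k(i := k i - 1))))" for i
    unfolding cpartial_deriv_def q hpoly_def using mpow_line_deriv[of z i _ 0]
    by (intro DERIV_imp_deriv DERIV_sum DERIV_cmult) simp_all
  moreover have "z $ i * (c k * (of_nat (k i) * mpow z (k(i := k i - 1)))) = of_nat (k i) * (c k * mpow z k)" for i k
  proof (cases "k i")
    case (Suc l)
    then have "z $ i * mpow z (k(i := k i - 1)) = mpow z k"
      by (auto simp: mpow_split[of z _ i] intro!: prod.cong)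
    then show ?thesis by (simp add: algebra_simps)
  qed simp
  ultimately have "(\<Sum>i\<in>UNIV. z $ i * cpartial_deriv i q z)
     = (\<Sum>i\<in>UNIV. \<Sum>k\<in>multi_indices m. of_nat (k i) * (c k * mpow z k))"
    by (simp only: sum_distrib_left)
  also have "\<dots> = (\<Sum>k\<in>multi_indices m. (\<Sum>i\<in>UNIV. of_nat (k i)) * (c k * mpow z k))"
    by (subst sum.swap) (simp add: sum_distrib_right)
  also have "\<dots> = of_nat m * q z"
    by (auto simp: q hpoly_def sum_distrib_left multi_indices_def simp flip: of_nat_sum intro!: sum.cong)
  finally show ?thesis .
qed

lemma homogeneous_continuous:
  assumes "homogeneous_polynomial m q"
  shows "continuous_on S q"
proof -
  obtain c where q: "q = hpoly m c" using homogeneous_imp_hpoly[OF assms] .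
  show ?thesis unfolding q hpoly_def[abs_def] mpow_def by (intro continuous_intros)
qed

definition vcnj :: "complex^'n \<Rightarrow> complex^'n" where "vcnj z = (\<chi> i. cnj (z $ i))"

text \<open>
The polynomial with conjugated coefficients. It agrees with the conjugate of \<open>q\<close> at real points and,
unlike the conjugate, is again a polynomial, so that results on the bilinear pairing on the real
sphere apply to the inner product.
\<close>
definition star :: "(complex^'n \<Rightarrow> complex) \<Rightarrow> complex^'n \<Rightarrow> complex" where
  "star q z = cnj (q (vcnj z))"

lemma vcnj_cvec [simp]: "vcnj (cvec x) = cvec x"
  by (simp add: vcnj_def cvec_def vec_eq_iff)

lemma star_cvec [simp]: "star q (cvec x) = cnj (q (cvec x))"
  by (simp add: star_def)

lemma star_hpoly: "star (hpoly m c) = hpoly m (\<lambda>k. cnj (c k))"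
  by (simp add: star_def hpoly_def mpow_def vcnj_def fun_eq_iff)

lemma star_homogeneous: "homogeneous_polynomial m q \<Longrightarrow> homogeneous_polynomial m (star q)"
  by (metis homogeneous_hpoly homogeneous_imp_hpoly star_hpoly)

lemma star_cpartial:
  assumes "homogeneous_polynomial m q"
  shows "cpartial_deriv i (star q) = star (cpartial_deriv i q)"
proof -
  obtain c where q: "q = hpoly m c" using homogeneous_imp_hpoly[OF assms] .
  show ?thesis unfolding q star_hpoly cpartial_hpoly
    by (auto simp: star_hpoly coeff_partial_def[abs_def]) (simp add: star_def fun_eq_iff)
qed

lemma star_claplacian:
  assumes "homogeneous_polynomial m q"
  shows "claplacian (star q) = star (claplacian q)"
  unfolding claplacian_def[abs_def]
  by (simp add: star_cpartial[OF assms] star_cpartial[OF homogeneous_cpartial[OF assms]])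
     (simp add: star_def fun_eq_iff)

lemma star_claplacian_pow:
  assumes "homogeneous_polynomial m q"
  shows "(claplacian ^^ p) (star q) = star ((claplacian ^^ p) q)"
  by (induction p) (simp_all add: star_claplacian[OF claplacian_pow_hom[OF assms]])

lemma star_polyharmonic: "q \<in> polyharmonic_polys p m \<Longrightarrow> star q \<in> polyharmonic_polys p m"
  by (auto simp: polyharmonic_polys_def star_homogeneous star_claplacian_pow) (simp add: star_def)

lemma polyharmonic_sum:
  assumes "\<And>i. i \<in> I \<Longrightarrow> q i \<in> polyharmonic_polys p m"
  shows "(\<lambda>z. \<Sum>i\<in>I. a i * q i z) \<in> polyharmonic_polys p m"
proof -
  have zero: "(\<lambda>_. 0) \<in> polyharmonic_polys p m"
    by (simp add: polyharmonic_polys_def homogeneous_zero)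
  show ?thesis using assms
proof (induction I rule: infinite_finite_induct)
  case (insert x F)
  let ?g = "\<lambda>z. \<Sum>i\<in>F. a i * q i z"
  from insert have g: "?g \<in> polyharmonic_polys p m" and x: "q x \<in> polyharmonic_polys p m" by auto
  then have h: "homogeneous_polynomial m ?g" "homogeneous_polynomial m (q x)"
    by (auto simp: polyharmonic_polys_def)
  have "homogeneous_polynomial m (\<lambda>z. a x * q x z + ?g z)"
    by (intro homogeneous_add homogeneous_scale h)
  moreover have "(claplacian ^^ p) (\<lambda>z. a x * q x z + ?g z) = (\<lambda>_. 0)"
    using g x unfolding claplacian_pow_add[OF homogeneous_scale[OF h(2), of "a x"] h(1)]
      claplacian_pow_scale[OF h(2)] by (simp add: polyharmonic_polys_def)
  ultimately have "(\<lambda>z. a x * q x z + ?g z) \<in> polyharmonic_polys p m"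
    unfolding polyharmonic_polys_def mem_Collect_eq by (metis (full_types))
  then show ?case unfolding sum.insert[OF insert(1,2)] .
next
  case (infinite A)
  then have "(\<lambda>z. \<Sum>i\<in>A. a i * q i z) = (\<lambda>_. 0)" by simp
  then show ?case by (metis zero)
next
  case empty
  show ?case using zero by simp
qed
qed

text \<open>
The action of the Laplacian on coefficients, for polynomials as well as for power series.
\<close>
definition coeff_laplacian :: "(('n::finite \<Rightarrow> nat) \<Rightarrow> complex) \<Rightarrow> ('n \<Rightarrow> nat) \<Rightarrow> complex" where
  "coeff_laplacian c k = (\<Sum>i\<in>UNIV. coeff_partial i (coeff_partial i c) k)"

lemma claplacian_hpoly:
  "claplacian (hpoly m c) = (if m < 2 then (\<lambda>_. 0) else hpoly (m - 2) (coeff_laplacian c))"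
proof -
  have "cpartial_deriv i (cpartial_deriv i (hpoly m c)) =
     (if m < 2 then (\<lambda>_. 0) else hpoly (m - 2) (coeff_partial i (coeff_partial i c)))" for i
  proof -
    consider "m = 0" | "m = 1" | "m \<ge> 2" by linarith
    then show ?thesis
    proof cases
      case 1
      then show ?thesis by (simp add: cpartial_hpoly) (simp add: cpartial_deriv_def fun_eq_iff)
    next
      case 2
      then show ?thesis by (simp add: cpartial_hpoly)
    next
      case 3
      then show ?thesis by (simp add: cpartial_hpoly diff_diff_left numeral_2_eq_2)
    qed
  qed
  then have "claplacian (hpoly m c) z = (\<Sum>i\<in>UNIV. if m < 2 then 0 else hpoly (m - 2) (coeff_partial i (coeff_partial i c)) z)" for z
    unfolding claplacian_def by (intro sum.cong) auto
  moreover have "(\<Sum>i\<in>UNIV. hpoly (m - 2) (coeff_partial i (coeff_partial i c)) z) = hpoly (m - 2) (coeff_laplacian c) z" for z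
    unfolding hpoly_def coeff_laplacian_def sum_distrib_right by (rule sum.swap)
  ultimately show ?thesis by (auto simp: fun_eq_iff)
qed

lemma claplacian_pow_hpoly:
  "(claplacian ^^ p) (hpoly m c) = (if m < 2 * p then (\<lambda>_. 0) else hpoly (m - 2 * p) ((coeff_laplacian ^^ p) c))"
proof (induction p)
  case (Suc p)
  have IH: "(claplacian ^^ Suc p) (hpoly m c) =
      claplacian (if m < 2 * p then (\<lambda>_. 0) else hpoly (m - 2 * p) ((coeff_laplacian ^^ p) c))"
    by (simp only: funpow.simps comp_def Suc.IH)
  show ?case
  proof (cases "m < 2 * p")
    case True
    then have "m < 2 * Suc p" by simp
    then show ?thesis unfolding IH if_P[OF True] by simp
  next
    case False
    have e: "m - 2 * p < 2 \<longleftrightarrow> m < 2 * Suc p" "m - 2 * p - 2 = m - 2 * Suc p"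
      using False by auto
    show ?thesis unfolding IH if_not_P[OF False] claplacian_hpoly e by simp
  qed
qed simp

lemma cvec_line: "cvec (x + t *\<^sub>R axis i 1) = cvec x + complex_of_real t *s axis i 1"
  by (auto simp: cvec_def vec_eq_iff axis_def)

lemma homogeneous_real_line_deriv:
  assumes "homogeneous_polynomial m q"
  shows "((\<lambda>t. q (cvec (x + t *\<^sub>R axis i 1))) has_vector_derivative cpartial_deriv i q (cvec x)) (at 0)"
  unfolding cvec_line
  by (rule has_vector_derivative_real_field)
     (use homogeneous_line_deriv[OF assms, of "cvec x" i 0] in auto)

lemma partial_deriv_cvec:
  assumes "homogeneous_polynomial m q"
  shows "partial_deriv i (\<lambda>x. q (cvec x)) = (\<lambda>x. cpartial_deriv i q (cvec x))"
  unfolding partial_deriv_def using homogeneous_real_line_deriv[OF assms]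
  by (intro ext vector_derivative_at) auto

lemma laplacian_cvec:
  assumes "homogeneous_polynomial m q"
  shows "laplacian (\<lambda>x. q (cvec x)) = (\<lambda>x. claplacian q (cvec x))"
  by (simp add: laplacian_def[abs_def] claplacian_def partial_deriv_cvec[OF assms]
      partial_deriv_cvec[OF homogeneous_cpartial[OF assms]])

text \<open>
The real Laplacian, which defines polyharmonic functions, and the complex one, which defines
polyharmonic polynomials, agree on homogeneous polynomials.
\<close>
lemma laplacian_pow_cvec:
  assumes "homogeneous_polynomial m q"
  shows "(laplacian ^^ p) (\<lambda>x. q (cvec x)) = (\<lambda>x. (claplacian ^^ p) q (cvec x))"
  by (induction p) (simp_all add: laplacian_cvec[OF claplacian_pow_hom[OF assms]])

lemma homogeneousD: "homogeneous_polynomial m q \<Longrightarrow> q (a *s z) = a ^ m * q z"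
  by (simp add: homogeneous_polynomial_def)

lemma cvec_scaleR: "cvec (r *\<^sub>R x) = complex_of_real r *s cvec x"
  by (simp add: cvec_def vec_eq_iff)

lemma homogeneous_scaleR: "homogeneous_polynomial m q \<Longrightarrow> q (cvec (r *\<^sub>R x)) = of_real r ^ m * q (cvec x)"
  by (simp add: cvec_scaleR homogeneousD)

lemma continuous_cvec: "continuous_on S cvec"
  unfolding cvec_def[abs_def] by (intro continuous_intros)

lemma polyharmonic_polys_homogeneous: "q \<in> polyharmonic_polys p m \<Longrightarrow> homogeneous_polynomial m q"
  by (simp add: polyharmonic_polys_def)

section \<open>Bounds for Taylor coefficients of homogeneous polynomials\<close>

text \<open>
Zeros of a nonzero convergent power series are isolated, and here they accumulate at \<open>0\<close>.
\<close>
lemma powser_zero: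
  fixes a :: "nat \<Rightarrow> complex"
  assumes r: "r > 0" and s: "\<And>t::real. 0 < t \<Longrightarrow> t < r \<Longrightarrow> (\<lambda>n. a n * of_real t ^ n) sums 0"
  shows "a n = 0"
proof -
  define f where "f z = (\<Sum>n. a n * z ^ n)" for z
  have f: "(\<lambda>n. a n * (z - 0) ^ n) sums f z" if z: "z \<in> ball 0 r" for z
  proof -
    obtain t where t: "norm z < t" "t < r" using dense[of "norm z" r] z by auto
    have "0 < t" using t norm_ge_zero[of z] by linarith
    then have "summable (\<lambda>n. a n * of_real t ^ n)" using s[of t] t by (simp add: sums_iff)
    then have "summable (\<lambda>n. a n * z ^ n)" by (rule powser_inside) (use t in auto)
    then show ?thesis by (simp add: f_def summable_sums)
  qed
  have "f holomorphic_on ball 0 r" using f by (rule power_series_holomorphic)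
  then have "isCont f 0"
    using r holomorphic_on_imp_continuous_on continuous_on_eq_continuous_at[OF open_ball] by (metis centre_in_ball)
  moreover have z: "f (of_real t) = 0" if "0 < t" "t < r" for t
    using f[of "of_real t"] s[OF that] that sums_unique2 by fastforce
  ultimately have f0: "f 0 = 0"
  proof -
    assume c: "isCont f 0"
    have "((\<lambda>t::real. f (of_real t)) \<longlongrightarrow> f (of_real 0)) (at_right 0)"
      using c by (intro isCont_tendsto_compose[where g = f] tendsto_intros) auto
    moreover have "((\<lambda>t::real. f (of_real t)) \<longlongrightarrow> 0) (at_right 0)"
    proof (rule tendsto_eventually)
      show "\<forall>\<^sub>F t in at_right 0. f (complex_of_real t) = 0"
        using eventually_at_right_less[of 0] eventually_at_right_real[OF r] 
        by eventually_elim (use z in auto)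
    qed
    ultimately show "f 0 = 0" using tendsto_unique[OF trivial_limit_at_right_real] by fastforce
  qed
  show ?thesis
  proof (cases "n = 0")
    case True
    have "f 0 = a 0" using f[of 0] r sums_unique2[OF _ powser_sums_zero] by force
    then show ?thesis using True f0 by simp
  next
    case False
    show ?thesis
    proof (rule ccontr)
      assume n: "a n \<noteq> 0"
      obtain s where s: "0 < s" "\<And>z. z \<in> cball 0 s - {0} \<Longrightarrow> f z \<noteq> 0"
      proof -
        have "(\<lambda>n. a n * (x - 0) ^ n) sums f x" if "norm (x - 0) < r" for x
          using f[of x] that by simp
        then show ?thesis
          using powser_0_nonzero[where \<xi> = 0 and a = a and f = f and r = r and m = n] r f0 n False that
          by blast
      qed
      have "f (of_real (min s (r/2))) \<noteq> 0" using s r by auto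
      moreover have "0 < min s (r/2)" "min s (r/2) < r" using s(1) r by linarith+
      ultimately show False using z[of "min s (r/2)"] by blast
    qed
  qed
qed

text \<open>
Bernstein's growth estimate. With the Joukowski map \<open>v \<mapsto> (v + 1/v)/2\<close> the function \<open>v ^ m P((v + 1/v)/2)\<close> is a
polynomial, which is bounded by \<open>A\<close> on the unit circle, where \<open>(v + 1/v)/2\<close> is real. The maximum
principle extends the bound to the unit disc, and the given \<open>z\<close> has a preimage \<open>v\<close> there with \<open>1/|v| \<le> R\<close>.
\<close>
lemma bernstein_poly:
  fixes a :: "nat \<Rightarrow> complex"
  assumes bnd: "\<And>t::real. \<bar>t\<bar> \<le> 1 \<Longrightarrow> cmod (\<Sum>j\<le>m. a j * of_real t ^ j) \<le> A"
    and R: "R \<ge> 1" and z: "cmod z \<le> (R - 1 / R) / 2"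
  shows "cmod (\<Sum>j\<le>m. a j * z ^ j) \<le> A * R ^ m"
proof -
  define P where "P z = (\<Sum>j\<le>m. a j * z ^ j)" for z
  \<comment> \<open>\<open>v ^ m * P ((v + 1/v)/2)\<close> with the denominators cleared\<close>
  define Q where "Q v = (\<Sum>j\<le>m. a j * v ^ (m - j) * ((v\<^sup>2 + 1) / 2) ^ j)" for v
  have A0: "A \<ge> 0" using norm_ge_zero order_trans bnd[of 0] by (metis abs_0 zero_le_one)
  have QP: "Q v = v ^ m * P ((v + 1 / v) / 2)" if "v \<noteq> 0" for v
  proof -
    have e: "(v\<^sup>2 + 1) / 2 = v * ((v + 1 / v) / 2)"
      using that by (simp add: field_simps power2_eq_square)
    have "a j * v ^ (m - j) * (v * ((v + 1 / v) / 2)) ^ j = v ^ m * (a j * ((v + 1 / v) / 2) ^ j)"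
      if "j \<le> m" for j
    proof -
      have "v ^ m = v ^ (m - j) * v ^ j" using that by (simp flip: power_add)
      then show ?thesis unfolding power_mult_distrib[of v] by (simp only: mult_ac)
    qed
    then show ?thesis unfolding Q_def P_def e sum_distrib_left by (intro sum.cong) auto
  qed
  have Q1: "cmod (Q v) \<le> A" if "cmod v = 1" for v
  proof -
    have "1 / v = cnj v" using that
      by (metis complex_div_cnj divide_conv_cnj mult_1)
    then have "(v + 1 / v) / 2 = of_real (Re v)" by (simp add: complex_eq_iff)
    moreover have "\<bar>Re v\<bar> \<le> 1" using abs_Re_le_cmod[of v] that by simp
    moreover have "v \<noteq> 0" using that by auto
    ultimately show ?thesis using QP[of v] bnd[of "Re v"] that by (simp add: norm_mult norm_power P_def)
  qed
  have Q: "cmod (Q v) \<le> A" if "cmod v \<le> 1" for v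
  proof (rule maximum_modulus_frontier[of Q "cball 0 1"])
    show "Q holomorphic_on interior (cball 0 1)" unfolding Q_def[abs_def] by (intro holomorphic_intros) auto
    show "continuous_on (closure (cball 0 1)) Q" unfolding Q_def[abs_def] by (intro continuous_intros) auto
    show "cmod (Q w) \<le> A" if "w \<in> frontier (cball 0 1)" for w
      using that Q1 by simp
  qed (use that in auto)
  \<comment> \<open>of the two solutions of \<open>v + 1/v = 2z\<close>, whose product is \<open>1\<close>, one lies in the closed unit disc\<close>
  define s where "s = csqrt (z\<^sup>2 - 1)"
  have s: "s\<^sup>2 = z\<^sup>2 - 1" by (simp add: s_def)
  have prod: "(z + s) * (z - s) = 1" using s by (simp add: algebra_simps power2_eq_square)
  obtain v where v: "v \<noteq> 0" "cmod v \<le> 1" "v + 1 / v = 2 * z"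
  proof (cases "cmod (z + s) \<le> 1")
    case True
    have "z + s \<noteq> 0" using prod by force
    moreover from this have "1 / (z + s) = z - s" using prod by (simp add: divide_eq_eq mult.commute)
    ultimately show ?thesis using True that[of "z + s"] by auto
  next
    case False
    have n: "cmod (z + s) * cmod (z - s) = 1" using prod by (metis norm_mult norm_one)
    then have "cmod (z - s) \<le> 1" using False
      by (smt (verit) mult_le_cancel_left1 norm_ge_zero)
    moreover have "z - s \<noteq> 0" using prod by force
    moreover from this have "1 / (z - s) = z + s" using prod by (simp add: divide_eq_eq)
    ultimately show ?thesis using that[of "z - s"] by auto
  qed
  define y where "y = 1 / cmod v"
  have y: "y \<ge> 1" using v by (simp add: y_def)
  have "y - 1 / y \<le> cmod (1 / v + v)"
    using norm_diff_ineq[of "1 / v" v] by (simp add: y_def norm_divide)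
  then have "y - 1 / y \<le> R - 1 / R" using v z by (simp add: norm_mult add.commute)
  then have yR: "y \<le> R"
  proof (rule contrapos_pp)
    assume "\<not> y \<le> R"
    then have "1 / y < 1 / R" "R < y" using R y by (auto intro!: divide_strict_left_mono)
    then show "\<not> y - 1 / y \<le> R - 1 / R" by linarith
  qed
  have "P z = Q v / v ^ m" using QP[OF v(1)] v by simp
  then have "cmod (P z) = cmod (Q v) * y ^ m" by (simp add: norm_divide norm_power y_def power_one_over)
  also have "\<dots> \<le> A * R ^ m" using Q[OF v(2)] yR y A0 by (intro mult_mono power_mono) auto
  finally show ?thesis by (simp add: P_def)
qed

text \<open>
Cauchy's inequality on the disc on which \<open>bernstein_poly\<close> controls the polynomial, after scaling the
interval to length \<open>2s\<close>.
\<close>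
lemma bernstein_coeff:
  fixes a :: "nat \<Rightarrow> complex"
  assumes s: "s > 0" and R: "R > 1" and j: "j \<le> m"
    and bnd: "\<And>t::real. \<bar>t\<bar> \<le> s \<Longrightarrow> cmod (\<Sum>j\<le>m. a j * of_real t ^ j) \<le> A"
  shows "cmod (a j) * (s * (R - 1 / R) / 2) ^ j \<le> A * R ^ m"
proof -
  define b where "b j = (if j \<le> m then a j * of_real s ^ j else 0)" for j
  define f where "f z = (\<Sum>j\<le>m. b j * z ^ j)" for z
  define d where "d = (R - 1 / R) / 2"
  have "1 / R < 1" using R by simp
  then have d: "d > 0" using R unfolding d_def by (smt (verit) half_gt_zero)
  have fb: "cmod (f z) \<le> A * R ^ m" if "cmod z \<le> d" for z
    unfolding f_def
  proof (rule bernstein_poly)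
    show "cmod (\<Sum>j\<le>m. b j * of_real t ^ j) \<le> A" if "\<bar>t\<bar> \<le> 1" for t
    proof -
      have "\<bar>s * t\<bar> \<le> s" using that s by (simp add: abs_mult mult_left_le)
      then show ?thesis using bnd[of "s * t"] by (simp add: b_def power_mult_distrib mult.assoc)
    qed
  qed (use R that in \<open>auto simp: d_def\<close>)
  have hol: "f holomorphic_on ball 0 d" unfolding f_def[abs_def] by (intro holomorphic_intros)
  have cont: "continuous_on (cball 0 d) f" unfolding f_def[abs_def] by (intro continuous_intros)
  have C: "cmod ((deriv ^^ j) f 0) \<le> fact j * (A * R ^ m) / d ^ j"
    by (rule Cauchy_inequality[OF hol cont d]) (use fb in auto)
  have "(deriv ^^ j) f 0 / fact j - b j = 0"
  proof (rule powser_zero[OF d, of "\<lambda>j. (deriv ^^ j) f 0 / fact j - b j"])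
    fix t :: real assume t: "0 < t" "t < d"
    have "(\<lambda>n. (deriv ^^ n) f 0 / fact n * (of_real t - 0) ^ n) sums f (of_real t)"
      by (rule holomorphic_power_series[OF hol]) (use t in auto)
    moreover have "(\<lambda>n. b n * of_real t ^ n) sums f (of_real t)"
      unfolding f_def by (rule sums_finite) (auto simp: b_def)
    ultimately show "(\<lambda>n. ((deriv ^^ n) f 0 / fact n - b n) * of_real t ^ n) sums 0"
      using sums_diff by (fastforce simp: left_diff_distrib)
  qed
  then have "cmod (b j) = cmod ((deriv ^^ j) f 0) / fact j"
    by (metis eq_iff_diff_eq_0 norm_divide norm_fact)
  also have "\<dots> \<le> A * R ^ m / d ^ j" using C by (simp add: field_simps)
  finally have "cmod (b j) * d ^ j \<le> A * R ^ m" using d by (simp add: field_simps)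
  moreover have "cmod (b j) * d ^ j = cmod (a j) * (s * (R - 1 / R) / 2) ^ j"
    using j s by (simp add: b_def d_def norm_mult norm_power power_mult_distrib flip: times_divide_eq_right)
  ultimately show ?thesis by simp
qed

text \<open>
The variables are treated one at a time: each coefficient with respect to one variable is a polynomial in
the remaining ones, to which the induction hypothesis applies. Every variable contributes a factor
\<open>R ^ m\<close>.
\<close>
lemma multi_coeff_bound:
  fixes c :: "('n \<Rightarrow> nat) \<Rightarrow> complex"
  assumes s: "s > 0" and R: "R > 1" and I: "finite I"
    and bnd: "\<And>h :: 'n \<Rightarrow> real. (\<And>i. i \<in> I \<Longrightarrow> \<bar>h i\<bar> \<le> s) \<Longrightarrow>
       cmod (\<Sum>k\<in>PiE I (\<lambda>_. {..m}). c k * (\<Prod>i\<in>I. of_real (h i) ^ k i)) \<le> A"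
    and k: "k \<in> PiE I (\<lambda>_. {..m})"
  shows "cmod (c k) * (s * (R - 1 / R) / 2) ^ sum k I \<le> A * R ^ (m * card I)"
  using I bnd k
proof (induction I arbitrary: c A k rule: finite_induct)
  case empty
  then show ?case by auto
next
  case (insert x I)
  let ?d = "s * (R - 1 / R) / 2"
  have "1 / R < 1" using R by simp
  then have d: "?d > 0" using R s by (smt (verit) half_gt_zero mult_pos_pos)
  from insert.prems(2) obtain g j where k: "k = g(x := j)" "j \<le> m" "g \<in> PiE I (\<lambda>_. {..m})"
    by (auto simp: PiE_insert_eq)
  have bj: "cmod (\<Sum>g\<in>PiE I (\<lambda>_. {..m}). c (g(x := j)) * (\<Prod>i\<in>I. of_real (h i) ^ g i)) \<le> A * R ^ m / ?d ^ j"
    if h: "\<And>i. i \<in> I \<Longrightarrow> \<bar>h i\<bar> \<le> s" for h :: "'n \<Rightarrow> real"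
  proof -
    let ?a = "\<lambda>l. \<Sum>g\<in>PiE I (\<lambda>_. {..m}). c (g(x := l)) * (\<Prod>i\<in>I. of_real (h i) ^ g i)"
    have "cmod (\<Sum>l\<le>m. ?a l * of_real t ^ l) \<le> A" if t: "\<bar>t\<bar> \<le> s" for t :: real
    proof -
      let ?h = "h(x := t)"
      have inj: "inj_on (\<lambda>(y, g). g(x := y)) ({..m} \<times> PiE I (\<lambda>_. {..m}))"
      proof (rule inj_onI, clarsimp)
        fix a b f g assume "f(x := a) = g(x := b)" "f \<in> PiE I (\<lambda>_. {..m})" "g \<in> PiE I (\<lambda>_. {..m})"
        then show "a = b \<and> f = g"
          using insert(2) by (metis PiE_arb fun_upd_eqD fun_upd_triv fun_upd_upd)
      qed
      have "(\<Sum>k\<in>PiE (insert x I) (\<lambda>_. {..m}). c k * (\<Prod>i\<in>insert x I. of_real (?h i) ^ k i))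
          = (\<Sum>(l, g)\<in>{..m} \<times> PiE I (\<lambda>_. {..m}). c (g(x := l)) * (\<Prod>i\<in>insert x I. of_real (?h i) ^ (g(x := l)) i))"
        unfolding PiE_insert_eq by (subst sum.reindex[OF inj]) (auto simp: case_prod_unfold)
      also have "\<dots> = (\<Sum>(l, g)\<in>{..m} \<times> PiE I (\<lambda>_. {..m}). c (g(x := l)) * (\<Prod>i\<in>I. of_real (h i) ^ g i) * of_real t ^ l)"
      proof (intro sum.cong refl, clarify)
        fix l g
        have "(\<Prod>i\<in>I. complex_of_real (?h i) ^ (g(x := l)) i) = (\<Prod>i\<in>I. of_real (h i) ^ g i)"
          using insert(2) by (intro prod.cong) auto
        then show "c (g(x := l)) * (\<Prod>i\<in>insert x I. complex_of_real (?h i) ^ (g(x := l)) i) =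
            c (g(x := l)) * (\<Prod>i\<in>I. of_real (h i) ^ g i) * of_real t ^ l"
          using insert(1,2) by (simp add: mult_ac)
      qed
      also have "\<dots> = (\<Sum>l\<le>m. ?a l * of_real t ^ l)"
        by (simp add: sum.cartesian_product sum_distrib_right)
      finally have eq: "(\<Sum>k\<in>PiE (insert x I) (\<lambda>_. {..m}). c k * (\<Prod>i\<in>insert x I. of_real (?h i) ^ k i))
          = (\<Sum>l\<le>m. ?a l * of_real t ^ l)" .
      have "\<bar>?h i\<bar> \<le> s" if "i \<in> insert x I" for i using that h t by auto
      from insert.prems(1)[of ?h, OF this] show ?thesis unfolding eq .
    qed
    from bernstein_coeff[OF s R k(2) this] have "cmod (?a j) * ?d ^ j \<le> A * R ^ m" by simp
    then show ?thesis using d by (simp add: pos_le_divide_eq)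
  qed
  have "cmod (c (g(x := j))) * ?d ^ sum g I \<le> A * R ^ m / ?d ^ j * R ^ (m * card I)"
    using insert.IH[of "\<lambda>g. c (g(x := j))", OF bj k(3)] .
  then have "cmod (c (g(x := j))) * ?d ^ sum g I * ?d ^ j \<le> A * R ^ m * R ^ (m * card I)"
    using d by (simp add: field_simps)
  moreover have "sum (g(x := j)) (insert x I) = j + sum g I"
    using insert(1,2) by (auto intro!: sum.cong)
  ultimately show ?case using insert(1,2) unfolding k(1)
    by (simp add: power_add mult_ac del: fun_upd_apply)
qed

definition mbox :: "nat \<Rightarrow> ('n::finite \<Rightarrow> nat) set" where
  "mbox m = PiE UNIV (\<lambda>_. {..m})"

lemma mbox_iff: "k \<in> mbox m \<longleftrightarrow> (\<forall>i. k i \<le> m)"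
  by (auto simp: mbox_def)

lemma finite_mbox [simp]: "finite (mbox m)"
  unfolding mbox_def by (intro finite_PiE) auto

text \<open>
Expansion around a point other than \<open>0\<close> destroys homogeneity but keeps every exponent at most \<open>m\<close>, which is why
the indices are taken from a box.
\<close>
lemma hpoly_translate:
  fixes w :: "complex^'n::finite"
  shows "\<exists>c'. \<forall>h. hpoly m c (w + h) = (\<Sum>g\<in>mbox m. c' g * mpow h g)"
proof -
  define e where "e k g = (\<Prod>i\<in>UNIV. of_nat (k i choose g i) * (w $ i) ^ (k i - g i))" for k g :: "'n \<Rightarrow> nat"
  have 1: "mpow (w + h) k = (\<Sum>g\<in>mbox m. e k g * mpow h g)" if k: "k \<in> multi_indices m" for k h
  proof -
    have km: "k i \<le> m" for i
      using k member_le_sum[of i "UNIV :: 'n set" k] by (auto simp: multi_indices_def)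
    have "(w $ i + h $ i) ^ k i = (\<Sum>j\<le>m. of_nat (k i choose j) * (w $ i) ^ (k i - j) * (h $ i) ^ j)" for i
    proof -
      have "(w $ i + h $ i) ^ k i = (\<Sum>j\<le>k i. of_nat (k i choose j) * (h $ i) ^ j * (w $ i) ^ (k i - j))"
        by (subst add.commute) (rule binomial_ring)
      also have "\<dots> = (\<Sum>j\<le>m. of_nat (k i choose j) * (w $ i) ^ (k i - j) * (h $ i) ^ j)"
        using km[of i] by (intro sum.mono_neutral_cong_left) (auto simp: mult_ac)
      finally show ?thesis .
    qed
    then have "mpow (w + h) k = (\<Prod>i\<in>UNIV. \<Sum>j\<le>m. of_nat (k i choose j) * (w $ i) ^ (k i - j) * (h $ i) ^ j)"
      by (simp add: mpow_def)
    also have "\<dots> = (\<Sum>g\<in>mbox m. e k g * mpow h g)"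
      unfolding mbox_def by (subst prod_sum_PiE) (auto simp: e_def mpow_def prod.distrib)
    finally show ?thesis .
  qed
  have "hpoly m c (w + h) = (\<Sum>g\<in>mbox m. (\<Sum>k\<in>multi_indices m. c k * e k g) * mpow h g)" for h
    unfolding hpoly_def sum_distrib_right
    by (subst sum.swap) (simp add: 1 sum_distrib_left mult.assoc)
  then show ?thesis by (intro exI[of _ "\<lambda>g. \<Sum>k\<in>multi_indices m. c k * e k g"]) auto
qed

lemma ex_unit_vector: "\<exists>x::real^'n::finite. norm x = 1"
  using norm_axis_1 by blast

lemma sphere_bound_nonneg:
  assumes "\<And>x::real^'n::finite. norm x = 1 \<Longrightarrow> cmod (q (cvec x)) \<le> M"
  shows "M \<ge> 0"
  using ex_unit_vector assms norm_ge_zero order_trans by metis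

lemma homogeneous_norm_le:
  fixes x :: "real^'n::finite"
  assumes q: "homogeneous_polynomial m q" and M: "\<And>x::real^'n. norm x = 1 \<Longrightarrow> cmod (q (cvec x)) \<le> M"
  shows "cmod (q (cvec x)) \<le> M * norm x ^ m"
proof -
  obtain u :: "real^'n" where u: "norm u = 1" "x = norm x *\<^sub>R u"
  proof (cases "x = 0")
    case True
    then show ?thesis using ex_unit_vector that by (metis norm_zero scaleR_zero_left)
  next
    case False
    then show ?thesis using that[of "x /\<^sub>R norm x"] by auto
  qed
  have "q (cvec x) = of_real (norm x) ^ m * q (cvec u)"
    by (subst u(2)) (rule homogeneous_scaleR[OF q])
  then show ?thesis using M[OF u(1)] by (simp add: norm_mult norm_power mult_left_mono mult.commute[of M])
qed

text \<open>
The decisive point is that for suitable \<open>s\<close> and \<open>R\<close> the constant grows as slowly as desired with \<open>m\<close>: like \<open>\<tau> ^ m\<close>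
with any \<open>\<tau> > 1\<close> if \<open>s\<close> and \<open>R - 1\<close> are small, and not at all if \<open>s\<close> and \<open>R - 1\<close> are of the order of \<open>1 / (m + 1)\<close>. It is used
in the first way for sums of series and in the second way for the Nikolskii inequality. Cauchy estimates
on complex balls would lose a fixed exponential factor.
\<close>
lemma taylor_bound:
  fixes a :: "real^'n::finite"
  assumes q: "homogeneous_polynomial m q" and M: "\<And>x::real^'n. norm x = 1 \<Longrightarrow> cmod (q (cvec x)) \<le> M"
    and a: "norm a \<le> 1" and s: "s > 0" and R: "R > 1"
  shows "\<exists>c. (\<forall>h. q (cvec a + h) = (\<Sum>k\<in>mbox m. c k * mpow h k)) \<and>
     (\<forall>k\<in>mbox m. cmod (c k) * (s * (R - 1 / R) / 2) ^ sum k UNIV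
         \<le> M * (1 + real CARD('n) * s) ^ m * R ^ (m * CARD('n)))"
proof -
  obtain d where d: "q = hpoly m d" using homogeneous_imp_hpoly[OF q] .
  obtain c where c: "\<And>h. q (cvec a + h) = (\<Sum>k\<in>mbox m. c k * mpow h k)"
    using hpoly_translate[of m d "cvec a"] d by blast
  have M0: "M \<ge> 0" using M by (rule sphere_bound_nonneg)
  have "cmod (\<Sum>k\<in>PiE UNIV (\<lambda>_. {..m}). c k * (\<Prod>i\<in>UNIV. of_real (h i) ^ k i)) \<le> M * (1 + real CARD('n) * s) ^ m"
    if h: "\<And>i. \<bar>h i\<bar> \<le> s" for h :: "'n \<Rightarrow> real"
  proof -
    let ?h = "\<chi> i. h i"
    have "norm ?h \<le> (\<Sum>i\<in>UNIV. \<bar>?h $ i\<bar>)" by (rule norm_le_l1_cart)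
    also have "\<dots> \<le> real CARD('n) * s" using sum_bounded_above[of UNIV "\<lambda>i. \<bar>?h $ i\<bar>" s] h by simp
    finally have n: "norm (a + ?h) \<le> 1 + real CARD('n) * s" using a norm_triangle_ineq[of a ?h] by linarith
    have "cvec a + cvec ?h = cvec (a + ?h)" by (simp add: cvec_def vec_eq_iff)
    then have "(\<Sum>k\<in>PiE UNIV (\<lambda>_. {..m}). c k * (\<Prod>i\<in>UNIV. of_real (h i) ^ k i)) = q (cvec (a + ?h))"
      using c[of "cvec ?h"] by (simp add: mbox_def mpow_def cvec_def)
    then have "cmod (\<Sum>k\<in>PiE UNIV (\<lambda>_. {..m}). c k * (\<Prod>i\<in>UNIV. of_real (h i) ^ k i)) \<le> M * norm (a + ?h) ^ m"
      using homogeneous_norm_le[OF q M] by simp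
    also have "\<dots> \<le> M * (1 + real CARD('n) * s) ^ m"
      using n M0 by (intro mult_left_mono power_mono) auto
    finally show ?thesis .
  qed
  from multi_coeff_bound[OF s R finite this]
  have "\<forall>k\<in>mbox m. cmod (c k) * (s * (R - 1 / R) / 2) ^ sum k UNIV
         \<le> M * (1 + real CARD('n) * s) ^ m * R ^ (m * CARD('n))" by (auto simp: mbox_def)
  with c show ?thesis by blast
qed

lemma sum_mbox_power:
  fixes x :: real
  shows "(\<Sum>k\<in>(mbox m :: ('n::finite \<Rightarrow> nat) set). x ^ sum k UNIV) = (\<Sum>j\<le>m. x ^ j) ^ CARD('n)"
proof -
  have "(\<Sum>j\<le>m. x ^ j) ^ CARD('n) = (\<Prod>i\<in>(UNIV::'n set). \<Sum>j\<le>m. x ^ j)" by simp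
  also have "\<dots> = (\<Sum>k\<in>(mbox m :: ('n \<Rightarrow> nat) set). x ^ sum k UNIV)"
    unfolding mbox_def by (subst prod_sum_PiE) (auto simp: power_sum)
  finally show ?thesis by simp
qed

lemma sum_mbox_power_le:
  fixes x :: real
  assumes "0 \<le> x" "x < 1"
  shows "(\<Sum>k\<in>(mbox m :: ('n::finite \<Rightarrow> nat) set). x ^ sum k UNIV) \<le> (1 / (1 - x)) ^ CARD('n)"
proof -
  have "(\<Sum>j\<le>m. x ^ j) = (1 - x ^ Suc m) / (1 - x)" 
    using assms by (subst sum_gp_basic[symmetric, of x m, THEN arg_cong[of _ _ "\<lambda>y. y / (1 - x)"]]) auto
  then have "(\<Sum>j\<le>m. x ^ j) \<le> 1 / (1 - x)" using assms by (simp add: divide_right_mono)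
  then show ?thesis unfolding sum_mbox_power using assms by (intro power_mono sum_nonneg) auto
qed

text \<open>
Every finite set of multi-indices lies in a box, over which the sum is a product of geometric sums.
\<close>
lemma summable_multi_power:
  fixes x :: real
  assumes "0 \<le> x" "x < 1"
  shows "(\<lambda>k::'n::finite \<Rightarrow> nat. x ^ sum k UNIV) summable_on UNIV"
    "infsum (\<lambda>k::'n::finite \<Rightarrow> nat. x ^ sum k UNIV) UNIV \<le> (1 / (1 - x)) ^ CARD('n)"
proof -
  have b: "sum (\<lambda>k::'n \<Rightarrow> nat. x ^ sum k UNIV) F \<le> (1 / (1 - x)) ^ CARD('n)" if F: "finite F" for F
  proof -
    define D where "D = Max (insert 0 ((\<lambda>k. sum k UNIV) ` F))"
    have "F \<subseteq> mbox D"
    proof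
      fix k assume "k \<in> F"
      then have "sum k UNIV \<le> D" using F unfolding D_def by (intro Max_ge) auto
      then have "k i \<le> D" for i using member_le_sum[of i UNIV k] by auto
      then show "k \<in> mbox D" by (simp add: mbox_iff)
    qed
    then have "sum (\<lambda>k::'n \<Rightarrow> nat. x ^ sum k UNIV) F \<le> sum (\<lambda>k::'n \<Rightarrow> nat. x ^ sum k UNIV) (mbox D)"
      using assms by (intro sum_mono2) auto
    also have "\<dots> \<le> (1 / (1 - x)) ^ CARD('n)" by (rule sum_mbox_power_le[OF assms])
    finally show ?thesis .
  qed
  show s: "(\<lambda>k::'n::finite \<Rightarrow> nat. x ^ sum k UNIV) summable_on UNIV"
    by (rule nonneg_bounded_partial_sums_imp_summable_on[where C = "(1 / (1 - x)) ^ CARD('n)"])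
       (use assms b in \<open>auto intro!: eventually_finite_subsets_at_top_weakI\<close>)
  show "infsum (\<lambda>k::'n::finite \<Rightarrow> nat. x ^ sum k UNIV) UNIV \<le> (1 / (1 - x)) ^ CARD('n)"
    by (rule infsum_le_finite_sums[OF s]) (use b in auto)
qed

section \<open>Local power series in several variables\<close>

text \<open>
A power series expansion of \<open>f\<close> around \<open>a\<close> on a cube of half-width \<open>\<delta>\<close>, with the geometric bound on the
coefficients as part of the data. The bound gives uniform convergence on smaller cubes.
\<close>
definition mps_on :: "real \<Rightarrow> real \<Rightarrow> (real^'n::finite \<Rightarrow> complex) \<Rightarrow> real^'n \<Rightarrow> (('n \<Rightarrow> nat) \<Rightarrow> complex) \<Rightarrow> bool" where
  "mps_on \<delta> C f a c \<longleftrightarrow> \<delta> > 0 \<and> (\<forall>k. cmod (c k) * \<delta> ^ sum k UNIV \<le> C) \<and>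
     (\<forall>h. (\<forall>i. \<bar>h $ i\<bar> < \<delta>) \<longrightarrow> ((\<lambda>k. c k * complex_of_real (mpow h k)) has_sum f (a + h)) UNIV)"

definition mps :: "(real^'n::finite \<Rightarrow> complex) \<Rightarrow> real^'n \<Rightarrow> (('n \<Rightarrow> nat) \<Rightarrow> complex) \<Rightarrow> bool" where
  "mps f a c \<longleftrightarrow> (\<exists>\<delta> C. mps_on \<delta> C f a c)"

lemma norm_mpow_le:
  fixes z :: "complex^'n::finite"
  assumes "\<And>i. cmod (z $ i) \<le> r"
  shows "cmod (mpow z k) \<le> r ^ sum k UNIV"
  unfolding mpow_def prod_norm[symmetric] norm_power power_sum
  by (intro prod_mono conjI power_mono assms) auto

lemma abs_mpow_le:
  fixes z :: "real^'n::finite"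
  assumes "\<And>i. \<bar>z $ i\<bar> \<le> r"
  shows "\<bar>mpow z k\<bar> \<le> r ^ sum k UNIV"
  unfolding mpow_def abs_prod power_abs power_sum
  by (intro prod_mono conjI power_mono assms) auto

lemma mps_on_coeff_le:
  assumes "mps_on \<delta> C f a c" and "0 \<le> x"
  shows "cmod (c k) * (x * \<delta>) ^ sum k UNIV \<le> C * x ^ sum k UNIV"
proof -
  have "cmod (c k) * \<delta> ^ sum k UNIV \<le> C" using assms by (simp add: mps_on_def)
  then have "cmod (c k) * \<delta> ^ sum k UNIV * x ^ sum k UNIV \<le> C * x ^ sum k UNIV"
    using assms by (intro mult_right_mono) auto
  then show ?thesis by (simp add: power_mult_distrib mult_ac)
qed

lemma mps_on_C_nonneg: "mps_on \<delta> C f a c \<Longrightarrow> 0 \<le> C"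
  unfolding mps_on_def by (meson less_imp_le mult_nonneg_nonneg norm_ge_zero order_trans zero_le_power)

lemma mps_on_mono:
  assumes "mps_on \<delta> C f a c" "0 < \<delta>'" "\<delta>' \<le> \<delta>" "C \<le> C'"
  shows "mps_on \<delta>' C' f a c"
proof -
  have "cmod (c k) * \<delta>' ^ sum k UNIV \<le> C'" for k
  proof -
    have "cmod (c k) * \<delta>' ^ sum k UNIV \<le> cmod (c k) * \<delta> ^ sum k UNIV"
      using assms by (intro mult_left_mono power_mono) auto
    also have "\<dots> \<le> C'" using assms unfolding mps_on_def by (meson order_trans)
    finally show ?thesis .
  qed
  then show ?thesis using assms unfolding mps_on_def by (meson less_le_trans)
qed

text \<open>
Convergence at the corner of a small cube inside the ball of convergence bounds the coefficients.
\<close>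
lemma real_analytic_imp_mps:
  fixes f :: "real^'n::finite \<Rightarrow> complex"
  assumes "real_analytic_on f U" "a \<in> U"
  shows "\<exists>c. mps f a c"
proof -
  from assms obtain r c where r: "r > 0" and c: "\<And>x. x \<in> ball a r \<Longrightarrow>
      ((\<lambda>k. c k * complex_of_real (\<Prod>i\<in>UNIV. (x $ i - a $ i) ^ k i)) has_sum f x) UNIV"
    unfolding real_analytic_on_def by meson
  \<comment> \<open>small enough for the closed cube of half-width \<open>\<delta>\<close> to lie in the ball of radius \<open>r\<close>\<close>
  define \<delta> where "\<delta> = r / (2 * real CARD('n))"
  have \<delta>: "\<delta> > 0" using r by (simp add: \<delta>_def)
  have small: "a + h \<in> ball a r" if "\<And>i. \<bar>h $ i\<bar> \<le> \<delta>" for h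
  proof -
    have "norm h \<le> (\<Sum>i\<in>UNIV. \<bar>h $ i\<bar>)" by (rule norm_le_l1_cart)
    also have "\<dots> \<le> real CARD('n) * \<delta>" using sum_bounded_above[of UNIV "\<lambda>i. \<bar>h $ i\<bar>" \<delta>] that by simp
    also have "\<dots> < r" using r by (simp add: \<delta>_def field_simps)
    finally show ?thesis by (simp add: dist_norm)
  qed
  have hs: "((\<lambda>k. c k * complex_of_real (mpow h k)) has_sum f (a + h)) UNIV"
    if "\<And>i. \<bar>h $ i\<bar> \<le> \<delta>" for h
    using c[OF small[OF that]] by (simp add: mpow_def)
  let ?h = "\<chi> i::'n. \<delta>"
  have "(\<lambda>k. c k * complex_of_real (mpow ?h k)) summable_on UNIV"
    by (rule has_sum_imp_summable[OF hs]) (use \<delta> in auto)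
  then have "(\<lambda>k. norm (c k * complex_of_real (mpow ?h k))) summable_on UNIV"
    unfolding summable_on_iff_abs_summable_on_complex .
  moreover have "norm (c k * complex_of_real (mpow ?h k)) = cmod (c k) * \<delta> ^ sum k UNIV" for k
    using \<delta> by (simp add: norm_mult mpow_def power_sum norm_power flip: prod_norm)
  ultimately have s: "(\<lambda>k. cmod (c k) * \<delta> ^ sum k UNIV) summable_on UNIV" by simp
  have "cmod (c k) * \<delta> ^ sum k UNIV \<le> infsum (\<lambda>k. cmod (c k) * \<delta> ^ sum k UNIV) UNIV" for k
    using finite_sum_le_infsum[OF s, of "{k}"] \<delta> by simp
  then have "mps_on \<delta> (infsum (\<lambda>k. cmod (c k) * \<delta> ^ sum k UNIV) UNIV) f a c"
    unfolding mps_on_def using hs \<delta> by (auto intro: less_imp_le)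
  then show ?thesis unfolding mps_def by blast
qed

lemma mps_imp_real_analytic:
  assumes "\<And>a. a \<in> U \<Longrightarrow> \<exists>c. mps f a c"
  shows "real_analytic_on f U"
  unfolding real_analytic_on_def
proof
  fix a assume "a \<in> U"
  then obtain \<delta> C c where c: "mps_on \<delta> C f a c" using assms unfolding mps_def by blast
  show "\<exists>r>0. \<exists>c. \<forall>x\<in>ball a r. ((\<lambda>k. c k * complex_of_real (\<Prod>i\<in>UNIV. (x $ i - a $ i) ^ k i)) has_sum f x) UNIV"
  proof (intro exI[of _ \<delta>] conjI exI[of _ c] ballI)
    fix x assume "x \<in> ball a \<delta>"
    then have "\<bar>(x - a) $ i\<bar> < \<delta>" for i
      using component_le_norm_cart[of "x - a" i] by (simp add: dist_norm norm_minus_commute)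
    then have "((\<lambda>k. c k * complex_of_real (mpow (x - a) k)) has_sum f (a + (x - a))) UNIV"
      using c unfolding mps_on_def by blast
    then show "((\<lambda>k. c k * complex_of_real (\<Prod>i\<in>UNIV. (x $ i - a $ i) ^ k i)) has_sum f x) UNIV"
      by (simp add: mpow_def)
  qed (use c in \<open>simp add: mps_on_def\<close>)
qed

lemma mps_at:
  assumes "mps f a c" shows "f a = c (\<lambda>_. 0)"
proof -
  obtain \<delta> C where "mps_on \<delta> C f a c" using assms unfolding mps_def by blast
  then have "((\<lambda>k. c k * complex_of_real (mpow 0 k)) has_sum f (a + 0)) UNIV"
    unfolding mps_on_def by (metis abs_zero zero_index)
  moreover have "((\<lambda>k. c k * complex_of_real (mpow 0 k)) has_sum c (\<lambda>_. 0)) UNIV"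
    by (rule has_sum_finite_neutralI[of "{\<lambda>_. 0}"]) (auto simp: mpow_0)
  ultimately show ?thesis using has_sum_unique by fastforce
qed

lemma mps_zero: "mps (\<lambda>_. 0) a (\<lambda>_. 0)"
  unfolding mps_def mps_on_def by (intro exI[of _ 1]) auto

lemma mps_add:
  assumes "mps f a c" "mps g a d"
  shows "mps (\<lambda>x. f x + g x) a (\<lambda>k. c k + d k)"
proof -
  obtain \<delta> C \<delta>' C' where A: "mps_on \<delta> C f a c" "mps_on \<delta>' C' g a d"
    using assms unfolding mps_def by blast
  let ?d = "min \<delta> \<delta>'"
  have d: "?d > 0" using A by (simp add: mps_on_def)
  have B: "mps_on ?d C f a c" "mps_on ?d C' g a d"
    using mps_on_mono[OF A(1) d] mps_on_mono[OF A(2) d] by auto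
  have "cmod (c k + d k) * ?d ^ sum k UNIV \<le> C + C'" for k
  proof -
    have "cmod (c k + d k) * ?d ^ sum k UNIV \<le> (cmod (c k) + cmod (d k)) * ?d ^ sum k UNIV"
      using d by (intro mult_right_mono norm_triangle_ineq) auto
    also have "\<dots> \<le> C + C'" using B unfolding mps_on_def distrib_right by (intro add_mono) auto
    finally show ?thesis .
  qed
  then have "mps_on ?d (C + C') (\<lambda>x. f x + g x) a (\<lambda>k. c k + d k)"
    using B d unfolding mps_on_def by (auto simp: distrib_right intro!: has_sum_add)
  then show ?thesis unfolding mps_def by blast
qed

lemma mps_sum:
  assumes "finite I" "\<And>i. i \<in> I \<Longrightarrow> mps (f i) a (c i)"
  shows "mps (\<lambda>x. \<Sum>i\<in>I. f i x) a (\<lambda>k. \<Sum>i\<in>I. c i k)"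
  using assms by (induction I rule: finite_induct) (auto simp: mps_zero intro!: mps_add)

lemma mpow_line_real:
  "mpow (h + t *\<^sub>R axis i 1) k = (h $ i + t) ^ k i * (\<Prod>j\<in>UNIV-{i}. (h $ j) ^ k j)" for h :: "real^'n::finite"
  by (subst mpow_split[of _ _ i]) (auto simp: axis_def intro!: prod.cong)

text \<open>
Along a coordinate line the expansion extends to a complex disc, where it converges uniformly, so it may be
differentiated term by term. The loss from \<open>\<delta>\<close> to \<open>\<delta> / 2\<close> absorbs the factor \<open>k i + 1\<close>.
\<close>
lemma mps_on_partial:
  fixes f :: "real^'n::finite \<Rightarrow> complex"
  assumes m: "mps_on \<delta> C f a c"
  shows "mps_on (\<delta> / 2) (C / \<delta>) (partial_deriv i f) a (coeff_partial i c)"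
proof -
  have \<delta>: "\<delta> > 0" and c: "\<And>k. cmod (c k) * \<delta> ^ sum k UNIV \<le> C"
    and f: "\<And>h. (\<And>i. \<bar>h $ i\<bar> < \<delta>) \<Longrightarrow> ((\<lambda>k. c k * complex_of_real (mpow h k)) has_sum f (a + h)) UNIV"
    using m by (auto simp: mps_on_def)
  have C0: "C \<ge> 0" using mps_on_C_nonneg[OF m] .
  have coef: "cmod (coeff_partial i c k) * (\<delta> / 2) ^ sum k UNIV \<le> C / \<delta>" for k
  proof -
    have "k i + 1 \<le> (2::nat) ^ k i" using Suc_leI[OF less_exp[of "k i"]] by simp
    also have "(2::nat) ^ k i \<le> 2 ^ sum k UNIV" using member_le_sum[of i UNIV k] by (intro power_increasing) auto
    finally have "real (k i + 1) \<le> 2 ^ sum k UNIV" using of_nat_mono by fastforce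
    then have e: "real (k i + 1) / 2 ^ sum k UNIV \<le> 1" by simp
    have "cmod (coeff_partial i c k) * (\<delta> / 2) ^ sum k UNIV
       = (cmod (c (k(i := Suc (k i)))) * \<delta> ^ sum (k(i := Suc (k i))) UNIV) / \<delta> * (real (k i + 1) / 2 ^ sum k UNIV)"
      using \<delta> unfolding sum_upd_Suc by (simp add: coeff_partial_def norm_mult power_divide field_simps flip: of_nat_Suc)
    also have "\<dots> \<le> C / \<delta> * 1"
      using c[of "k(i := Suc (k i))"] \<delta> C0 e by (intro mult_mono divide_right_mono) auto
    finally show ?thesis by simp
  qed
  have "((\<lambda>k. coeff_partial i c k * complex_of_real (mpow h k)) has_sum partial_deriv i f (a + h)) UNIV"
    if h: "\<And>j. \<bar>h $ j\<bar> < \<delta> / 2" for h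
  proof -
    \<comment> \<open>any number strictly between \<open>\<delta> / 2\<close> and \<open>\<delta>\<close>\<close>
    define r where "r = 3 / 4 * \<delta>"
    define P where "P k = c k * complex_of_real (\<Prod>j\<in>UNIV-{i}. (h $ j) ^ k j)" for k
    define g where "g k s = P k * s ^ k i" for k and s :: complex
    define G where "G s = infsum (\<lambda>k. g k s) UNIV" for s
    have r: "r > 0" using \<delta> by (simp add: r_def)
    have hr: "\<bar>h $ j\<bar> \<le> r" for j using h[of j] \<delta> by (simp add: r_def)
    have gb: "norm (g k s) \<le> C * (3 / 4) ^ sum k UNIV" if s: "s \<in> cball 0 r" for k s
    proof -
      have "norm (g k s) = cmod (c k) * ((\<Prod>j\<in>UNIV-{i}. \<bar>h $ j\<bar> ^ k j) * cmod s ^ k i)"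
        by (simp add: g_def P_def norm_mult norm_power flip: prod_norm)
      also have "\<dots> \<le> cmod (c k) * ((\<Prod>j\<in>UNIV-{i}. r ^ k j) * r ^ k i)"
        using s r by (intro mult_left_mono mult_mono prod_mono power_mono prod_nonneg conjI hr) auto
      also have "(\<Prod>j\<in>UNIV-{i}. r ^ k j) * r ^ k i = r ^ sum k UNIV"
        unfolding power_sum by (subst prod.remove[of UNIV i]) auto
      also have "cmod (c k) * r ^ sum k UNIV \<le> C * (3 / 4) ^ sum k UNIV"
        unfolding r_def by (rule mps_on_coeff_le[OF m]) simp
      finally show ?thesis .
    qed
    have summ: "(\<lambda>k::'n \<Rightarrow> nat. C * (3 / 4) ^ sum k UNIV) summable_on UNIV"
      by (intro summable_on_cmult_right summable_multi_power) auto
    have ul: "uniform_limit (cball 0 r) (\<lambda>X s. \<Sum>k\<in>X. g k s) G (finite_subsets_at_top UNIV)"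
      unfolding G_def by (rule Weierstrass_m_test_general[OF gb summ])
    obtain G' where G': "\<And>w. w \<in> ball 0 r \<Longrightarrow> (G has_field_derivative G' w) (at w) \<and>
        ((\<lambda>X. \<Sum>k\<in>X. P k * (of_nat (k i) * w ^ (k i - 1))) \<longlongrightarrow> G' w) (finite_subsets_at_top UNIV)"
    proof (rule has_complex_derivative_uniform_limit[OF _ ul _ r,
        of "\<lambda>X w. \<Sum>k\<in>X. P k * (of_nat (k i) * w ^ (k i - 1))"])
      show "\<forall>\<^sub>F X in finite_subsets_at_top UNIV. continuous_on (cball 0 r) (\<lambda>s. \<Sum>k\<in>X. g k s) \<and>
         (\<forall>w\<in>ball 0 r. ((\<lambda>s. \<Sum>k\<in>X. g k s) has_field_derivative (\<Sum>k\<in>X. P k * (of_nat (k i) * w ^ (k i - 1)))) (at w))"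
        unfolding g_def
        by (intro always_eventually allI conjI ballI continuous_intros DERIV_sum DERIV_cmult)
           (auto intro!: derivative_eq_intros)
    qed auto
    let ?w = "complex_of_real (h $ i)"
    have w: "?w \<in> ball 0 r" using h[of i] \<delta> by (simp add: r_def)
    have fG: "f (a + h + t *\<^sub>R axis i 1) = G (?w + of_real t)" if t: "\<bar>t\<bar> < \<delta> / 2" for t
    proof -
      have "\<bar>(h + t *\<^sub>R axis i 1) $ j\<bar> < \<delta>" for j
        using h[of j] t \<delta> by (auto simp: axis_def)
      from f[OF this] have "((\<lambda>k. c k * complex_of_real (mpow (h + t *\<^sub>R axis i 1) k)) has_sum f (a + h + t *\<^sub>R axis i 1)) UNIV"
        by (simp add: add.assoc)
      moreover have "c k * complex_of_real (mpow (h + t *\<^sub>R axis i 1) k) = g k (?w + of_real t)" for k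
        by (simp add: mpow_line_real g_def P_def mult_ac)
      ultimately show ?thesis by (simp add: G_def infsumI)
    qed
    have "((\<lambda>t. G (?w + of_real t)) has_vector_derivative G' ?w) (at 0)"
    proof -
      have "((\<lambda>t. G (?w + t)) has_field_derivative G' ?w) (at (of_real 0))"
        using G'[OF w] DERIV_shift[of G "G' ?w" 0 ?w] by (simp add: add.commute)
      then show ?thesis by (rule has_vector_derivative_real_field)
    qed
    then have "((\<lambda>t. f (a + h + t *\<^sub>R axis i 1)) has_vector_derivative G' ?w) (at 0)"
    proof (rule has_vector_derivative_transform_within_open[where S = "ball 0 (\<delta>/2)"])
      show "G (?w + of_real t) = f (a + h + t *\<^sub>R axis i 1)" if "t \<in> ball 0 (\<delta> / 2)" for t
        using fG[of t] that by simp
    qed (use \<delta> in auto)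
    then have pd: "partial_deriv i f (a + h) = G' ?w"
      unfolding partial_deriv_def by (rule vector_derivative_at)
    \<comment> \<open>reindex by \<open>k i \<mapsto> k i + 1\<close>; indices with \<open>k i = 0\<close> contribute nothing\<close>
    have "((\<lambda>k. P k * (of_nat (k i) * ?w ^ (k i - 1))) has_sum G' ?w) UNIV"
      using G'[OF w] by (simp add: has_sum_def)
    then have "((\<lambda>k. P k * (of_nat (k i) * ?w ^ (k i - 1))) has_sum G' ?w) ((\<lambda>k. k(i := Suc (k i))) ` UNIV)"
    proof (subst (asm) has_sum_cong_neutral[where T = "(\<lambda>k. k(i := Suc (k i))) ` UNIV"
          and g = "\<lambda>k. P k * (of_nat (k i) * ?w ^ (k i - 1))"])
      fix k :: "'n \<Rightarrow> nat" assume k: "k \<in> UNIV - (\<lambda>k. k(i := Suc (k i))) ` UNIV"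
      have "k i = 0"
      proof (rule ccontr)
        assume "k i \<noteq> 0"
        then have "k = (\<lambda>k. k(i := Suc (k i))) (k(i := k i - 1))" by auto
        then show False using k by blast
      qed
      then show "P k * (of_nat (k i) * ?w ^ (k i - 1)) = 0" by simp
    qed auto
    moreover have "inj (\<lambda>k::'n \<Rightarrow> nat. k(i := Suc (k i)))"
      by (rule injI) (metis fun_upd_eqD fun_upd_triv fun_upd_upd nat.inject)
    ultimately have "((\<lambda>k. P k * (of_nat (k i) * ?w ^ (k i - 1))) \<circ> (\<lambda>k. k(i := Suc (k i))) has_sum G' ?w) UNIV"
      by (simp only: has_sum_reindex)
    moreover have "((\<lambda>k. P k * (of_nat (k i) * ?w ^ (k i - 1))) \<circ> (\<lambda>k. k(i := Suc (k i)))) k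
        = coeff_partial i c k * complex_of_real (mpow h k)" for k
    proof -
      have "(\<Prod>j\<in>UNIV-{i}. (h $ j) ^ (k(i := Suc (k i))) j) = (\<Prod>j\<in>UNIV-{i}. (h $ j) ^ k j)"
        by (intro prod.cong) auto
      then have "P (k(i := Suc (k i))) = c (k(i := Suc (k i))) * complex_of_real (\<Prod>j\<in>UNIV-{i}. (h $ j) ^ k j)"
        unfolding P_def by simp
      then show ?thesis by (simp add: coeff_partial_def mpow_split[of h k i] mult_ac)
    qed
    ultimately show ?thesis unfolding pd by (simp add: o_def)
  qed
  then show ?thesis unfolding mps_on_def using coef \<delta> by auto
qed

lemma mps_partial: "mps f a c \<Longrightarrow> mps (partial_deriv i f) a (coeff_partial i c)"
  unfolding mps_def using mps_on_partial by blast

lemma mps_laplacian: "mps f a c \<Longrightarrow> mps (laplacian f) a (coeff_laplacian c)"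
  unfolding laplacian_def[abs_def] coeff_laplacian_def[abs_def]
  by (intro mps_sum mps_partial) auto

lemma mps_laplacian_pow: "mps f a c \<Longrightarrow> mps ((laplacian ^^ p) f) a ((coeff_laplacian ^^ p) c)"
  by (induction p) (auto intro: mps_laplacian)

lemma partial_deriv_zero_near:
  assumes "\<And>x. x \<in> ball a r \<Longrightarrow> f x = 0" "x \<in> ball a r"
  shows "partial_deriv i f x = 0"
proof -
  have "((\<lambda>t. f (x + t *\<^sub>R axis i 1)) has_vector_derivative 0) (at 0)"
  proof (rule has_vector_derivative_transform_within_open[where S = "(\<lambda>t. x + t *\<^sub>R axis i 1) -` ball a r"])
    show "((\<lambda>_. 0) has_vector_derivative 0) (at (0::real))" by (rule has_vector_derivative_const)
    show "open ((\<lambda>t. x + t *\<^sub>R axis i 1) -` ball a r)"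
      by (intro open_vimage open_ball continuous_intros)
  qed (use assms in auto)
  then show ?thesis unfolding partial_deriv_def by (rule vector_derivative_at)
qed

text \<open>
The coefficient of index \<open>k\<close> is, up to a factor, the value at \<open>a\<close> of an iterated partial derivative, and all partial
derivatives vanish near \<open>a\<close> as well.
\<close>
lemma mps_zero_unique:
  fixes a :: "real^'n::finite"
  assumes "mps f a c" "r > 0" "\<And>x. x \<in> ball a r \<Longrightarrow> f x = 0"
  shows "c k = 0"
  using assms
proof (induction "sum k UNIV" arbitrary: f c k)
  case 0
  then have "k = (\<lambda>_. 0)" by (auto simp: fun_eq_iff)
  then show ?case using mps_at[OF 0(2)] 0 by simp
next
  case (Suc l)
  have "\<exists>i. k i \<noteq> 0"
  proof (rule ccontr)
    assume "\<not> (\<exists>i. k i \<noteq> 0)"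
    then have "sum k UNIV = 0" by simp
    then show False using Suc(2) by simp
  qed
  then obtain i where i: "k i \<noteq> 0" by blast
  have l: "l = sum (k(i := k i - 1)) UNIV"
    using sum_upd_Suc[of "k(i := k i - 1)" i] i Suc(2) by (simp del: fun_upd_apply add: fun_upd_same)
  have "coeff_partial i c (k(i := k i - 1)) = 0"
    by (rule Suc(1)[OF l mps_partial[OF Suc(3)] Suc(4)])
       (use partial_deriv_zero_near[of a r f] Suc(5) in auto)
  then show ?case using i by (simp add: coeff_partial_def)
qed

lemma mps_continuous:
  fixes a :: "real^'n::finite"
  assumes "mps f a c" shows "isCont f a"
proof -
  obtain \<delta> C where m: "mps_on \<delta> C f a c" using assms unfolding mps_def by blast
  then have \<delta>: "\<delta> > 0" by (simp add: mps_on_def)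
  have lim: "uniform_limit (ball 0 (\<delta>/2)) (\<lambda>X h. \<Sum>k\<in>X. c k * complex_of_real (mpow h k)) (\<lambda>h. f (a + h)) (finite_subsets_at_top UNIV)"
  proof (rule Weierstrass_m_test_general')
    fix k and h :: "real^'n" assume h: "h \<in> ball 0 (\<delta>/2)"
    have hi: "\<bar>h $ i\<bar> \<le> 1 / 2 * \<delta>" for i using component_le_norm_cart[of h i] h by simp
    have "norm (c k * complex_of_real (mpow h k)) \<le> cmod (c k) * (1 / 2 * \<delta>) ^ sum k UNIV"
      using abs_mpow_le[of h "1 / 2 * \<delta>" k] hi by (simp add: norm_mult mult_left_mono)
    also have "\<dots> \<le> C * (1 / 2) ^ sum k UNIV" by (rule mps_on_coeff_le[OF m]) simp
    finally show "norm (c k * complex_of_real (mpow h k)) \<le> C * (1 / 2) ^ sum k UNIV" .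
  next
    fix h :: "real^'n" assume h: "h \<in> ball 0 (\<delta>/2)"
    have "\<bar>h $ i\<bar> < \<delta>" for i using component_le_norm_cart[of h i] h \<delta> by simp
    then show "((\<lambda>k. c k * complex_of_real (mpow h k)) has_sum f (a + h)) UNIV"
      using m unfolding mps_on_def by blast
  next
    show "(\<lambda>k::'n \<Rightarrow> nat. C * (1 / 2) ^ sum k UNIV) summable_on UNIV"
      by (intro summable_on_cmult_right summable_multi_power) auto
  qed
  have "continuous_on (ball 0 (\<delta>/2)) (\<lambda>h. f (a + h))"
    by (rule uniform_limit_theorem[OF _ lim])
       (auto intro!: always_eventually continuous_intros simp: mpow_def)
  then have "isCont (\<lambda>h. f (a + h)) 0"
    using \<delta> by (simp add: continuous_on_eq_continuous_at)
  then have "isCont (\<lambda>x. f (a + (x - a))) a"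
    by (intro isCont_o2[of a "\<lambda>x. x - a" "\<lambda>h. f (a + h)"]) auto
  then show ?thesis by simp
qed

lemma mps_continuous_on:
  assumes "\<And>a. a \<in> U \<Longrightarrow> \<exists>c. mps f a c"
  shows "continuous_on U f"
  using assms mps_continuous by (auto intro!: continuous_at_imp_continuous_on)

text \<open>
Absolute convergence allows the terms of the power series to be grouped by total degree.
\<close>
lemma mps_homogeneous_series:
  fixes u :: "real^'n::finite \<Rightarrow> complex"
  assumes "mps u 0 c"
  obtains \<delta> b where "\<delta> > 0" "summable b"
    "\<And>m x. norm x < \<delta> \<Longrightarrow> cmod (hpoly m c (cvec x)) \<le> b m"
    "\<And>x. norm x < \<delta> \<Longrightarrow> (\<lambda>m. hpoly m c (cvec x)) sums u x"
proof -
  obtain \<delta> C where m: "mps_on \<delta> C u 0 c" using assms unfolding mps_def by blast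
  then have \<delta>: "\<delta> > 0" by (simp add: mps_on_def)
  define b where "b l = (\<Sum>k\<in>(multi_indices l :: ('n \<Rightarrow> nat) set). C * (1 / 2) ^ sum k UNIV)" for l
  have bij: "bij_betw snd (SIGMA l:UNIV. multi_indices l) (UNIV :: ('n \<Rightarrow> nat) set)"
    by (rule bij_betwI[of _ _ _ "\<lambda>k. (sum k UNIV, k)"]) (auto simp: multi_indices_def)
  have group: "((\<lambda>l. \<Sum>k\<in>multi_indices l. g k) has_sum S) UNIV" if "(g has_sum S) UNIV"
    for g :: "('n \<Rightarrow> nat) \<Rightarrow> 'b::{topological_comm_monoid_add, t3_space}" and S
  proof (rule has_sum_SigmaD)
    show "((\<lambda>x. g (snd x)) has_sum S) (SIGMA l:UNIV. multi_indices l)"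
      using that has_sum_reindex_bij_betw[OF bij, of g S] by simp
  qed simp
  have "(\<lambda>k::'n \<Rightarrow> nat. C * (1 / 2) ^ sum k UNIV) summable_on UNIV"
    by (intro summable_on_cmult_right summable_multi_power) auto
  then have "b summable_on UNIV" unfolding b_def[abs_def] summable_on_def using group by blast
  then have b: "summable b" by (rule summable_on_imp_summable)
  show ?thesis
  proof (rule that[of "\<delta>/2" b])
    fix l and x :: "real^'n" assume x: "norm x < \<delta> / 2"
    have hi: "\<bar>x $ i\<bar> \<le> 1 / 2 * \<delta>" for i using component_le_norm_cart[of x i] x by simp
    have "cmod (c k * mpow (cvec x) k) \<le> C * (1 / 2) ^ sum k UNIV" for k
    proof -
      have "cmod (c k * mpow (cvec x) k) \<le> cmod (c k) * (1 / 2 * \<delta>) ^ sum k UNIV"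
        using abs_mpow_le[of x "1 / 2 * \<delta>" k] hi by (simp add: norm_mult mult_left_mono mpow_cvec)
      also have "\<dots> \<le> C * (1 / 2) ^ sum k UNIV" by (rule mps_on_coeff_le[OF m]) simp
      finally show ?thesis .
    qed
    then show "cmod (hpoly l c (cvec x)) \<le> b l"
      unfolding hpoly_def b_def by (intro sum_norm_le)
  next
    fix x :: "real^'n" assume x: "norm x < \<delta> / 2"
    have "\<bar>x $ i\<bar> < \<delta>" for i using component_le_norm_cart[of x i] x \<delta> by simp
    then have "((\<lambda>k. c k * complex_of_real (mpow x k)) has_sum u (0 + x)) UNIV"
      using m unfolding mps_on_def by blast
    then have "((\<lambda>k. c k * mpow (cvec x) k) has_sum u x) UNIV" by (simp add: mpow_cvec)
    from has_sum_imp_sums[OF group[OF this]] show "(\<lambda>m. hpoly m c (cvec x)) sums u x"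
      by (simp add: hpoly_def)
  qed (use \<delta> b in auto)
qed

text \<open>
The radius and the bound are uniform in the base point near \<open>a\<close> and in the direction, because the power
series itself converges at complex points.
\<close>
lemma mps_line_extension:
  fixes a :: "real^'n::finite"
  assumes "mps u a c"
  shows "\<exists>\<epsilon>>0. \<exists>C. \<forall>b\<in>ball a \<epsilon>. \<forall>e. norm e = 1 \<longrightarrow>
     (\<exists>H. H holomorphic_on ball 0 \<epsilon> \<and> (\<forall>t\<in>ball 0 \<epsilon>. cmod (H t) \<le> C) \<and>
       (\<forall>t::real. \<bar>t\<bar> < \<epsilon> \<longrightarrow> H (of_real t) = u (b + t *\<^sub>R e)))"
proof -
  obtain \<delta> C where m: "mps_on \<delta> C u a c" using assms unfolding mps_def by blast
  then have \<delta>: "\<delta> > 0" by (simp add: mps_on_def)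
  let ?\<epsilon> = "\<delta> / 4"
  let ?C = "infsum (\<lambda>k::'n \<Rightarrow> nat. C * (1 / 2) ^ sum k UNIV) UNIV"
  have summ: "(\<lambda>k::'n \<Rightarrow> nat. C * (1 / 2) ^ sum k UNIV) summable_on UNIV"
    by (intro summable_on_cmult_right summable_multi_power) auto
  have "\<exists>H. H holomorphic_on ball 0 ?\<epsilon> \<and> (\<forall>t\<in>ball 0 ?\<epsilon>. cmod (H t) \<le> ?C) \<and>
       (\<forall>t::real. \<bar>t\<bar> < ?\<epsilon> \<longrightarrow> H (of_real t) = u (b + t *\<^sub>R e))"
    if b: "b \<in> ball a ?\<epsilon>" and e: "norm e = 1" for b e
  proof -
    define z where "z t = cvec (b - a) + t *s cvec e" for t
    define g where "g k t = c k * mpow (z t) k" for k t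
    define H where "H t = infsum (\<lambda>k. g k t) UNIV" for t
    have be: "\<bar>(b - a) $ i\<bar> \<le> ?\<epsilon>" "\<bar>e $ i\<bar> \<le> 1" for i
      using b e component_le_norm_cart[of "b - a" i] component_le_norm_cart[of e i]
      by (auto simp: dist_norm norm_minus_commute)
    have gb: "norm (g k t) \<le> C * (1 / 2) ^ sum k UNIV" if t: "t \<in> cball 0 ?\<epsilon>" for k t
    proof -
      have "cmod (z t $ i) \<le> 1 / 2 * \<delta>" for i
      proof -
        have "cmod (z t $ i) \<le> \<bar>(b - a) $ i\<bar> + cmod t * \<bar>e $ i\<bar>"
          unfolding z_def by (rule order_trans[OF _ order_trans[OF norm_triangle_ineq]])
             (auto simp: cvec_def norm_mult simp flip: of_real_diff)
        also have "\<dots> \<le> ?\<epsilon> + ?\<epsilon> * 1" using be t \<delta> by (intro add_mono mult_mono) auto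
        finally show ?thesis by simp
      qed
      then have "norm (g k t) \<le> cmod (c k) * (1 / 2 * \<delta>) ^ sum k UNIV"
        unfolding g_def norm_mult by (intro mult_left_mono norm_mpow_le) auto
      also have "\<dots> \<le> C * (1 / 2) ^ sum k UNIV" by (rule mps_on_coeff_le[OF m]) simp
      finally show ?thesis .
    qed
    have ul: "uniform_limit (cball 0 ?\<epsilon>) (\<lambda>X t. \<Sum>k\<in>X. g k t) H (finite_subsets_at_top UNIV)"
      unfolding H_def by (rule Weierstrass_m_test_general[OF gb summ])
    have hol: "H holomorphic_on ball 0 ?\<epsilon>"
    proof (rule holomorphic_uniform_limit[OF _ ul])
      show "\<forall>\<^sub>F X in finite_subsets_at_top UNIV. continuous_on (cball 0 ?\<epsilon>) (\<lambda>t. \<Sum>k\<in>X. g k t) \<and>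
          (\<lambda>t. \<Sum>k\<in>X. g k t) holomorphic_on ball 0 ?\<epsilon>"
        unfolding g_def z_def mpow_def
        by (intro always_eventually allI conjI) (auto intro!: continuous_intros holomorphic_intros)
    qed auto
    have bound: "cmod (H t) \<le> ?C" if "t \<in> ball 0 ?\<epsilon>" for t
    proof (rule norm_infsum_le)
      show "((\<lambda>k. g k t) has_sum H t) UNIV" unfolding H_def
        by (rule has_sum_infsum, rule abs_summable_summable,
            rule Infinite_Sum.abs_summable_on_comparison_test'[OF summ], rule gb) (use that in auto)
      show "((\<lambda>k. C * (1 / 2) ^ sum k UNIV) has_sum ?C) (UNIV :: ('n \<Rightarrow> nat) set)"
        using summ by (rule has_sum_infsum)
    qed (use gb that in auto)
    have "H (of_real t) = u (b + t *\<^sub>R e)" if t: "\<bar>t\<bar> < ?\<epsilon>" for t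
    proof -
      let ?h = "b - a + t *\<^sub>R e"
      have "\<bar>?h $ i\<bar> < \<delta>" for i
      proof -
        have "\<bar>?h $ i\<bar> \<le> \<bar>(b - a) $ i\<bar> + \<bar>t\<bar> * \<bar>e $ i\<bar>" using abs_triangle_ineq[of "(b - a) $ i" "t * e $ i"]
          by (simp add: abs_mult)
        also have "\<dots> \<le> ?\<epsilon> + ?\<epsilon> * 1" using be t \<delta> by (intro add_mono mult_mono) auto
        finally show ?thesis using \<delta> by simp
      qed
      then have "((\<lambda>k. c k * complex_of_real (mpow ?h k)) has_sum u (a + ?h)) UNIV"
        using m unfolding mps_on_def by blast
      moreover have "c k * complex_of_real (mpow ?h k) = g k (of_real t)" for k
      proof -
        have "z (of_real t) = cvec ?h" by (simp add: z_def cvec_def vec_eq_iff)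
        then show ?thesis by (simp add: g_def mpow_cvec)
      qed
      ultimately show ?thesis by (simp add: H_def infsumI algebra_simps)
    qed
    then show ?thesis using hol bound by blast
  qed
  then show ?thesis using \<delta> by (intro exI[of _ ?\<epsilon>] conjI exI[of _ ?C]) auto
qed

lemma compact_line_extension:
  fixes K :: "(real^'n::finite) set"
  assumes K: "compact K" and u: "\<And>a. a \<in> K \<Longrightarrow> \<exists>c. mps u a c"
  obtains \<epsilon> C where "\<epsilon> > 0"
    "\<And>a e. a \<in> K \<Longrightarrow> norm e = 1 \<Longrightarrow>
     (\<exists>H. H holomorphic_on ball 0 \<epsilon> \<and> (\<forall>t\<in>ball 0 \<epsilon>. cmod (H t) \<le> C) \<and>
       (\<forall>t::real. \<bar>t\<bar> < \<epsilon> \<longrightarrow> H (of_real t) = u (a + t *\<^sub>R e)))"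
proof -
  define Q where "Q \<epsilon> C b \<longleftrightarrow> (\<forall>e. norm e = 1 \<longrightarrow>
     (\<exists>H. H holomorphic_on ball 0 \<epsilon> \<and> (\<forall>t\<in>ball 0 \<epsilon>. cmod (H t) \<le> C) \<and>
       (\<forall>t::real. \<bar>t\<bar> < \<epsilon> \<longrightarrow> H (of_real t) = u (b + t *\<^sub>R e))))" for \<epsilon> C b
  have mono: "Q \<epsilon>' C' b" if "Q \<epsilon> C b" "\<epsilon>' \<le> \<epsilon>" "C \<le> C'" for \<epsilon> C \<epsilon>' C' b
    unfolding Q_def
  proof (intro allI impI)
    fix e :: "real^'n" assume "norm e = 1"
    with that(1) obtain H where "H holomorphic_on ball 0 \<epsilon>" "\<forall>t\<in>ball 0 \<epsilon>. cmod (H t) \<le> C"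
       "\<forall>t::real. \<bar>t\<bar> < \<epsilon> \<longrightarrow> H (of_real t) = u (b + t *\<^sub>R e)" unfolding Q_def by blast
    then show "\<exists>H. H holomorphic_on ball 0 \<epsilon>' \<and> (\<forall>t\<in>ball 0 \<epsilon>'. cmod (H t) \<le> C') \<and>
       (\<forall>t::real. \<bar>t\<bar> < \<epsilon>' \<longrightarrow> H (of_real t) = u (b + t *\<^sub>R e))"
      using that(2,3)
      by (intro exI[of _ H] conjI ballI) (auto intro: holomorphic_on_subset[of H "ball 0 \<epsilon>"] order_trans[of _ C])
  qed
  have "\<forall>a\<in>K. \<exists>\<epsilon> C. \<epsilon> > 0 \<and> (\<forall>b\<in>ball a \<epsilon>. Q \<epsilon> C b)"
    unfolding Q_def using u mps_line_extension by metis
  then obtain \<epsilon> C where eC: "\<And>a. a \<in> K \<Longrightarrow> \<epsilon> a > 0" "\<And>a b. a \<in> K \<Longrightarrow> b \<in> ball a (\<epsilon> a) \<Longrightarrow> Q (\<epsilon> a) (C a) b"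
    by metis
  obtain D where D: "D \<subseteq> K" "finite D" "K \<subseteq> (\<Union>a\<in>D. ball a (\<epsilon> a))"
    using compactE_image[OF K, of K "\<lambda>a. ball a (\<epsilon> a)"] eC(1) by (metis (no_types, lifting) UN_iff centre_in_ball open_ball subsetI)
  define \<epsilon>0 where "\<epsilon>0 = Min (insert 1 (\<epsilon> ` D))"
  define C0 where "C0 = Max (insert 0 (C ` D))"
  have "\<epsilon>0 > 0" unfolding \<epsilon>0_def using D eC(1) by (subst Min_gr_iff) auto
  moreover have "Q \<epsilon>0 C0 b" if "b \<in> K" for b
  proof -
    obtain a where a: "a \<in> D" "b \<in> ball a (\<epsilon> a)" using D \<open>b \<in> K\<close> by blast
    then have "Q (\<epsilon> a) (C a) b" using eC D by blast
    then show ?thesis by (rule mono) (use a D in \<open>auto simp: \<epsilon>0_def C0_def\<close>)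
  qed
  ultimately show ?thesis using that unfolding Q_def by blast
qed

section \<open>Polar coordinates\<close>

text \<open>
A uniformly distributed random point of the unit ball. By definition \<open>sphere_measure\<close> is the law of its
direction.
\<close>
definition ball_law :: "(real^'n::finite) measure" where
  "ball_law = uniform_measure lborel (ball 0 1)"

definition sq_radius_law :: "'n::finite itself \<Rightarrow> real measure" where
  "sq_radius_law _ = distr (ball_law :: (real^'n) measure) borel (\<lambda>x. (norm x)\<^sup>2)"

lemma unit_ball_emeasure: "emeasure lborel (ball (0::real^'n::finite) 1) = ennreal (unit_ball_vol (real CARD('n)))"
  by (simp add: emeasure_ball)

lemma unit_ball_vol_card_pos: "unit_ball_vol (real CARD('n::finite)) > 0"
  by simp

lemma unit_ball_borel [measurable]: "ball (0::real^'n::finite) r \<in> sets borel"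
  by simp

lemma indicator_ball_borel [measurable]:
  "(\<lambda>x. indicator (ball 0 r) x :: real) \<in> borel_measurable (borel :: (real^'n::finite) measure)"
  by (rule borel_measurable_indicator) simp

lemma ball_law_density:
  "ball_law = density lborel (\<lambda>x::real^'n::finite. ennreal (indicator (ball 0 1) x / unit_ball_vol (real CARD('n))))"
proof -
  have "indicator (ball 0 1) x / ennreal (unit_ball_vol (real CARD('n)))
      = ennreal (indicator (ball 0 1) x / unit_ball_vol (real CARD('n)))" for x :: "real^'n"
    using divide_ennreal[of 1 "unit_ball_vol (real CARD('n))"] by (auto split: split_indicator)
  then show ?thesis
    unfolding ball_law_def uniform_measure_def unit_ball_emeasure by simp
qed

lemma sets_ball_law [measurable_cong, simp]: "sets ball_law = sets borel"
  by (simp add: ball_law_def)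

lemma space_ball_law [simp]: "space ball_law = UNIV"
  by (simp add: ball_law_def)

lemma prob_space_ball_law: "prob_space (ball_law :: (real^'n::finite) measure)"
  unfolding ball_law_def
proof (rule prob_space_uniform_measure)
  have "unit_ball_vol (real CARD('n)) \<noteq> 0" using unit_ball_vol_card_pos[where 'n = 'n] by linarith
  then show "emeasure lborel (ball (0::real^'n) 1) \<noteq> 0" unfolding unit_ball_emeasure by simp
  show "emeasure lborel (ball (0::real^'n) 1) \<noteq> \<infinity>" unfolding unit_ball_emeasure by simp
qed

lemma sgn_borel_measurable [measurable]: "(sgn :: real^'n::finite \<Rightarrow> _) \<in> borel_measurable borel"
  unfolding sgn_div_norm[abs_def] by measurable

lemma sphere_measure_eq: "sphere_measure = distr ball_law borel sgn"
  by (simp add: sphere_measure_def ball_law_def)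

lemma sets_sphere_measure [measurable_cong, simp]: "sets sphere_measure = sets borel"
  by (simp add: sphere_measure_def)

lemma space_sphere_measure [simp]: "space sphere_measure = UNIV"
  by (simp add: sphere_measure_def)

lemma prob_space_sphere_measure: "prob_space (sphere_measure :: (real^'n::finite) measure)"
  unfolding sphere_measure_eq by (intro prob_space.prob_space_distr prob_space_ball_law) simp

lemma AE_ball_law_nonzero: "AE x in (ball_law :: (real^'n::finite) measure). x \<noteq> 0"
proof -
  have "AE x in (lborel :: (real^'n) measure). x \<noteq> 0" by (rule AE_lborel_singleton)
  then show ?thesis unfolding ball_law_density by (subst AE_density) auto
qed

lemma AE_sphere_measure: "AE x in (sphere_measure :: (real^'n::finite) measure). norm x = 1"
  unfolding sphere_measure_eq
  by (subst AE_distr_iff) (use AE_ball_law_nonzero in \<open>auto simp: norm_sgn\<close>)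

text \<open>
Dilation by \<open>r\<close> multiplies Lebesgue measure by \<open>r ^ n\<close> and does not change directions.
\<close>
lemma emeasure_cone:
  fixes B :: "(real^'n::finite) set"
  assumes r: "r > 0" and B[measurable]: "B \<in> sets borel"
  shows "emeasure lborel {x. x \<in> ball 0 r \<and> sgn x \<in> B} =
         ennreal (r ^ CARD('n)) * emeasure lborel {x. x \<in> ball 0 1 \<and> sgn x \<in> B}"
proof -
  let ?S = "{x. x \<in> ball 0 r \<and> sgn x \<in> B}"
  have m: "?S \<in> sets borel" by measurable
  have "lborel = density (distr lborel borel (\<lambda>x::real^'n. 0 + r *\<^sub>R x)) (\<lambda>_. ennreal (\<bar>r\<bar> ^ CARD('n)))"
    using lborel_affine[of r "0::real^'n"] r by simp
  then have "emeasure lborel ?S = emeasure (density (distr lborel borel (\<lambda>x::real^'n. 0 + r *\<^sub>R x)) (\<lambda>_. ennreal (\<bar>r\<bar> ^ CARD('n)))) ?S"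
    by simp
  also have "\<dots> = ennreal (r ^ CARD('n)) * emeasure (distr lborel borel (\<lambda>x::real^'n. 0 + r *\<^sub>R x)) ?S"
    using m r by (subst emeasure_density_const) auto
  also have "emeasure (distr lborel borel (\<lambda>x::real^'n. 0 + r *\<^sub>R x)) ?S = emeasure lborel ((\<lambda>x. 0 + r *\<^sub>R x) -` ?S \<inter> space lborel)"
    using m by (intro emeasure_distr) auto
  also have "(\<lambda>x. 0 + r *\<^sub>R x) -` ?S \<inter> space lborel = {x. x \<in> ball 0 1 \<and> sgn x \<in> B}"
    using r by (auto simp: sgn_scaleR)
  finally show ?thesis .
qed

lemma ball_law_cone:
  fixes B :: "(real^'n::finite) set"
  assumes B[measurable]: "B \<in> sets borel"
  shows "emeasure ball_law {x. (norm x)\<^sup>2 < t \<and> sgn x \<in> B} =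
         ennreal (min 1 (max 0 t) powr (real CARD('n) / 2)) * emeasure sphere_measure B"
proof -
  let ?V = "emeasure lborel (ball (0::real^'n) 1)"
  have [measurable]: "{x::real^'n. (norm x)\<^sup>2 < t \<and> sgn x \<in> B} \<in> sets lborel" by measurable
  have e: "emeasure ball_law {x::real^'n. (norm x)\<^sup>2 < t \<and> sgn x \<in> B}
      = emeasure lborel (ball 0 1 \<inter> {x. (norm x)\<^sup>2 < t \<and> sgn x \<in> B}) / ?V"
    unfolding ball_law_def by (rule emeasure_uniform_measure) auto
  have s: "emeasure sphere_measure B = emeasure lborel {x. x \<in> ball 0 1 \<and> sgn x \<in> B} / ?V"
  proof -
    have "emeasure sphere_measure B = emeasure (uniform_measure lborel (ball 0 1)) {x. sgn x \<in> B}"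
      unfolding sphere_measure_def by (subst emeasure_distr) (auto simp: vimage_def)
    also have "\<dots> = emeasure lborel (ball 0 1 \<inter> {x. sgn x \<in> B}) / ?V"
      by (rule emeasure_uniform_measure) auto
    also have "ball 0 1 \<inter> {x. sgn x \<in> B} = {x. x \<in> ball 0 1 \<and> sgn x \<in> B}" by auto
    finally show ?thesis .
  qed
  consider "t \<le> 0" | "0 < t" "t \<le> 1" | "t > 1" by linarith
  then show ?thesis
  proof cases
    case 1
    then have "{x::real^'n. (norm x)\<^sup>2 < t \<and> sgn x \<in> B} = {}"
      by (auto simp: not_less intro: order_trans[OF _ zero_le_power2])
    then have "emeasure ball_law {x::real^'n. (norm x)\<^sup>2 < t \<and> sgn x \<in> B} = 0" by (simp only: emeasure_empty)
    then show ?thesis using 1 by simp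
  next
    case 2
    have "ball 0 1 \<inter> {x. (norm x)\<^sup>2 < t \<and> sgn x \<in> B} = {x. x \<in> ball 0 (sqrt t) \<and> sgn x \<in> B}"
    proof -
      have "norm x < sqrt t \<longleftrightarrow> (norm x)\<^sup>2 < t" for x :: "real^'n"
        using 2 by (metis norm_ge_zero real_less_rsqrt real_sqrt_less_iff real_sqrt_unique)
      moreover have "norm x < 1" if "norm x < sqrt t" for x :: "real^'n"
        using that 2 by (meson less_le_trans real_sqrt_le_1_iff)
      ultimately show ?thesis by auto
    qed
    moreover have "sqrt t ^ CARD('n) = t powr (real CARD('n) / 2)"
      using 2 by (simp add: powr_half_sqrt[symmetric] powr_powr flip: powr_realpow)
    moreover have "emeasure lborel {x. x \<in> ball 0 (sqrt t) \<and> sgn x \<in> B} =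
        ennreal (sqrt t ^ CARD('n)) * emeasure lborel {x. x \<in> ball 0 1 \<and> sgn x \<in> B}"
      by (rule emeasure_cone) (use 2 in auto)
    moreover have "min 1 (max 0 t) = t" using 2 by simp
    ultimately show ?thesis unfolding e s by (simp only: ennreal_times_divide)
  next
    case 3
    have "(norm x)\<^sup>2 < t" if "norm x < 1" for x :: "real^'n"
      using that 3 power_le_one[of "norm x" 2] by auto
    then have "ball 0 1 \<inter> {x. (norm x)\<^sup>2 < t \<and> sgn x \<in> B} = {x. x \<in> ball 0 1 \<and> sgn x \<in> B}" by auto
    then show ?thesis unfolding e s using 3 by simp
  qed
qed

lemma sq_radius_law_below:
  "emeasure (sq_radius_law TYPE('n::finite)) {..<t} = ennreal (min 1 (max 0 t) powr (real CARD('n) / 2))"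
proof -
  have "emeasure (sq_radius_law TYPE('n)) {..<t} = emeasure ball_law {x::real^'n. (norm x)\<^sup>2 < t \<and> sgn x \<in> UNIV}"
    unfolding sq_radius_law_def by (subst emeasure_distr) (auto intro!: arg_cong[where f = "emeasure ball_law"])
  also have "\<dots> = ennreal (min 1 (max 0 t) powr (real CARD('n) / 2))"
    using prob_space.emeasure_space_1[OF prob_space_sphere_measure[where 'n = 'n]]
    by (subst ball_law_cone) auto
  finally show ?thesis .
qed

lemma sets_sq_radius_law [measurable_cong, simp]: "sets (sq_radius_law TYPE('n::finite)) = sets borel"
  by (simp add: sq_radius_law_def)

lemma prob_space_sq_radius_law: "prob_space (sq_radius_law TYPE('n::finite))"
  unfolding sq_radius_law_def by (intro prob_space.prob_space_distr prob_space_ball_law) simp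

text \<open>
The half-lines \<open>{..<t}\<close> form a generator of the Borel sets that is closed under intersection.
\<close>
lemma measure_eqI_below:
  fixes M N :: "real measure"
  assumes "sets M = sets borel" "sets N = sets borel"
    and "\<And>t. emeasure M {..<t} = emeasure N {..<t}" "\<And>t. emeasure M {..<t} \<noteq> \<infinity>"
  shows "M = N"
proof (rule measure_eqI_generator_eq[where E = "range lessThan" and \<Omega> = UNIV and A = "\<lambda>i. {..<real i}"])
  show "Int_stable (range lessThan :: real set set)"
  proof (rule Int_stableI, elim rangeE)
    fix a b :: "real set" and s t assume "a = {..<s}" "b = {..<t}"
    then have "a \<inter> b = {..<min s t}" by auto
    then show "a \<inter> b \<in> range lessThan" by blast
  qed
  show "sets M = sigma_sets UNIV (range lessThan)" "sets N = sigma_sets UNIV (range lessThan)"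
    using assms(1,2) by (simp_all add: borel_Iio)
  show "(\<Union>i. {..<real i}) = UNIV" using reals_Archimedean2 by auto
qed (use assms in auto)

text \<open>
The squared radius is preferred to the radius because the weights \<open>(1 - |x|\<^sup>2) powr \<beta>\<close> then lead directly to
Beta integrals.
\<close>
lemma sq_radius_law_density:
  "sq_radius_law TYPE('n::finite) =
     density lborel (\<lambda>s. ennreal (real CARD('n) / 2 * s powr (real CARD('n) / 2 - 1) * indicator {0<..<1} s))"
proof (rule measure_eqI_below)
  fix t :: real
  let ?n = "real CARD('n)"
  let ?c = "min 1 (max 0 t)"
  show "emeasure (sq_radius_law TYPE('n)) {..<t} \<noteq> \<infinity>" by (simp add: sq_radius_law_below)
  have n: "?n > 0" by simp
  have "((\<lambda>s. ?n / 2 * s powr (?n / 2 - 1)) has_integral ?n / 2 * (?c powr (?n / 2 - 1 + 1) / (?n / 2 - 1 + 1))) {0..?c}"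
    using n by (intro has_integral_mult_right has_integral_powr_from_0) auto
  then have "((\<lambda>s. ?n / 2 * s powr (?n / 2 - 1)) has_integral ?c powr (?n / 2)) {0..?c}" by simp
  then have I: "((\<lambda>s. if s \<in> {0..?c} then ?n / 2 * s powr (?n / 2 - 1) else 0) has_integral ?c powr (?n / 2)) UNIV"
    by (simp only: has_integral_restrict_UNIV)
  have "emeasure (density lborel (\<lambda>s. ennreal (?n / 2 * s powr (?n / 2 - 1) * indicator {0<..<1} s))) {..<t}
     = (\<integral>\<^sup>+ s. ennreal (?n / 2 * s powr (?n / 2 - 1) * indicator {0<..<1} s) * indicator {..<t} s \<partial>lborel)"
    by (subst emeasure_density) auto
  also have "\<dots> = (\<integral>\<^sup>+ s. ennreal (if s \<in> {0..?c} then ?n / 2 * s powr (?n / 2 - 1) else 0) \<partial>lborel)"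
  proof (rule nn_integral_cong_AE)
    have "AE s in (lborel :: real measure). s \<noteq> 0 \<and> s \<noteq> ?c"
      using AE_lborel_singleton[of "0::real"] AE_lborel_singleton[of ?c] by auto
    then show "AE s in lborel. ennreal (?n / 2 * s powr (?n / 2 - 1) * indicator {0<..<1} s) * indicator {..<t} s
        = ennreal (if s \<in> {0..?c} then ?n / 2 * s powr (?n / 2 - 1) else 0)"
      by eventually_elim (auto split: split_indicator)
  qed
  also have "\<dots> = ennreal (?c powr (?n / 2))"
    by (rule nn_integral_has_integral_lborel[OF _ _ I]) auto
  finally show "emeasure (sq_radius_law TYPE('n)) {..<t} =
      emeasure (density lborel (\<lambda>s. ennreal (?n / 2 * s powr (?n / 2 - 1) * indicator {0<..<1} s))) {..<t}"
    by (simp add: sq_radius_law_below)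
qed auto

text \<open>
Fubini's theorem in polar coordinates in probabilistic form: the squared radius and the direction of a
random point of the ball are independent. It suffices to test this on the events that the squared radius is
below \<open>t\<close>, where it is the scaling behaviour of cones.
\<close>
lemma radius_direction_independent:
  "sq_radius_law TYPE('n::finite) \<Otimes>\<^sub>M sphere_measure
     = distr ball_law (borel \<Otimes>\<^sub>M borel) (\<lambda>x::real^'n. ((norm x)\<^sup>2, sgn x))"
proof (rule pair_measure_eqI)
  interpret R: prob_space "sq_radius_law TYPE('n)" by (rule prob_space_sq_radius_law)
  interpret S: prob_space "sphere_measure :: (real^'n) measure" by (rule prob_space_sphere_measure)
  interpret L: prob_space "ball_law :: (real^'n) measure" by (rule prob_space_ball_law)
  show "sigma_finite_measure (sq_radius_law TYPE('n))" "sigma_finite_measure (sphere_measure :: (real^'n) measure)"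
    by unfold_locales
  show "sets (sq_radius_law TYPE('n) \<Otimes>\<^sub>M sphere_measure) = sets (distr ball_law (borel \<Otimes>\<^sub>M borel) (\<lambda>x::real^'n. ((norm x)\<^sup>2, sgn x)))"
    by (simp cong: sets_pair_measure_cong)
  fix A and B :: "(real^'n) set"
  assume "A \<in> sets (sq_radius_law TYPE('n))" "B \<in> sets sphere_measure"
  then have A[measurable]: "A \<in> sets borel" and B[measurable]: "B \<in> sets borel" by auto
  let ?c = "emeasure sphere_measure B"
  let ?M = "distr (density ball_law (indicator {x. sgn x \<in> B})) borel (\<lambda>x::real^'n. (norm x)\<^sup>2)"
  let ?N = "density (sq_radius_law TYPE('n)) (\<lambda>_. ?c)"
  have M: "emeasure ?M C = emeasure ball_law {x. (norm x)\<^sup>2 \<in> C \<and> sgn x \<in> B}" if C[measurable]: "C \<in> sets borel" for C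
  proof -
    have "emeasure ?M C = emeasure (density ball_law (indicator {x. sgn x \<in> B})) {x::real^'n. (norm x)\<^sup>2 \<in> C}"
      by (subst emeasure_distr) (auto intro!: arg_cong2[where f = emeasure])
    also have "\<dots> = (\<integral>\<^sup>+ x. indicator {x. sgn x \<in> B} x * indicator {x. (norm x)\<^sup>2 \<in> C} x \<partial>ball_law)"
      by (subst emeasure_density) auto
    also have "\<dots> = (\<integral>\<^sup>+ x. indicator {x. (norm x)\<^sup>2 \<in> C \<and> sgn x \<in> B} x \<partial>ball_law)"
      by (intro nn_integral_cong) (auto split: split_indicator)
    also have "\<dots> = emeasure ball_law {x. (norm x)\<^sup>2 \<in> C \<and> sgn x \<in> B}"
      by (subst nn_integral_indicator) auto
    finally show ?thesis .
  qed
  have "?M = ?N"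
  proof (rule measure_eqI_below)
    fix t
    have "emeasure ?M {..<t} = ennreal (min 1 (max 0 t) powr (real CARD('n) / 2)) * ?c"
      by (subst M) (auto simp: ball_law_cone)
    also have "\<dots> = emeasure ?N {..<t}"
      by (subst emeasure_density_const) (auto simp: sq_radius_law_below mult.commute)
    finally show "emeasure ?M {..<t} = emeasure ?N {..<t}" .
    show "emeasure ?M {..<t} \<noteq> \<infinity>" by (subst M) auto
  qed auto
  then have "emeasure ball_law {x. (norm x)\<^sup>2 \<in> A \<and> sgn x \<in> B} = emeasure ?N A" using M[OF A] by simp
  also have "\<dots> = ?c * emeasure (sq_radius_law TYPE('n)) A"
    by (subst emeasure_density_const) auto
  finally show "emeasure (sq_radius_law TYPE('n)) A * emeasure sphere_measure B =
      emeasure (distr ball_law (borel \<Otimes>\<^sub>M borel) (\<lambda>x::real^'n. ((norm x)\<^sup>2, sgn x))) (A \<times> B)"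
  proof (subst emeasure_distr)
    have "(\<lambda>x::real^'n. ((norm x)\<^sup>2, sgn x)) -` (A \<times> B) = {x. (norm x)\<^sup>2 \<in> A \<and> sgn x \<in> B}" by auto
    moreover assume "emeasure ball_law {x. (norm x)\<^sup>2 \<in> A \<and> sgn x \<in> B} = ?c * emeasure (sq_radius_law TYPE('n)) A"
    ultimately show "emeasure (sq_radius_law TYPE('n)) A * ?c
        = emeasure ball_law ((\<lambda>x::real^'n. ((norm x)\<^sup>2, sgn x)) -` (A \<times> B) \<inter> space ball_law)"
      by (simp add: mult.commute)
  qed auto
qed

lemma ball_law_integral:
  fixes f :: "real^'n::finite \<Rightarrow> 'b::{banach, second_countable_topology}"
  assumes f[measurable]: "f \<in> borel_measurable borel"
  shows "integrable ball_law f \<longleftrightarrow> set_integrable lborel (ball 0 1) f"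
    and "integral\<^sup>L ball_law f = (LINT x:ball 0 1|lborel. f x) /\<^sub>R unit_ball_vol (real CARD('n))"
proof -
  let ?V = "unit_ball_vol (real CARD('n))"
  have V: "?V > 0" by simp
  have e: "(indicator (ball 0 1) x / ?V) *\<^sub>R f x = (1 / ?V) *\<^sub>R (indicator (ball 0 1) x *\<^sub>R f x)" for x
    by simp
  have "integrable ball_law f \<longleftrightarrow> integrable lborel (\<lambda>x. (1 / ?V) *\<^sub>R (indicator (ball 0 1) x *\<^sub>R f x))"
    unfolding ball_law_density by (subst integrable_density) (use V in \<open>auto simp flip: e\<close>)
  also have "\<dots> \<longleftrightarrow> set_integrable lborel (ball 0 1) f"
    unfolding set_integrable_def
  proof
    assume h: "integrable lborel (\<lambda>x. (1 / ?V) *\<^sub>R (indicator (ball 0 1) x *\<^sub>R f x))"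
    have "integrable lborel (\<lambda>x. ?V *\<^sub>R ((1 / ?V) *\<^sub>R (indicator (ball 0 1) x *\<^sub>R f x)))"
      by (rule integrable_scaleR_right[OF h])
    moreover have "?V *\<^sub>R ((1 / ?V) *\<^sub>R (indicator (ball 0 1) x *\<^sub>R f x)) = indicator (ball 0 1) x *\<^sub>R f x" for x
    proof -
      have "?V \<noteq> 0" using V by linarith
      then show ?thesis by simp
    qed
    ultimately show "integrable lborel (\<lambda>x. indicator (ball 0 1) x *\<^sub>R f x)" by (simp only:)
  next
    assume h: "integrable lborel (\<lambda>x. indicator (ball 0 1) x *\<^sub>R f x)"
    show "integrable lborel (\<lambda>x. (1 / ?V) *\<^sub>R (indicator (ball 0 1) x *\<^sub>R f x))"
      by (rule integrable_scaleR_right[OF h])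
  qed
  finally show "integrable ball_law f \<longleftrightarrow> set_integrable lborel (ball 0 1) f" .
  have "integral\<^sup>L ball_law f = integral\<^sup>L lborel (\<lambda>x. (1 / ?V) *\<^sub>R (indicator (ball 0 1) x *\<^sub>R f x))"
    unfolding ball_law_density by (subst integral_density) (use V in \<open>auto simp flip: e\<close>)
  also have "\<dots> = (1 / ?V) *\<^sub>R (LINT x:ball 0 1|lborel. f x)"
    unfolding set_lebesgue_integral_def by (rule integral_scaleR_right)
  finally show "integral\<^sup>L ball_law f = (LINT x:ball 0 1|lborel. f x) /\<^sub>R ?V" by (simp add: divide_inverse)
qed

lemma polar_coordinates:
  fixes P :: "real^'n::finite \<Rightarrow> complex" and \<psi> :: "real \<Rightarrow> real"
  assumes P: "integrable sphere_measure P" and \<psi>[measurable]: "\<psi> \<in> borel_measurable borel"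
    and i: "set_integrable lborel {0<..<1} (\<lambda>s. s powr (real CARD('n) / 2 - 1) * \<psi> s)"
  shows "set_integrable lborel (ball 0 1) (\<lambda>x. of_real (\<psi> ((norm x)\<^sup>2)) * P (sgn x))"
    and "(LINT x:ball 0 1|lborel. of_real (\<psi> ((norm x)\<^sup>2)) * P (sgn x)) =
       of_real (real CARD('n) * unit_ball_vol (real CARD('n)) / 2 *
          (LINT s:{0<..<1}|lborel. s powr (real CARD('n) / 2 - 1) * \<psi> s)) * integral\<^sup>L sphere_measure P"
proof -
  let ?R = "sq_radius_law TYPE('n)" and ?S = "sphere_measure :: (real^'n) measure"
  let ?V = "unit_ball_vol (real CARD('n))" and ?n = "real CARD('n)"
  let ?I = "LINT s:{0<..<1}|lborel. s powr (?n / 2 - 1) * \<psi> s"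
  interpret R: prob_space ?R by (rule prob_space_sq_radius_law)
  interpret S: prob_space ?S by (rule prob_space_sphere_measure)
  interpret RS: pair_sigma_finite ?R ?S by unfold_locales
  have Pm[measurable]: "P \<in> borel_measurable borel" using borel_measurable_integrable[OF P] by simp
  have V: "?V > 0" by simp
  have e: "(?n / 2 * s powr (?n / 2 - 1) * indicator {0<..<1} s) *\<^sub>R \<psi> s
      = ?n / 2 * (indicator {0<..<1} s *\<^sub>R (s powr (?n / 2 - 1) * \<psi> s))" for s
    by simp
  have iR: "integrable ?R \<psi>"
    unfolding sq_radius_law_density
  proof (subst integrable_density)
    show "integrable lborel (\<lambda>s. (?n / 2 * s powr (?n / 2 - 1) * indicator {0<..<1} s) *\<^sub>R \<psi> s)"
      unfolding e using i unfolding set_integrable_def by (rule integrable_mult_right)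
  qed auto
  have IR: "integral\<^sup>L ?R \<psi> = ?n / 2 * ?I"
    unfolding sq_radius_law_density
  proof (subst integral_density)
    show "(\<integral>s. (?n / 2 * s powr (?n / 2 - 1) * indicator {0<..<1} s) *\<^sub>R \<psi> s \<partial>lborel) = ?n / 2 * ?I"
      unfolding e set_lebesgue_integral_def by (rule integral_mult_right_zero)
  qed auto
  have int: "integrable (?R \<Otimes>\<^sub>M ?S) (\<lambda>(s, z). of_real (\<psi> s) * P z)"
  proof (rule RS.Fubini_integrable)
    show "(\<lambda>(s, z). of_real (\<psi> s) * P z) \<in> borel_measurable (?R \<Otimes>\<^sub>M ?S)" by measurable
    have "(\<lambda>x. \<integral>y. norm (case (x, y) of (s, z) \<Rightarrow> of_real (\<psi> s) * P z) \<partial>?S) = (\<lambda>x. \<bar>\<psi> x\<bar> * (\<integral>y. norm (P y) \<partial>?S))"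
      by (simp add: norm_mult fun_eq_iff)
    then show "integrable ?R (\<lambda>x. \<integral>y. norm (case (x, y) of (s, z) \<Rightarrow> of_real (\<psi> s) * P z) \<partial>?S)"
      using iR by simp
    show "AE x in ?R. integrable ?S (\<lambda>y. case (x, y) of (s, z) \<Rightarrow> of_real (\<psi> s) * P z)"
      using P by simp
  qed
  have Int: "integral\<^sup>L (?R \<Otimes>\<^sub>M ?S) (\<lambda>(s, z). of_real (\<psi> s) * P z) = of_real (?n / 2 * ?I) * integral\<^sup>L ?S P"
    by (subst RS.integral_fst'[OF int, symmetric]) (simp add: IR)
  have m: "(\<lambda>x::real^'n. ((norm x)\<^sup>2, sgn x)) \<in> ball_law \<rightarrow>\<^sub>M borel \<Otimes>\<^sub>M borel" by measurable
  have m2: "(\<lambda>(s, z). complex_of_real (\<psi> s) * P z) \<in> borel_measurable (borel \<Otimes>\<^sub>M borel)" by measurable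
  have iL: "integrable ball_law (\<lambda>x. of_real (\<psi> ((norm x)\<^sup>2)) * P (sgn x))"
    using int unfolding radius_direction_independent by (subst (asm) integrable_distr_eq[OF m m2]) simp
  have IL: "integral\<^sup>L ball_law (\<lambda>x. of_real (\<psi> ((norm x)\<^sup>2)) * P (sgn x)) = of_real (?n / 2 * ?I) * integral\<^sup>L ?S P"
    using Int unfolding radius_direction_independent by (subst (asm) integral_distr[OF m m2]) simp
  have mf: "(\<lambda>x. of_real (\<psi> ((norm x)\<^sup>2)) * P (sgn x)) \<in> borel_measurable borel" by measurable
  show "set_integrable lborel (ball 0 1) (\<lambda>x. of_real (\<psi> ((norm x)\<^sup>2)) * P (sgn x))"
    using iL ball_law_integral(1)[OF mf] by simp
  have "(LINT x:ball 0 1|lborel. of_real (\<psi> ((norm x)\<^sup>2)) * P (sgn x)) = of_real ?V * (of_real (?n / 2 * ?I) * integral\<^sup>L ?S P)"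
    using ball_law_integral(2)[OF mf] V unfolding IL by (simp add: scaleR_conv_of_real field_simps)
  then show "(LINT x:ball 0 1|lborel. of_real (\<psi> ((norm x)\<^sup>2)) * P (sgn x)) =
       of_real (?n * ?V / 2 * ?I) * integral\<^sup>L ?S P"
    by (simp add: mult_ac)
qed

section \<open>Green's identity and orthogonality on the sphere\<close>

lemma integrable_sphere_measure:
  fixes f :: "real^'n::finite \<Rightarrow> complex"
  assumes "continuous_on UNIV f"
  shows "integrable sphere_measure f"
proof -
  interpret prob_space "sphere_measure :: (real^'n) measure" by (rule prob_space_sphere_measure)
  have "compact (f ` sphere 0 1)"
    by (intro compact_continuous_image continuous_on_subset[OF assms]) auto
  then obtain C where C: "\<forall>y\<in>f ` sphere 0 1. norm y \<le> C" using compact_imp_bounded bounded_iff by metis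
  have "AE x in sphere_measure. norm (f x) \<le> C"
    using AE_sphere_measure by eventually_elim (use C in auto)
  then show ?thesis
    by (rule integrable_const_bound) (use borel_measurable_continuous_onI[OF assms] in simp)
qed

lemma has_bochner_integral_beta:
  fixes c \<beta> :: real
  assumes "c > 0" "\<beta> > -1"
  shows "has_bochner_integral lborel (\<lambda>s. indicator {0<..<1} s *\<^sub>R (s powr (c - 1) * (1 - s) powr \<beta>)) (Beta c (\<beta> + 1))"
proof (rule has_bochner_integral_nn_integral)
  let ?f = "\<lambda>s. indicator {0<..<1} s *\<^sub>R (s powr (c - 1) * (1 - s) powr \<beta>)"
  have "((\<lambda>s. s powr (c - 1) * (1 - s) powr (\<beta> + 1 - 1)) has_integral Beta c (\<beta> + 1)) {0..1}"
    using assms by (intro has_integral_Beta_real) auto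
  then have "((\<lambda>s. s powr (c - 1) * (1 - s) powr \<beta>) has_integral Beta c (\<beta> + 1)) {0<..<1}"
    by (simp add: has_integral_Icc_iff_Ioo)
  then have "((\<lambda>s. if s \<in> {0<..<1} then s powr (c - 1) * (1 - s) powr \<beta> else 0) has_integral Beta c (\<beta> + 1)) UNIV"
    by (simp only: has_integral_restrict_UNIV)
  also have "(\<lambda>s. if s \<in> {0<..<1} then s powr (c - 1) * (1 - s) powr \<beta> else 0) = ?f"
    by (auto simp: fun_eq_iff)
  finally show "(\<integral>\<^sup>+ s. ennreal (?f s) \<partial>lborel) = ennreal (Beta c (\<beta> + 1))"
    by (intro nn_integral_has_integral_lborel) auto
  show "0 \<le> Beta c (\<beta> + 1)" using assms by (simp add: Beta_def Gamma_real_nonneg)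
qed auto

lemma beta_set_integral:
  fixes c \<beta> :: real
  assumes "c > 0" "\<beta> > -1"
  shows "set_integrable lborel {0<..<1} (\<lambda>s. s powr (c - 1) * (1 - s) powr \<beta>)"
    and "(LINT s:{0<..<1}|lborel. s powr (c - 1) * (1 - s) powr \<beta>) = Beta c (\<beta> + 1)"
  using has_bochner_integral_beta[OF assms]
  unfolding set_integrable_def set_lebesgue_integral_def has_bochner_integral_iff by auto

text \<open>
A homogeneous function is a power of the radius times its restriction to the sphere, so the radial
integral becomes a Beta integral.
\<close>
lemma homogeneous_ball_integral:
  fixes P :: "real^'n::finite \<Rightarrow> complex"
  assumes P: "continuous_on UNIV P" and hom: "\<And>r x. r > 0 \<Longrightarrow> P (r *\<^sub>R x) = of_real r ^ d * P x"
    and c: "c > 0" "c = (real CARD('n) + \<alpha> + real d) / 2" and \<beta>: "\<beta> > -1"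
  shows "set_integrable lborel (ball 0 1) (\<lambda>x. P x * of_real (norm x powr \<alpha> * (1 - (norm x)\<^sup>2) powr \<beta>))"
    and "(LINT x:ball 0 1|lborel. P x * of_real (norm x powr \<alpha> * (1 - (norm x)\<^sup>2) powr \<beta>)) =
       of_real (real CARD('n) * unit_ball_vol (real CARD('n)) / 2 * Beta c (\<beta> + 1)) * integral\<^sup>L sphere_measure P"
proof -
  let ?n = "real CARD('n)"
  define \<psi> where "\<psi> s = s powr ((\<alpha> + real d) / 2) * (1 - s) powr \<beta>" for s :: real
  have m[measurable]: "\<psi> \<in> borel_measurable borel" unfolding \<psi>_def by measurable
  have Pm[measurable]: "P \<in> borel_measurable borel" by (rule borel_measurable_continuous_onI[OF P])
  have e: "s powr (?n / 2 - 1) * \<psi> s = s powr (c - 1) * (1 - s) powr \<beta>" if "s \<in> {0<..<1}" for s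
  proof -
    have "?n / 2 - 1 + (\<alpha> + real d) / 2 = c - 1" using c(2) by (simp add: field_simps)
    then have "s powr (?n / 2 - 1) * s powr ((\<alpha> + real d) / 2) = s powr (c - 1)" by (simp only: powr_add[symmetric])
    then show ?thesis unfolding \<psi>_def by (simp only: mult.assoc[symmetric])
  qed
  have i: "set_integrable lborel {0<..<1} (\<lambda>s. s powr (?n / 2 - 1) * \<psi> s)"
    using beta_set_integral(1)[OF c(1) \<beta>] e by (subst set_integrable_cong) auto
  have I: "(LINT s:{0<..<1}|lborel. s powr (?n / 2 - 1) * \<psi> s) = Beta c (\<beta> + 1)"
    using beta_set_integral(2)[OF c(1) \<beta>] e by (subst set_lebesgue_integral_cong) auto
  let ?f = "\<lambda>x. P x * of_real (norm x powr \<alpha> * (1 - (norm x)\<^sup>2) powr \<beta>)"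
  let ?g = "\<lambda>x. of_real (\<psi> ((norm x)\<^sup>2)) * P (sgn x)"
  have eq: "?f x = ?g x" if x: "x \<noteq> 0" for x
  proof -
    have "P x = P (norm x *\<^sub>R sgn x)" using x by (simp add: sgn_div_norm)
    also have "\<dots> = of_real (norm x) ^ d * P (sgn x)" using x by (intro hom) auto
    finally have "P x = of_real (norm x powr d) * P (sgn x)" using x by (simp add: powr_realpow)
    moreover have "((norm x)\<^sup>2) powr ((\<alpha> + real d) / 2) = norm x powr \<alpha> * norm x powr d"
    proof -
      have "(norm x)\<^sup>2 = norm x powr 2" using x powr_realpow[of "norm x" 2] by simp
      then have "((norm x)\<^sup>2) powr ((\<alpha> + real d) / 2) = norm x powr (2 * ((\<alpha> + real d) / 2))"
        by (simp only: powr_powr)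
      also have "2 * ((\<alpha> + real d) / 2) = \<alpha> + real d" by simp
      finally show ?thesis by (simp only: powr_add)
    qed
    ultimately show ?thesis by (simp add: \<psi>_def mult_ac)
  qed
  have ae: "AE x in lborel. x \<in> ball 0 1 \<longrightarrow> ?f x = ?g x"
    using AE_lborel_singleton[of "0::real^'n"] by eventually_elim (use eq in auto)
  have mm: "?f \<in> borel_measurable lborel" "?g \<in> borel_measurable lborel" by measurable
  have iP: "integrable sphere_measure P" by (rule integrable_sphere_measure[OF P])
  show "set_integrable lborel (ball 0 1) ?f"
    using polar_coordinates(1)[OF iP m i] set_integrable_cong_AE[OF mm ae] by simp
  have "(LINT x:ball 0 1|lborel. ?f x) = (LINT x:ball 0 1|lborel. ?g x)"
    by (rule set_lebesgue_integral_cong_AE[OF _ mm ae]) simp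
  then show "(LINT x:ball 0 1|lborel. ?f x) = of_real (?n * unit_ball_vol ?n / 2 * Beta c (\<beta> + 1)) * integral\<^sup>L sphere_measure P"
    using polar_coordinates(2)[OF iP m i] I by simp
qed

lemma max_sq_deriv: "((\<lambda>s::real. (max 0 s)\<^sup>2) has_field_derivative 2 * max 0 s) (at s)"
proof -
  consider "s > 0" | "s < 0" | "s = 0" by linarith
  then show ?thesis
  proof cases
    case 1
    have "((\<lambda>s::real. s\<^sup>2) has_field_derivative 2 * max 0 s) (at s)"
      using 1 by (auto intro!: derivative_eq_intros)
    then show ?thesis
      by (rule has_field_derivative_transform_within_open[where S = "{0<..}"]) (use 1 in auto)
  next
    case 2
    have "((\<lambda>s::real. 0) has_field_derivative 2 * max 0 s) (at s)"
      using 2 by (auto intro!: derivative_eq_intros)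
    then show ?thesis
      by (rule has_field_derivative_transform_within_open[where S = "{..<0}"]) (use 2 in auto)
  next
    case 3
    have "((\<lambda>h. ((max 0 (0 + h))\<^sup>2 - (max 0 0)\<^sup>2) / h) \<longlongrightarrow> 0) (at (0::real))"
    proof (rule Lim_null_comparison[where g = "\<lambda>h. \<bar>h\<bar>"])
      show "\<forall>\<^sub>F h in at (0::real). norm (((max 0 (0 + h))\<^sup>2 - (max 0 0)\<^sup>2) / h) \<le> \<bar>h\<bar>"
        by (auto simp: eventually_at_filter max_def power2_eq_square)
      show "((\<lambda>h. \<bar>h\<bar>) \<longlongrightarrow> 0) (at (0::real))" by (rule tendsto_rabs_zero) (rule tendsto_ident_at)
    qed
    then show ?thesis using 3 by (simp add: DERIV_def)
  qed
qed

text \<open>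
The difference quotients of \<open>f\<close> have integral \<open>0\<close> by translation invariance, and by Lipschitz continuity they
converge dominatedly to \<open>D\<close>. This replaces the divergence theorem on the ball.
\<close>
lemma integral_derivative_eq_0:
  fixes f D :: "real^'n::finite \<Rightarrow> complex"
  assumes f: "continuous_on UNIV f" and D: "continuous_on UNIV D"
    and der: "\<And>x. ((\<lambda>t. f (x + t *\<^sub>R e)) has_vector_derivative D x) (at 0)"
    and out: "\<And>x. norm x \<ge> 1 \<Longrightarrow> f x = 0" "\<And>x. norm x \<ge> 1 \<Longrightarrow> D x = 0"
    and e: "norm e = 1"
  shows "integral\<^sup>L lborel D = 0"
proof -
  have "compact (D ` cball 0 1)" by (intro compact_continuous_image continuous_on_subset[OF D]) auto
  then obtain L0 where L0: "\<forall>y\<in>D ` cball 0 1. norm y \<le> L0" using compact_imp_bounded bounded_iff by metis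
  define L where "L = max 0 L0"
  have L: "norm (D x) \<le> L" for x
    using L0 out(2)[of x] by (cases "norm x \<le> 1") (auto simp: L_def le_max_iff_disj)
  have der': "((\<lambda>t. f (x + t *\<^sub>R e)) has_vector_derivative D (x + t *\<^sub>R e)) (at t)" for x t
  proof -
    have "((\<lambda>s. f ((x + t *\<^sub>R e) + s *\<^sub>R e)) has_vector_derivative D (x + t *\<^sub>R e)) (at 0)" by (rule der)
    then have g: "((\<lambda>s. f ((x + t *\<^sub>R e) + s *\<^sub>R e)) has_vector_derivative D (x + t *\<^sub>R e)) (at (t - t))" by simp
    have "((\<lambda>u. u - t) has_vector_derivative 1) (at t)"
      by (auto intro!: derivative_eq_intros)
    from vector_diff_chain_at[OF this g]
    have "((\<lambda>s. f ((x + t *\<^sub>R e) + s *\<^sub>R e)) \<circ> (\<lambda>u. u - t) has_vector_derivative D (x + t *\<^sub>R e)) (at t)" by simp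
    moreover have "(\<lambda>s. f ((x + t *\<^sub>R e) + s *\<^sub>R e)) \<circ> (\<lambda>u. u - t) = (\<lambda>u. f (x + u *\<^sub>R e))"
      by (simp add: fun_eq_iff algebra_simps)
    ultimately show ?thesis by simp
  qed
  have lip: "norm (f (x + t *\<^sub>R e) - f x) \<le> L * \<bar>t\<bar>" for x t
  proof -
    have "norm (f (x + t *\<^sub>R e) - f (x + 0 *\<^sub>R e)) \<le> L * norm (t - 0)"
    proof (rule differentiable_bound[of UNIV "\<lambda>t. f (x + t *\<^sub>R e)" "\<lambda>t h. h *\<^sub>R D (x + t *\<^sub>R e)"])
      show "((\<lambda>t. f (x + t *\<^sub>R e)) has_derivative (\<lambda>h. h *\<^sub>R D (x + s *\<^sub>R e))) (at s within UNIV)" for s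
        using der'[of x s] by (simp add: has_vector_derivative_def)
      show "onorm (\<lambda>h. h *\<^sub>R D (x + s *\<^sub>R e)) \<le> L" for s
        by (rule onorm_bound) (use L[of "x + s *\<^sub>R e"] in \<open>auto simp: L_def mult.commute intro!: mult_left_mono\<close>)
    qed auto
    then show ?thesis by simp
  qed
  have fm[measurable]: "f \<in> borel_measurable borel" by (rule borel_measurable_continuous_onI[OF f])
  have Dm[measurable]: "D \<in> borel_measurable borel" by (rule borel_measurable_continuous_onI[OF D])
  have fi: "integrable lborel f"
  proof -
    have "integrable lborel (\<lambda>x. indicator (cball 0 1) x *\<^sub>R f x)"
      by (intro borel_integrable_compact continuous_on_subset[OF f]) auto
    moreover have "indicator (cball 0 1) x *\<^sub>R f x = f x" for x
      using out(1)[of x] by (auto split: split_indicator)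
    ultimately show ?thesis by (simp only:)
  qed
  define \<tau> where "\<tau> k = 1 / real (Suc k)" for k
  have \<tau>: "\<tau> k > 0" "\<tau> k \<le> 1" for k by (auto simp: \<tau>_def)
  have \<tau>0: "\<tau> \<longlonglongrightarrow> 0" unfolding \<tau>_def by (rule LIMSEQ_Suc[OF lim_1_over_n])
  define F where "F k x = (f (x + \<tau> k *\<^sub>R e) - f x) /\<^sub>R \<tau> k" for k x
  have shift: "integrable lborel (\<lambda>x. f (x + c))" "integral\<^sup>L lborel (\<lambda>x. f (x + c)) = integral\<^sup>L lborel f" for c
  proof -
    have "integrable (distr lborel borel ((+) c)) f" using fi by (simp add: lborel_distr_plus)
    then show "integrable lborel (\<lambda>x. f (x + c))" by (subst (asm) integrable_distr_eq) (auto simp: add.commute)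
    have "integral\<^sup>L (distr lborel borel ((+) c)) f = integral\<^sup>L lborel (\<lambda>x. f (c + x))"
      by (rule integral_distr) auto
    then show "integral\<^sup>L lborel (\<lambda>x. f (x + c)) = integral\<^sup>L lborel f"
      by (simp add: lborel_distr_plus add.commute)
  qed
  have F0: "integral\<^sup>L lborel (F k) = 0" for k
    unfolding F_def using shift fi by simp
  have "(\<lambda>k. integral\<^sup>L lborel (F k)) \<longlonglongrightarrow> integral\<^sup>L lborel D"
  proof (rule integral_dominated_convergence[where w = "\<lambda>x. L * indicator (cball 0 2) x"])
    show "integrable lborel (\<lambda>x::real^'n. L * indicator (cball 0 2) x)"
      by (intro integrable_mult_right integrable_real_indicator emeasure_compact_finite) auto
    show "AE x in lborel. (\<lambda>k. F k x) \<longlonglongrightarrow> D x"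
    proof (rule AE_I2)
      fix x
      have "((\<lambda>t. (f (x + t *\<^sub>R e) - f x) /\<^sub>R t) \<longlongrightarrow> D x) (at 0)"
      proof (rule LIM_zero_cancel, rule tendsto_norm_zero_cancel)
        have "((\<lambda>h. norm (f (x + h *\<^sub>R e) - f x - h *\<^sub>R D x) / norm h) \<longlongrightarrow> 0) (at 0)"
          using der[of x] unfolding has_vector_derivative_def has_derivative_at by simp
        then show "((\<lambda>h. norm ((f (x + h *\<^sub>R e) - f x) /\<^sub>R h - D x)) \<longlongrightarrow> 0) (at 0)"
        proof (rule Lim_transform_eventually)
          have "norm (f (x + h *\<^sub>R e) - f x - h *\<^sub>R D x) / norm h = norm ((f (x + h *\<^sub>R e) - f x) /\<^sub>R h - D x)"
            if "h \<noteq> 0" for h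
          proof -
            have "(f (x + h *\<^sub>R e) - f x) /\<^sub>R h - D x = (f (x + h *\<^sub>R e) - f x - h *\<^sub>R D x) /\<^sub>R h"
              using that by (simp add: scaleR_diff_right)
            then show ?thesis by (simp add: divide_inverse mult.commute)
          qed
          then show "\<forall>\<^sub>F h in at 0. norm (f (x + h *\<^sub>R e) - f x - h *\<^sub>R D x) / norm h
              = norm ((f (x + h *\<^sub>R e) - f x) /\<^sub>R h - D x)"
            by (auto simp: eventually_at_filter)
        qed
      qed
      then show "(\<lambda>k. F k x) \<longlonglongrightarrow> D x" unfolding F_def
        by (rule filterlim_compose) (use \<tau> \<tau>0 in \<open>auto simp: filterlim_at less_imp_neq[symmetric] intro!: always_eventually\<close>)
    qed
    show "AE x in lborel. norm (F k x) \<le> L * indicator (cball 0 2) x" for k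
    proof (rule AE_I2)
      fix x
      show "norm (F k x) \<le> L * indicator (cball 0 2) x"
      proof (cases "x \<in> cball 0 2")
        case True
        have "norm (F k x) = norm (f (x + \<tau> k *\<^sub>R e) - f x) / \<tau> k"
          using \<tau>[of k] by (simp add: F_def divide_inverse mult.commute)
        also have "\<dots> \<le> L" using lip[of x "\<tau> k"] \<tau>[of k] by (simp add: divide_le_eq)
        finally show ?thesis using True by simp
      next
        case False
        have "norm x \<le> norm (x + \<tau> k *\<^sub>R e) + norm (\<tau> k *\<^sub>R e)" using norm_triangle_ineq4[of "x + \<tau> k *\<^sub>R e" "\<tau> k *\<^sub>R e"] by simp
        then have "norm (x + \<tau> k *\<^sub>R e) \<ge> 1" "norm x \<ge> 1" using False \<tau>[of k] e by auto
        then show ?thesis using False out(1) by (simp add: F_def)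
      qed
    qed
  qed (auto simp: F_def[abs_def])
  then show ?thesis unfolding F0 by (simp add: LIMSEQ_const_iff)
qed

lemma cvec_continuous: "continuous_on UNIV q \<Longrightarrow> continuous_on S (\<lambda>x. q (cvec x))"
  by (rule continuous_on_compose2[of UNIV q, OF _ continuous_cvec]) auto

lemma homogeneous_cvec_continuous:
  "homogeneous_polynomial m q \<Longrightarrow> continuous_on S (\<lambda>x. q (cvec x))"
  by (intro cvec_continuous homogeneous_continuous)

lemma sq_norm_line: "(norm (x + t *\<^sub>R axis i 1))\<^sup>2 = (norm x)\<^sup>2 + 2 * t * (x $ i) + t\<^sup>2" for x :: "real^'n::finite"
proof -
  have "axis i 1 \<bullet> axis i (1::real) = 1" "x \<bullet> axis i 1 = x $ i" "axis i 1 \<bullet> x = x $ i"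
    by (simp_all add: inner_axis inner_axis')
  then show ?thesis
    unfolding power2_norm_eq_inner inner_add_left inner_add_right inner_scaleR_left inner_scaleR_right
    by (simp only:) (simp add: power2_eq_square algebra_simps)
qed

text \<open>
Green's identity with the weight \<open>(1 - |x|\<^sup>2)\<^sup>2\<close>, which vanishes to second order on the sphere, so that there is no
boundary term and the weight can be continued by \<open>0\<close> as a differentiable function. The derivative of the
weight is radial, and Euler's identity evaluates the radial derivatives as the degrees \<open>a\<close> and \<open>b\<close>.
\<close>
lemma green_ball:
  fixes q r :: "complex^'n::finite \<Rightarrow> complex"
  assumes q: "homogeneous_polynomial b q" and r: "homogeneous_polynomial a r"
  shows "(LINT x:ball 0 1|lborel. (q (cvec x) * claplacian r (cvec x) - claplacian q (cvec x) * r (cvec x)) * of_real ((1 - (norm x)\<^sup>2)\<^sup>2))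
     = 4 * (of_nat a - of_nat b) * (LINT x:ball 0 1|lborel. q (cvec x) * r (cvec x) * of_real (1 - (norm x)\<^sup>2))"
proof -
  let ?m = "\<lambda>x::real^'n. max 0 (1 - (norm x)\<^sup>2)"
  let ?q = "\<lambda>i x. cpartial_deriv i q (cvec x)" and ?r = "\<lambda>i x. cpartial_deriv i r (cvec x)"
  let ?qq = "\<lambda>i x. cpartial_deriv i (cpartial_deriv i q) (cvec x)"
  let ?rr = "\<lambda>i x. cpartial_deriv i (cpartial_deriv i r) (cvec x)"
  let ?f = "\<lambda>i x. (q (cvec x) * ?r i x - r (cvec x) * ?q i x) * of_real ((?m x)\<^sup>2)"
  let ?D = "\<lambda>i x. (q (cvec x) * ?rr i x - r (cvec x) * ?qq i x) * of_real ((?m x)\<^sup>2)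
     + (q (cvec x) * ?r i x - r (cvec x) * ?q i x) * of_real (2 * ?m x * (- 2 * (x $ i)))"
  note hq = homogeneous_cpartial[OF q] and hr = homogeneous_cpartial[OF r]
  note cont = homogeneous_cvec_continuous[OF q] homogeneous_cvec_continuous[OF r]
    homogeneous_cvec_continuous[OF hq] homogeneous_cvec_continuous[OF hr]
    homogeneous_cvec_continuous[OF homogeneous_cpartial[OF hq]] homogeneous_cvec_continuous[OF homogeneous_cpartial[OF hr]]
  have out: "?m x = 0" if "norm x \<ge> 1" for x using one_le_power[OF that, of 2] by (simp add: max_def)
  have Dc: "continuous_on UNIV (?D i)" and fc: "continuous_on UNIV (?f i)" for i
    by (intro continuous_intros cont)+
  have I0: "integral\<^sup>L lborel (?D i) = 0" for i
  proof (rule integral_derivative_eq_0[OF fc Dc, where e = "axis i 1"])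
    fix x
    have w: "((\<lambda>t. complex_of_real ((?m (x + t *\<^sub>R axis i 1))\<^sup>2)) has_vector_derivative of_real (2 * ?m x * (- 2 * (x $ i)))) (at 0)"
    proof -
      have "((\<lambda>t. 1 - (norm (x + t *\<^sub>R axis i 1))\<^sup>2) has_field_derivative - 2 * (x $ i)) (at 0)"
        unfolding sq_norm_line by (auto intro!: derivative_eq_intros)
      then have "((\<lambda>t. (?m (x + t *\<^sub>R axis i 1))\<^sup>2) has_field_derivative (2 * ?m x) * (- 2 * (x $ i))) (at 0)"
        using DERIV_chain'[of "\<lambda>t. 1 - (norm (x + t *\<^sub>R axis i 1))\<^sup>2" "- 2 * (x $ i)" 0 UNIV "\<lambda>s. (max 0 s)\<^sup>2" "2 * ?m x"] max_sq_deriv[of "1 - (norm x)\<^sup>2"] 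
        by simp
      then show ?thesis by (intro has_vector_derivative_of_real) (simp add: has_real_derivative_iff_has_vector_derivative)
    qed
    note dq = homogeneous_real_line_deriv[OF q, of x i] and dr = homogeneous_real_line_deriv[OF r, of x i]
      and dqi = homogeneous_real_line_deriv[OF hq[of i], of x i] and dri = homogeneous_real_line_deriv[OF hr[of i], of x i]
    have "((\<lambda>t. ?f i (x + t *\<^sub>R axis i 1)) has_vector_derivative
        (q (cvec x) * ?r i x - r (cvec x) * ?q i x) * of_real (2 * ?m x * (- 2 * (x $ i)))
        + ((q (cvec x) * ?rr i x + ?q i x * ?r i x) - (r (cvec x) * ?qq i x + ?r i x * ?q i x)) * of_real ((?m x)\<^sup>2)) (at 0)"
      using has_vector_derivative_mult[OF has_vector_derivative_diff[OF
          has_vector_derivative_mult[OF dq dri] has_vector_derivative_mult[OF dr dqi]] w]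
      by simp
    then show "((\<lambda>t. ?f i (x + t *\<^sub>R axis i 1)) has_vector_derivative ?D i x) (at 0)"
      by (simp add: algebra_simps)
  qed (auto simp: out)
  have Di: "integrable lborel (?D i)" for i
  proof -
    have "integrable lborel (\<lambda>x. indicator (cball 0 1) x *\<^sub>R ?D i x)"
      by (intro borel_integrable_compact continuous_on_subset[OF Dc]) auto
    moreover have "indicator (cball 0 1) x *\<^sub>R ?D i x = ?D i x" for x
      using out[of x] by (auto split: split_indicator)
    ultimately show ?thesis by (simp only:)
  qed
  let ?A = "\<lambda>x. (q (cvec x) * claplacian r (cvec x) - claplacian q (cvec x) * r (cvec x)) * of_real ((?m x)\<^sup>2)"
  let ?B = "\<lambda>x. q (cvec x) * r (cvec x) * of_real (?m x)"
  have Ac: "continuous_on UNIV ?A" and Bc: "continuous_on UNIV ?B"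
    by (intro continuous_intros cont homogeneous_cvec_continuous[OF homogeneous_claplacian[OF q]]
        homogeneous_cvec_continuous[OF homogeneous_claplacian[OF r]])+
  have AB: "integrable lborel ?A" "integrable lborel ?B" 
    "integral\<^sup>L lborel ?A = (LINT x:ball 0 1|lborel. (q (cvec x) * claplacian r (cvec x) - claplacian q (cvec x) * r (cvec x)) * of_real ((1 - (norm x)\<^sup>2)\<^sup>2))"
    "integral\<^sup>L lborel ?B = (LINT x:ball 0 1|lborel. q (cvec x) * r (cvec x) * of_real (1 - (norm x)\<^sup>2))"
  proof -
    have "indicator (cball 0 1) x *\<^sub>R ?A x = ?A x" "indicator (cball 0 1) x *\<^sub>R ?B x = ?B x" for x
      using out[of x] by (auto split: split_indicator)
    moreover have "integrable lborel (\<lambda>x. indicator (cball 0 1) x *\<^sub>R ?A x)" "integrable lborel (\<lambda>x. indicator (cball 0 1) x *\<^sub>R ?B x)"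
      by (intro borel_integrable_compact continuous_on_subset[OF Ac] continuous_on_subset[OF Bc]; simp)+
    ultimately show "integrable lborel ?A" "integrable lborel ?B" by (simp_all only:)
    have "?m x = 1 - (norm x)\<^sup>2" if "x \<in> ball 0 1" for x using that power_le_one[of "norm x" 2] by (simp add: max_def)
    then show "integral\<^sup>L lborel ?A = (LINT x:ball 0 1|lborel. (q (cvec x) * claplacian r (cvec x) - claplacian q (cvec x) * r (cvec x)) * of_real ((1 - (norm x)\<^sup>2)\<^sup>2))"
      "integral\<^sup>L lborel ?B = (LINT x:ball 0 1|lborel. q (cvec x) * r (cvec x) * of_real (1 - (norm x)\<^sup>2))"
      unfolding set_lebesgue_integral_def
      by (intro Bochner_Integration.integral_cong refl; use out in \<open>auto split: split_indicator\<close>)+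
  qed
  have "(\<Sum>i\<in>UNIV. ?D i x) = ?A x - 4 * (of_nat a - of_nat b) * ?B x" for x
  proof -
    have "(\<Sum>i\<in>UNIV. ?D i x) = (q (cvec x) * (\<Sum>i\<in>UNIV. ?rr i x) - r (cvec x) * (\<Sum>i\<in>UNIV. ?qq i x)) * of_real ((?m x)\<^sup>2)
      - 4 * of_real (?m x) * (q (cvec x) * (\<Sum>i\<in>UNIV. cvec x $ i * ?r i x) - r (cvec x) * (\<Sum>i\<in>UNIV. cvec x $ i * ?q i x))"
      by (simp add: sum.distrib sum_subtractf sum_distrib_left sum_distrib_right cvec_def algebra_simps)
    also have "\<dots> = ?A x - 4 * (of_nat a - of_nat b) * ?B x"
      unfolding euler_homogeneous[OF q] euler_homogeneous[OF r] by (simp add: claplacian_def algebra_simps)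
    finally show ?thesis .
  qed
  moreover have "integral\<^sup>L lborel (\<lambda>x. \<Sum>i\<in>UNIV. ?D i x) = 0"
    using Di I0 by (subst Bochner_Integration.integral_sum) auto
  ultimately have "integral\<^sup>L lborel (\<lambda>x. ?A x - 4 * (of_nat a - of_nat b) * ?B x) = 0" by simp
  then have "integral\<^sup>L lborel ?A = 4 * (of_nat a - of_nat b) * integral\<^sup>L lborel ?B"
    using AB by simp
  then show ?thesis unfolding AB(3,4) .
qed

text \<open>
The bilinear pairing, without conjugation; the integrand is a polynomial again.
\<close>
definition sphere_pair :: "(complex^'n::finite \<Rightarrow> complex) \<Rightarrow> (complex^'n \<Rightarrow> complex) \<Rightarrow> complex" where
  "sphere_pair q r = integral\<^sup>L sphere_measure (\<lambda>x. q (cvec x) * r (cvec x))"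

lemma integrable_sphere_pair:
  assumes "homogeneous_polynomial a q" "homogeneous_polynomial b r"
  shows "integrable sphere_measure (\<lambda>x. q (cvec x) * r (cvec x))"
  by (intro integrable_sphere_measure continuous_intros homogeneous_cvec_continuous[OF assms(1)]
      homogeneous_cvec_continuous[OF assms(2)])

lemma pair_ball_integral:
  fixes q r :: "complex^'n::finite \<Rightarrow> complex"
  assumes q: "homogeneous_polynomial b q" and r: "homogeneous_polynomial a r"
    and c: "c > 0" "c = (real CARD('n) + \<alpha> + real (b + a)) / 2" and \<beta>: "\<beta> > -1"
  shows "set_integrable lborel (ball 0 1) (\<lambda>x. q (cvec x) * r (cvec x) * of_real (norm x powr \<alpha> * (1 - (norm x)\<^sup>2) powr \<beta>))"
    and "(LINT x:ball 0 1|lborel. q (cvec x) * r (cvec x) * of_real (norm x powr \<alpha> * (1 - (norm x)\<^sup>2) powr \<beta>)) =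
       of_real (real CARD('n) * unit_ball_vol (real CARD('n)) / 2 * Beta c (\<beta> + 1)) * sphere_pair q r"
proof -
  have "continuous_on UNIV (\<lambda>x. q (cvec x) * r (cvec x))"
    by (intro continuous_intros homogeneous_cvec_continuous[OF q] homogeneous_cvec_continuous[OF r])
  moreover have "q (cvec (s *\<^sub>R x)) * r (cvec (s *\<^sub>R x)) = of_real s ^ (b + a) * (q (cvec x) * r (cvec x))" for s x
    by (simp add: homogeneous_scaleR[OF q] homogeneous_scaleR[OF r] power_add)
  ultimately show "set_integrable lborel (ball 0 1) (\<lambda>x. q (cvec x) * r (cvec x) * of_real (norm x powr \<alpha> * (1 - (norm x)\<^sup>2) powr \<beta>))"
    "(LINT x:ball 0 1|lborel. q (cvec x) * r (cvec x) * of_real (norm x powr \<alpha> * (1 - (norm x)\<^sup>2) powr \<beta>)) =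
       of_real (real CARD('n) * unit_ball_vol (real CARD('n)) / 2 * Beta c (\<beta> + 1)) * sphere_pair q r"
    unfolding sphere_pair_def using c \<beta> by (rule homogeneous_ball_integral)+
qed

text \<open>
The case \<open>\<alpha> = 0\<close> of \<open>pair_ball_integral\<close>, with powers of natural exponent in place of real ones, which differ
only at the origin. The summand \<open>0\<close> in the Beta value is this \<open>\<alpha>\<close>.
\<close>
lemma pair_ball_integral_poly_weight:
  fixes q r :: "complex^'n::finite \<Rightarrow> complex"
  assumes q: "homogeneous_polynomial b q" and r: "homogeneous_polynomial a r"
  shows "set_integrable lborel (ball 0 1) (\<lambda>x. q (cvec x) * r (cvec x) * of_real ((1 - (norm x)\<^sup>2) ^ k))"
    and "(LINT x:ball 0 1|lborel. q (cvec x) * r (cvec x) * of_real ((1 - (norm x)\<^sup>2) ^ k)) =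
      of_real (real CARD('n) * unit_ball_vol (real CARD('n)) / 2 * Beta ((real CARD('n) + 0 + real (b + a)) / 2) (real k + 1)) * sphere_pair q r"
    and "0 < real CARD('n) * unit_ball_vol (real CARD('n)) / 2 * Beta ((real CARD('n) + 0 + real (b + a)) / 2) (real k + 1)"
proof -
  let ?c = "(real CARD('n) + 0 + real (b + a)) / 2"
  let ?f = "\<lambda>x. q (cvec x) * r (cvec x) * of_real (norm x powr 0 * (1 - (norm x)\<^sup>2) powr real k)"
  let ?g = "\<lambda>x. q (cvec x) * r (cvec x) * of_real ((1 - (norm x)\<^sup>2) ^ k)"
  have c: "?c > 0" by (intro divide_pos_pos add_pos_nonneg) auto
  note I = pair_ball_integral[OF q r c refl, of "real k", simplified of_nat_0_le_iff]
  have ae: "AE x in lborel. x \<in> ball 0 1 \<longrightarrow> ?f x = ?g x"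
    using AE_lborel_singleton[of "0::real^'n"]
  proof eventually_elim
    case (elim x)
    have "1 - (norm x)\<^sup>2 > 0" if "x \<in> ball 0 1"
      using that power_less_one_iff[of "norm x" 2] by simp
    then show ?case using elim by (auto simp: powr_realpow)
  qed
  have [measurable]: "(\<lambda>x. q (cvec x)) \<in> borel_measurable borel" "(\<lambda>x. r (cvec x)) \<in> borel_measurable borel"
    by (intro borel_measurable_continuous_onI homogeneous_cvec_continuous[OF q] homogeneous_cvec_continuous[OF r])+
  have mm: "?f \<in> borel_measurable lborel" "?g \<in> borel_measurable lborel" by measurable
  show "set_integrable lborel (ball 0 1) ?g"
    using I(1) set_integrable_cong_AE[OF mm ae] by simp
  have "(LINT x:ball 0 1|lborel. ?f x) = (LINT x:ball 0 1|lborel. ?g x)"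
    by (rule set_lebesgue_integral_cong_AE[OF _ mm ae]) simp
  then show "(LINT x:ball 0 1|lborel. ?g x) = of_real (real CARD('n) * unit_ball_vol (real CARD('n)) / 2 * Beta ?c (real k + 1)) * sphere_pair q r"
    using I(2) by simp
  have k: "real k + 1 > 0" "?c + (real k + 1) > 0" using c by linarith+
  have "Beta ?c (real k + 1) > 0" unfolding Beta_def
    using Gamma_real_pos[OF c] Gamma_real_pos[OF k(1)] Gamma_real_pos[OF k(2)] by simp
  then show "0 < real CARD('n) * unit_ball_vol (real CARD('n)) / 2 * Beta ?c (real k + 1)" by simp
qed

text \<open>
On the ball all three pairings in Green's identity are positive multiples of pairings on the sphere, and the
factor \<open>a - b\<close> does not vanish.
\<close>
lemma sphere_pair_green:
  fixes q r :: "complex^'n::finite \<Rightarrow> complex"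
  assumes q: "homogeneous_polynomial b q" and r: "homogeneous_polynomial a r" and ab: "a \<noteq> b"
    and 1: "sphere_pair q (claplacian r) = 0" and 2: "sphere_pair (claplacian q) r = 0"
  shows "sphere_pair q r = 0"
proof -
  note lq = homogeneous_claplacian[OF q] and lr = homogeneous_claplacian[OF r]
  obtain \<kappa>1 where k1: "(LINT x:ball 0 1|lborel. q (cvec x) * claplacian r (cvec x) * of_real ((1 - (norm x)\<^sup>2)\<^sup>2)) = of_real \<kappa>1 * sphere_pair q (claplacian r)"
    using pair_ball_integral_poly_weight(2)[OF q lr, of 2] by blast
  obtain \<kappa>2 where k2: "(LINT x:ball 0 1|lborel. claplacian q (cvec x) * r (cvec x) * of_real ((1 - (norm x)\<^sup>2)\<^sup>2)) = of_real \<kappa>2 * sphere_pair (claplacian q) r"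
    using pair_ball_integral_poly_weight(2)[OF lq r, of 2] by blast
  obtain \<kappa> :: real where k: "\<kappa> > 0" "(LINT x:ball 0 1|lborel. q (cvec x) * r (cvec x) * of_real (1 - (norm x)\<^sup>2)) = of_real \<kappa> * sphere_pair q r"
    using pair_ball_integral_poly_weight(2)[OF q r, of 1] pair_ball_integral_poly_weight(3)[OF q r, of 1] that
    unfolding power_one_right by blast
  have "(LINT x:ball 0 1|lborel. (q (cvec x) * claplacian r (cvec x) - claplacian q (cvec x) * r (cvec x)) * of_real ((1 - (norm x)\<^sup>2)\<^sup>2)) = 0"
    using set_integral_diff(2)[OF pair_ball_integral_poly_weight(1)[OF q lr, of 2] pair_ball_integral_poly_weight(1)[OF lq r, of 2]] k1 k2 1 2
    by (simp add: left_diff_distrib)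
  then have "4 * (of_nat a - of_nat b) * (of_real \<kappa> * sphere_pair q r) = 0"
    using green_ball[OF q r] k by simp
  then show ?thesis using ab k by simp
qed

lemma claplacian_low_degree:
  assumes "homogeneous_polynomial m q" "m < 2"
  shows "claplacian q = (\<lambda>_. 0)"
  using assms by (auto elim!: homogeneous_imp_hpoly simp: claplacian_hpoly)

lemma sphere_pair_zero [simp]: "sphere_pair (\<lambda>_. 0) r = 0" "sphere_pair q (\<lambda>_. 0) = 0"
  by (simp_all add: sphere_pair_def)

text \<open>
Induction on \<open>s + t\<close> through \<open>sphere_pair_green\<close>: applying the Laplacian to one of the polynomials lowers its
order by one and its degree by two, and the condition excludes precisely that the degrees become equal
before one of the polynomials has become zero. For \<open>s = t = 1\<close> this is the orthogonality of spherical
harmonics of different degrees.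
\<close>
lemma sphere_pair_orthogonal:
  fixes q r :: "complex^'n::finite \<Rightarrow> complex"
  assumes "q \<in> polyharmonic_polys s b" "r \<in> polyharmonic_polys t a"
    and "\<And>i j. i < s \<Longrightarrow> j < t \<Longrightarrow> a + 2 * i \<noteq> b + 2 * j"
  shows "sphere_pair q r = 0"
  using assms
proof (induction "s + t" arbitrary: s t q r a b rule: less_induct)
  case less
  have q: "homogeneous_polynomial b q" "(claplacian ^^ s) q = (\<lambda>_. 0)"
    and r: "homogeneous_polynomial a r" "(claplacian ^^ t) r = (\<lambda>_. 0)"
    using less.prems by (auto simp: polyharmonic_polys_def)
  show ?case
  proof (cases "s = 0 \<or> t = 0")
    case True
    then show ?thesis using q(2) r(2) by auto
  next
    case False
    then obtain s' t' where st: "s = Suc s'" "t = Suc t'" by (metis not0_implies_Suc)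
    have lq: "claplacian q \<in> polyharmonic_polys s' (b - 2)" and lr: "claplacian r \<in> polyharmonic_polys t' (a - 2)"
      using q r homogeneous_claplacian unfolding st polyharmonic_polys_def funpow_Suc_right o_apply by auto
    show ?thesis
    proof (rule sphere_pair_green[OF q(1) r(1)])
      show "a \<noteq> b" using less.prems(3)[of 0 0] st by simp
      show "sphere_pair q (claplacian r) = 0"
      proof (cases "a < 2")
        case True
        then show ?thesis using claplacian_low_degree[OF r(1)] by simp
      next
        case a: False
        show ?thesis
        proof (rule less.hyps[OF _ less.prems(1) lr])
          show "s + t' < s + t" using st by simp
          show "a - 2 + 2 * i \<noteq> b + 2 * j" if "i < s" "j < t'" for i j
            using less.prems(3)[of i "Suc j"] that st a by auto
        qed
      qed
      show "sphere_pair (claplacian q) r = 0"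
      proof (cases "b < 2")
        case True
        then show ?thesis using claplacian_low_degree[OF q(1)] by simp
      next
        case b: False
        show ?thesis
        proof (rule less.hyps[OF _ lq less.prems(2)])
          show "s' + t < s + t" using st by simp
          show "a + 2 * i \<noteq> b - 2 + 2 * j" if "i < s'" "j < t" for i j
            using less.prems(3)[of "Suc i" j] that st b by auto
        qed
      qed
    qed
  qed
qed

section \<open>Reproducing kernels of homogeneous polyharmonic polynomials\<close>

definition sphere_inner :: "(complex^'n::finite \<Rightarrow> complex) \<Rightarrow> (complex^'n \<Rightarrow> complex) \<Rightarrow> complex" where
  "sphere_inner q r = sphere_pair q (star r)"

definition sphere_sq :: "(complex^'n::finite \<Rightarrow> complex) \<Rightarrow> real" where
  "sphere_sq q = integral\<^sup>L sphere_measure (\<lambda>x. (cmod (q (cvec x)))\<^sup>2)"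

lemma sphere_inner_self: "sphere_inner q q = of_real (sphere_sq q)"
  unfolding sphere_inner_def sphere_pair_def sphere_sq_def
  by (simp add: complex_norm_square[symmetric] flip: of_real_power)

lemma sphere_sq_nonneg: "sphere_sq q \<ge> 0"
  unfolding sphere_sq_def by (intro Bochner_Integration.integral_nonneg) auto

lemma sphere_inner_cnj: "sphere_inner r q = cnj (sphere_inner q r)"
proof -
  have "cnj (sphere_inner q r) = integral\<^sup>L sphere_measure (\<lambda>x. cnj (q (cvec x) * star r (cvec x)))"
    unfolding sphere_inner_def sphere_pair_def by (rule Bochner_Integration.integral_cnj[symmetric])
  then show ?thesis unfolding sphere_inner_def sphere_pair_def by (simp add: mult.commute)
qed

lemma sphere_inner_sum_left:
  assumes "\<And>i. i \<in> I \<Longrightarrow> homogeneous_polynomial m (q i)" "homogeneous_polynomial m' r"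
  shows "sphere_inner (\<lambda>z. \<Sum>i\<in>I. a i * q i z) r = (\<Sum>i\<in>I. a i * sphere_inner (q i) r)"
proof -
  have i: "integrable sphere_measure (\<lambda>x. q i (cvec x) * star r (cvec x))" if "i \<in> I" for i
    by (rule integrable_sphere_pair[OF assms(1)[OF that] star_homogeneous[OF assms(2)]])
  have "sphere_inner (\<lambda>z. \<Sum>i\<in>I. a i * q i z) r
      = integral\<^sup>L sphere_measure (\<lambda>x. \<Sum>i\<in>I. a i * (q i (cvec x) * star r (cvec x)))"
    unfolding sphere_inner_def sphere_pair_def by (simp add: sum_distrib_right mult.assoc)
  also have "\<dots> = (\<Sum>i\<in>I. a i * sphere_inner (q i) r)"
    unfolding sphere_inner_def sphere_pair_def
    using i by (subst Bochner_Integration.integral_sum) auto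
  finally show ?thesis .
qed

lemma sphere_inner_sum_right:
  assumes "\<And>i. i \<in> I \<Longrightarrow> homogeneous_polynomial m (q i)" "homogeneous_polynomial m' r"
  shows "sphere_inner r (\<lambda>z. \<Sum>i\<in>I. a i * q i z) = (\<Sum>i\<in>I. cnj (a i) * sphere_inner r (q i))"
proof -
  have "sphere_inner r (\<lambda>z. \<Sum>i\<in>I. a i * q i z) = cnj (sphere_inner (\<lambda>z. \<Sum>i\<in>I. a i * q i z) r)"
    by (rule sphere_inner_cnj)
  also have "\<dots> = (\<Sum>i\<in>I. cnj (a i) * cnj (sphere_inner (q i) r))"
    by (simp add: sphere_inner_sum_left[OF assms])
  also have "\<dots> = (\<Sum>i\<in>I. cnj (a i) * sphere_inner r (q i))"
    by (simp only: sphere_inner_cnj[symmetric])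
  finally show ?thesis .
qed

lemma sphere_inner_diff_left:
  assumes "homogeneous_polynomial m q" "homogeneous_polynomial m g" "homogeneous_polynomial m' r"
  shows "sphere_inner (\<lambda>z. q z - g z) r = sphere_inner q r - sphere_inner g r"
  unfolding sphere_inner_def sphere_pair_def left_diff_distrib
  by (rule Bochner_Integration.integral_diff)
     (rule integrable_sphere_pair[OF assms(1) star_homogeneous[OF assms(3)]]
           integrable_sphere_pair[OF assms(2) star_homogeneous[OF assms(3)]])+

lemma sphere_inner_scale_left: "sphere_inner (\<lambda>z. a * q z) r = a * sphere_inner q r"
  unfolding sphere_inner_def sphere_pair_def by (simp add: mult.assoc)

lemma sphere_inner_scale_right: "sphere_inner r (\<lambda>z. a * q z) = cnj a * sphere_inner r q"
  by (metis complex_cnj_mult sphere_inner_cnj sphere_inner_scale_left)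

text \<open>
A polynomial bounded by \<open>M\<close> on the sphere varies by at most \<open>M / 2\<close> on a ball of radius proportional to
\<open>(m + 1)\<^sup>-\<^sup>2\<close>, with a constant \<open>x\<close> that depends on the dimension only. This is Markov's inequality in disguise;
the estimate comes from \<open>taylor_bound\<close> with \<open>s = R - 1 = 1 / (m + 1)\<close>.
\<close>
lemma homogeneous_large_near_max:
  obtains x :: real where "0 < x" "x < 1"
    "\<And>m q (\<eta>::real^'n::finite) M y. homogeneous_polynomial m q \<Longrightarrow> (\<And>z::real^'n. norm z = 1 \<Longrightarrow> cmod (q (cvec z)) \<le> M) \<Longrightarrow>
       norm \<eta> = 1 \<Longrightarrow> cmod (q (cvec \<eta>)) = M \<Longrightarrow> norm (y - \<eta>) \<le> x / (2 * (real m + 1)\<^sup>2) \<Longrightarrow> M / 2 \<le> cmod (q (cvec y))"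
proof -
  let ?n = "CARD('n)"
  \<comment> \<open>\<open>E\<close> bounds the growth factors, and \<open>x\<close> is chosen such that the Taylor polynomial without its constant term is at most \<open>M / 2\<close>\<close>
  define E where "E = exp (2 * real ?n)"
  have "((\<lambda>x::real. E * ((1 / (1 - x)) ^ ?n - 1)) \<longlongrightarrow> E * ((1 / (1 - 0)) ^ ?n - 1)) (at_right 0)"
    by (intro tendsto_intros) auto
  then have "\<forall>\<^sub>F x::real in at_right 0. E * ((1 / (1 - x)) ^ ?n - 1) < 1 / 2"
    by (rule order_tendstoD) simp
  then have "\<forall>\<^sub>F x::real in at_right 0. E * ((1 / (1 - x)) ^ ?n - 1) < 1 / 2 \<and> x \<in> {0<..<1}"
    by (rule eventually_conj) (rule eventually_at_right_real, simp)
  then obtain x :: real where x: "E * ((1 / (1 - x)) ^ ?n - 1) < 1 / 2" "0 < x" "x < 1"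
    using eventually_happens'[OF trivial_limit_at_right_real[of 0]] by fastforce
  show ?thesis
  proof (rule that[OF x(2,3)])
    fix m q M and \<eta> y :: "real^'n"
    assume q: "homogeneous_polynomial m q" and M: "\<And>z::real^'n. norm z = 1 \<Longrightarrow> cmod (q (cvec z)) \<le> M"
      and \<eta>: "norm \<eta> = 1" "cmod (q (cvec \<eta>)) = M" and y: "norm (y - \<eta>) \<le> x / (2 * (real m + 1)\<^sup>2)"
    define s where "s = 1 / (real m + 1)"
    define R where "R = 1 + s"
    define \<delta> where "\<delta> = s * (R - 1 / R) / 2"
    define d where "d = 1 / (2 * (real m + 1)\<^sup>2)"
    have s: "s > 0" "s * real m \<le> 1" by (simp_all add: s_def)
    have R: "R > 1" using s by (simp add: R_def)
    have M0: "M \<ge> 0" using \<eta> by auto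
    obtain c where c: "\<And>h. q (cvec \<eta> + h) = (\<Sum>k\<in>mbox m. c k * mpow h k)"
      "\<And>k. k \<in> mbox m \<Longrightarrow> cmod (c k) * \<delta> ^ sum k UNIV \<le> M * (1 + real ?n * s) ^ m * R ^ (m * ?n)"
      using taylor_bound[OF q M _ s(1) R, of \<eta>] \<eta>(1) unfolding \<delta>_def by auto
    have "(1 + real ?n * s) ^ m \<le> exp (real ?n * s) ^ m"
      using s by (intro power_mono) auto
    also have "\<dots> = exp (real ?n * (s * real m))" by (simp add: exp_of_nat_mult[symmetric] mult_ac)
    also have "\<dots> \<le> exp (real ?n)" using s mult_left_mono[of "s * real m" 1 "real ?n"] by simp
    finally have e1: "(1 + real ?n * s) ^ m \<le> exp (real ?n)" .
    have "R ^ (m * ?n) \<le> exp s ^ (m * ?n)" using R unfolding R_def by (intro power_mono) auto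
    also have "\<dots> = exp (real ?n * (s * real m))" by (simp add: exp_of_nat_mult[symmetric] mult_ac)
    also have "\<dots> \<le> exp (real ?n)" using s mult_left_mono[of "s * real m" 1 "real ?n"] by simp
    finally have e2: "R ^ (m * ?n) \<le> exp (real ?n)" .
    have "(1 + real ?n * s) ^ m * R ^ (m * ?n) \<le> exp (real ?n) * exp (real ?n)"
      using e1 e2 R s by (intro mult_mono) auto
    also have "\<dots> = E" by (simp add: E_def exp_add[symmetric])
    finally have e3: "M * ((1 + real ?n * s) ^ m * R ^ (m * ?n)) \<le> M * E" using M0 by (rule mult_left_mono)
    have "1 / R \<le> 1" using R by simp
    then have "s * s / 2 \<le> \<delta>" unfolding \<delta>_def R_def using s by (intro divide_right_mono mult_left_mono) auto
    then have "d \<le> \<delta>" by (simp add: d_def s_def power2_eq_square mult_ac)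
    moreover have "d > 0" unfolding d_def by (intro divide_pos_pos) auto
    ultimately have d: "d \<le> \<delta>" "d > 0" by auto
    have ck: "cmod (c k) * d ^ sum k UNIV \<le> M * E" if k: "k \<in> mbox m" for k
    proof -
      have "cmod (c k) * d ^ sum k UNIV \<le> cmod (c k) * \<delta> ^ sum k UNIV"
        using d by (intro mult_left_mono power_mono) auto
      also have "\<dots> \<le> M * E" using c(2)[OF k] e3 by (simp add: mult.assoc)
      finally show ?thesis .
    qed
    let ?h = "y - \<eta>"
    have hi: "\<bar>?h $ i\<bar> \<le> x * d" for i
      using component_le_norm_cart[of ?h i] y by (simp add: d_def)
    have tb: "cmod (c k * mpow (cvec ?h) k) \<le> M * E * x ^ sum k UNIV" if k: "k \<in> mbox m" for k
    proof -
      have "cmod (c k * mpow (cvec ?h) k) \<le> cmod (c k) * (x * d) ^ sum k UNIV"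
        using abs_mpow_le[OF hi] by (simp add: norm_mult mpow_cvec mult_left_mono)
      also have "\<dots> = cmod (c k) * d ^ sum k UNIV * x ^ sum k UNIV" by (simp add: power_mult_distrib)
      also have "\<dots> \<le> M * E * x ^ sum k UNIV" using ck[OF k] x by (intro mult_right_mono) auto
      finally show ?thesis .
    qed
    have 0: "(\<lambda>_. 0) \<in> (mbox m :: ('n \<Rightarrow> nat) set)" by (simp add: mbox_iff)
    have c0: "q (cvec \<eta>) = c (\<lambda>_. 0)"
    proof -
      have "q (cvec \<eta> + 0) = (\<Sum>k\<in>mbox m. c k * mpow 0 k)" by (rule c)
      also have "\<dots> = (\<Sum>k\<in>mbox m. if k = (\<lambda>_. 0) then c k else 0)" by (intro sum.cong) (auto simp: mpow_0)
      also have "\<dots> = c (\<lambda>_. 0)" using 0 by (simp add: sum.delta)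
      finally show ?thesis by simp
    qed
    have cy: "cvec \<eta> + cvec ?h = cvec y" by (simp add: cvec_def vec_eq_iff)
    have "q (cvec y) = c (\<lambda>_. 0) * mpow (cvec ?h) (\<lambda>_. 0) + (\<Sum>k\<in>mbox m - {\<lambda>_. 0}. c k * mpow (cvec ?h) k)"
      using c(1)[of "cvec ?h"] unfolding cy by (subst (asm) sum.remove[OF finite_mbox 0]) 
    then have "q (cvec y) - q (cvec \<eta>) = (\<Sum>k\<in>mbox m - {\<lambda>_. 0}. c k * mpow (cvec ?h) k)"
      unfolding c0 by (simp add: mpow_def)
    then have "cmod (q (cvec y) - q (cvec \<eta>)) \<le> (\<Sum>k\<in>mbox m - {\<lambda>_. 0}. M * E * x ^ sum k (UNIV :: 'n set))"
      using tb by (simp only:) (intro sum_norm_le, auto)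
    also have "\<dots> = M * E * ((\<Sum>k\<in>mbox m. x ^ sum k (UNIV :: 'n set)) - 1)"
    proof -
      have "(\<Sum>k\<in>mbox m. x ^ sum k (UNIV :: 'n set)) = 1 + (\<Sum>k\<in>mbox m - {\<lambda>_. 0}. x ^ sum k (UNIV :: 'n set))"
        by (subst sum.remove[OF finite_mbox 0]) simp
      then show ?thesis by (simp add: sum_distrib_left)
    qed
    also have "\<dots> \<le> M * E * ((1 / (1 - x)) ^ ?n - 1)"
      using sum_mbox_power_le[of x m, where 'n = 'n] x M0 by (intro mult_left_mono) (auto simp: E_def)
    also have "\<dots> = M * (E * ((1 / (1 - x)) ^ ?n - 1))" by simp
    also have "\<dots> \<le> M * (1 / 2)" using x M0 by (intro mult_left_mono) auto
    finally have "cmod (q (cvec y) - q (cvec \<eta>)) \<le> M / 2" by simp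
    then show "M / 2 \<le> cmod (q (cvec y))"
      using norm_triangle_ineq2[of "q (cvec \<eta>)" "q (cvec y)"] \<eta>(2) by (simp add: norm_minus_commute)
  qed
qed

lemma sphere_max:
  fixes q :: "complex^'n::finite \<Rightarrow> complex"
  assumes "homogeneous_polynomial m q"
  obtains \<eta> where "norm \<eta> = 1" "\<And>z. norm z = 1 \<Longrightarrow> cmod (q (cvec z)) \<le> cmod (q (cvec \<eta>))"
proof -
  have "\<exists>\<eta>\<in>sphere 0 1. \<forall>z\<in>sphere 0 1. cmod (q (cvec z)) \<le> cmod (q (cvec \<eta>))"
    by (rule continuous_attains_sup)
       (use ex_unit_vector[where 'n='n] in \<open>auto intro!: continuous_intros homogeneous_cvec_continuous[OF assms]\<close>)
  then show ?thesis using that by auto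
qed

text \<open>
Near a maximum point the polynomial stays above half its maximum on a ball of radius \<open>\<rho> / 2\<close> inside the unit ball,
with \<open>\<rho>\<close> of order \<open>(m + 1)\<^sup>-\<^sup>2\<close>. The integral of its square over the unit ball is therefore at least a constant times
\<open>M\<^sup>2 \<rho> ^ n\<close>, and it is at most the volume of the ball times the mean square on the sphere.
\<close>
lemma nikolskii:
  obtains A :: real and N :: nat where "A > 0"
    "\<And>m q (\<eta>::real^'n::finite). homogeneous_polynomial m q \<Longrightarrow> norm \<eta> = 1 \<Longrightarrow>
       (cmod (q (cvec \<eta>)))\<^sup>2 \<le> A * (real m + 1) ^ N * sphere_sq q"
proof -
  let ?n = "CARD('n)"
  let ?V = "unit_ball_vol (real ?n)"
  have V: "?V > 0" by simp
  obtain x :: real where x: "0 < x" "x < 1" and large: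
    "\<And>m q (\<eta>::real^'n) M y. homogeneous_polynomial m q \<Longrightarrow> (\<And>z::real^'n. norm z = 1 \<Longrightarrow> cmod (q (cvec z)) \<le> M) \<Longrightarrow>
       norm \<eta> = 1 \<Longrightarrow> cmod (q (cvec \<eta>)) = M \<Longrightarrow> norm (y - \<eta>) \<le> x / (2 * (real m + 1)\<^sup>2) \<Longrightarrow> M / 2 \<le> cmod (q (cvec y))"
    using homogeneous_large_near_max by blast
  show ?thesis
  proof (rule that[of "4 * (4 / x) ^ ?n" "2 * ?n"])
    show "4 * (4 / x) ^ ?n > 0" using x by simp
    fix m and q :: "complex^'n \<Rightarrow> complex" and \<eta>' :: "real^'n"
    assume q: "homogeneous_polynomial m q" and \<eta>': "norm \<eta>' = 1"
    obtain \<eta> where \<eta>: "norm \<eta> = 1" "\<And>z. norm z = 1 \<Longrightarrow> cmod (q (cvec z)) \<le> cmod (q (cvec \<eta>))"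
      using sphere_max[OF q] by blast
    define M where "M = cmod (q (cvec \<eta>))"
    define \<rho> where "\<rho> = x / (2 * (real m + 1)\<^sup>2)"
    have \<rho>0: "0 < \<rho>" unfolding \<rho>_def using x by (intro divide_pos_pos) auto
    moreover have "\<rho> \<le> x / 2" unfolding \<rho>_def using x by (intro divide_left_mono) auto
    ultimately have \<rho>: "0 < \<rho>" "\<rho> < 1" using x by linarith+
    \<comment> \<open>the ball of radius \<open>\<rho> / 2\<close> that touches the sphere at \<open>\<eta>\<close> from inside\<close>
    let ?a = "(1 - \<rho> / 2) *\<^sub>R \<eta>"
    let ?B = "ball ?a (\<rho> / 2)"
    have sub: "?B \<subseteq> ball 0 1"
    proof
      fix y assume "y \<in> ?B"
      then have "norm (y - ?a) < \<rho> / 2" by (simp add: dist_norm norm_minus_commute)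
      moreover have "norm ?a = 1 - \<rho> / 2" using \<rho> \<eta>(1) by simp
      ultimately show "y \<in> ball 0 1" using norm_triangle_sub[of y ?a] by simp
    qed
    have big: "(M / 2)\<^sup>2 \<le> (cmod (q (cvec y)))\<^sup>2" if "y \<in> ?B" for y
    proof -
      have "norm (?a - \<eta>) = \<rho> / 2"
      proof -
        have "?a - \<eta> = (- \<rho> / 2) *\<^sub>R \<eta>" by (simp add: algebra_simps)
        then show ?thesis using \<rho> \<eta>(1) by simp
      qed
      moreover have "norm (y - ?a) < \<rho> / 2" using that by (simp add: dist_norm norm_minus_commute)
      ultimately have "norm (y - \<eta>) \<le> \<rho>" using norm_triangle_ineq[of "y - ?a" "?a - \<eta>"] by simp
      then have "M / 2 \<le> cmod (q (cvec y))"
        using large[OF q \<eta>(2) \<eta>(1) refl] unfolding M_def \<rho>_def by blast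
      then show ?thesis by (intro power_mono) (auto simp: M_def)
    qed
    let ?g = "\<lambda>y. (cmod (q (cvec y)))\<^sup>2"
    have g: "q (cvec y) * star q (cvec y) = of_real (?g y)" for y
      by (simp add: complex_norm_square[symmetric] flip: of_real_power)
    note I = pair_ball_integral_poly_weight[OF q star_homogeneous[OF q], of 0]
    have gi: "set_integrable lborel (ball 0 1) ?g"
      using I(1) integrable_Re unfolding set_integrable_def g by fastforce
    \<comment> \<open>by homogeneity the factor is \<open>n / (n + 2m) \<le> 1\<close>\<close>
    have gI: "(LINT y:ball 0 1|lborel. ?g y) \<le> ?V * sphere_sq q"
    proof -
      let ?c = "(real ?n + 0 + real (m + m)) / 2"
      have c: "?c > 0" by (intro divide_pos_pos add_pos_nonneg) auto
      have "complex_of_real (LINT y:ball 0 1|lborel. ?g y) = (LINT y:ball 0 1|lborel. q (cvec y) * star q (cvec y) * of_real ((1 - (norm y)\<^sup>2) ^ 0))"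
        unfolding set_lebesgue_integral_def g by (subst integral_complex_of_real[symmetric]) (simp add: scaleR_conv_of_real)
      also have "\<dots> = of_real (real ?n * ?V / 2 * Beta ?c (real 0 + 1) * sphere_sq q)"
        unfolding I(2) sphere_inner_def[symmetric] sphere_inner_self by simp
      finally have "(LINT y:ball 0 1|lborel. ?g y) = real ?n * ?V / 2 * Beta ?c (real 0 + 1) * sphere_sq q"
        using of_real_eq_iff by blast
      moreover have "Beta ?c (real 0 + 1) = 1 / ?c"
      proof -
        have "Gamma (?c + 1) = ?c * Gamma ?c" using c by (intro Gamma_plus1) (auto dest: nonpos_Ints_nonpos)
        moreover have "Gamma ?c > 0" by (rule Gamma_real_pos[OF c])
        moreover have "g / (c * g) = 1 / c" if "g > 0" for g c :: real using that by simp
        ultimately show ?thesis by (simp only: Beta_def of_nat_0 add_0 Gamma_1 mult_1_right)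
      qed
      moreover have "real ?n * ?V / 2 * (1 / ?c) \<le> ?V"
      proof -
        have "real ?n / 2 * (1 / ?c) \<le> 1" using c by (simp add: field_simps)
        then have "?V * (real ?n / 2 * (1 / ?c)) \<le> ?V * 1" using V by (intro mult_left_mono) auto
        then show ?thesis by (simp add: mult_ac)
      qed
      ultimately show ?thesis using sphere_sq_nonneg[of q] by (simp only:) (rule mult_right_mono)
    qed
    have "(M / 2)\<^sup>2 * (?V * (\<rho> / 2) ^ ?n) = (LINT y:?B|lborel. (M / 2)\<^sup>2)"
      using \<rho> by (simp add: set_integral_const measure_def emeasure_ball mult_ac)
    also have "\<dots> \<le> (LINT y:?B|lborel. ?g y)"
    proof (rule set_integral_mono)
      show "set_integrable lborel ?B (\<lambda>y. (M / 2)\<^sup>2)"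
        unfolding set_integrable_def by (intro integrable_scaleR_left integrable_real_indicator) (use emeasure_lborel_ball_finite[of ?a "\<rho>/2"] in auto)
      show "set_integrable lborel ?B ?g" using gi by (rule set_integrable_subset) (use sub in auto)
    qed (use big in auto)
    also have "\<dots> \<le> (LINT y:ball 0 1|lborel. ?g y)"
    proof -
      have s: "set_integrable lborel ?B ?g" using gi by (rule set_integrable_subset) (use sub in auto)
      show ?thesis using s gi unfolding set_lebesgue_integral_def set_integrable_def
        by (rule integral_mono) (use sub in \<open>auto split: split_indicator\<close>)
    qed
    also note gI
    finally have "(M / 2)\<^sup>2 * (\<rho> / 2) ^ ?n * ?V \<le> sphere_sq q * ?V" by (simp add: mult_ac)
    then have "(M / 2)\<^sup>2 * (\<rho> / 2) ^ ?n \<le> sphere_sq q" using V by (rule mult_right_le_imp_le)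
    then have "M\<^sup>2 \<le> 4 * (1 / (\<rho> / 2)) ^ ?n * sphere_sq q" using \<rho> by (simp add: field_simps power_divide)
    also have "1 / (\<rho> / 2) = (4 / x) * (real m + 1)\<^sup>2" using x by (simp add: \<rho>_def field_simps)
    also have "4 * ((4 / x) * (real m + 1)\<^sup>2) ^ ?n * sphere_sq q = 4 * (4 / x) ^ ?n * (real m + 1) ^ (2 * ?n) * sphere_sq q"
      by (simp only: power_mult_distrib power_mult mult.assoc)
    finally have "M\<^sup>2 \<le> 4 * (4 / x) ^ ?n * (real m + 1) ^ (2 * ?n) * sphere_sq q" .
    moreover have "(cmod (q (cvec \<eta>')))\<^sup>2 \<le> M\<^sup>2" using \<eta>(2)[OF \<eta>'] by (intro power_mono) (auto simp: M_def)
    ultimately show "(cmod (q (cvec \<eta>')))\<^sup>2 \<le> 4 * (4 / x) ^ ?n * (real m + 1) ^ (2 * ?n) * sphere_sq q" by linarith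
  qed
qed

lemma polyharmonic_polys_diff:
  assumes "q \<in> polyharmonic_polys p m" "r \<in> polyharmonic_polys p m"
  shows "(\<lambda>z. q z - r z) \<in> polyharmonic_polys p m"
  using polyharmonic_sum[of "UNIV :: bool set" "\<lambda>b. if b then q else r" p m "\<lambda>b. if b then 1 else -1"] assms
  by (simp add: UNIV_bool)

lemma polyharmonic_polys_scale:
  assumes "q \<in> polyharmonic_polys p m"
  shows "(\<lambda>z. a * q z) \<in> polyharmonic_polys p m"
  using polyharmonic_sum[of "{()}" "\<lambda>_. q" p m "\<lambda>_. a"] assms by simp

definition orthonormal_family :: "nat \<Rightarrow> nat \<Rightarrow> nat \<Rightarrow> (nat \<Rightarrow> complex^'n::finite \<Rightarrow> complex) \<Rightarrow> bool" where
  "orthonormal_family p m d f \<longleftrightarrow> (\<forall>i<d. f i \<in> polyharmonic_polys p m) \<and>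
     (\<forall>i<d. \<forall>j<d. sphere_inner (f i) (f j) = (if i = j then 1 else 0))"

text \<open>
Apply the hypothesis to the linear combination that is the partial reproducing kernel at \<open>\<eta>\<close>: its value at \<open>\<eta>\<close> and its
mean square are both the sum in question.
\<close>
lemma orthonormal_family_bound:
  fixes f :: "nat \<Rightarrow> complex^'n::finite \<Rightarrow> complex"
  assumes f: "orthonormal_family p m d f" and C: "C \<ge> 0"
    and nik: "\<And>q. homogeneous_polynomial m q \<Longrightarrow> (cmod (q (cvec \<eta>)))\<^sup>2 \<le> C * sphere_sq q"
  shows "(\<Sum>i<d. (cmod (f i (cvec \<eta>)))\<^sup>2) \<le> C"
proof -
  have h: "homogeneous_polynomial m (f i)" if "i < d" for i
    using f that by (auto simp: orthonormal_family_def polyharmonic_polys_def)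
  let ?S = "\<Sum>i<d. (cmod (f i (cvec \<eta>)))\<^sup>2"
  let ?g = "\<lambda>z. \<Sum>i<d. cnj (f i (cvec \<eta>)) * f i z"
  have g: "homogeneous_polynomial m ?g" by (intro homogeneous_sum homogeneous_scale) (use h in auto)
  have S: "(\<Sum>i<d. cnj (f i (cvec \<eta>)) * f i (cvec \<eta>)) = of_real ?S"
    unfolding of_real_sum complex_norm_square by (simp only: mult.commute)
  have gS: "?g (cvec \<eta>) = of_real ?S" by (rule S)
  have "sphere_inner ?g ?g = (\<Sum>i<d. cnj (f i (cvec \<eta>)) * sphere_inner (f i) ?g)"
    by (rule sphere_inner_sum_left[where m = m and m' = m]) (use h g in auto)
  also have "\<dots> = (\<Sum>i<d. cnj (f i (cvec \<eta>)) * (\<Sum>j<d. f j (cvec \<eta>) * sphere_inner (f i) (f j)))"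
    using h by (intro sum.cong refl arg_cong2[where f = "(*)"], subst sphere_inner_sum_right[where m = m and m' = m]) auto
  also have "\<dots> = (\<Sum>i<d. cnj (f i (cvec \<eta>)) * (\<Sum>j<d. if i = j then f j (cvec \<eta>) else 0))"
    using f by (intro sum.cong refl arg_cong2[where f = "(*)"]) (auto simp: orthonormal_family_def)
  also have "\<dots> = of_real ?S" unfolding S[symmetric] by (intro sum.cong) auto
  finally have sq: "sphere_sq ?g = ?S" unfolding sphere_inner_self using of_real_eq_iff by blast
  have S0: "?S \<ge> 0" by (intro sum_nonneg) auto
  have "?S\<^sup>2 \<le> C * ?S" using nik[OF g] S0 unfolding gS sq norm_of_real by (simp only: abs_of_nonneg)
  then have "?S * ?S \<le> C * ?S" by (simp add: power2_eq_square)
  then show ?thesis using S0 C by (cases "?S = 0") auto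
qed

text \<open>
Integrating the pointwise bound over the sphere counts the members of the family. This shows that the
space is finite-dimensional without computing a dimension.
\<close>
lemma orthonormal_family_size:
  fixes f :: "nat \<Rightarrow> complex^'n::finite \<Rightarrow> complex"
  assumes f: "orthonormal_family p m d f"
    and b: "\<And>\<eta>::real^'n. norm \<eta> = 1 \<Longrightarrow> (\<Sum>i<d. (cmod (f i (cvec \<eta>)))\<^sup>2) \<le> C"
  shows "real d \<le> C"
proof -
  interpret prob_space "sphere_measure :: (real^'n) measure" by (rule prob_space_sphere_measure)
  have h: "homogeneous_polynomial m (f i)" if "i < d" for i
    using f that by (auto simp: orthonormal_family_def polyharmonic_polys_def)
  have i: "integrable sphere_measure (\<lambda>x. (cmod (f i (cvec x)))\<^sup>2)" if "i < d" for i
    using integrable_Re[OF integrable_sphere_pair[OF h[OF that] star_homogeneous[OF h[OF that]]]]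
    by (simp add: complex_norm_square[symmetric] cmod_power2 power2_eq_square)
  have "sphere_sq (f i) = 1" if "i < d" for i
    using f that sphere_inner_self[of "f i"] by (auto simp: orthonormal_family_def)
  then have "real d = (\<Sum>i<d. integral\<^sup>L sphere_measure (\<lambda>x. (cmod (f i (cvec x)))\<^sup>2))"
    by (simp flip: sphere_sq_def)
  also have "\<dots> = integral\<^sup>L sphere_measure (\<lambda>x. \<Sum>i<d. (cmod (f i (cvec x)))\<^sup>2)"
    using i by (subst Bochner_Integration.integral_sum) auto
  also have "\<dots> \<le> integral\<^sup>L sphere_measure (\<lambda>x::real^'n. C)"
  proof (rule integral_mono_AE)
    show "AE x in sphere_measure. (\<Sum>i<d. (cmod (f i (cvec x)))\<^sup>2) \<le> C"
      using AE_sphere_measure by eventually_elim (use b in auto)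
  qed (use i in auto)
  also have "\<dots> = C" using prob_space by simp
  finally show ?thesis .
qed

text \<open>
A maximal orthonormal family exists by the bound on its size and is a basis, because the remainder of an
expansion could be normalized and added. The kernel is then the usual sum over the basis, and its bound
is the diagonal one by the inequality between arithmetic and geometric mean. The constants \<open>A\<close> and \<open>N\<close> depend
on the dimension only. The kernel represents values at all points \<open>c x\<close> with complex \<open>c\<close>, in particular
on the rotated spheres.
\<close>
lemma zonal_kernel_exists:
  obtains A :: real and N :: nat where "A > 0"
    "\<forall>p m. \<exists>K :: complex^'n::finite \<Rightarrow> complex^'n \<Rightarrow> complex.
       (\<forall>w. (\<lambda>z. K z w) \<in> polyharmonic_polys p m) \<and> (\<forall>z w. K z w = cnj (K w z)) \<and>
       (\<forall>q c x. q \<in> polyharmonic_polys p m \<longrightarrow> q (c *s cvec x) = sphere_inner q (\<lambda>z. K z (c *s cvec x))) \<and>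
       (\<forall>x y. norm x = 1 \<longrightarrow> norm y = 1 \<longrightarrow> cmod (K (cvec x) (cvec y)) \<le> A * (real m + 1) ^ N)"
proof -
  obtain A :: real and N :: nat where A: "A > 0" and nik:
    "\<And>m q (\<eta>::real^'n). homogeneous_polynomial m q \<Longrightarrow> norm \<eta> = 1 \<Longrightarrow>
       (cmod (q (cvec \<eta>)))\<^sup>2 \<le> A * (real m + 1) ^ N * sphere_sq q"
    using nikolskii by blast
  show ?thesis
  proof (rule that[OF A], intro allI)
    fix p m
    let ?C = "A * (real m + 1) ^ N"
    let ?H = "polyharmonic_polys p m :: (complex^'n \<Rightarrow> complex) set"
    have C: "?C \<ge> 0" using A by simp
    have bes: "(\<Sum>i<d. (cmod (f i (cvec \<eta>)))\<^sup>2) \<le> ?C" if "orthonormal_family p m d f" "norm \<eta> = 1"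
      for d and f :: "nat \<Rightarrow> complex^'n \<Rightarrow> complex" and \<eta>
      by (rule orthonormal_family_bound[OF that(1) C]) (rule nik[OF _ that(2)])
    define P where "P d \<longleftrightarrow> (\<exists>f :: nat \<Rightarrow> complex^'n \<Rightarrow> complex. orthonormal_family p m d f)" for d
    have bd: "d \<le> nat \<lceil>?C\<rceil>" if "P d" for d
    proof -
      from that have "real d \<le> ?C" unfolding P_def using orthonormal_family_size bes by blast
      then show ?thesis by linarith
    qed
    have P0: "P 0" by (simp add: P_def orthonormal_family_def)
    define d where "d = (GREATEST d. P d)"
    have Pd: "P d" unfolding d_def using P0 bd by (rule GreatestI_nat)
    have max: "d' \<le> d" if "P d'" for d' unfolding d_def using that bd by (rule Greatest_le_nat)
    obtain f :: "nat \<Rightarrow> complex^'n \<Rightarrow> complex" where f: "orthonormal_family p m d f"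
      using Pd unfolding P_def by blast
    have fH: "f i \<in> ?H" and h: "homogeneous_polynomial m (f i)" if "i < d" for i
      using f that by (auto simp: orthonormal_family_def polyharmonic_polys_def)
    have exp: "q (c *s cvec x) = (\<Sum>i<d. sphere_inner q (f i) * f i (c *s cvec x))" if q: "q \<in> ?H" for q c x
    proof -
      let ?s = "\<lambda>z. \<Sum>i<d. sphere_inner q (f i) * f i z"
      have sH: "?s \<in> ?H" by (rule polyharmonic_sum) (use fH in auto)
      define g where "g z = q z - ?s z" for z
      have gH: "g \<in> ?H" unfolding g_def by (rule polyharmonic_polys_diff[OF q sH])
      have hq: "homogeneous_polynomial m q" and hs: "homogeneous_polynomial m ?s" and hg: "homogeneous_polynomial m g"
        using q sH gH by (auto simp: polyharmonic_polys_def)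
      have orth: "sphere_inner g (f j) = 0" if j: "j < d" for j
      proof -
        have "sphere_inner g (f j) = sphere_inner q (f j) - sphere_inner ?s (f j)"
          unfolding g_def[abs_def] by (rule sphere_inner_diff_left[OF hq hs h[OF j]])
        also have "sphere_inner ?s (f j) = (\<Sum>i<d. sphere_inner q (f i) * sphere_inner (f i) (f j))"
          by (rule sphere_inner_sum_left[OF _ h[OF j]]) (use h in auto)
        also have "\<dots> = (\<Sum>i<d. if i = j then sphere_inner q (f i) else 0)"
          using f j by (intro sum.cong) (auto simp: orthonormal_family_def)
        also have "\<dots> = sphere_inner q (f j)" using j by simp
        finally show ?thesis by simp
      qed
      \<comment> \<open>otherwise the normalized remainder would enlarge the maximal family\<close>
      have "sphere_sq g = 0"
      proof (rule ccontr)
        assume "sphere_sq g \<noteq> 0"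
        then have pos: "sphere_sq g > 0" using sphere_sq_nonneg[of g] by linarith
        define a where "a = complex_of_real (1 / sqrt (sphere_sq g))"
        define F where "F = f(d := (\<lambda>z. a * g z))"
        have self: "sphere_inner (\<lambda>z. a * g z) (\<lambda>z. a * g z) = 1"
        proof -
          have "sphere_inner (\<lambda>z. a * g z) (\<lambda>z. a * g z) = a * (cnj a * of_real (sphere_sq g))"
            by (simp only: sphere_inner_scale_left sphere_inner_scale_right sphere_inner_self)
          also have "\<dots> = of_real ((1 / sqrt (sphere_sq g)) * ((1 / sqrt (sphere_sq g)) * sphere_sq g))"
            unfolding a_def complex_cnj_complex_of_real of_real_mult ..
          also have "(1 / sqrt (sphere_sq g)) * ((1 / sqrt (sphere_sq g)) * sphere_sq g) = 1"
            using pos by (simp add: field_simps flip: power2_eq_square)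
          finally show ?thesis by simp
        qed
        have o1: "sphere_inner (\<lambda>z. a * g z) (f j) = 0" "sphere_inner (f j) (\<lambda>z. a * g z) = 0" if "j < d" for j
          using orth[OF that] sphere_inner_cnj[of "f j" g]
          by (simp_all only: sphere_inner_scale_left sphere_inner_scale_right, simp_all)
        have "orthonormal_family p m (Suc d) F"
          unfolding orthonormal_family_def F_def
          using f polyharmonic_polys_scale[OF gH, of a] self o1
          by (auto simp: orthonormal_family_def less_Suc_eq)
        then have "P (Suc d)" unfolding P_def by blast
        from max[OF this] show False by simp
      qed
      then have gz: "g (cvec y) = 0" if "norm y = 1" for y
        using nik[OF hg that] by simp
      have "cmod (g (cvec x)) \<le> 0 * norm x ^ m"
        by (rule homogeneous_norm_le[OF hg]) (use gz in auto)
      then have "g (cvec x) = 0" by simp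
      then have "g (c *s cvec x) = 0" using homogeneousD[OF hg] by simp
      then show ?thesis by (simp add: g_def)
    qed
    define K where "K z w = (\<Sum>i<d. cnj (f i w) * f i z)" for z w
    show "\<exists>K :: complex^'n \<Rightarrow> complex^'n \<Rightarrow> complex.
       (\<forall>w. (\<lambda>z. K z w) \<in> ?H) \<and> (\<forall>z w. K z w = cnj (K w z)) \<and>
       (\<forall>q c x. q \<in> ?H \<longrightarrow> q (c *s cvec x) = sphere_inner q (\<lambda>z. K z (c *s cvec x))) \<and>
       (\<forall>x y. norm x = 1 \<longrightarrow> norm y = 1 \<longrightarrow> cmod (K (cvec x) (cvec y)) \<le> ?C)"
    proof (intro exI[of _ K] conjI allI impI)
      show "(\<lambda>z. K z w) \<in> ?H" for w unfolding K_def by (rule polyharmonic_sum) (use fH in auto)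
      show "K z w = cnj (K w z)" for z w by (simp add: K_def mult.commute)
    next
      fix q c x assume q: "q \<in> ?H"
      have "sphere_inner q (\<lambda>z. K z (c *s cvec x)) = (\<Sum>i<d. cnj (cnj (f i (c *s cvec x))) * sphere_inner q (f i))"
        unfolding K_def by (rule sphere_inner_sum_right[where m = m and m' = m]) (use h q in \<open>auto simp: polyharmonic_polys_def\<close>)
      then show "q (c *s cvec x) = sphere_inner q (\<lambda>z. K z (c *s cvec x))"
        using exp[OF q, of c x] by (simp add: mult.commute)
    next
      fix x y :: "real^'n" assume xy: "norm x = 1" "norm y = 1"
      have "cmod (K (cvec x) (cvec y)) \<le> (\<Sum>i<d. cmod (f i (cvec x)) * cmod (f i (cvec y)))"
        unfolding K_def by (rule order_trans[OF norm_sum]) (simp add: norm_mult mult.commute)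
      also have "\<dots> \<le> (\<Sum>i<d. ((cmod (f i (cvec x)))\<^sup>2 + (cmod (f i (cvec y)))\<^sup>2) / 2)"
      proof (rule sum_mono)
        fix i
        show "cmod (f i (cvec x)) * cmod (f i (cvec y)) \<le> ((cmod (f i (cvec x)))\<^sup>2 + (cmod (f i (cvec y)))\<^sup>2) / 2"
          using sum_squares_bound[of "cmod (f i (cvec x))" "cmod (f i (cvec y))"] by simp
      qed
      also have "\<dots> = ((\<Sum>i<d. (cmod (f i (cvec x)))\<^sup>2) + (\<Sum>i<d. (cmod (f i (cvec y)))\<^sup>2)) / 2"
        by (simp add: sum.distrib flip: sum_divide_distrib)
      also have "\<dots> \<le> ?C" using bes[OF f xy(1)] bes[OF f xy(2)] by simp
      finally show "cmod (K (cvec x) (cvec y)) \<le> ?C" .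
    qed
  qed
qed

section \<open>Series of homogeneous polyharmonic polynomials\<close>

lemma coeff_laplacian_sums:
  assumes "\<And>k. (\<lambda>m. c m k) sums C k"
  shows "(\<lambda>m. coeff_laplacian (c m) k) sums coeff_laplacian C k"
  unfolding coeff_laplacian_def coeff_partial_def by (intro sums_sum sums_mult assms)

lemma coeff_laplacian_pow_sums:
  assumes "\<And>k. (\<lambda>m. c m k) sums C k"
  shows "(\<lambda>m. (coeff_laplacian ^^ p) (c m) k) sums (coeff_laplacian ^^ p) C k"
proof (induction p arbitrary: k)
  case 0
  then show ?case using assms by simp
next
  case (Suc p)
  show ?case using coeff_laplacian_sums[of "\<lambda>m. (coeff_laplacian ^^ p) (c m)", OF Suc] by simp
qed

lemma summable_on_product:
  fixes a :: "nat \<Rightarrow> real" and b :: "'k \<Rightarrow> real"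
  assumes a: "summable a" "\<And>m. a m \<ge> 0" and b: "b summable_on UNIV" "\<And>k. b k \<ge> 0"
  shows "(\<lambda>(m, k). a m * b k) summable_on UNIV \<times> UNIV"
proof (rule summable_on_SigmaI)
  show "((\<lambda>k. case (m, k) of (m, k) \<Rightarrow> a m * b k) has_sum a m * infsum b UNIV) UNIV" for m
    using b(1) by (auto intro: has_sum_cmult_right has_sum_infsum)
  have "a summable_on UNIV" using a by (subst summable_on_UNIV_nonneg_real_iff) auto
  then show "(\<lambda>m. a m * infsum b UNIV) summable_on UNIV" by (rule summable_on_cmult_left)
qed (use a b in auto)

text \<open>
Around a point \<open>a\<close> of the ball the coefficients of the terms are added up. This is possible because
\<open>taylor_bound\<close> bounds the coefficients of the \<open>m\<close>-th term by \<open>A m * \<tau> ^ m\<close> on a cube whose size does not depend on \<open>m\<close>.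
The Laplacian acts on coefficients through finite sums and thus commutes with the summation.
\<close>
lemma series_polyharmonic:
  fixes f :: "nat \<Rightarrow> complex^'n::finite \<Rightarrow> complex"
  assumes f: "\<And>m. f m \<in> polyharmonic_polys p m"
    and A: "\<And>m (x::real^'n). norm x = 1 \<Longrightarrow> cmod (f m (cvec x)) \<le> A m"
    and \<tau>: "\<tau> > 1" "summable (\<lambda>m. A m * \<tau> ^ m)"
  shows "(\<lambda>x. \<Sum>m. f m (cvec x)) \<in> polyharmonic_ball p"
    and "homogeneous_expansion (\<lambda>x. \<Sum>m. f m (cvec x)) f"
proof -
  let ?n = "CARD('n)"
  let ?U = "\<lambda>x. \<Sum>m. f m (cvec x)"
  have fh: "homogeneous_polynomial m (f m)" for m using f by (simp add: polyharmonic_polys_def)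
  have A0: "A m \<ge> 0" for m using A[of _ m] by (rule sphere_bound_nonneg)
  have \<tau>A: "A m * t ^ m \<le> A m * \<tau> ^ m" if "0 \<le> t" "t \<le> \<tau>" for t m
    using that A0 by (intro mult_left_mono power_mono) auto
  have sm: "(\<lambda>m. f m (cvec x)) sums ?U x" if "norm x \<le> \<tau>" for x
  proof (rule summable_sums, rule summable_comparison_test'[OF \<tau>(2), of 0])
    show "norm (f m (cvec x)) \<le> A m * \<tau> ^ m" for m
    proof -
      have "cmod (f m (cvec x)) \<le> A m * norm x ^ m" by (rule homogeneous_norm_le[OF fh A])
      then show ?thesis using \<tau>A[of "norm x" m] that by simp
    qed
  qed
  show "homogeneous_expansion ?U f"
    unfolding homogeneous_expansion_def using fh sm \<tau> by auto
  define T where "T = (\<Sum>m. A m * \<tau> ^ m)"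
  have T: "A m * \<tau> ^ m \<le> T" for m
    unfolding T_def using sum_le_suminf[OF \<tau>(2), of "{m}"] A0 \<tau>(1) by simp
  \<comment> \<open>choose \<open>s\<close> and \<open>R = 1 + s\<close> such that the growth rate in \<open>taylor_bound\<close> is below \<open>\<tau>\<close>\<close>
  have "((\<lambda>s. (1 + real ?n * s) * (1 + s) ^ ?n) \<longlongrightarrow> (1 + real ?n * 0) * (1 + 0) ^ ?n) (at_right (0::real))"
    by (intro tendsto_intros)
  then have "\<forall>\<^sub>F s::real in at_right 0. (1 + real ?n * s) * (1 + s) ^ ?n < \<tau>"
    by (rule order_tendstoD) (use \<tau> in simp)
  then have "\<forall>\<^sub>F s::real in at_right 0. (1 + real ?n * s) * (1 + s) ^ ?n < \<tau> \<and> s \<in> {0<..<1}"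
    by (rule eventually_conj) (rule eventually_at_right_real, simp)
  then obtain s :: real where s: "(1 + real ?n * s) * (1 + s) ^ ?n < \<tau>" "0 < s"
    using eventually_happens'[OF trivial_limit_at_right_real[of 0]] by fastforce
  define R where "R = 1 + s"
  define \<delta> where "\<delta> = s * (R - 1 / R) / 2"
  have R: "R > 1" using s by (simp add: R_def)
  then have "1 / R < 1" by simp
  then have \<delta>: "\<delta> > 0" using R s unfolding \<delta>_def by (smt (verit) half_gt_zero mult_pos_pos)
  have main: "\<exists>c. mps ?U a c \<and> (\<exists>d. (\<forall>k. (\<lambda>m. d m k) sums c k) \<and> (\<forall>m. mps (\<lambda>x. f m (cvec x)) a (d m)))"
    if a: "a \<in> ball 0 1" for a
  proof -
    have "\<exists>c. (\<forall>h. f m (cvec a + h) = (\<Sum>k\<in>mbox m. c k * mpow h k)) \<and>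
       (\<forall>k\<in>mbox m. cmod (c k) * \<delta> ^ sum k UNIV \<le> A m * \<tau> ^ m)" for m
    proof -
      have "(1 + real ?n * s) ^ m * R ^ (m * ?n) = ((1 + real ?n * s) * R ^ ?n) ^ m"
        by (simp add: power_mult_distrib mult.commute[of m] power_mult)
      then have "A m * (1 + real ?n * s) ^ m * R ^ (m * ?n) \<le> A m * \<tau> ^ m"
        using \<tau>A[of "(1 + real ?n * s) * R ^ ?n" m] s R unfolding R_def by (simp add: mult.assoc)
      moreover have "\<exists>c. (\<forall>h. f m (cvec a + h) = (\<Sum>k\<in>mbox m. c k * mpow h k)) \<and>
         (\<forall>k\<in>mbox m. cmod (c k) * \<delta> ^ sum k UNIV \<le> A m * (1 + real ?n * s) ^ m * R ^ (m * ?n))"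
        unfolding \<delta>_def by (rule taylor_bound[OF fh A _ s(2) R]) (use a in auto)
      ultimately show ?thesis by (meson order_trans)
    qed
    then obtain c0 where c0: "\<And>m h. f m (cvec a + h) = (\<Sum>k\<in>mbox m. c0 m k * mpow h k)"
      "\<And>m k. k \<in> mbox m \<Longrightarrow> cmod (c0 m k) * \<delta> ^ sum k UNIV \<le> A m * \<tau> ^ m"
      by metis
    define d where "d m k = (if k \<in> mbox m then c0 m k else 0)" for m k
    have db: "cmod (d m k) * \<delta> ^ sum k UNIV \<le> A m * \<tau> ^ m" for m k
      using c0(2) A0 \<tau> by (auto simp: d_def)
    have dsum: "((\<lambda>k. d m k * complex_of_real (mpow h k)) has_sum f m (cvec (a + h))) UNIV" for m h
    proof (rule has_sum_finite_neutralI[OF finite_mbox[of m]])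
      have "cvec a + cvec h = cvec (a + h)" by (simp add: cvec_def vec_eq_iff)
      then show "f m (cvec (a + h)) = (\<Sum>k\<in>mbox m. d m k * complex_of_real (mpow h k))"
        using c0(1)[of m "cvec h"] by (simp add: d_def mpow_cvec)
    qed (auto simp: d_def)
    have dm: "mps (\<lambda>x. f m (cvec x)) a (d m)" for m
      unfolding mps_def mps_on_def using \<delta> db dsum by blast
    have dsm: "summable (\<lambda>m. norm (d m k))" for k
    proof (rule summable_comparison_test'[of "\<lambda>m. (A m * \<tau> ^ m) / \<delta> ^ sum k UNIV" 0])
      show "summable (\<lambda>m. A m * \<tau> ^ m / \<delta> ^ sum k UNIV)" using \<tau>(2) by (rule summable_divide)
      show "norm (norm (d m k)) \<le> A m * \<tau> ^ m / \<delta> ^ sum k UNIV" for m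
        using db[of m k] \<delta> by (simp add: field_simps)
    qed
    define c where "c k = (\<Sum>m. d m k)" for k
    have cs: "(\<lambda>m. d m k) sums c k" for k
    unfolding c_def by (rule summable_sums, rule summable_norm_cancel, rule dsm)
    have cb: "cmod (c k) * (\<delta> / 2) ^ sum k UNIV \<le> T" for k
    proof -
      have "cmod (c k) * \<delta> ^ sum k UNIV \<le> (\<Sum>m. norm (d m k)) * \<delta> ^ sum k UNIV"
        unfolding c_def using \<delta> by (intro mult_right_mono summable_norm dsm) auto
      also have "\<dots> = (\<Sum>m. norm (d m k) * \<delta> ^ sum k UNIV)" using dsm by (rule suminf_mult2)
      also have "\<dots> \<le> T" unfolding T_def using db dsm \<tau>(2) by (intro suminf_le summable_mult2) auto
      finally have "cmod (c k) * \<delta> ^ sum k UNIV \<le> T" .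
      moreover have "cmod (c k) * (\<delta> / 2) ^ sum k UNIV \<le> cmod (c k) * \<delta> ^ sum k UNIV"
        using \<delta> by (intro mult_left_mono power_mono) auto
      ultimately show ?thesis by linarith
    qed
    have "((\<lambda>k. c k * complex_of_real (mpow h k)) has_sum ?U (a + h)) UNIV"
      if h: "\<And>i. \<bar>h $ i\<bar> < \<delta> / 2" for h
    proof -
      let ?F = "\<lambda>(m, k). d m k * complex_of_real (mpow h k)"
      have "(\<lambda>(m, k). (A m * \<tau> ^ m) * (1 / 2) ^ sum k UNIV) summable_on (UNIV :: nat set) \<times> (UNIV :: ('n \<Rightarrow> nat) set)"
        by (rule summable_on_product) (use \<tau> A0 summable_multi_power(1)[of "1/2", where 'n = 'n] in auto)
      then have "(\<lambda>x. norm (?F x)) summable_on UNIV \<times> UNIV"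
      proof (rule Infinite_Sum.abs_summable_on_comparison_test')
        fix x :: "nat \<times> ('n \<Rightarrow> nat)"
        obtain m k where x: "x = (m, k)" by fastforce
        have "norm (?F x) \<le> cmod (d m k) * (\<delta> / 2) ^ sum k UNIV"
          unfolding x using abs_mpow_le[of h "\<delta>/2" k, OF less_imp_le[OF h]] by (simp add: norm_mult mult_left_mono)
        also have "\<dots> = cmod (d m k) * \<delta> ^ sum k UNIV * (1 / 2) ^ sum k UNIV" by (simp add: power_divide)
        also have "\<dots> \<le> (A m * \<tau> ^ m) * (1 / 2) ^ sum k UNIV" using db by (intro mult_right_mono) auto
        finally show "norm (?F x) \<le> (case x of (m, k) \<Rightarrow> (A m * \<tau> ^ m) * (1 / 2) ^ sum k UNIV)" by (simp add: x)
      qed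
      then have "?F summable_on UNIV \<times> UNIV" by (rule abs_summable_summable)
      then obtain S where S: "(?F has_sum S) (UNIV \<times> UNIV)" by (auto simp: summable_on_def)
      have "((\<lambda>m. f m (cvec (a + h))) has_sum S) UNIV"
        by (rule has_sum_SigmaD[OF S]) (use dsum in simp)
      then have "(\<lambda>m. f m (cvec (a + h))) sums S" by (rule has_sum_imp_sums)
      then have SU: "S = ?U (a + h)" by (simp add: sums_iff)
      have S': "((\<lambda>(k, m). d m k * complex_of_real (mpow h k)) has_sum S) (UNIV \<times> UNIV)"
        using S has_sum_swap[of ?F UNIV UNIV S] by (simp add: case_prod_unfold)
      have "((\<lambda>k. c k * complex_of_real (mpow h k)) has_sum S) UNIV"
      proof (rule has_sum_SigmaD[OF S'])
        show "((\<lambda>m. case (k, m) of (k, m) \<Rightarrow> d m k * complex_of_real (mpow h k)) has_sum c k * complex_of_real (mpow h k)) UNIV" for k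
          using norm_summable_imp_has_sum[OF dsm cs] by (simp add: has_sum_cmult_left)
      qed
      then show ?thesis unfolding SU .
    qed
    then have "mps_on (\<delta> / 2) T ?U a c" unfolding mps_on_def using \<delta> cb by auto
    then have "mps ?U a c" unfolding mps_def by blast
    then show ?thesis using cs dm by blast
  qed
  have "real_analytic_on ?U (ball 0 1)" by (rule mps_imp_real_analytic) (use main in blast)
  moreover have "(laplacian ^^ p) ?U a = 0" if a: "a \<in> ball 0 1" for a
  proof -
    obtain c d where c: "mps ?U a c" and cd: "\<And>k. (\<lambda>m. d m k) sums c k" "\<And>m. mps (\<lambda>x. f m (cvec x)) a (d m)"
      using main[OF a] by blast
    have "(coeff_laplacian ^^ p) (d m) (\<lambda>_. 0) = 0" for m
    proof -
      have "(coeff_laplacian ^^ p) (d m) (\<lambda>_. 0) = (laplacian ^^ p) (\<lambda>x. f m (cvec x)) a"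
        using mps_at[OF mps_laplacian_pow[OF cd(2)]] by simp
      also have "\<dots> = 0" using f[of m] by (simp add: laplacian_pow_cvec[OF fh] polyharmonic_polys_def)
      finally show ?thesis .
    qed
    moreover have "(\<lambda>m. (coeff_laplacian ^^ p) (d m) (\<lambda>_. 0)) sums (coeff_laplacian ^^ p) c (\<lambda>_. 0)"
      by (rule coeff_laplacian_pow_sums) (rule cd(1))
    ultimately have "(\<lambda>m. 0) sums (coeff_laplacian ^^ p) c (\<lambda>_. 0)" by simp
    then have "(coeff_laplacian ^^ p) c (\<lambda>_. 0) = 0" by (simp add: sums_iff)
    then show ?thesis using mps_at[OF mps_laplacian_pow[OF c, where p = p]] by simp
  qed
  ultimately show "?U \<in> polyharmonic_ball p" unfolding polyharmonic_ball_def by blast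
qed

section \<open>The homogeneous expansion of a polyharmonic function\<close>

text \<open>
Dominated convergence for series in the form in which it is applied to expansions into homogeneous
polynomials, with a bound that is a product of a summable sequence and an integrable function.
\<close>
lemma sums_integral_dominated:
  fixes f :: "nat \<Rightarrow> 'a \<Rightarrow> complex" and w :: "'a \<Rightarrow> real"
  assumes f[measurable]: "\<And>j. f j \<in> borel_measurable M" and g[measurable]: "g \<in> borel_measurable M"
    and w: "integrable M w" and b: "summable b"
    and dom: "AE x in M. \<forall>j. norm (f j x) \<le> b j * w x" and s: "AE x in M. (\<lambda>j. f j x) sums g x"
  shows "(\<lambda>j. integral\<^sup>L M (f j)) sums integral\<^sup>L M g"
proof -
  have i: "integrable M (f j)" for j
  proof (rule Bochner_Integration.integrable_bound)
    show "integrable M (\<lambda>x. b j * w x)" using w by simp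
    show "AE x in M. norm (f j x) \<le> norm (b j * w x)"
      using dom by eventually_elim (metis abs_ge_self order_trans real_norm_def)
  qed simp
  have 1: "AE x in M. summable (\<lambda>j. norm (f j x))"
    using dom
  proof eventually_elim
    case (elim x)
    show ?case by (rule summable_comparison_test'[OF summable_mult2[OF b, of "w x"], of 0]) (use elim in auto)
  qed
  have 2: "summable (\<lambda>j. \<integral>x. norm (f j x) \<partial>M)"
  proof (rule summable_comparison_test'[OF summable_mult2[OF b, of "integral\<^sup>L M w"], of 0])
    fix j
    have "(\<integral>x. norm (f j x) \<partial>M) \<le> (\<integral>x. b j * w x \<partial>M)"
      by (rule integral_mono_AE) (use i w dom in \<open>auto elim: eventually_mono\<close>)
    then show "norm (\<integral>x. norm (f j x) \<partial>M) \<le> b j * integral\<^sup>L M w" by simp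
  qed
  have "(\<lambda>j. integral\<^sup>L M (f j)) sums (\<integral>x. (\<Sum>j. f j x) \<partial>M)"
    by (rule sums_integral[OF i 1 2])
  also have "(\<integral>x. (\<Sum>j. f j x) \<partial>M) = integral\<^sup>L M g"
    by (rule integral_cong_AE) (use s in \<open>auto elim!: eventually_mono simp: sums_iff\<close>)
  finally show ?thesis .
qed

text \<open>
Real analyticity on the open unit interval, for functions of the radius.
\<close>
definition locally_powser :: "(real \<Rightarrow> complex) \<Rightarrow> bool" where
  "locally_powser b \<longleftrightarrow> (\<forall>r\<in>{0<..<1}. \<exists>\<rho>>0. \<exists>G. \<forall>t. \<bar>t\<bar> < \<rho> \<longrightarrow> (\<lambda>j. G j * of_real t ^ j) sums b (r + t))"

lemma locally_powser_diff:
  assumes "locally_powser a" "locally_powser b"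
  shows "locally_powser (\<lambda>r. a r - b r)"
  unfolding locally_powser_def
proof
  fix r :: real assume r: "r \<in> {0<..<1}"
  obtain \<rho> G where 1: "\<rho> > 0" "\<And>t. \<bar>t\<bar> < \<rho> \<Longrightarrow> (\<lambda>j. G j * of_real t ^ j) sums a (r + t)"
    using assms(1) r unfolding locally_powser_def by meson
  obtain \<rho>' G' where 2: "\<rho>' > 0" "\<And>t. \<bar>t\<bar> < \<rho>' \<Longrightarrow> (\<lambda>j. G' j * of_real t ^ j) sums b (r + t)"
    using assms(2) r unfolding locally_powser_def by meson
  show "\<exists>\<rho>>0. \<exists>G. \<forall>t. \<bar>t\<bar> < \<rho> \<longrightarrow> (\<lambda>j. G j * of_real t ^ j) sums (a (r + t) - b (r + t))"
    using sums_diff[OF 1(2) 2(2)] 1(1) 2(1)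
    by (intro exI[of _ "min \<rho> \<rho>'"] conjI exI[of _ "\<lambda>j. G j - G' j"]) (auto simp: left_diff_distrib)
qed

lemma locally_powser_holomorphic:
  assumes f: "f holomorphic_on ball 0 1" and b: "\<And>r. r \<in> {0<..<1} \<Longrightarrow> b r = f (of_real r)"
  shows "locally_powser b"
  unfolding locally_powser_def
proof
  fix r :: real assume r: "r \<in> {0<..<1}"
  let ?\<rho> = "min r (1 - r)"
  have sub: "ball (of_real r) ?\<rho> \<subseteq> ball (0::complex) 1"
  proof
    fix z :: complex assume "z \<in> ball (of_real r) ?\<rho>"
    then show "z \<in> ball 0 1" using norm_triangle_sub[of z "of_real r"] r by (simp add: dist_norm norm_minus_commute)
  qed
  have "(\<lambda>j. (deriv ^^ j) f (of_real r) / fact j * of_real t ^ j) sums b (r + t)" if t: "\<bar>t\<bar> < ?\<rho>" for t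
  proof -
    have "(\<lambda>j. (deriv ^^ j) f (of_real r) / fact j * (of_real (r + t) - of_real r) ^ j) sums f (of_real (r + t))"
      by (rule holomorphic_power_series[OF holomorphic_on_subset[OF f sub]]) (use t in \<open>simp add: dist_norm\<close>)
    moreover have "r + t \<in> {0<..<1}" using t r by auto
    ultimately show ?thesis using b by simp
  qed
  then show "\<exists>\<rho>>0. \<exists>G. \<forall>t. \<bar>t\<bar> < \<rho> \<longrightarrow> (\<lambda>j. G j * of_real t ^ j) sums b (r + t)"
    using r by (intro exI[of _ ?\<rho>] conjI exI[of _ "\<lambda>j. (deriv ^^ j) f (of_real r) / fact j"]) auto
qed

text \<open>
The identity theorem. The supremum of the points up to which \<open>b\<close> vanishes could be increased, since the power
series there vanishes to its left and hence identically.
\<close>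
lemma locally_powser_identity:
  assumes b: "locally_powser b" and \<delta>: "\<delta> > 0" "\<And>r. 0 < r \<Longrightarrow> r < \<delta> \<Longrightarrow> b r = 0"
    and r: "0 < r" "r < 1"
  shows "b r = 0"
proof (rule ccontr)
  assume nz: "b r \<noteq> 0"
  define S where "S = {x. 0 < x \<and> x < 1 \<and> (\<forall>s. 0 < s \<and> s < x \<longrightarrow> b s = 0)}"
  define x where "x = Sup S"
  have S1: "min (\<delta>) (1/2) \<in> S" using \<delta> by (auto simp: S_def)
  have ub: "y \<le> r" if "y \<in> S" for y using that nz r unfolding S_def by (metis (mono_tags, lifting) mem_Collect_eq not_le)
  have bdd: "bdd_above S" by (rule bdd_aboveI[of _ r]) (rule ub)
  have x0: "x > 0" using cSup_upper[OF S1 bdd] \<delta> by (simp add: x_def)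
  have xr: "x \<le> r" unfolding x_def using S1 ub by (intro cSup_least) auto
  have zero: "b s = 0" if s: "0 < s" "s < x" for s
  proof -
    have "\<exists>y\<in>S. s < y" using s(2) less_cSup_iff[of S s] S1 bdd unfolding x_def by auto
    then show ?thesis using s by (auto simp: S_def)
  qed
  have "x \<in> {0<..<1}" using x0 xr r by simp
  then obtain \<rho> G where G: "\<rho> > 0" "\<And>t. \<bar>t\<bar> < \<rho> \<Longrightarrow> (\<lambda>j. G j * of_real t ^ j) sums b (x + t)"
    using b unfolding locally_powser_def by meson
  have "G j * (-1) ^ j = 0" for j
  proof (rule powser_zero[of "min \<rho> x"])
    fix t :: real assume t: "0 < t" "t < min \<rho> x"
    have "(\<lambda>j. G j * of_real (- t) ^ j) sums b (x + - t)" by (rule G(2)) (use t in auto)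
    also have "b (x + - t) = 0" using zero[of "x - t"] t by simp
    finally show "(\<lambda>j. G j * (-1) ^ j * of_real t ^ j) sums 0"
      by (simp add: power_minus[of "complex_of_real t"] mult.assoc)
  qed (use G x0 in auto)
  then have G0: "G j = 0" for j by simp
  have zero2: "b (x + t) = 0" if t: "\<bar>t\<bar> < \<rho>" for t
  proof -
    have "(\<lambda>j. 0) sums b (x + t)" using G(2)[OF t] by (simp add: G0)
    then show ?thesis by (simp add: sums_iff)
  qed
  define y where "y = min (x + \<rho> / 2) ((1 + x) / 2)"
  have y: "x < y" "y < 1" using G(1) xr r by (auto simp: y_def min_less_iff_disj)
  have "b s = 0" if "0 < s" "s < y" for s
  proof (cases "s < x")
    case False
    then have "\<bar>s - x\<bar> < \<rho>" using that G(1) by (auto simp: y_def)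
    then show ?thesis using zero2[of "s - x"] by simp
  qed (use zero that in auto)
  then have "y \<in> S" using y x0 by (auto simp: S_def)
  then have "y \<le> x" unfolding x_def using bdd by (rule cSup_upper)
  then show False using y by simp
qed

text \<open>
Near a sphere of radius \<open>r\<close> the function \<open>t \<mapsto> u((r + t)\<zeta>)\<close> extends holomorphically to a disc of radius and with a bound
independent of \<open>\<zeta>\<close>, by compactness. Cauchy's inequality dominates its Taylor coefficients, which can therefore
be integrated over \<open>\<zeta>\<close>. The indicator makes the integrand measurable: the measure lives on the whole space,
and for \<open>\<zeta>\<close> off the sphere \<open>r\<zeta>\<close> may leave the ball, where \<open>u\<close> is arbitrary.
\<close>
lemma spherical_mean_locally_powser:
  fixes u f :: "real^'n::finite \<Rightarrow> complex"
  assumes u: "\<And>a. a \<in> ball 0 1 \<Longrightarrow> \<exists>c. mps u a c" and f: "continuous_on UNIV f"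
  shows "locally_powser (\<lambda>r. integral\<^sup>L sphere_measure (\<lambda>\<zeta>. indicator (sphere 0 1) \<zeta> *\<^sub>R (u (r *\<^sub>R \<zeta>) * f \<zeta>)))"
  unfolding locally_powser_def
proof
  fix r :: real assume r: "r \<in> {0<..<1}"
  let ?S = "sphere 0 1 :: (real^'n) set"
  interpret prob_space "sphere_measure :: (real^'n) measure" by (rule prob_space_sphere_measure)
  have comp: "compact (sphere 0 r :: (real^'n) set)" by simp
  obtain \<epsilon> C where \<epsilon>: "\<epsilon> > 0" and H: "\<And>a e. a \<in> sphere (0::real^'n) r \<Longrightarrow> norm e = 1 \<Longrightarrow>
     (\<exists>H. H holomorphic_on ball 0 \<epsilon> \<and> (\<forall>t\<in>ball 0 \<epsilon>. cmod (H t) \<le> C) \<and>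
       (\<forall>t::real. \<bar>t\<bar> < \<epsilon> \<longrightarrow> H (of_real t) = u (a + t *\<^sub>R e)))"
  proof (rule compact_line_extension[OF comp, of u])
    show "\<exists>c. mps u a c" if "a \<in> sphere 0 r" for a using that r by (intro u) auto
  qed blast
  have "\<exists>H. H holomorphic_on ball 0 \<epsilon> \<and> (\<forall>t\<in>ball 0 \<epsilon>. cmod (H t) \<le> C) \<and>
       (\<forall>t::real. \<bar>t\<bar> < \<epsilon> \<longrightarrow> H (of_real t) = u ((r + t) *\<^sub>R \<zeta>))" if "\<zeta> \<in> ?S" for \<zeta>
    using H[of "r *\<^sub>R \<zeta>" \<zeta>] that r by (simp add: scaleR_add_left)
  then obtain H where Hh: "\<And>\<zeta>. \<zeta> \<in> ?S \<Longrightarrow> H \<zeta> holomorphic_on ball 0 \<epsilon>"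
    and Hb: "\<And>\<zeta> t. \<zeta> \<in> ?S \<Longrightarrow> t \<in> ball 0 \<epsilon> \<Longrightarrow> cmod (H \<zeta> t) \<le> C"
    and Hu: "\<And>\<zeta> t. \<zeta> \<in> ?S \<Longrightarrow> \<bar>t\<bar> < \<epsilon> \<Longrightarrow> H \<zeta> (of_real t) = u ((r + t) *\<^sub>R \<zeta>)"
    by metis
  define \<rho> where "\<rho> = min (\<epsilon> / 2) (min (r / 2) ((1 - r) / 2))"
  have "\<rho> \<le> \<epsilon> / 2" "\<rho> \<le> r / 2" "\<rho> \<le> (1 - r) / 2"
    unfolding \<rho>_def by (meson min.cobounded1 min.cobounded2 order_trans)+
  moreover have "\<rho> > 0" using \<epsilon> r by (simp add: \<rho>_def)
  moreover have r01: "0 < r" "r < 1" using r by auto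
  ultimately have \<rho>: "\<rho> > 0" "\<rho> < \<epsilon>" "\<rho> < r" "r + \<rho> < 1"
    using \<epsilon> r01 by (auto simp: field_simps)
  define g where "g j \<zeta> = indicator ?S \<zeta> *\<^sub>R ((deriv ^^ j) (H \<zeta>) 0 / fact j)" for j \<zeta>
  define v where "v t \<zeta> = indicator ?S \<zeta> *\<^sub>R u ((r + t) *\<^sub>R \<zeta>)" for t \<zeta>
  have gs: "(\<lambda>j. g j \<zeta> * z ^ j) sums (indicator ?S \<zeta> *\<^sub>R H \<zeta> z)" if "cmod z < \<epsilon>" for z \<zeta>
  proof (cases "\<zeta> \<in> ?S")
    case True
    have "(\<lambda>j. (deriv ^^ j) (H \<zeta>) 0 / fact j * (z - 0) ^ j) sums H \<zeta> z"
      by (rule holomorphic_power_series[OF Hh[OF True]]) (use that in simp)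
    then show ?thesis using True by (simp add: g_def)
  qed (simp add: g_def)
  have vs: "(\<lambda>j. g j \<zeta> * of_real t ^ j) sums v t \<zeta>" if "\<bar>t\<bar> < \<epsilon>" for t \<zeta>
    using gs[of "of_real t" \<zeta>] that Hu[of \<zeta> t] by (auto simp: v_def split: split_indicator)
  have C0: "C \<ge> 0"
  proof -
    obtain \<zeta> :: "real^'n" where "norm \<zeta> = 1" using ex_unit_vector by blast
    then have "cmod (H \<zeta> 0) \<le> C" using Hb[of \<zeta> 0] \<epsilon> by simp
    then show ?thesis using norm_ge_zero order_trans by blast
  qed
  have gb: "cmod (g j \<zeta>) \<le> C / \<rho> ^ j" for j \<zeta>
  proof (cases "\<zeta> \<in> ?S")
    case True
    have "cmod ((deriv ^^ j) (H \<zeta>) 0) \<le> fact j * C / \<rho> ^ j"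
    proof (rule Cauchy_inequality)
      show "H \<zeta> holomorphic_on ball 0 \<rho>" by (rule holomorphic_on_subset[OF Hh[OF True]]) (use \<rho> in auto)
      show "continuous_on (cball 0 \<rho>) (H \<zeta>)"
        by (rule continuous_on_subset[OF holomorphic_on_imp_continuous_on[OF Hh[OF True]]]) (use \<rho> in auto)
    qed (use \<rho> Hb[OF True] in auto)
    then show ?thesis using True by (simp add: g_def norm_divide field_simps)
  qed (use C0 \<rho> in \<open>simp add: g_def\<close>)
  have vm: "v t \<in> borel_measurable borel" if "\<bar>t\<bar> \<le> \<rho>" for t
    unfolding v_def
  proof (rule borel_measurable_continuous_on_indicator)
    have c: "continuous_on (ball 0 1) u" by (rule mps_continuous_on[OF u])
    show "continuous_on ?S (\<lambda>\<zeta>. u ((r + t) *\<^sub>R \<zeta>))"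
      by (rule continuous_on_compose2[OF c]) (use that \<rho> r in \<open>auto intro!: continuous_intros\<close>)
  qed simp
  \<comment> \<open>Taylor coefficients are iterated limits of difference quotients of measurable functions; the extension \<open>H \<zeta>\<close> was chosen for each \<open>\<zeta>\<close> separately\<close>
  have gm[measurable]: "g j \<in> borel_measurable borel" for j
  proof (induction j rule: less_induct)
    case (less j)
    define \<tau> where "\<tau> k = \<rho> / real (Suc k)" for k
    have \<tau>: "0 < \<tau> k" "\<tau> k \<le> \<rho>" for k using \<rho> by (auto simp: \<tau>_def divide_le_eq)
    have \<tau>0: "\<tau> \<longlonglongrightarrow> 0"
      unfolding \<tau>_def using LIMSEQ_Suc[OF lim_const_over_n[of \<rho>]] by simp
    show ?case
    proof (rule borel_measurable_LIMSEQ_metric)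
      show "(\<lambda>\<zeta>. (v (\<tau> k) \<zeta> - (\<Sum>i<j. g i \<zeta> * of_real (\<tau> k) ^ i)) / of_real (\<tau> k) ^ j) \<in> borel_measurable borel" for k
        using vm[of "\<tau> k"] less \<tau>[of k] by (intro borel_measurable_divide borel_measurable_diff borel_measurable_sum borel_measurable_times) auto
      fix \<zeta> :: "real^'n"
      let ?F = "\<lambda>z. (\<Sum>i. g (i + j) \<zeta> * z ^ i)"
      have shift: "(\<lambda>i. g (i + j) \<zeta> * z ^ i) sums ((indicator ?S \<zeta> *\<^sub>R H \<zeta> z - (\<Sum>i<j. g i \<zeta> * z ^ i)) / z ^ j)"
        if z: "cmod z < \<epsilon>" "z \<noteq> 0" for z
      proof -
        have "(\<lambda>i. g (i + j) \<zeta> * z ^ (i + j)) sums (indicator ?S \<zeta> *\<^sub>R H \<zeta> z - (\<Sum>i<j. g i \<zeta> * z ^ i))"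
          using sums_split_initial_segment[OF gs[OF z(1)], of j] by simp
        from sums_divide[OF this, of "z ^ j"] show ?thesis using z by (simp add: power_add)
      qed
      have "((\<lambda>z. ?F z) \<longlongrightarrow> g (0 + j) \<zeta>) (at 0)"
      proof (rule powser_limit_0_strong[OF \<epsilon>])
        show "(\<lambda>i. g (i + j) \<zeta> * z ^ i) sums ?F z" if "z \<noteq> 0" "norm z < \<epsilon>" for z
          using shift[of z] that by (simp add: sums_iff)
      qed
      then have "(\<lambda>k. ?F (of_real (\<tau> k))) \<longlonglongrightarrow> g (0 + j) \<zeta>"
        by (rule filterlim_compose)
           (use tendsto_of_real[OF \<tau>0, where 'a = complex] \<tau>(1) in
             \<open>auto simp: filterlim_at less_imp_neq[symmetric] intro!: always_eventually\<close>)
      moreover have "?F (of_real (\<tau> k)) = (v (\<tau> k) \<zeta> - (\<Sum>i<j. g i \<zeta> * of_real (\<tau> k) ^ i)) / of_real (\<tau> k) ^ j" for k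
      proof -
        have t: "\<bar>\<tau> k\<bar> < \<epsilon>" "\<tau> k \<noteq> 0" using \<tau>[of k] \<rho> by auto
        have "v (\<tau> k) \<zeta> = indicator ?S \<zeta> *\<^sub>R H \<zeta> (of_real (\<tau> k))"
          using Hu[of \<zeta> "\<tau> k"] t by (auto simp: v_def split: split_indicator)
        then show ?thesis using shift[of "of_real (\<tau> k)"] t by (simp add: sums_iff)
      qed
      ultimately show "(\<lambda>k. (v (\<tau> k) \<zeta> - (\<Sum>i<j. g i \<zeta> * of_real (\<tau> k) ^ i)) / of_real (\<tau> k) ^ j) \<longlonglongrightarrow> g j \<zeta>" by simp
    qed
  qed
  have fm[measurable]: "f \<in> borel_measurable borel" by (rule borel_measurable_continuous_onI[OF f])
  have fi: "integrable sphere_measure f" by (rule integrable_sphere_measure[OF f])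
  let ?G = "\<lambda>j. integral\<^sup>L sphere_measure (\<lambda>\<zeta>. g j \<zeta> * f \<zeta>)"
  have "(\<lambda>j. ?G j * of_real t ^ j) sums integral\<^sup>L sphere_measure (\<lambda>\<zeta>. indicator ?S \<zeta> *\<^sub>R (u ((r + t) *\<^sub>R \<zeta>) * f \<zeta>))"
    if t: "\<bar>t\<bar> < \<rho>" for t
  proof -
    have "(\<lambda>j. integral\<^sup>L sphere_measure (\<lambda>\<zeta>. g j \<zeta> * of_real t ^ j * f \<zeta>)) sums integral\<^sup>L sphere_measure (\<lambda>\<zeta>. v t \<zeta> * f \<zeta>)"
    proof (rule sums_integral_dominated[where w = "\<lambda>\<zeta>. cmod (f \<zeta>)" and b = "\<lambda>j. C * (\<bar>t\<bar> / \<rho>) ^ j"])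
      have [measurable]: "v t \<in> borel_measurable borel" using vm[of t] t by simp
      show "(\<lambda>\<zeta>. v t \<zeta> * f \<zeta>) \<in> borel_measurable sphere_measure" by measurable
      show "(\<lambda>\<zeta>. g j \<zeta> * of_real t ^ j * f \<zeta>) \<in> borel_measurable sphere_measure" for j by measurable
      show "summable (\<lambda>j. C * (\<bar>t\<bar> / \<rho>) ^ j)" using t \<rho> by (intro summable_mult summable_geometric) auto
      show "AE \<zeta> in sphere_measure. \<forall>j. norm (g j \<zeta> * of_real t ^ j * f \<zeta>) \<le> C * (\<bar>t\<bar> / \<rho>) ^ j * cmod (f \<zeta>)"
      proof (rule AE_I2, intro allI)
        fix \<zeta> j
        have "norm (g j \<zeta> * of_real t ^ j * f \<zeta>) = cmod (g j \<zeta>) * \<bar>t\<bar> ^ j * cmod (f \<zeta>)" by (simp add: norm_mult norm_power)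
        also have "\<dots> \<le> C / \<rho> ^ j * \<bar>t\<bar> ^ j * cmod (f \<zeta>)" by (intro mult_right_mono gb) auto
        finally show "norm (g j \<zeta> * of_real t ^ j * f \<zeta>) \<le> C * (\<bar>t\<bar> / \<rho>) ^ j * cmod (f \<zeta>)" by (simp add: power_divide)
      qed
      show "AE \<zeta> in sphere_measure. (\<lambda>j. g j \<zeta> * of_real t ^ j * f \<zeta>) sums (v t \<zeta> * f \<zeta>)"
        using t \<rho> by (intro AE_I2 sums_mult2 vs) auto
    qed (use fi in auto)
    moreover have "integral\<^sup>L sphere_measure (\<lambda>\<zeta>. g j \<zeta> * of_real t ^ j * f \<zeta>) = ?G j * of_real t ^ j" for j
    proof -
      have "(\<lambda>\<zeta>. g j \<zeta> * of_real t ^ j * f \<zeta>) = (\<lambda>\<zeta>. (g j \<zeta> * f \<zeta>) * of_real t ^ j)" by (simp add: fun_eq_iff mult_ac)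
      then show ?thesis by simp
    qed
    ultimately show ?thesis by (simp add: v_def)
  qed
  then show "\<exists>\<rho>>0. \<exists>G. \<forall>t. \<bar>t\<bar> < \<rho> \<longrightarrow> (\<lambda>j. G j * of_real t ^ j) sums
      integral\<^sup>L sphere_measure (\<lambda>\<zeta>. indicator ?S \<zeta> *\<^sub>R (u ((r + t) *\<^sub>R \<zeta>) * f \<zeta>))"
    using \<rho>(1) by (intro exI[of _ \<rho>] conjI exI[of _ ?G]) auto
qed

text \<open>
If \<open>a r\<close> denotes the sum, passing to \<open>a (\<mu> r) - \<mu> ^ k * a r\<close> removes the term \<open>k\<close>, multiplies the others by
\<open>\<mu> ^ m - \<mu> ^ k\<close> and at most doubles the bound. Repeating this leaves the term \<open>l\<close> alone.
\<close>
lemma isolate_coefficient: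
  fixes B :: "nat \<Rightarrow> complex"
  assumes "finite G" "l \<notin> G" and \<mu>: "0 < \<mu>" "\<mu> < 1"
    and bnd: "\<And>r. 0 < r \<Longrightarrow> r \<le> r1 \<Longrightarrow> cmod (of_real r ^ l * B l + (\<Sum>m\<in>G. of_real r ^ m * B m)) \<le> A"
    and r1: "r1 > 0"
  shows "cmod (B l) * r1 ^ l * (\<Prod>m\<in>G. \<bar>\<mu> ^ l - \<mu> ^ m\<bar>) \<le> 2 ^ card G * A"
  using assms(1,2) bnd
proof (induction G arbitrary: B A rule: finite_induct)
  case empty
  then show ?case using r1 by (auto simp: norm_mult norm_power mult.commute dest: spec[of _ r1])
next
  case (insert k G)
  define B' where "B' m = (of_real (\<mu> ^ m) - of_real (\<mu> ^ k)) * B m" for m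
  define a where "a r = of_real r ^ l * B l + (\<Sum>m\<in>insert k G. of_real r ^ m * B m)" for r :: real
  have "cmod (of_real r ^ l * B' l + (\<Sum>m\<in>G. of_real r ^ m * B' m)) \<le> 2 * A" if r: "0 < r" "r \<le> r1" for r
  proof -
    have "of_real r ^ l * B' l + (\<Sum>m\<in>G. of_real r ^ m * B' m) = a (\<mu> * r) - of_real (\<mu> ^ k) * a r"
      using insert(1,2) by (simp add: a_def B'_def algebra_simps power_mult_distrib sum_distrib_left sum_subtractf)
    also have "cmod \<dots> \<le> cmod (a (\<mu> * r)) + \<mu> ^ k * cmod (a r)"
      using \<mu> by (intro order_trans[OF norm_triangle_ineq4]) (simp add: norm_mult norm_power)
    also have "\<dots> \<le> A + 1 * A"
    proof (intro add_mono mult_mono)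
      have "\<mu> * r \<le> r1" using r \<mu> mult_right_mono[of \<mu> 1 r] by linarith
      then show "cmod (a (\<mu> * r)) \<le> A" unfolding a_def using \<mu> r by (intro insert.prems) auto
      show "cmod (a r) \<le> A" unfolding a_def using r by (intro insert.prems) auto
    qed (use \<mu> in \<open>auto intro: power_le_one\<close>)
    finally show ?thesis by simp
  qed
  from insert.IH[OF _ this] insert.prems
  have "cmod (B' l) * r1 ^ l * (\<Prod>m\<in>G. \<bar>\<mu> ^ l - \<mu> ^ m\<bar>) \<le> 2 ^ card G * (2 * A)" by simp
  moreover have "cmod (B' l) = \<bar>\<mu> ^ l - \<mu> ^ k\<bar> * cmod (B l)"
    unfolding B'_def norm_mult of_real_diff[symmetric] norm_of_real ..
  ultimately show ?case using insert(1,2) by (simp add: mult_ac)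
qed

lemma summable_of_ratio_limit:
  fixes f :: "nat \<Rightarrow> real"
  assumes pos: "\<And>m. f m > 0" and lim: "(\<lambda>m. f (Suc m) / f m) \<longlonglongrightarrow> x" and x: "x < 1"
  shows "summable f"
proof -
  obtain c where c: "x < c" "c < 1" using dense[OF x] by blast
  have "\<forall>\<^sub>F m in sequentially. f (Suc m) / f m < c" using order_tendstoD(2)[OF lim c(1)] .
  then obtain M where M: "\<And>m. m \<ge> M \<Longrightarrow> f (Suc m) / f m < c" by (auto simp: eventually_sequentially)
  show ?thesis
  proof (rule summable_ratio_test[OF c(2), of M])
    fix m assume "m \<ge> M"
    from M[OF this] show "norm (f (Suc m)) \<le> c * norm (f m)"
      using pos[of m] pos[of "Suc m"] by (simp add: field_simps)
  qed
qed

lemma shifted_ratio_limit: "(\<lambda>m. (real m + a) / (real m + b)) \<longlonglongrightarrow> 1"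
proof -
  have "(\<lambda>m. 1 + (a - b) * inverse (real m + b)) \<longlonglongrightarrow> 1 + (a - b) * 0"
  proof (intro tendsto_intros tendsto_inverse_0_at_top)
    have "filterlim (\<lambda>m. b + real m) at_top sequentially"
      by (rule filterlim_tendsto_add_at_top[OF tendsto_const filterlim_real_sequentially])
    then show "filterlim (\<lambda>m. real m + b) at_top sequentially" by (simp add: add.commute)
  qed
  moreover have "\<forall>\<^sub>F m in sequentially. 1 + (a - b) * inverse (real m + b) = (real m + a) / (real m + b)"
    using eventually_gt_at_top[of "nat \<lceil>- b\<rceil>"]
  proof eventually_elim
    case (elim m)
    then have "real m + b > 0" by linarith
    then show ?case by (simp add: field_simps)
  qed
  ultimately show ?thesis by (simp add: tendsto_cong)
qed

lemma summable_power_times_geometric: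
  fixes x :: real
  assumes "0 < x" "x < 1"
  shows "summable (\<lambda>m. (real m + 1) ^ N * x ^ m)"
proof (rule summable_of_ratio_limit[OF _ _ assms(2)])
  have "(\<lambda>m. ((real m + 2) / (real m + 1)) ^ N * x) \<longlonglongrightarrow> 1 ^ N * x"
    by (intro tendsto_intros shifted_ratio_limit)
  moreover have "((real m + 2) / (real m + 1)) ^ N * x = (real (Suc m) + 1) ^ N * x ^ Suc m / ((real m + 1) ^ N * x ^ m)" for m
    using assms by (simp add: power_divide add.commute)
  ultimately show "(\<lambda>m. (real (Suc m) + 1) ^ N * x ^ Suc m / ((real m + 1) ^ N * x ^ m)) \<longlonglongrightarrow> x" by simp
qed (use assms in auto)

lemma norm_sphere_integral_le:
  fixes f :: "real^'n::finite \<Rightarrow> complex"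
  assumes "\<And>x. norm x = 1 \<Longrightarrow> norm (f x) \<le> C" "C \<ge> 0"
  shows "norm (integral\<^sup>L sphere_measure f) \<le> C"
proof (cases "integrable sphere_measure f")
  case True
  interpret prob_space "sphere_measure :: (real^'n) measure" by (rule prob_space_sphere_measure)
  have "norm (integral\<^sup>L sphere_measure f) \<le> integral\<^sup>L sphere_measure (\<lambda>x. norm (f x))"
    by (rule integral_norm_bound)
  also have "\<dots> \<le> integral\<^sup>L sphere_measure (\<lambda>x::real^'n. C)"
  proof (rule integral_mono_AE)
    show "AE x in sphere_measure. norm (f x) \<le> C"
      using AE_sphere_measure by eventually_elim (use assms in auto)
  qed (use True in auto)
  also have "\<dots> = C" using prob_space by simp
  finally show ?thesis .
qed (use assms in \<open>simp add: not_integrable_integral_eq\<close>)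

lemma sphere_inner_orthogonal:
  assumes "q \<in> polyharmonic_polys p m" "r \<in> polyharmonic_polys p l"
    and "\<And>i j. i < p \<Longrightarrow> j < p \<Longrightarrow> l + 2 * i \<noteq> m + 2 * j"
  shows "sphere_inner q r = 0"
  unfolding sphere_inner_def by (rule sphere_pair_orthogonal[OF assms(1) star_polyharmonic[OF assms(2)] assms(3)])

text \<open>
The Taylor coefficients are annihilated by the coefficient Laplacian by uniqueness of power series, so each
homogeneous part is polyharmonic by itself.
\<close>
lemma polyharmonic_local_expansion:
  fixes u :: "real^'n::finite \<Rightarrow> complex"
  assumes u: "u \<in> polyharmonic_ball p"
  obtains q \<delta> b where "\<And>m. q m \<in> polyharmonic_polys p m" "\<delta> > 0" "summable b"
    "\<And>m x. norm x < \<delta> \<Longrightarrow> cmod (q m (cvec x)) \<le> b m"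
    "\<And>x. norm x < \<delta> \<Longrightarrow> (\<lambda>m. q m (cvec x)) sums u x"
proof -
  have "real_analytic_on u (ball 0 1)" using u by (simp add: polyharmonic_ball_def)
  then obtain c where c: "mps u 0 c" using real_analytic_imp_mps[of u "ball 0 1" 0] by auto
  have z: "(coeff_laplacian ^^ p) c k = 0" for k
    by (rule mps_zero_unique[OF mps_laplacian_pow[OF c], of 1]) (use u in \<open>auto simp: polyharmonic_ball_def\<close>)
  then have "(coeff_laplacian ^^ p) c = (\<lambda>_. 0)" by auto
  then have "hpoly m c \<in> polyharmonic_polys p m" for m
    by (simp add: polyharmonic_polys_def homogeneous_hpoly claplacian_pow_hpoly)
  then show ?thesis using mps_homogeneous_series[OF c] that[of "\<lambda>m. hpoly m c"] by metis
qed

text \<open>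
The spherical means of \<open>u\<close> against the conjugate of \<open>q l\<close> form a finite combination of the powers \<open>r ^ m\<close> with
\<open>|m - l| < 2p\<close>, first for small \<open>r\<close> and then, by analyticity, for all \<open>r < 1\<close>. They are bounded for \<open>r \<le> \<mu>\<close> because \<open>u\<close>
is, and the coefficient of \<open>r ^ l\<close>, which is the mean square of \<open>q l\<close>, is isolated from at most \<open>4p\<close> other
coefficients.
\<close>
lemma spherical_coefficients_bounded:
  fixes u :: "real^'n::finite \<Rightarrow> complex"
  assumes mps: "\<And>a. a \<in> ball 0 1 \<Longrightarrow> \<exists>c. mps u a c"
    and q: "\<And>m. q m \<in> polyharmonic_polys p m" and \<delta>: "\<delta> > 0" and b: "summable b"
    "\<And>m x. norm x < \<delta> \<Longrightarrow> cmod (q m (cvec x)) \<le> b m"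
    "\<And>x. norm x < \<delta> \<Longrightarrow> (\<lambda>m. q m (cvec x)) sums u x"
    and \<mu>: "0 < \<mu>" "\<mu> < 1"
  obtains M where "M \<ge> 0" "\<And>l Q. (\<And>x::real^'n. norm x = 1 \<Longrightarrow> cmod (q l (cvec x)) \<le> Q) \<Longrightarrow>
    sphere_sq (q l) * \<mu> ^ l * ((1 - \<mu>) * \<mu> ^ l) ^ (4 * p) \<le> 2 ^ (4 * p) * (M * Q)"
proof -
  have hq: "homogeneous_polynomial m (q m)" for m using q by (simp add: polyharmonic_polys_def)
  have uc: "continuous_on (ball 0 1) u" by (rule mps_continuous_on[OF mps])
  have "compact (u ` cball 0 \<mu>)"
    by (intro compact_continuous_image continuous_on_subset[OF uc]) (use \<mu> in auto)
  then obtain M0 where "\<forall>y\<in>u ` cball 0 \<mu>. norm y \<le> M0" using compact_imp_bounded bounded_iff by metis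
  then have M: "cmod (u x) \<le> max 0 M0" if "norm x \<le> \<mu>" for x using that by (auto simp: le_max_iff_disj)
  show ?thesis
  proof (rule that[of "max 0 M0"])
    fix l Q assume Q: "\<And>x::real^'n. norm x = 1 \<Longrightarrow> cmod (q l (cvec x)) \<le> Q"
    have Q0: "Q \<ge> 0" using Q by (rule sphere_bound_nonneg)
    let ?s = "\<lambda>\<zeta>. star (q l) (cvec \<zeta>)"
    define a where "a r = integral\<^sup>L sphere_measure (\<lambda>\<zeta>. indicator (sphere 0 1) \<zeta> *\<^sub>R (u (r *\<^sub>R \<zeta>) * ?s \<zeta>))" for r
    define B where "B m = sphere_inner (q m) (q l)" for m
    \<comment> \<open>the degrees whose polynomials need not be orthogonal to \<open>q l\<close>\<close>
    define W where "W = {m. m < l + 2 * p \<and> l < m + 2 * p}"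
    have W: "finite W" by (rule finite_subset[of _ "{..<l + 2 * p}"]) (auto simp: W_def)
    have B0: "B m = 0" if "m \<notin> W" for m
      unfolding B_def by (rule sphere_inner_orthogonal[OF q q]) (use that in \<open>auto simp: W_def\<close>)
    have sc: "continuous_on UNIV ?s" by (rule homogeneous_cvec_continuous[OF star_homogeneous[OF hq]])
    have near: "a r = (\<Sum>m\<in>W. of_real r ^ m * B m)" if r: "0 < r" "r < min \<delta> 1" for r
    proof -
      have "(\<lambda>m. integral\<^sup>L sphere_measure (\<lambda>\<zeta>. of_real r ^ m * (q m (cvec \<zeta>) * ?s \<zeta>))) sums a r"
        unfolding a_def
      proof (rule sums_integral_dominated[where w = "\<lambda>\<zeta>. cmod (?s \<zeta>)", OF _ _ _ b(1)])
        have [measurable]: "(\<lambda>\<zeta>. q m (cvec \<zeta>)) \<in> borel_measurable borel" "?s \<in> borel_measurable borel" for m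
          by (intro borel_measurable_continuous_onI homogeneous_cvec_continuous[OF hq] sc)+
        show "(\<lambda>\<zeta>. of_real r ^ m * (q m (cvec \<zeta>) * ?s \<zeta>)) \<in> borel_measurable sphere_measure" for m by measurable
        have "continuous_on (sphere 0 1) (\<lambda>\<zeta>. u (r *\<^sub>R \<zeta>) * ?s \<zeta>)"
          by (intro continuous_intros continuous_on_compose2[OF uc] continuous_on_subset[OF sc]) (use r in auto)
        then show "(\<lambda>\<zeta>. indicator (sphere 0 1) \<zeta> *\<^sub>R (u (r *\<^sub>R \<zeta>) * ?s \<zeta>)) \<in> borel_measurable sphere_measure"
          by (subst measurable_cong_sets[OF sets_sphere_measure refl])
             (intro borel_measurable_continuous_on_indicator, auto)
        show "integrable sphere_measure (\<lambda>\<zeta>. cmod (?s \<zeta>))" by (intro integrable_norm integrable_sphere_measure sc)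
        have e: "of_real r ^ m * q m (cvec \<zeta>) = q m (cvec (r *\<^sub>R \<zeta>))" for m \<zeta>
          using homogeneous_scaleR[OF hq] by simp
        show "AE \<zeta> in sphere_measure. \<forall>m. norm (of_real r ^ m * (q m (cvec \<zeta>) * ?s \<zeta>)) \<le> b m * cmod (?s \<zeta>)"
          using AE_sphere_measure
        proof eventually_elim
          case (elim \<zeta>)
          then have "cmod (q m (cvec (r *\<^sub>R \<zeta>))) \<le> b m" for m using b(2)[of "r *\<^sub>R \<zeta>" m] r by simp
          then show ?case unfolding mult.assoc[symmetric] e norm_mult by (intro allI mult_right_mono) auto
        qed
        show "AE \<zeta> in sphere_measure. (\<lambda>m. of_real r ^ m * (q m (cvec \<zeta>) * ?s \<zeta>)) sums
            (indicator (sphere 0 1) \<zeta> *\<^sub>R (u (r *\<^sub>R \<zeta>) * ?s \<zeta>))"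
          using AE_sphere_measure
        proof eventually_elim
          case (elim \<zeta>)
          then have "(\<lambda>m. q m (cvec (r *\<^sub>R \<zeta>))) sums u (r *\<^sub>R \<zeta>)" using b(3)[of "r *\<^sub>R \<zeta>"] r by simp
          then show ?case unfolding mult.assoc[symmetric] e using elim by (simp add: sums_mult2)
        qed
      qed
      moreover have "integral\<^sup>L sphere_measure (\<lambda>\<zeta>. of_real r ^ m * (q m (cvec \<zeta>) * ?s \<zeta>)) = of_real r ^ m * B m" for m
        by (simp add: B_def sphere_inner_def sphere_pair_def)
      ultimately have "(\<lambda>m. of_real r ^ m * B m) sums a r" by (simp only:)
      moreover have "(\<lambda>m. of_real r ^ m * B m) sums (\<Sum>m\<in>W. of_real r ^ m * B m)"
        by (rule sums_finite[OF W]) (use B0 in auto)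
      ultimately show ?thesis by (rule sums_unique2)
    qed
    have "locally_powser (\<lambda>r. a r - (\<Sum>m\<in>W. of_real r ^ m * B m))"
    proof (rule locally_powser_diff)
      show "locally_powser a" unfolding a_def by (rule spherical_mean_locally_powser[OF mps sc])
      show "locally_powser (\<lambda>r. \<Sum>m\<in>W. of_real r ^ m * B m)"
        by (rule locally_powser_holomorphic[of "\<lambda>z. \<Sum>m\<in>W. z ^ m * B m"]) (auto intro!: holomorphic_intros)
    qed
    then have "a r - (\<Sum>m\<in>W. of_real r ^ m * B m) = 0" if "0 < r" "r < 1" for r
      by (rule locally_powser_identity[where \<delta> = "min \<delta> 1"]) (use \<delta> near that in auto)
    then have aW: "a r = (\<Sum>m\<in>W. of_real r ^ m * B m)" if "0 < r" "r < 1" for r using that by auto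
    have ab: "cmod (a r) \<le> max 0 M0 * Q" if "0 < r" "r \<le> \<mu>" for r
      unfolding a_def
    proof (rule norm_sphere_integral_le)
      fix x :: "real^'n" assume x: "norm x = 1"
      then have "cmod (u (r *\<^sub>R x)) \<le> max 0 M0" using that by (intro M) auto
      then show "norm (indicator (sphere 0 1) x *\<^sub>R (u (r *\<^sub>R x) * ?s x)) \<le> max 0 M0 * Q"
        using x Q[OF x] by (simp add: norm_mult mult_mono)
    qed (use Q0 in auto)
    show "sphere_sq (q l) * \<mu> ^ l * ((1 - \<mu>) * \<mu> ^ l) ^ (4 * p) \<le> 2 ^ (4 * p) * (max 0 M0 * Q)"
    proof (cases "p = 0")
      case True
      then have "q l z = 0" for z using q[of l] by (simp add: polyharmonic_polys_def)
      then show ?thesis using Q0 by (simp add: sphere_sq_def)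
    next
      case False
      then have lW: "l \<in> W" by (simp add: W_def)
      have cardW: "card (W - {l}) \<le> 4 * p"
      proof -
        have "W \<subseteq> {l + 1 - 2 * p..<l + 2 * p}" by (auto simp: W_def)
        then have "card W \<le> card {l + 1 - 2 * p..<l + 2 * p}" by (intro card_mono) auto
        then have "card W \<le> 4 * p" by simp
        then show ?thesis using card_Diff1_le[of W l] by linarith
      qed
      have "cmod (B l) * \<mu> ^ l * (\<Prod>m\<in>W - {l}. \<bar>\<mu> ^ l - \<mu> ^ m\<bar>) \<le> 2 ^ card (W - {l}) * (max 0 M0 * Q)"
      proof (rule isolate_coefficient[OF _ _ \<mu>])
        fix r assume r: "0 < r" "r \<le> \<mu>"
        have "of_real r ^ l * B l + (\<Sum>m\<in>W - {l}. of_real r ^ m * B m) = a r"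
          using aW[of r] r \<mu> W lW by (simp add: sum.remove)
        then show "cmod (of_real r ^ l * B l + (\<Sum>m\<in>W - {l}. of_real r ^ m * B m)) \<le> max 0 M0 * Q"
          using ab[OF r] by simp
      qed (use W \<mu> in auto)
      also have "\<dots> \<le> 2 ^ (4 * p) * (max 0 M0 * Q)"
        using cardW Q0 by (intro mult_right_mono power_increasing) auto
      finally have 1: "cmod (B l) * \<mu> ^ l * (\<Prod>m\<in>W - {l}. \<bar>\<mu> ^ l - \<mu> ^ m\<bar>) \<le> 2 ^ (4 * p) * (max 0 M0 * Q)" .
      have x: "0 \<le> (1 - \<mu>) * \<mu> ^ l" "(1 - \<mu>) * \<mu> ^ l \<le> 1"
        using \<mu> by (auto intro!: mult_le_one power_le_one)
      have "((1 - \<mu>) * \<mu> ^ l) ^ (4 * p) \<le> ((1 - \<mu>) * \<mu> ^ l) ^ card (W - {l})"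
        using cardW x by (intro power_decreasing) auto
      also have "\<dots> = (\<Prod>m\<in>W - {l}. (1 - \<mu>) * \<mu> ^ l)" by simp
      also have "\<dots> \<le> (\<Prod>m\<in>W - {l}. \<bar>\<mu> ^ l - \<mu> ^ m\<bar>)"
      proof (intro prod_mono conjI x)
        fix m assume "m \<in> W - {l}"
        then consider "m < l" | "l < m" by force
        then show "(1 - \<mu>) * \<mu> ^ l \<le> \<bar>\<mu> ^ l - \<mu> ^ m\<bar>"
        proof cases
          case 1
          then have "\<mu> ^ l \<le> \<mu> * \<mu> ^ m" using \<mu> power_decreasing[of "Suc m" l \<mu>] by simp
          moreover have "(1 - \<mu>) * \<mu> ^ l \<le> (1 - \<mu>) * \<mu> ^ m"
            using \<mu> 1 by (intro mult_left_mono power_decreasing) auto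
          ultimately show ?thesis by (simp add: algebra_simps)
        next
          case 2
          then have "\<mu> ^ m \<le> \<mu> * \<mu> ^ l" using \<mu> power_decreasing[of "Suc l" m \<mu>] by simp
          then show ?thesis by (simp add: algebra_simps)
        qed
      qed
      finally have "cmod (B l) * \<mu> ^ l * ((1 - \<mu>) * \<mu> ^ l) ^ (4 * p) \<le> cmod (B l) * \<mu> ^ l * (\<Prod>m\<in>W - {l}. \<bar>\<mu> ^ l - \<mu> ^ m\<bar>)"
        using \<mu> by (intro mult_left_mono) auto
      moreover have "cmod (B l) = sphere_sq (q l)"
        unfolding B_def sphere_inner_self by (simp add: sphere_sq_nonneg)
      ultimately show ?thesis using 1 by simp
    qed
  qed simp
qed

text \<open>
For \<open>\<mu>\<close> close to \<open>1\<close> the bound of \<open>spherical_coefficients_bounded\<close>, combined with the Nikolskii inequality, shows that the sup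
norms of \<open>q m\<close> on the sphere grow more slowly than any geometric sequence with ratio above \<open>1\<close>. The series
therefore converges on the whole ball, and on each ray its sum agrees with \<open>u\<close> by the identity theorem.
\<close>
lemma polyharmonic_expansion:
  fixes u :: "real^'n::finite \<Rightarrow> complex"
  assumes u: "u \<in> polyharmonic_ball p"
  obtains q where "homogeneous_expansion u q" "\<And>m. q m \<in> polyharmonic_polys p m"
    "\<And>r. 0 < r \<Longrightarrow> r < 1 \<Longrightarrow> \<exists>C. \<forall>m x. norm x = 1 \<longrightarrow> cmod (q m (cvec x)) * r ^ m \<le> C"
proof -
  have mps: "\<exists>c. mps u a c" if "a \<in> ball 0 1" for a
    using u that real_analytic_imp_mps[of u "ball 0 1" a] by (simp add: polyharmonic_ball_def)
  obtain q \<delta> b where q: "\<And>m. q m \<in> polyharmonic_polys p m" and \<delta>: "\<delta> > 0" and b: "summable b"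
    "\<And>m x. norm x < \<delta> \<Longrightarrow> cmod (q m (cvec x)) \<le> b m"
    "\<And>x. norm x < \<delta> \<Longrightarrow> (\<lambda>m. q m (cvec x)) sums u x"
    using polyharmonic_local_expansion[OF u] by blast
  have hq: "homogeneous_polynomial m (q m)" for m using q by (simp add: polyharmonic_polys_def)
  have bounds: "\<exists>C. \<forall>m x. norm x = 1 \<longrightarrow> cmod (q m (cvec x)) * r ^ m \<le> C" if r: "0 < r" "r < 1" for r
  proof -
    define r' where "r' = (1 + r) / 2"
    have r': "0 < r'" "r' < 1" "r < r'" using r by (auto simp: r'_def)
    \<comment> \<open>chosen to make the total power of \<open>\<mu>\<close> in \<open>spherical_coefficients_bounded\<close> equal to \<open>r' ^ l\<close>\<close>
    define \<mu> where "\<mu> = root (4 * p + 1) r'"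
    have \<mu>: "0 < \<mu>" "\<mu> < 1" "\<mu> ^ (4 * p + 1) = r'"
      unfolding \<mu>_def using r' real_root_lt_1_iff[of "4 * p + 1" r'] by (auto simp: real_root_gt_zero real_root_pow_pos2 simp del: power_Suc power_add)
    obtain M where M: "M \<ge> 0" "\<And>l Q. (\<And>x::real^'n. norm x = 1 \<Longrightarrow> cmod (q l (cvec x)) \<le> Q) \<Longrightarrow>
        sphere_sq (q l) * \<mu> ^ l * ((1 - \<mu>) * \<mu> ^ l) ^ (4 * p) \<le> 2 ^ (4 * p) * (M * Q)"
      using spherical_coefficients_bounded[OF mps q \<delta> b \<mu>(1,2)] by blast
    obtain A :: real and N :: nat where A: "A > 0" and nik:
      "\<And>m q (\<eta>::real^'n). homogeneous_polynomial m q \<Longrightarrow> norm \<eta> = 1 \<Longrightarrow>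
       (cmod (q (cvec \<eta>)))\<^sup>2 \<le> A * (real m + 1) ^ N * sphere_sq q"
      using nikolskii by blast
    define D where "D = A * 2 ^ (4 * p) * M / (1 - \<mu>) ^ (4 * p)"
    have D: "D \<ge> 0" using A M \<mu> by (simp add: D_def)
    \<comment> \<open>the maximum \<open>Q\<close> of \<open>q l\<close> occurs squared in the Nikolskii inequality and linearly in the spherical bound, so one factor cancels\<close>
    have Q: "cmod (q l (cvec x)) * r' ^ l \<le> D * (real l + 1) ^ N" if x: "norm x = 1" for l x
    proof -
      obtain \<eta> where \<eta>: "norm \<eta> = 1" "\<And>z. norm z = 1 \<Longrightarrow> cmod (q l (cvec z)) \<le> cmod (q l (cvec \<eta>))"
        using sphere_max[OF hq] by blast
      define Q where "Q = cmod (q l (cvec \<eta>))"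
      have Q0: "Q \<ge> 0" by (simp add: Q_def)
      have "\<mu> ^ l * ((1 - \<mu>) * \<mu> ^ l) ^ (4 * p) = (1 - \<mu>) ^ (4 * p) * (\<mu> ^ (4 * p + 1)) ^ l"
        by (simp add: power_mult_distrib power_mult[symmetric] power_add mult_ac)
      then have pw: "\<mu> ^ l * ((1 - \<mu>) * \<mu> ^ l) ^ (4 * p) = (1 - \<mu>) ^ (4 * p) * r' ^ l" unfolding \<mu>(3) .
      have "sphere_sq (q l) * \<mu> ^ l * ((1 - \<mu>) * \<mu> ^ l) ^ (4 * p) \<le> 2 ^ (4 * p) * (M * Q)"
        by (rule M(2)) (use \<eta> in \<open>simp add: Q_def\<close>)
      then have 1: "sphere_sq (q l) * ((1 - \<mu>) ^ (4 * p) * r' ^ l) \<le> 2 ^ (4 * p) * (M * Q)"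
        by (simp only: mult.assoc pw)
      have "Q\<^sup>2 * ((1 - \<mu>) ^ (4 * p) * r' ^ l) \<le> A * (real l + 1) ^ N * sphere_sq (q l) * ((1 - \<mu>) ^ (4 * p) * r' ^ l)"
        using nik[OF hq \<eta>(1)] \<mu> r' unfolding Q_def by (intro mult_right_mono) auto
      also have "\<dots> \<le> A * (real l + 1) ^ N * (2 ^ (4 * p) * (M * Q))"
        using 1 A by (simp only: mult.assoc) (intro mult_left_mono, auto)
      finally have 2: "Q * (Q * ((1 - \<mu>) ^ (4 * p) * r' ^ l)) \<le> Q * (A * (real l + 1) ^ N * (2 ^ (4 * p) * M))"
        by (simp add: power2_eq_square mult_ac)
      have "Q * r' ^ l \<le> D * (real l + 1) ^ N"
      proof (cases "Q = 0")
        case True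
        then show ?thesis using D by simp
      next
        case False
        then have "Q * ((1 - \<mu>) ^ (4 * p) * r' ^ l) \<le> A * (real l + 1) ^ N * (2 ^ (4 * p) * M)"
          using 2 Q0 by (metis less_eq_real_def mult_le_cancel_left_pos)
        then show ?thesis using \<mu> unfolding D_def by (simp add: field_simps)
      qed
      moreover have "cmod (q l (cvec x)) * r' ^ l \<le> Q * r' ^ l"
        using \<eta>(2)[OF x] r' unfolding Q_def by (intro mult_right_mono) auto
      ultimately show ?thesis by linarith
    qed
    have "summable (\<lambda>m. (real m + 1) ^ N * (r / r') ^ m)"
      by (rule summable_power_times_geometric) (use r r' in auto)
    then have "Bseq (\<lambda>m. (real m + 1) ^ N * (r / r') ^ m)"
      using summable_LIMSEQ_zero convergent_imp_Bseq convergentI by blast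
    then obtain E where E: "\<And>m. norm ((real m + 1) ^ N * (r / r') ^ m) \<le> E" unfolding Bseq_def by blast
    have "cmod (q m (cvec x)) * r ^ m \<le> D * E" if x: "norm x = 1" for m x
    proof -
      have "cmod (q m (cvec x)) * r ^ m = (cmod (q m (cvec x)) * r' ^ m) * (r / r') ^ m"
        using r' by (simp add: power_divide)
      also have "\<dots> \<le> D * (real m + 1) ^ N * (r / r') ^ m"
        using r r' by (intro mult_right_mono Q[OF x]) auto
      also have "\<dots> \<le> D * E"
        using E[of m] D r r' unfolding mult.assoc by (intro mult_left_mono) auto
      finally show ?thesis .
    qed
    then show ?thesis by blast
  qed
  have sums: "(\<lambda>m. q m (cvec x)) sums u x" if x: "x \<in> ball 0 1" for x
  proof (cases "x = 0")
    case True
    then show ?thesis using b(3)[of x] \<delta> by simp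
  next
    case False
    let ?\<zeta> = "sgn x"
    have \<zeta>: "norm ?\<zeta> = 1" using False by (simp add: norm_sgn)
    define f where "f z = (\<Sum>m. q m (cvec ?\<zeta>) * z ^ m)" for z
    have fs: "(\<lambda>m. q m (cvec ?\<zeta>) * (z - 0) ^ m) sums f z" if z: "z \<in> ball 0 1" for z
    proof -
      have "cmod z < 1" using z by simp
      then obtain \<rho> where \<rho>: "cmod z < \<rho>" "\<rho> < 1" using dense by blast
      then obtain r where r: "\<rho> < r" "r < 1" using dense by blast
      have \<rho>0: "0 < \<rho>" using \<rho> norm_ge_zero[of z] by linarith
      obtain C where C: "\<And>m x. norm x = 1 \<Longrightarrow> cmod (q m (cvec x)) * r ^ m \<le> C"
        using bounds[of r] r \<rho>0 by auto
      have "summable (\<lambda>m. q m (cvec ?\<zeta>) * z ^ m)"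
      proof (rule summable_comparison_test'[of "\<lambda>m. C * (\<rho> / r) ^ m" 0])
        show "summable (\<lambda>m. C * (\<rho> / r) ^ m)" using r \<rho>0 by (intro summable_mult summable_geometric) auto
        fix m
        have "norm (q m (cvec ?\<zeta>) * z ^ m) \<le> cmod (q m (cvec ?\<zeta>)) * \<rho> ^ m"
          using \<rho> by (simp add: norm_mult norm_power mult_left_mono power_mono)
        also have "\<dots> = cmod (q m (cvec ?\<zeta>)) * r ^ m * (\<rho> / r) ^ m" using r \<rho>0 by (simp add: power_divide)
        also have "\<dots> \<le> C * (\<rho> / r) ^ m" using r \<rho>0 by (intro mult_right_mono C[OF \<zeta>]) auto
        finally show "norm (q m (cvec ?\<zeta>) * z ^ m) \<le> C * (\<rho> / r) ^ m" .
      qed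
      then show ?thesis by (simp add: f_def summable_sums)
    qed
    have fh: "f holomorphic_on ball 0 1" using fs by (rule power_series_holomorphic)
    have qs: "q m (cvec (r *\<^sub>R ?\<zeta>)) = q m (cvec ?\<zeta>) * of_real r ^ m" for m r
      using homogeneous_scaleR[OF hq] by (simp add: mult.commute)
    have "locally_powser (\<lambda>r. u (r *\<^sub>R ?\<zeta>) - f (of_real r))"
    proof (rule locally_powser_diff)
      show "locally_powser (\<lambda>r. f (of_real r))" by (rule locally_powser_holomorphic[OF fh]) simp
      show "locally_powser (\<lambda>r. u (r *\<^sub>R ?\<zeta>))"
        unfolding locally_powser_def
      proof
        fix r :: real assume r: "r \<in> {0<..<1}"
        obtain c where "mps u (r *\<^sub>R ?\<zeta>) c" using mps[of "r *\<^sub>R ?\<zeta>"] r \<zeta> by auto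
        from mps_line_extension[OF this] obtain \<epsilon> H where \<epsilon>: "\<epsilon> > 0" and H: "H holomorphic_on ball 0 \<epsilon>"
          "\<And>t::real. \<bar>t\<bar> < \<epsilon> \<Longrightarrow> H (of_real t) = u (r *\<^sub>R ?\<zeta> + t *\<^sub>R ?\<zeta>)"
          using \<zeta> by (metis centre_in_ball)
        have "(\<lambda>j. (deriv ^^ j) H 0 / fact j * of_real t ^ j) sums u ((r + t) *\<^sub>R ?\<zeta>)" if "\<bar>t\<bar> < \<epsilon>" for t
          using holomorphic_power_series[OF H(1), of "of_real t"] H(2)[OF that] that by (simp add: scaleR_add_left)
        then show "\<exists>\<rho>>0. \<exists>G. \<forall>t. \<bar>t\<bar> < \<rho> \<longrightarrow> (\<lambda>j. G j * of_real t ^ j) sums u ((r + t) *\<^sub>R ?\<zeta>)"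
          using \<epsilon> by (intro exI[of _ \<epsilon>] conjI exI[of _ "\<lambda>j. (deriv ^^ j) H 0 / fact j"]) auto
      qed
    qed
    moreover have "u (r *\<^sub>R ?\<zeta>) - f (of_real r) = 0" if "0 < r" "r < min \<delta> 1" for r
      using b(3)[of "r *\<^sub>R ?\<zeta>"] fs[of "of_real r"] that \<zeta> unfolding qs by (auto dest: sums_unique2)
    moreover have "min \<delta> 1 > 0" using \<delta> by simp
    moreover have "0 < norm x" "norm x < 1" using x False by auto
    ultimately have "u (norm x *\<^sub>R ?\<zeta>) - f (of_real (norm x)) = 0"
      using locally_powser_identity[of "\<lambda>r. u (r *\<^sub>R ?\<zeta>) - f (of_real r)" "min \<delta> 1" "norm x"] by blast
    moreover have e: "norm x *\<^sub>R ?\<zeta> = x" using False by (simp add: sgn_div_norm)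
    ultimately have "u x = f (of_real (norm x))" by simp
    moreover have "(\<lambda>m. q m (cvec (norm x *\<^sub>R ?\<zeta>))) sums f (of_real (norm x))"
      using fs[of "of_real (norm x)"] x unfolding qs by simp
    ultimately show ?thesis unfolding e by simp
  qed
  have "homogeneous_expansion u q" unfolding homogeneous_expansion_def using hq sums by blast
  then show ?thesis using q bounds by (rule that)
qed

section \<open>Rotations and the weighted Bergman space\<close>

text \<open>
Polar coordinates for integrands that are not products of a radial and an angular part.
\<close>
lemma polar_fubini:
  fixes F :: "real^'n::finite \<Rightarrow> complex"
  assumes F[measurable]: "F \<in> borel_measurable borel" and i: "set_integrable lborel (ball 0 1) F"
  shows "(LINT x:ball 0 1|lborel. F x) = of_real (real CARD('n) * unit_ball_vol (real CARD('n)) / 2) *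
     (LINT s:{0<..<1}|lborel. of_real (s powr (real CARD('n) / 2 - 1)) * integral\<^sup>L sphere_measure (\<lambda>\<zeta>. F (sqrt s *\<^sub>R \<zeta>)))"
proof -
  let ?R = "sq_radius_law TYPE('n)" and ?S = "sphere_measure :: (real^'n) measure"
  let ?V = "unit_ball_vol (real CARD('n))" and ?n = "real CARD('n)"
  interpret R: prob_space ?R by (rule prob_space_sq_radius_law)
  interpret S: prob_space ?S by (rule prob_space_sphere_measure)
  interpret RS: pair_sigma_finite ?R ?S by unfold_locales
  have V: "?V > 0" by simp
  let ?H = "\<lambda>(s, \<zeta>). F (sqrt s *\<^sub>R \<zeta>)"
  have m: "(\<lambda>x::real^'n. ((norm x)\<^sup>2, sgn x)) \<in> ball_law \<rightarrow>\<^sub>M borel \<Otimes>\<^sub>M borel" by measurable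
  have m2: "?H \<in> borel_measurable (borel \<Otimes>\<^sub>M borel)" by measurable
  have e: "?H ((norm x)\<^sup>2, sgn x) = F x" for x by (cases "x = 0") (simp_all add: sgn_div_norm)
  have iL: "integrable ball_law F" using i ball_law_integral(1)[OF F] by simp
  have int: "integrable (?R \<Otimes>\<^sub>M ?S) ?H"
    unfolding radius_direction_independent by (subst integrable_distr_eq[OF m m2]) (use iL in \<open>simp only: e\<close>)
  have "integral\<^sup>L (?R \<Otimes>\<^sub>M ?S) ?H = integral\<^sup>L ball_law F"
    unfolding radius_direction_independent by (subst integral_distr[OF m m2]) (simp only: e)
  then have 1: "integral\<^sup>L ball_law F = (\<integral>s. (\<integral>\<zeta>. F (sqrt s *\<^sub>R \<zeta>) \<partial>?S) \<partial>?R)"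
    using RS.integral_fst'[OF int] by simp
  let ?g = "\<lambda>s. \<integral>\<zeta>. F (sqrt s *\<^sub>R \<zeta>) \<partial>?S"
  have gm: "?g \<in> borel_measurable lborel"
  proof -
    have "?g \<in> borel_measurable ?R" using int RS.integrable_fst'[OF int] by simp
    then show ?thesis by simp
  qed
  have "(\<integral>s. ?g s \<partial>?R) = (\<integral>s. (?n / 2 * s powr (?n / 2 - 1) * indicator {0<..<1} s) *\<^sub>R ?g s \<partial>lborel)"
    unfolding sq_radius_law_density by (rule integral_density[OF gm]) auto
  also have "\<dots> = (\<integral>s. of_real (?n / 2) * (indicator {0<..<1} s *\<^sub>R (of_real (s powr (?n / 2 - 1)) * ?g s)) \<partial>lborel)"
    by (intro Bochner_Integration.integral_cong refl) (auto simp: scaleR_conv_of_real mult_ac split: split_indicator)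
  also have "\<dots> = of_real (?n / 2) * (LINT s:{0<..<1}|lborel. of_real (s powr (?n / 2 - 1)) * ?g s)"
    unfolding set_lebesgue_integral_def by (rule integral_mult_right_zero)
  finally have "integral\<^sup>L ball_law F = of_real (?n / 2) * (LINT s:{0<..<1}|lborel. of_real (s powr (?n / 2 - 1)) * ?g s)"
    unfolding 1 .
  moreover have "integral\<^sup>L ball_law F = (LINT x:ball 0 1|lborel. F x) /\<^sub>R ?V" by (rule ball_law_integral(2)[OF F])
  ultimately have eq: "(LINT x:ball 0 1|lborel. F x) /\<^sub>R ?V = of_real (?n / 2) * (LINT s:{0<..<1}|lborel. of_real (s powr (?n / 2 - 1)) * ?g s)" by simp
  have "?V \<noteq> 0" using V by linarith
  then have "(LINT x:ball 0 1|lborel. F x) = ?V *\<^sub>R ((LINT x:ball 0 1|lborel. F x) /\<^sub>R ?V)" by simp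
  also have "\<dots> = ?V *\<^sub>R (of_real (?n / 2) * (LINT s:{0<..<1}|lborel. of_real (s powr (?n / 2 - 1)) * ?g s))"
    unfolding eq ..
  finally show ?thesis by (simp add: scaleR_conv_of_real mult_ac)
qed

lemma norm_smult: "norm (c *s v) = cmod c * norm v" for v :: "complex^'n::finite"
  by (simp add: norm_vec_def norm_mult L2_set_right_distrib)

lemma norm_cvec: "norm (cvec x) = norm x"
  by (simp add: norm_vec_def cvec_def)

abbreviation rot :: "nat \<Rightarrow> nat \<Rightarrow> complex" where
  "rot p k \<equiv> cis (real k * pi / real p)"

lemma hat_ball_iff: "z \<in> hat_ball p \<longleftrightarrow> (\<exists>k<p. \<exists>x. norm x < 1 \<and> z = rot p k *s cvec x)"
  unfolding hat_ball_def UN_iff image_iff Bex_def lessThan_iff mem_ball_0 by blast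

lemma hat_sphere_iff: "z \<in> hat_sphere p \<longleftrightarrow> (\<exists>k<p. \<exists>x. norm x = 1 \<and> z = rot p k *s cvec x)"
  unfolding hat_sphere_def UN_iff image_iff Bex_def lessThan_iff mem_sphere_0 by blast

lemma norm_hat_ball: "z \<in> hat_ball p \<Longrightarrow> norm z < 1"
  by (auto simp: hat_ball_iff norm_smult norm_cvec)

text \<open>
For polynomials of the same degree the factors from the rotations cancel. Hence the zonal polyharmonics
are determined by the real sphere alone.
\<close>
lemma hat_sphere_inner_eq:
  fixes q r :: "complex^'n::finite \<Rightarrow> complex"
  assumes p: "p \<ge> 1" and q: "homogeneous_polynomial m q" and r: "homogeneous_polynomial m r"
  shows "hat_sphere_inner p (restrict q (hat_sphere p)) (restrict r (hat_sphere p)) = sphere_inner q r"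
proof -
  let ?F = "\<lambda>\<zeta>. \<Sum>j<p. restrict q (hat_sphere p) (rot p j *s cvec \<zeta>) * cnj (restrict r (hat_sphere p) (rot p j *s cvec \<zeta>))"
  have F: "?F \<zeta> = of_nat p * (q (cvec \<zeta>) * star r (cvec \<zeta>))" if "norm \<zeta> = 1" for \<zeta>
  proof -
    have "restrict q (hat_sphere p) (rot p j *s cvec \<zeta>) * cnj (restrict r (hat_sphere p) (rot p j *s cvec \<zeta>))
        = q (cvec \<zeta>) * star r (cvec \<zeta>)" if "j < p" for j
    proof -
      have "rot p j *s cvec \<zeta> \<in> hat_sphere p" using that \<open>norm \<zeta> = 1\<close> by (auto simp: hat_sphere_iff)
      moreover have "rot p j * cnj (rot p j) = 1" by (simp add: cis_cnj cis_mult)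
      then have "rot p j ^ m * cnj (rot p j) ^ m = 1" by (metis power_mult_distrib power_one)
      ultimately show ?thesis
        by (simp add: homogeneousD[OF q] homogeneousD[OF r] mult_ac)
    qed
    then show ?thesis by simp
  qed
  have "(LINT \<zeta>:sphere 0 1|sphere_measure. ?F \<zeta>) = integral\<^sup>L sphere_measure (\<lambda>\<zeta>. of_nat p * (q (cvec \<zeta>) * star r (cvec \<zeta>)))"
    unfolding set_lebesgue_integral_def
  proof (rule integral_cong_AE)
    have m: "(\<lambda>\<zeta>. of_nat p * (q (cvec \<zeta>) * star r (cvec \<zeta>))) \<in> borel_measurable borel"
      by (intro borel_measurable_continuous_onI continuous_intros homogeneous_cvec_continuous[OF q] homogeneous_cvec_continuous[OF star_homogeneous[OF r]])
    then show "(\<lambda>\<zeta>. of_nat p * (q (cvec \<zeta>) * star r (cvec \<zeta>))) \<in> borel_measurable sphere_measure" by simp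
    have "(\<lambda>\<zeta>. indicator (sphere 0 1) \<zeta> *\<^sub>R ?F \<zeta>) = (\<lambda>\<zeta>. indicator (sphere 0 1) \<zeta> *\<^sub>R (of_nat p * (q (cvec \<zeta>) * star r (cvec \<zeta>))))"
      using F by (auto split: split_indicator)
    then show "(\<lambda>\<zeta>. indicator (sphere 0 1) \<zeta> *\<^sub>R ?F \<zeta>) \<in> borel_measurable sphere_measure"
    proof (simp only:)
      have "(\<lambda>\<zeta>. indicator (sphere 0 1) \<zeta> *\<^sub>R (of_nat p * (q (cvec \<zeta>) * star r (cvec \<zeta>)))) \<in> borel_measurable borel"
        by (intro borel_measurable_scaleR m borel_measurable_indicator) simp
      then show "(\<lambda>\<zeta>. indicator (sphere 0 1) \<zeta> *\<^sub>R (of_nat p * (q (cvec \<zeta>) * star r (cvec \<zeta>)))) \<in> borel_measurable sphere_measure"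
        by simp
    qed
    show "AE \<zeta> in sphere_measure. indicator (sphere 0 1) \<zeta> *\<^sub>R ?F \<zeta> = of_nat p * (q (cvec \<zeta>) * star r (cvec \<zeta>))"
      using AE_sphere_measure by eventually_elim (use F in simp)
  qed
  also have "\<dots> = of_nat p * sphere_inner q r"
    unfolding sphere_inner_def sphere_pair_def by (rule integral_mult_right_zero)
  finally show ?thesis using p by (simp add: hat_sphere_inner_def)
qed

text \<open>
Either the polynomials are already orthogonal on the real sphere, or the degrees differ by \<open>2(i - j)\<close> with
\<open>i, j < p\<close>. In the latter case the sum is a geometric one over a nontrivial \<open>p\<close>-th root of unity. This is where
the number of rotated balls and the order of polyharmonicity fit together.
\<close>
lemma rotation_average_orthogonal:
  fixes q r :: "complex^'n::finite \<Rightarrow> complex"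
  assumes q: "q \<in> polyharmonic_polys p l" and r: "r \<in> polyharmonic_polys p m" and lm: "l \<noteq> m"
  shows "(\<Sum>k<p. rot p k ^ l * cnj (rot p k) ^ m) * sphere_inner q r = 0"
proof (cases "\<exists>i j. i < p \<and> j < p \<and> m + 2 * i = l + 2 * j")
  case False
  have "sphere_inner q r = 0"
    by (rule sphere_inner_orthogonal[OF q r]) (use False in blast)
  then show ?thesis by simp
next
  case True
  then obtain i j where ij: "i < p" "j < p" "m + 2 * i = l + 2 * j" by blast
  let ?d = "real i - real j"
  have "real (m + 2 * i) = real (l + 2 * j)" using ij(3) by (rule arg_cong)
  then have lmd: "real l - real m = 2 * ?d" by simp
  define \<omega> where "\<omega> = cis (2 * ?d * pi / real p)"
  have "rot p k ^ l * cnj (rot p k) ^ m = \<omega> ^ k" for k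
  proof -
    have "rot p k ^ l * cnj (rot p k) ^ m = cis (real l * (real k * pi / real p) - real m * (real k * pi / real p))"
      by (simp add: cis_cnj Complex.DeMoivre cis_mult)
    also have "real l * (real k * pi / real p) - real m * (real k * pi / real p) = (real l - real m) * (real k * pi / real p)"
      by (simp only: left_diff_distrib)
    also have "\<dots> = real k * (2 * ?d * pi / real p)" unfolding lmd by simp
    also have "cis \<dots> = \<omega> ^ k" unfolding \<omega>_def by (rule Complex.DeMoivre[symmetric])
    finally show ?thesis .
  qed
  moreover have "\<omega> ^ p = 1"
  proof -
    have "\<omega> ^ p = cis (real p * (2 * ?d * pi / real p))" unfolding \<omega>_def by (rule Complex.DeMoivre)
    also have "real p * (2 * ?d * pi / real p) = 2 * pi * of_int (int i - int j)" using ij(1) by simp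
    also have "cis \<dots> = 1" by (rule cis_multiple_2pi) simp
    finally show ?thesis .
  qed
  moreover have "\<omega> \<noteq> 1"
  proof
    assume "\<omega> = 1"
    then have "cos (2 * ?d * pi / real p) = 1" unfolding \<omega>_def by (metis cis.sel(1) one_complex.sel(1))
    then obtain n :: int where "2 * ?d * pi / real p = of_int n * 2 * pi" using cos_one_2pi_int by metis
    then have "2 * ?d * pi = of_int n * 2 * pi * real p" using ij(1) by (simp add: divide_eq_eq)
    then have "(of_int n * real p) * (2 * pi) = ?d * (2 * pi)" by (simp add: mult_ac)
    then have "?d = of_int n * real p" using mult_right_cancel[of "2 * pi" "of_int n * real p" ?d] by simp
    then have "of_int (int i - int j) = (of_int (n * int p) :: real)" by simp
    then have n: "int i - int j = n * int p" using of_int_eq_iff by blast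
    have "n \<noteq> 0" using n ij(3) lm by auto
    then have "1 \<le> \<bar>n\<bar>" by linarith
    then have "1 * int p \<le> \<bar>n\<bar> * int p" by (rule mult_right_mono) simp
    then have "\<bar>n * int p\<bar> \<ge> int p" by (simp add: abs_mult)
    moreover have "\<bar>int i - int j\<bar> < int p" using ij by linarith
    ultimately show False using n by linarith
  qed
  ultimately have "(\<Sum>k<p. rot p k ^ l * cnj (rot p k) ^ m) = 0"
    by (simp add: geometric_sum)
  then show ?thesis by simp
qed

text \<open>
On each ray the difference of two expansions is a power series that vanishes.
\<close>
lemma expansion_unique:
  assumes q: "homogeneous_expansion u q" and q': "homogeneous_expansion u q'" and x: "x \<in> ball 0 1"
  shows "q m (cvec x) = q' m (cvec x)"
proof -
  have h: "homogeneous_polynomial m (q m)" "homogeneous_polynomial m (q' m)" for m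
    using q q' by (auto simp: homogeneous_expansion_def)
  have "q m (cvec x) - q' m (cvec x) = 0"
  proof (rule powser_zero[of 1 "\<lambda>m. q m (cvec x) - q' m (cvec x)"])
    fix t :: real assume t: "0 < t" "t < 1"
    have "norm (t *\<^sub>R x) < 1" using t x mult_le_one[of t "norm x"] mult_strict_mono[of t 1 "norm x" 1] by simp
    then have b: "t *\<^sub>R x \<in> ball 0 1" by simp
    have "(\<lambda>m. q m (cvec (t *\<^sub>R x)) - q' m (cvec (t *\<^sub>R x))) sums (u (t *\<^sub>R x) - u (t *\<^sub>R x))"
      using q q' b unfolding homogeneous_expansion_def by (intro sums_diff) auto
    then show "(\<lambda>m. (q m (cvec x) - q' m (cvec x)) * of_real t ^ m) sums 0"
      by (simp add: homogeneous_scaleR[OF h(1)] homogeneous_scaleR[OF h(2)] algebra_simps)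
  qed simp
  then show ?thesis by simp
qed

text \<open>
Every expansion and every representation of the point give the same terms, so the description in the
definition of \<open>rot_ext\<close> is unique. The series converges also at rotated points, as a power series that
converges on a longer ray.
\<close>
lemma rot_ext_sums:
  assumes q: "homogeneous_expansion u q" and x: "x \<in> ball 0 1"
  shows "(\<lambda>m. q m (cis \<psi> *s cvec x)) sums rot_ext u (cis \<psi> *s cvec x)"
proof -
  have h: "homogeneous_polynomial m (q m)" for m using q by (auto simp: homogeneous_expansion_def)
  let ?z = "cis \<psi> *s cvec x"
  have qz: "q m (cis \<phi> *s cvec y) = cis (real m * \<phi>) * q m (cvec y)"
    for m \<phi> y
    using homogeneousD[OF h] by (simp add: Complex.DeMoivre)
  obtain t where t: "t > 1" "t *\<^sub>R x \<in> ball 0 1"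
  proof (cases "x = 0")
    case False
    have "1 < 1 / norm x" using x False by simp
    then obtain t where "1 < t" "t < 1 / norm x" using dense by blast
    then show ?thesis using that[of t] False by (simp add: field_simps)
  qed (use that[of 2] in auto)
  have "summable (\<lambda>m. q m (cvec (t *\<^sub>R x)))" using q t(2) by (auto simp: homogeneous_expansion_def sums_iff)
  then have "summable (\<lambda>m. q m (cvec x) * of_real t ^ m)" by (simp add: homogeneous_scaleR[OF h] mult.commute)
  then have "summable (\<lambda>m. q m (cvec x) * cis \<psi> ^ m)" by (rule powser_inside) (use t in auto)
  then have sm: "summable (\<lambda>m. q m ?z)" using homogeneousD[OF h] by (simp add: mult.commute)
  have "rot_ext u ?z = suminf (\<lambda>m. q m ?z)"
    unfolding rot_ext_def
  proof (rule the_equality)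
    show "\<exists>q' \<phi> y. homogeneous_expansion u q' \<and> y \<in> ball 0 1 \<and> ?z = cis \<phi> *s cvec y \<and>
        (\<lambda>m. cis (real m * \<phi>) * q' m (cvec y)) sums (\<Sum>m. q m ?z)"
      using q x summable_sums[OF sm] qz by (intro exI[of _ q] exI[of _ \<psi>] exI[of _ x]) simp
  next
    fix w
    assume "\<exists>q' \<phi> y. homogeneous_expansion u q' \<and> y \<in> ball 0 1 \<and> ?z = cis \<phi> *s cvec y \<and>
        (\<lambda>m. cis (real m * \<phi>) * q' m (cvec y)) sums w"
    then obtain q' \<phi> y where *: "homogeneous_expansion u q'" "y \<in> ball 0 1" "?z = cis \<phi> *s cvec y"
        "(\<lambda>m. cis (real m * \<phi>) * q' m (cvec y)) sums w" by blast
    have "cis (real m * \<phi>) * q' m (cvec y) = q m ?z" for m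
      unfolding *(3) qz expansion_unique[OF q *(1,2)] ..
    then show "w = (\<Sum>m. q m ?z)" using *(4) by (simp add: sums_iff)
  qed
  then show ?thesis using sm by (simp add: sums_iff)
qed

lemma bergman_inner_cnj:
  "bergman_inner p \<alpha> \<beta> v u = cnj (bergman_inner p \<alpha> \<beta> u v)"
proof -
  have "cnj (LINT y:ball 0 1|lborel. u (rot p k *s cvec y) * cnj (v (rot p k *s cvec y)) * complex_of_real (bergman_weight \<alpha> \<beta> y))
     = (LINT y:ball 0 1|lborel. v (rot p k *s cvec y) * cnj (u (rot p k *s cvec y)) * complex_of_real (bergman_weight \<alpha> \<beta> y))" for k
    unfolding set_lebesgue_integral_def Bochner_Integration.integral_cnj[symmetric]
    by (intro Bochner_Integration.integral_cong) (auto simp: mult_ac)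
  then show ?thesis by (simp add: bergman_inner_def)
qed

lemma bergman_weight_integrable:
  assumes "real CARD('n::finite) + \<alpha> > 0" "\<beta> > -1"
  shows "set_integrable lborel (ball 0 1) (bergman_weight \<alpha> \<beta> :: real^'n \<Rightarrow> real)"
proof -
  have "set_integrable lborel (ball 0 1) (\<lambda>x::real^'n. (\<lambda>_. 1) x * complex_of_real (norm x powr \<alpha> * (1 - (norm x)\<^sup>2) powr \<beta>))"
    by (rule homogeneous_ball_integral(1)[where d = 0 and c = "(real CARD('n) + \<alpha> + real 0) / 2"]) (use assms in auto)
  then have "integrable lborel (\<lambda>x::real^'n. Re (indicator (ball 0 1) x *\<^sub>R complex_of_real (bergman_weight \<alpha> \<beta> x)))"
    unfolding set_integrable_def bergman_weight_def by (intro integrable_Re) simp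
  then show ?thesis by (simp add: set_integrable_def)
qed

lemma bergman_weight_measurable [measurable]: "bergman_weight \<alpha> \<beta> \<in> borel_measurable borel"
  unfolding bergman_weight_def[abs_def] by measurable

lemma bergman_weight_nonneg: "bergman_weight \<alpha> \<beta> y \<ge> 0"
  by (simp add: bergman_weight_def)

lemma bergman_coeff_pos:
  assumes "n + \<alpha> > 0" "\<beta> > -1"
  shows "bergman_coeff n \<alpha> \<beta> m > 0"
proof -
  have h: "(n + \<alpha>) / 2 > 0" and b: "\<beta> + 1 > 0" using assms by auto
  have a: "real m + (n + \<alpha>) / 2 > 0" using h by (rule add_nonneg_pos[OF of_nat_0_le_iff])
  have "real m + (n + \<alpha>) / 2 + \<beta> + 1 > 0" using add_pos_pos[OF a b] by (simp add: add.assoc)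
  then show ?thesis using a b unfolding bergman_coeff_def by (intro divide_pos_pos mult_pos_pos Gamma_real_pos) simp_all
qed

lemma bergman_coeff_beta:
  "Beta (real m + (n + \<alpha>) / 2) (\<beta> + 1) = 2 / bergman_coeff n \<alpha> \<beta> m"
  by (simp add: Beta_def bergman_coeff_def add.assoc mult.commute)

text \<open>
The functional equation of the Gamma function turns the ratio into a quotient that tends to \<open>1\<close>, which makes the
ratio test applicable to the kernel series.
\<close>
lemma bergman_coeff_ratio:
  assumes "n + \<alpha> > 0" "\<beta> > -1"
  shows "bergman_coeff n \<alpha> \<beta> (Suc m) / bergman_coeff n \<alpha> \<beta> m = (real m + ((n + \<alpha>) / 2 + \<beta> + 1)) / (real m + (n + \<alpha>) / 2)"
proof -
  let ?a = "real m + (n + \<alpha>) / 2" and ?b = "real m + (n + \<alpha>) / 2 + \<beta> + 1"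
  have h: "(n + \<alpha>) / 2 > 0" and b: "\<beta> + 1 > 0" using assms by auto
  have a: "?a > 0" using h by (rule add_nonneg_pos[OF of_nat_0_le_iff])
  have "?b > 0" using add_pos_pos[OF a b] by (simp add: add.assoc)
  then have pos: "?a > 0" "\<beta> + 1 > 0" "?b > 0" using a b by auto
  have G: "Gamma (?a + 1) = ?a * Gamma ?a" "Gamma (?b + 1) = ?b * Gamma ?b"
  proof -
    have "Gamma (x + 1) = x * Gamma x" if "x > 0" for x :: real
      using that by (intro Gamma_plus1) (auto dest: nonpos_Ints_nonpos)
    from this[OF pos(1)] this[OF pos(3)]
    show "Gamma (?a + 1) = ?a * Gamma ?a" "Gamma (?b + 1) = ?b * Gamma ?b" .
  qed
  have e: "real (Suc m) + (n + \<alpha>) / 2 + \<beta> + 1 = ?b + 1" "real (Suc m) + (n + \<alpha>) / 2 = ?a + 1" by simp_all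
  have "Gamma ?a > 0" "Gamma ?b > 0" "Gamma (\<beta> + 1) > 0" using pos by (auto intro: Gamma_real_pos)
  moreover have c1: "bergman_coeff n \<alpha> \<beta> (Suc m) = 2 * Gamma (?b + 1) / (Gamma (\<beta> + 1) * Gamma (?a + 1))"
    unfolding bergman_coeff_def by (subst e(1), subst e(2)) (rule refl)
  moreover have c0: "bergman_coeff n \<alpha> \<beta> m = 2 * Gamma ?b / (Gamma (\<beta> + 1) * Gamma ?a)"
    unfolding bergman_coeff_def ..
  moreover have e3: "real m + ((n + \<alpha>) / 2 + \<beta> + 1) = ?b" by simp
  moreover have "x > 0 \<Longrightarrow> y > 0 \<Longrightarrow> z > 0 \<Longrightarrow> (2 * (b * y) / (z * (a * x))) / (2 * y / (z * x)) = b / a" for x y z a b :: real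
    by (simp add: field_simps)
  ultimately show ?thesis unfolding c1 c0 G e3 by simp
qed

lemma bergman_series_summable:
  assumes "n + \<alpha> > 0" "\<beta> > -1" and x: "0 < x" "x < 1" and A: "A > 0"
  shows "summable (\<lambda>m. bergman_coeff n \<alpha> \<beta> m * (A * (real m + 1) ^ N) * x ^ m)"
proof (rule summable_of_ratio_limit[OF _ _ x(2)])
  note pos = bergman_coeff_pos[OF assms(1,2)]
  show "bergman_coeff n \<alpha> \<beta> m * (A * (real m + 1) ^ N) * x ^ m > 0" for m
    using pos[of m] A x by (intro mult_pos_pos) auto
  have "(\<lambda>m. (real m + ((n + \<alpha>) / 2 + \<beta> + 1)) / (real m + (n + \<alpha>) / 2) * ((real m + 2) / (real m + 1)) ^ N * x) \<longlonglongrightarrow> 1 * 1 ^ N * x"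
    by (intro tendsto_intros shifted_ratio_limit)
  moreover have "(real m + ((n + \<alpha>) / 2 + \<beta> + 1)) / (real m + (n + \<alpha>) / 2) * ((real m + 2) / (real m + 1)) ^ N * x
     = bergman_coeff n \<alpha> \<beta> (Suc m) * (A * (real (Suc m) + 1) ^ N) * x ^ Suc m / (bergman_coeff n \<alpha> \<beta> m * (A * (real m + 1) ^ N) * x ^ m)" for m
  proof -
    have e: "real (Suc m) + 1 = real m + 2" by simp
    have "c1 / c0 * (b1 / b0) ^ N * x = c1 * (A * b1 ^ N) * x ^ Suc m / (c0 * (A * b0 ^ N) * x ^ m)"
      if "c0 > 0" "b0 > 0" for c1 c0 b1 b0 :: real
      using that A x by (simp add: power_divide)
    from this[of "bergman_coeff n \<alpha> \<beta> m" "real m + 1" "bergman_coeff n \<alpha> \<beta> (Suc m)" "real m + 2"]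
    show ?thesis unfolding bergman_coeff_ratio[OF assms(1,2)] e using pos[of m] by simp
  qed
  ultimately show "(\<lambda>m. bergman_coeff n \<alpha> \<beta> (Suc m) * (A * (real (Suc m) + 1) ^ N) * x ^ Suc m / (bergman_coeff n \<alpha> \<beta> m * (A * (real m + 1) ^ N) * x ^ m)) \<longlonglongrightarrow> x"
    by simp
qed

lemma expansion_measurable:
  fixes u :: "real^'n::finite \<Rightarrow> complex"
  assumes q: "homogeneous_expansion u q"
  shows "(\<lambda>y. indicator (ball 0 1) y *\<^sub>R rot_ext u (cis \<psi> *s cvec y)) \<in> borel_measurable borel"
proof (rule borel_measurable_LIMSEQ_metric)
  have h: "homogeneous_polynomial m (q m)" for m using q by (auto simp: homogeneous_expansion_def)
  have e: "q m (cis \<psi> *s cvec y) = cis \<psi> ^ m * q m (cvec y)" for m y by (rule homogeneousD[OF h])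
  have [measurable]: "(\<lambda>y. q m (cvec y)) \<in> borel_measurable borel" for m
    by (rule borel_measurable_continuous_onI[OF homogeneous_cvec_continuous[OF h]])
  show "(\<lambda>y. indicator (ball 0 1) y *\<^sub>R (\<Sum>m<M. q m (cis \<psi> *s cvec y))) \<in> borel_measurable borel" for M
    unfolding e by measurable
  show "(\<lambda>M. indicator (ball 0 1) y *\<^sub>R (\<Sum>m<M. q m (cis \<psi> *s cvec y))) \<longlonglongrightarrow> indicator (ball 0 1) y *\<^sub>R rot_ext u (cis \<psi> *s cvec y)" for y
    using rot_ext_sums[OF q, of y \<psi>] by (auto simp: sums_def split: split_indicator)
qed

section \<open>The zonal polyharmonics and the Bergman kernel\<close>

lemma borel_measurable_cnj [measurable (raw)]:
  "f \<in> borel_measurable M \<Longrightarrow> (\<lambda>x. cnj (f x)) \<in> borel_measurable M"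
  by (rule measurable_compose[OF _ borel_measurable_continuous_onI[OF continuous_on_cnj[OF continuous_on_id]]])

text \<open>
The properties provided by \<open>zonal_kernel_exists\<close>, for all degrees at once.
\<close>
locale zonal_kernels =
  fixes p :: nat and K :: "nat \<Rightarrow> complex^'n::finite \<Rightarrow> complex^'n \<Rightarrow> complex" and A :: real and N :: nat
  assumes p: "p \<ge> 1" and A: "A > 0"
    and K_poly: "\<And>m w. (\<lambda>z. K m z w) \<in> polyharmonic_polys p m"
    and K_cnj: "\<And>m z w. K m z w = cnj (K m w z)"
    and K_repr: "\<And>m q c x. q \<in> polyharmonic_polys p m \<Longrightarrow> q (c *s cvec x) = sphere_inner q (\<lambda>z. K m z (c *s cvec x))"
    and K_bound: "\<And>m x y. norm x = 1 \<Longrightarrow> norm y = 1 \<Longrightarrow> cmod (K m (cvec x) (cvec y)) \<le> A * (real m + 1) ^ N"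
begin

lemma K_hom: "homogeneous_polynomial m (\<lambda>z. K m z w)"
  using K_poly by (simp add: polyharmonic_polys_def)

lemma K_scale_left: "K m (a *s z) w = a ^ m * K m z w"
  using homogeneousD[OF K_hom[of m w], of a z] .

lemma K_scale_right: "K m z (a *s w) = cnj a ^ m * K m z w"
  by (metis K_cnj K_scale_left complex_cnj_mult complex_cnj_power)

text \<open>
Two representing elements agree: \<open>g z\<close> is obtained by pairing \<open>g\<close> with the kernel at \<open>z\<close>, and pairing the kernel at \<open>z\<close>
with \<open>g\<close> evaluates the kernel at \<open>\<eta>\<close>.
\<close>
lemma zonal_sphere_eq:
  assumes \<zeta>: "\<zeta> \<in> hat_sphere p" and \<eta>: "\<eta> \<in> hat_sphere p"
  shows "zonal_sphere p m \<zeta> \<eta> = K m \<zeta> \<eta>"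
proof -
  let ?R = "\<lambda>q. restrict q (hat_sphere p) :: complex^'n \<Rightarrow> complex"
  have repr: "q w = sphere_inner q (\<lambda>z. K m z w)" if "q \<in> polyharmonic_polys p m" "w \<in> hat_sphere p" for q w
    using K_repr[OF that(1)] that(2) by (auto simp: hat_sphere_iff)
  have ip: "hat_sphere_inner p (?R q) (?R r) = sphere_inner q r"
    if "q \<in> polyharmonic_polys p m" "r \<in> polyharmonic_polys p m" for q r
    using hat_sphere_inner_eq[OF p, of m q r] that by (simp add: polyharmonic_polys_def)
  have "(THE f. f \<in> spherical_polyharmonics p m \<and>
        (\<forall>q\<in>spherical_polyharmonics p m. q \<eta> = hat_sphere_inner p q f)) = ?R (\<lambda>z. K m z \<eta>)"
  proof (rule the_equality)
    show "?R (\<lambda>z. K m z \<eta>) \<in> spherical_polyharmonics p m \<and>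
        (\<forall>q\<in>spherical_polyharmonics p m. q \<eta> = hat_sphere_inner p q (?R (\<lambda>z. K m z \<eta>)))"
      using K_poly repr[OF _ \<eta>] \<eta> ip[OF _ K_poly] by (auto simp: spherical_polyharmonics_def)
  next
    fix f assume f: "f \<in> spherical_polyharmonics p m \<and> (\<forall>q\<in>spherical_polyharmonics p m. q \<eta> = hat_sphere_inner p q f)"
    then obtain g where g: "g \<in> polyharmonic_polys p m" "f = ?R g" by (auto simp: spherical_polyharmonics_def)
    show "f = ?R (\<lambda>z. K m z \<eta>)"
    proof
      fix z
      show "f z = ?R (\<lambda>z. K m z \<eta>) z"
      proof (cases "z \<in> hat_sphere p")
        case True
        have "?R (\<lambda>w. K m w z) \<in> spherical_polyharmonics p m"
          using K_poly by (auto simp: spherical_polyharmonics_def)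
        then have "?R (\<lambda>w. K m w z) \<eta> = hat_sphere_inner p (?R (\<lambda>w. K m w z)) (?R g)" using f g(2) by blast
        then have "K m \<eta> z = sphere_inner (\<lambda>w. K m w z) g" using ip[OF K_poly g(1)] \<eta> by simp
        also have "\<dots> = cnj (sphere_inner g (\<lambda>w. K m w z))" by (rule sphere_inner_cnj)
        also have "\<dots> = cnj (g z)" using repr[OF g(1) True] by simp
        finally have "g z = K m z \<eta>" using K_cnj[of m z \<eta>] by simp
        then show ?thesis using True g(2) by simp
      qed (use g in simp)
    qed
  qed
  then show ?thesis unfolding zonal_sphere_def using \<zeta> by simp
qed

lemma hat_ball_polar:
  fixes z :: "complex^'n"
  assumes "z \<in> hat_ball p"
  obtains r \<zeta> where "r \<in> {0..<1::real}" "\<zeta> \<in> hat_sphere p" "z = r *\<^sub>R \<zeta>"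
proof -
  obtain k and x :: "real^'n" where k: "k < p" "norm x < 1" "z = rot p k *s cvec x" using assms by (auto simp: hat_ball_iff)
  obtain u :: "real^'n" where u: "norm u = 1" "x = norm x *\<^sub>R u"
  proof (cases "x = 0")
    case True
    then show ?thesis using ex_unit_vector[where 'n = 'n] that by auto
  next
    case False
    then show ?thesis using that[of "x /\<^sub>R norm x"] by auto
  qed
  have "z = norm x *\<^sub>R (rot p k *s cvec u)"
    unfolding k(3) by (subst u(2)) (simp add: cvec_def vec_eq_iff scaleR_conv_of_real[where 'a = complex])
  then show ?thesis using that[of "norm x" "rot p k *s cvec u"] k u by (auto simp: hat_sphere_iff)
qed

text \<open>
The polynomials \<open>K m\<close> are homogeneous in both arguments, as prescribed for the zonal polyharmonics. Therefore all
polar representations of \<open>x\<close> and \<open>y\<close> yield the same value, also at the origin.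
\<close>
lemma zonal_eq:
  assumes x: "x \<in> hat_ball p" and y: "y \<in> hat_ball p"
  shows "zonal p m x y = K m x y"
proof -
  have sc: "K m (r *\<^sub>R \<zeta>) (s *\<^sub>R \<eta>) = complex_of_real (r ^ m * s ^ m) * K m \<zeta> \<eta>" for r s \<zeta> \<eta>
  proof -
    have "r *\<^sub>R \<zeta> = complex_of_real r *s \<zeta>" "s *\<^sub>R \<eta> = complex_of_real s *s \<eta>"
      by (simp_all add: vec_eq_iff scaleR_conv_of_real[where 'a = complex])
    then show ?thesis by (simp only: K_scale_left K_scale_right) simp
  qed
  obtain r \<zeta> where r: "r \<in> {0..<1::real}" "\<zeta> \<in> hat_sphere p" "x = r *\<^sub>R \<zeta>" using hat_ball_polar[OF x] .
  obtain s \<eta> where s: "s \<in> {0..<1::real}" "\<eta> \<in> hat_sphere p" "y = s *\<^sub>R \<eta>" using hat_ball_polar[OF y] .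
  show ?thesis unfolding zonal_def
  proof (rule the_equality)
    show "\<exists>r\<in>{0..<1}. \<exists>s\<in>{0..<1}. \<exists>\<zeta>\<in>hat_sphere p. \<exists>\<eta>\<in>hat_sphere p. x = r *\<^sub>R \<zeta> \<and> y = s *\<^sub>R \<eta> \<and>
        K m x y = complex_of_real (r ^ m * s ^ m) * zonal_sphere p m \<zeta> \<eta>"
    proof (intro bexI conjI)
      show "K m x y = complex_of_real (r ^ m * s ^ m) * zonal_sphere p m \<zeta> \<eta>"
        unfolding zonal_sphere_eq[OF r(2) s(2)] r(3) s(3) by (rule sc)
    qed (fact r s)+
  next
    fix w
    assume "\<exists>r\<in>{0..<1}. \<exists>s\<in>{0..<1}. \<exists>\<zeta>\<in>hat_sphere p. \<exists>\<eta>\<in>hat_sphere p. x = r *\<^sub>R \<zeta> \<and> y = s *\<^sub>R \<eta> \<and>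
        w = complex_of_real (r ^ m * s ^ m) * zonal_sphere p m \<zeta> \<eta>"
    then obtain r s \<zeta> \<eta> where h: "\<zeta> \<in> hat_sphere p" "\<eta> \<in> hat_sphere p" "x = r *\<^sub>R \<zeta>" "y = s *\<^sub>R \<eta>"
        "w = complex_of_real (r ^ m * s ^ m) * zonal_sphere p m \<zeta> \<eta>" by blast
    show "w = K m x y" unfolding h(5) zonal_sphere_eq[OF h(1,2)] unfolding h(3,4) by (rule sc[symmetric])
  qed
qed

lemma K_bound_cvec: "cmod (K m (cvec x) (cvec y)) \<le> A * (real m + 1) ^ N * norm x ^ m * norm y ^ m"
proof -
  have 1: "cmod (K m (cvec x) (cvec y)) \<le> A * (real m + 1) ^ N * norm x ^ m" if "norm y = 1" for x y
    by (rule homogeneous_norm_le[OF K_hom]) (rule K_bound[OF _ that])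
  have "cmod (K m (cvec y) (cvec x)) \<le> A * (real m + 1) ^ N * norm x ^ m * norm y ^ m"
  proof (rule homogeneous_norm_le[OF K_hom])
    fix z :: "real^'n" assume "norm z = 1"
    from 1[OF this, of x] show "cmod (K m (cvec z) (cvec x)) \<le> A * (real m + 1) ^ N * norm x ^ m"
      using K_cnj[of m "cvec z" "cvec x"] by simp
  qed
  then show ?thesis using K_cnj[of m "cvec x" "cvec y"] by simp
qed

lemma K_bound_hat:
  assumes "z \<in> hat_ball p" "w \<in> hat_ball p"
  shows "cmod (K m z w) \<le> A * (real m + 1) ^ N * norm z ^ m * norm w ^ m"
proof -
  obtain k and x :: "real^'n" where k: "z = rot p k *s cvec x" using assms(1) by (auto simp: hat_ball_iff)
  obtain l and y :: "real^'n" where l: "w = rot p l *s cvec y" using assms(2) by (auto simp: hat_ball_iff)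
  have "cmod (K m z w) = cmod (K m (cvec x) (cvec y))"
    unfolding k l K_scale_left K_scale_right by (simp add: norm_mult norm_power)
  then show ?thesis using K_bound_cvec[of m x y] by (simp add: k l norm_smult norm_cvec)
qed

end

text \<open>
The abbreviating parameters \<open>area\<close>, the surface area of the sphere, and \<open>coef\<close>, the coefficients of the
kernel series, are determined by the last two assumptions.
\<close>
locale bergman_kernels = zonal_kernels p K A N
  for p and K :: "nat \<Rightarrow> complex^'n::finite \<Rightarrow> complex^'n \<Rightarrow> complex" and A N +
  fixes \<alpha> \<beta> area :: real and coef :: "nat \<Rightarrow> real"
  assumes \<alpha>: "real CARD('n) + \<alpha> > 0" and \<beta>: "\<beta> > -1"
    and coef: "coef = bergman_coeff (real CARD('n)) \<alpha> \<beta>"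
    and area: "area = real CARD('n) * unit_ball_vol (real CARD('n))"
begin

lemma area_pos: "area > 0"
proof -
  have "unit_ball_vol (real CARD('n)) > 0" by (rule unit_ball_vol_pos) simp
  then show ?thesis unfolding area by (intro mult_pos_pos) auto
qed

lemma coef_pos: "coef m > 0" unfolding coef by (rule bergman_coeff_pos[OF \<alpha> \<beta>])

definition kernel_term :: "complex^'n \<Rightarrow> nat \<Rightarrow> complex^'n \<Rightarrow> complex" where
  "kernel_term x m y = complex_of_real (coef m / area) * K m y x"

definition term_bound :: "real \<Rightarrow> nat \<Rightarrow> real" where
  "term_bound \<rho> m = coef m * (A * (real m + 1) ^ N) * \<rho> ^ m"

lemma term_bound_summable: "0 < \<rho> \<Longrightarrow> \<rho> < 1 \<Longrightarrow> summable (term_bound \<rho>)"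
  unfolding term_bound_def[abs_def] unfolding coef by (rule bergman_series_summable[OF \<alpha> \<beta> _ _ A])

lemma term_bound_nonneg: "0 < \<rho> \<Longrightarrow> 0 \<le> term_bound \<rho> m"
  unfolding term_bound_def using coef_pos[of m] A by (intro mult_nonneg_nonneg) auto

lemma coef_K_bound:
  assumes x: "norm x \<le> \<rho>" and y: "cmod (K m y x) \<le> A * (real m + 1) ^ N * norm x ^ m"
  shows "cmod (complex_of_real (coef m) * K m y x) \<le> term_bound \<rho> m"
proof -
  have "cmod (complex_of_real (coef m) * K m y x) = coef m * cmod (K m y x)" using coef_pos[of m] by (simp add: norm_mult)
  also have "\<dots> \<le> coef m * (A * (real m + 1) ^ N * \<rho> ^ m)"
  proof (rule mult_left_mono)
    have "norm x ^ m \<le> \<rho> ^ m" using x by (intro power_mono) auto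
    then have "A * (real m + 1) ^ N * norm x ^ m \<le> A * (real m + 1) ^ N * \<rho> ^ m" using A by (intro mult_left_mono) auto
    then show "cmod (K m y x) \<le> A * (real m + 1) ^ N * \<rho> ^ m" using y by linarith
  qed (use coef_pos[of m] in auto)
  finally show ?thesis by (simp add: term_bound_def mult_ac)
qed

lemma kernel_term_poly: "kernel_term x m \<in> polyharmonic_polys p m"
  unfolding kernel_term_def[abs_def] by (rule polyharmonic_polys_scale[OF K_poly])

lemma kernel_term_sphere_bound:
  assumes x: "x \<in> hat_ball p" "norm x \<le> \<rho>" and y: "norm y = 1"
  shows "cmod (kernel_term x m (cvec y)) \<le> term_bound \<rho> m / area"
proof -
  obtain k and x' :: "real^'n" where k: "x = rot p k *s cvec x'" using x(1) by (auto simp: hat_ball_iff)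
  have "cmod (K m (cvec y) x) \<le> A * (real m + 1) ^ N * norm x ^ m"
    using K_bound_cvec[of m y x'] y unfolding k K_scale_right by (simp add: norm_mult norm_power norm_smult norm_cvec)
  then have "cmod (complex_of_real (coef m) * K m (cvec y) x) \<le> term_bound \<rho> m" by (rule coef_K_bound[OF x(2)])
  moreover have "kernel_term x m (cvec y) = (complex_of_real (coef m) * K m (cvec y) x) / complex_of_real area"
    by (simp add: kernel_term_def)
  ultimately show ?thesis using area_pos by (simp add: norm_divide divide_right_mono del: of_real_mult)
qed

definition kernel_sum :: "complex^'n \<Rightarrow> real^'n \<Rightarrow> complex" where
  "kernel_sum x y = (\<Sum>m. kernel_term x m (cvec y))"

lemma ex_radius:
  assumes "x \<in> hat_ball p" obtains \<rho> where "0 < \<rho>" "\<rho> < 1" "norm x \<le> \<rho>"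
proof -
  obtain \<rho> where "norm x < \<rho>" "\<rho> < 1" using dense norm_hat_ball[OF assms] by blast
  then show ?thesis using that[of \<rho>] norm_ge_zero[of x] by (meson le_less_trans less_imp_le)
qed

text \<open>
As \<open>|x| \<le> \<rho> < 1\<close>, the terms are bounded by a geometric sequence of ratio \<open>\<rho>\<close>, which leaves room for a factor
\<open>\<tau> ^ m\<close> with some \<open>\<tau> > 1\<close>.
\<close>
lemma kernel_sum_polyharmonic:
  assumes x: "x \<in> hat_ball p"
  shows "kernel_sum x \<in> polyharmonic_ball p" and "homogeneous_expansion (kernel_sum x) (kernel_term x)"
proof -
  obtain \<rho> where \<rho>: "0 < \<rho>" "\<rho> < 1" "norm x \<le> \<rho>" using ex_radius[OF x] .
  define \<tau> where "\<tau> = (1 + 1 / \<rho>) / 2"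
  have "1 / \<rho> > 1" using \<rho> by simp
  then have \<tau>: "\<tau> > 1" by (simp add: \<tau>_def)
  have \<rho>\<tau>_eq: "\<rho> * \<tau> = (\<rho> + 1) / 2" using \<rho> by (simp add: \<tau>_def field_simps)
  have \<rho>\<tau>: "0 < \<rho> * \<tau>" "\<rho> * \<tau> < 1" using \<rho> \<tau> \<rho>\<tau>_eq by auto
  have kb: "term_bound \<rho> m / area * \<tau> ^ m = term_bound (\<rho> * \<tau>) m / area" for m
    by (simp add: term_bound_def power_mult_distrib)
  have s: "summable (\<lambda>m. term_bound \<rho> m / area * \<tau> ^ m)"
    unfolding kb by (rule summable_divide[OF term_bound_summable[OF \<rho>\<tau>]])
  show "kernel_sum x \<in> polyharmonic_ball p" "homogeneous_expansion (kernel_sum x) (kernel_term x)"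
    using series_polyharmonic[OF kernel_term_poly kernel_term_sphere_bound[OF x \<rho>(3)] \<tau> s] by (simp_all add: kernel_sum_def[abs_def])
qed

lemma kernel_sum_sums:
  assumes x: "x \<in> hat_ball p" and y: "y \<in> ball 0 1"
  shows "(\<lambda>m. kernel_term x m (cis \<psi> *s cvec y)) sums rot_ext (kernel_sum x) (cis \<psi> *s cvec y)"
  by (rule rot_ext_sums[OF kernel_sum_polyharmonic(2)[OF x] y])

lemma kernel_term_bound:
  assumes x: "x \<in> hat_ball p" "norm x \<le> \<rho>" "0 < \<rho>" and y: "norm y \<le> 1"
  shows "cmod (kernel_term x m (cis \<psi> *s cvec y)) \<le> term_bound \<rho> m / area"
proof -
  note h = polyharmonic_polys_homogeneous[OF kernel_term_poly[of x m]]
  have "cmod (kernel_term x m (cis \<psi> *s cvec y)) = cmod (kernel_term x m (cvec y))"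
    using homogeneousD[OF h] by (simp add: norm_mult norm_power)
  also have "\<dots> \<le> term_bound \<rho> m / area * norm y ^ m"
    by (rule homogeneous_norm_le[OF h]) (rule kernel_term_sphere_bound[OF x(1,2)])
  also have "\<dots> \<le> term_bound \<rho> m / area * 1"
    using y term_bound_nonneg[OF x(3), of m] area_pos by (intro mult_left_mono power_le_one divide_nonneg_nonneg) auto
  finally show ?thesis by simp
qed

lemma kernel_sum_bound:
  assumes x: "x \<in> hat_ball p"
  obtains T where "\<And>\<psi> y. y \<in> ball 0 1 \<Longrightarrow> cmod (rot_ext (kernel_sum x) (cis \<psi> *s cvec y)) \<le> T"
proof -
  obtain \<rho> where \<rho>: "0 < \<rho>" "\<rho> < 1" "norm x \<le> \<rho>" using ex_radius[OF x] .
  have s: "summable (\<lambda>m. term_bound \<rho> m / area)" by (intro summable_divide term_bound_summable \<rho>)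
  show ?thesis
  proof (rule that[of "\<Sum>m. term_bound \<rho> m / area"])
    fix \<psi> and y :: "real^'n" assume y: "y \<in> ball 0 1"
    have b: "cmod (kernel_term x m (cis \<psi> *s cvec y)) \<le> term_bound \<rho> m / area" for m
      by (rule kernel_term_bound[OF x \<rho>(3,1)]) (use y in simp)
    have "rot_ext (kernel_sum x) (cis \<psi> *s cvec y) = (\<Sum>m. kernel_term x m (cis \<psi> *s cvec y))"
      using kernel_sum_sums[OF x y, of \<psi>] by (simp add: sums_iff)
    then show "cmod (rot_ext (kernel_sum x) (cis \<psi> *s cvec y)) \<le> (\<Sum>m. term_bound \<rho> m / area)"
      using norm_suminf_le[OF b s] by simp
  qed
qed

text \<open>
The candidate for the Bergman kernel at \<open>x\<close>, restricted in the same way as the elements of the Bergman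
space.
\<close>
definition kernel_elem :: "complex^'n \<Rightarrow> complex^'n \<Rightarrow> complex" where
  "kernel_elem x = restrict (rot_ext (kernel_sum x)) (hat_ball p)"

lemma rot_in_hat_ball: "k < p \<Longrightarrow> y \<in> ball 0 1 \<Longrightarrow> rot p k *s cvec y \<in> hat_ball p"
  by (auto simp: hat_ball_iff)

text \<open>
The kernel sum is bounded, and the weight is integrable exactly because \<open>n + \<alpha> > 0\<close> and \<open>\<beta> > -1\<close>.
\<close>
lemma kernel_elem_in_space:
  assumes x: "x \<in> hat_ball p"
  shows "kernel_elem x \<in> bergman_space p \<alpha> \<beta>"
proof -
  obtain T where T: "\<And>\<psi> y. y \<in> ball 0 1 \<Longrightarrow> cmod (rot_ext (kernel_sum x) (cis \<psi> *s cvec y)) \<le> T"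
    using kernel_sum_bound[OF x] by blast
  have "set_integrable lborel (ball 0 1)
       (\<lambda>y. (cmod (rot_ext (kernel_sum x) (rot p k *s cvec y)))\<^sup>2 * bergman_weight \<alpha> \<beta> y)" for k
  proof -
    let ?f = "\<lambda>y. indicator (ball 0 1) y *\<^sub>R rot_ext (kernel_sum x) (rot p k *s cvec y)"
    have [measurable]: "?f \<in> borel_measurable borel" by (rule expansion_measurable[OF kernel_sum_polyharmonic(2)[OF x]])
    have eq: "indicator (ball 0 1) y *\<^sub>R ((cmod (rot_ext (kernel_sum x) (rot p k *s cvec y)))\<^sup>2 * bergman_weight \<alpha> \<beta> y)
      = (cmod (?f y))\<^sup>2 * bergman_weight \<alpha> \<beta> y" for y by (simp split: split_indicator)
    show ?thesis unfolding set_integrable_def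
    proof (rule Bochner_Integration.integrable_bound)
      show "integrable lborel (\<lambda>y::real^'n. T\<^sup>2 * (indicator (ball 0 1) y *\<^sub>R bergman_weight \<alpha> \<beta> y))"
        using bergman_weight_integrable[OF \<alpha> \<beta>] unfolding set_integrable_def by (intro integrable_mult_right)
      show "(\<lambda>y. indicator (ball 0 1) y *\<^sub>R ((cmod (rot_ext (kernel_sum x) (rot p k *s cvec y)))\<^sup>2 * bergman_weight \<alpha> \<beta> y)) \<in> borel_measurable lborel"
        unfolding eq by measurable
      show "AE y in lborel. norm (indicator (ball 0 1) y *\<^sub>R ((cmod (rot_ext (kernel_sum x) (rot p k *s cvec y)))\<^sup>2 * bergman_weight \<alpha> \<beta> y))
          \<le> norm (T\<^sup>2 * (indicator (ball 0 1) y *\<^sub>R bergman_weight \<alpha> \<beta> y))"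
      proof (rule AE_I2)
        fix y :: "real^'n"
        show "norm (indicator (ball 0 1) y *\<^sub>R ((cmod (rot_ext (kernel_sum x) (rot p k *s cvec y)))\<^sup>2 * bergman_weight \<alpha> \<beta> y))
          \<le> norm (T\<^sup>2 * (indicator (ball 0 1) y *\<^sub>R bergman_weight \<alpha> \<beta> y))"
        proof (cases "y \<in> ball 0 1")
          case True
          have "(cmod (rot_ext (kernel_sum x) (rot p k *s cvec y)))\<^sup>2 \<le> T\<^sup>2" by (rule power_mono[OF T[OF True]]) simp
          then show ?thesis using True bergman_weight_nonneg[of \<alpha> \<beta> y] by (simp add: abs_mult mult_right_mono)
        qed simp
      qed
    qed
  qed
  then show ?thesis unfolding bergman_space_def kernel_elem_def using kernel_sum_polyharmonic(1)[OF x] by blast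
qed

text \<open>
The integral is computed by spheres. For a fixed radius \<open>\<surd>s < 1\<close> the expansion of \<open>V\<close> converges uniformly on the sphere and only
its term of degree \<open>m\<close> survives. Integrability of \<open>V\<close> justifies the passage to polar coordinates. What remains is the Beta integral, whose reciprocal is built
into \<open>kernel_term\<close>.
\<close>
lemma inner_kernel_term:
  fixes q :: "nat \<Rightarrow> complex^'n \<Rightarrow> complex" and V :: "nat \<Rightarrow> real^'n \<Rightarrow> complex"
  assumes q: "\<And>l. q l \<in> polyharmonic_polys p l"
    and qb: "\<And>r. 0 < r \<Longrightarrow> r < 1 \<Longrightarrow> \<exists>C. \<forall>l x. norm x = 1 \<longrightarrow> cmod (q l (cvec x)) * r ^ l \<le> C"
    and V: "\<And>k y. y \<in> ball 0 1 \<Longrightarrow> (\<lambda>l. q l (rot p k *s cvec y)) sums V k y"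
    and Vm: "\<And>k. (\<lambda>y. indicator (ball 0 1) y *\<^sub>R V k y) \<in> borel_measurable borel"
    and Vi: "\<And>k. k < p \<Longrightarrow> set_integrable lborel (ball 0 1) (\<lambda>y. cmod (V k y) * bergman_weight \<alpha> \<beta> y)"
    and x: "x \<in> hat_ball p"
  shows "(LINT y:ball 0 1|lborel. (\<Sum>k<p. V k y * cnj (kernel_term x m (rot p k *s cvec y))) * of_real (bergman_weight \<alpha> \<beta> y))
    = of_nat p * q m x"
proof -
  let ?n = "real CARD('n)"
  let ?w = "bergman_weight \<alpha> \<beta> :: real^'n \<Rightarrow> real"
  define f where "f = kernel_term x m"
  have fP: "f \<in> polyharmonic_polys p m" unfolding f_def by (rule kernel_term_poly)
  note hf = polyharmonic_polys_homogeneous[OF fP] and hq = polyharmonic_polys_homogeneous[OF q]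
  have fm[measurable]: "(\<lambda>y. f (cvec y)) \<in> borel_measurable borel"
    by (rule borel_measurable_continuous_onI[OF homogeneous_cvec_continuous[OF hf]])
  have qm[measurable]: "(\<lambda>y. q l (cvec y)) \<in> borel_measurable borel" for l
    by (rule borel_measurable_continuous_onI[OF homogeneous_cvec_continuous[OF hq]])
  have frot: "f (rot p k *s cvec y) = rot p k ^ m * f (cvec y)" for k y by (rule homogeneousD[OF hf])
  have qrot: "q l (rot p k *s cvec y) = rot p k ^ l * q l (cvec y)" for l k y by (rule homogeneousD[OF hq])
  obtain B where B: "\<And>y. norm y = 1 \<Longrightarrow> cmod (f (cvec y)) \<le> B" using sphere_max[OF hf] by metis
  have B0: "B \<ge> 0" using B by (rule sphere_bound_nonneg)
  have fB: "cmod (f (cvec y)) \<le> B" if "y \<in> ball 0 1" for y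
  proof -
    have "cmod (f (cvec y)) \<le> B * norm y ^ m" by (rule homogeneous_norm_le[OF hf B])
    also have "\<dots> \<le> B * 1" using that B0 by (intro mult_left_mono power_le_one) auto
    finally show ?thesis by simp
  qed
  define F where "F y = (\<Sum>k<p. (indicator (ball 0 1) y *\<^sub>R V k y) * cnj (f (rot p k *s cvec y))) * of_real (?w y)" for y
  have Fm[measurable]: "F \<in> borel_measurable borel"
  proof -
    show ?thesis unfolding F_def frot by (intro borel_measurable_times borel_measurable_sum Vm) measurable
  qed
  have FV: "F y = (\<Sum>k<p. V k y * cnj (f (rot p k *s cvec y))) * of_real (?w y)" if "y \<in> ball 0 1" for y
    using that by (simp add: F_def)
  have Fi: "set_integrable lborel (ball 0 1) F"
    unfolding set_integrable_def
  proof (rule Bochner_Integration.integrable_bound)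
    show "integrable lborel (\<lambda>y. \<Sum>k<p. B * (indicator (ball 0 1) y *\<^sub>R (cmod (V k y) * ?w y)))"
      using Vi unfolding set_integrable_def by (intro Bochner_Integration.integrable_sum integrable_mult_right) auto
    show "(\<lambda>y. indicator (ball 0 1) y *\<^sub>R F y) \<in> borel_measurable lborel" by measurable
    show "AE y in lborel. norm (indicator (ball 0 1) y *\<^sub>R F y) \<le> norm (\<Sum>k<p. B * (indicator (ball 0 1) y *\<^sub>R (cmod (V k y) * ?w y)))"
    proof (rule AE_I2)
      fix y :: "real^'n"
      show "norm (indicator (ball 0 1) y *\<^sub>R F y) \<le> norm (\<Sum>k<p. B * (indicator (ball 0 1) y *\<^sub>R (cmod (V k y) * ?w y)))"
      proof (cases "y \<in> ball 0 1")
        case True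
        note w0 = bergman_weight_nonneg[of \<alpha> \<beta> y]
        have "norm (F y) \<le> (\<Sum>k<p. cmod (V k y) * cmod (f (cvec y))) * ?w y"
          unfolding FV[OF True] norm_mult norm_of_real frot using w0
          by (simp add: mult_right_mono sum_norm_le norm_mult norm_power)
        also have "\<dots> \<le> (\<Sum>k<p. cmod (V k y) * B) * ?w y"
          using w0 fB[OF True] by (intro mult_right_mono sum_mono mult_left_mono) auto
        also have "\<dots> = (\<Sum>k<p. B * (cmod (V k y) * ?w y))" by (simp add: sum_distrib_right sum_distrib_left mult_ac)
        finally show ?thesis using True by simp
      qed simp
    qed
  qed
  have inner: "integral\<^sup>L sphere_measure (\<lambda>\<zeta>. F (sqrt s *\<^sub>R \<zeta>))
      = of_nat p * sphere_inner (q m) f * of_real (s powr (real m + \<alpha> / 2) * (1 - s) powr \<beta>)"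
    if s: "s \<in> {0<..<1}" for s
  proof -
    let ?t = "sqrt s"
    have t: "0 < ?t" "?t < 1" using s by auto
    have wt: "?w (?t *\<^sub>R \<zeta>) = s powr (\<alpha> / 2) * (1 - s) powr \<beta>" if "norm \<zeta> = 1" for \<zeta>
    proof -
      have n: "norm (?t *\<^sub>R \<zeta>) = ?t" using that t by simp
      have "?t powr \<alpha> = s powr (\<alpha> / 2)" using s by (simp add: powr_half_sqrt[symmetric] powr_powr)
      moreover have "?t\<^sup>2 = s" using s by simp
      ultimately show ?thesis unfolding bergman_weight_def n by simp
    qed
    let ?W = "s powr (\<alpha> / 2) * (1 - s) powr \<beta>"
    \<comment> \<open>the factor by which averaging over the rotations multiplies the pairing of the degrees \<open>l\<close> and \<open>m\<close>\<close>
    define c where "c l = (\<Sum>k<p. rot p k ^ l * cnj (rot p k) ^ m)" for l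
    \<comment> \<open>the bound on the \<open>q l\<close> at a radius \<open>r > \<surd>s\<close> gives a geometric majorant on the sphere of radius \<open>\<surd>s\<close>\<close>
    obtain r where r: "?t < r" "r < 1" using dense t by blast
    have r0: "r > 0" using r t by linarith
    obtain C where C: "\<And>l x. norm x = 1 \<Longrightarrow> cmod (q l (cvec x)) * r ^ l \<le> C" using qb[of r] r t by auto
    define G where "G l \<zeta> = (c l * of_real (?t ^ (l + m) * ?W)) * (q l (cvec \<zeta>) * star f (cvec \<zeta>))" for l \<zeta>
    have cb: "cmod (c l) \<le> real p" for l
      unfolding c_def by (rule order_trans[OF norm_sum]) (simp add: norm_mult norm_power)
    have Gs: "(\<lambda>l. G l \<zeta>) sums F (?t *\<^sub>R \<zeta>)" if \<zeta>: "norm \<zeta> = 1" for \<zeta>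
    proof -
      have b: "?t *\<^sub>R \<zeta> \<in> ball 0 1" using t \<zeta> by simp
      have "(\<lambda>l. (\<Sum>k<p. q l (rot p k *s cvec (?t *\<^sub>R \<zeta>)) * cnj (f (rot p k *s cvec (?t *\<^sub>R \<zeta>)))) * of_real (?w (?t *\<^sub>R \<zeta>))) sums F (?t *\<^sub>R \<zeta>)"
        unfolding FV[OF b] by (intro sums_mult2 sums_sum V[OF b])
      moreover have "(\<Sum>k<p. q l (rot p k *s cvec (?t *\<^sub>R \<zeta>)) * cnj (f (rot p k *s cvec (?t *\<^sub>R \<zeta>)))) * of_real (?w (?t *\<^sub>R \<zeta>)) = G l \<zeta>" for l
        unfolding qrot frot wt[OF \<zeta>] G_def c_def homogeneous_scaleR[OF hq] homogeneous_scaleR[OF hf]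
        by (simp add: sum_distrib_right sum_distrib_left power_add mult_ac)
      ultimately show ?thesis by simp
    qed
    have "(\<lambda>l. integral\<^sup>L sphere_measure (G l)) sums integral\<^sup>L sphere_measure (\<lambda>\<zeta>. F (?t *\<^sub>R \<zeta>))"
    proof (rule sums_integral_dominated[where w = "\<lambda>_. 1" and b = "\<lambda>l. real p * ?W * C * B * (?t / r) ^ l"])
      interpret prob_space "sphere_measure :: (real^'n) measure" by (rule prob_space_sphere_measure)
      show "integrable sphere_measure (\<lambda>_::real^'n. 1::real)" by simp
      show "G l \<in> borel_measurable sphere_measure" for l unfolding G_def star_cvec by measurable
      show "(\<lambda>\<zeta>. F (?t *\<^sub>R \<zeta>)) \<in> borel_measurable sphere_measure" by measurable
      show "summable (\<lambda>l. real p * ?W * C * B * (?t / r) ^ l)"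
      proof (intro summable_mult summable_geometric)
        have "r > 0" using r t by linarith
        then have "?t / r < 1" by (subst divide_less_eq_1_pos) (use r in auto)
        moreover have "0 \<le> ?t / r" by (rule divide_nonneg_pos) (use t \<open>r > 0\<close> in linarith)+
        ultimately show "norm (?t / r) < 1" unfolding real_norm_def by linarith
      qed
      show "AE \<zeta> in sphere_measure. (\<lambda>l. G l \<zeta>) sums F (?t *\<^sub>R \<zeta>)"
        using AE_sphere_measure by eventually_elim (rule Gs)
      show "AE \<zeta> in sphere_measure. \<forall>l. norm (G l \<zeta>) \<le> real p * ?W * C * B * (?t / r) ^ l * 1"
        using AE_sphere_measure
      proof eventually_elim
        case (elim \<zeta>)
        show ?case
        proof
          fix l
          have W0: "?W \<ge> 0" by simp
          have "norm (G l \<zeta>) = cmod (c l) * (?t ^ (l + m) * ?W) * (cmod (q l (cvec \<zeta>)) * cmod (f (cvec \<zeta>)))"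
            unfolding G_def norm_mult norm_of_real star_cvec complex_mod_cnj using t W0 by (simp add: abs_mult)
          also have "\<dots> \<le> real p * (?t ^ l * ?W) * (cmod (q l (cvec \<zeta>)) * B)"
          proof (intro mult_mono cb B[OF elim])
            show "?t ^ (l + m) \<le> ?t ^ l" using t by (intro power_decreasing) auto
          qed (use t W0 B0 in auto)
          also have "\<dots> = real p * ?W * B * (cmod (q l (cvec \<zeta>)) * r ^ l) * (?t / r) ^ l"
            using r0 by (simp add: power_divide)
          also have "\<dots> \<le> real p * ?W * B * C * (?t / r) ^ l"
            using C[OF elim, of l] W0 B0 r0 t
            by (intro mult_right_mono mult_left_mono zero_le_power divide_nonneg_nonneg) auto
          finally show "norm (G l \<zeta>) \<le> real p * ?W * C * B * (?t / r) ^ l * 1" by (simp add: mult_ac)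
        qed
      qed
    qed
    moreover have "integral\<^sup>L sphere_measure (G l) = (c l * sphere_inner (q l) f) * of_real (?t ^ (l + m) * ?W)" for l
      unfolding G_def[abs_def] sphere_inner_def sphere_pair_def integral_mult_right_zero by (simp only: mult_ac)
    moreover have "c l * sphere_inner (q l) f = (if l = m then of_nat p * sphere_inner (q m) f else 0)" for l
    proof (cases "l = m")
      case True
      have "rot p k ^ m * cnj (rot p k) ^ m = 1" for k
      proof -
        have "rot p k * cnj (rot p k) = 1" by (simp add: cis_cnj cis_mult)
        then show ?thesis by (metis power_mult_distrib power_one)
      qed
      then have "c m = of_nat p" unfolding c_def by simp
      then show ?thesis using True by simp
    next
      case False
      then show ?thesis unfolding c_def using rotation_average_orthogonal[OF q fP False] by simp
    qed
    ultimately have "(\<lambda>l. (if l = m then of_nat p * sphere_inner (q m) f else 0) * of_real (?t ^ (l + m) * ?W)) sums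
        integral\<^sup>L sphere_measure (\<lambda>\<zeta>. F (?t *\<^sub>R \<zeta>))" by (simp only:)
    moreover have "(\<lambda>l. (if l = m then of_nat p * sphere_inner (q m) f else 0) * of_real (?t ^ (l + m) * ?W)) sums
        (of_nat p * sphere_inner (q m) f * of_real (?t ^ (m + m) * ?W))"
      using sums_single[of m "\<lambda>l. of_nat p * sphere_inner (q m) f * of_real (?t ^ (l + m) * ?W)"]
      by (simp add: if_distrib[of "\<lambda>x. x * _"] cong: if_cong)
    ultimately have "integral\<^sup>L sphere_measure (\<lambda>\<zeta>. F (?t *\<^sub>R \<zeta>)) = of_nat p * sphere_inner (q m) f * of_real (?t ^ (m + m) * ?W)"
      by (rule sums_unique2)
    moreover have "?t ^ (m + m) * ?W = s powr (real m + \<alpha> / 2) * (1 - s) powr \<beta>"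
    proof -
      have "?t ^ (m + m) = s ^ m" using s by (simp only: mult_2[symmetric] power_mult) simp
      also have "\<dots> = s powr real m" using s by (simp add: powr_realpow)
      finally show ?thesis by (simp add: powr_add)
    qed
    ultimately show ?thesis by simp
  qed
  let ?c = "real m + (?n + \<alpha>) / 2"
  have c: "?c > 0" using \<alpha> by (intro add_nonneg_pos) auto
  have "(LINT y:ball 0 1|lborel. (\<Sum>k<p. V k y * cnj (kernel_term x m (rot p k *s cvec y))) * of_real (?w y)) = (LINT y:ball 0 1|lborel. F y)"
    by (intro set_lebesgue_integral_cong) (auto simp: FV f_def)
  also have "\<dots> = of_real (area / 2) * (LINT s:{0<..<1}|lborel. of_real (s powr (?n / 2 - 1)) * integral\<^sup>L sphere_measure (\<lambda>\<zeta>. F (sqrt s *\<^sub>R \<zeta>)))"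
    unfolding area by (rule polar_fubini[OF Fm Fi])
  also have "(LINT s:{0<..<1}|lborel. of_real (s powr (?n / 2 - 1)) * integral\<^sup>L sphere_measure (\<lambda>\<zeta>. F (sqrt s *\<^sub>R \<zeta>)))
     = (LINT s:{0<..<1}|lborel. (of_nat p * sphere_inner (q m) f) * complex_of_real (s powr (?c - 1) * (1 - s) powr \<beta>))"
  proof (intro set_lebesgue_integral_cong allI impI)
    fix s :: real assume s: "s \<in> {0<..<1}"
    have "?n / 2 - 1 + (real m + \<alpha> / 2) = ?c - 1" by (simp add: field_simps)
    then have "s powr (?n / 2 - 1) * s powr (real m + \<alpha> / 2) = s powr (?c - 1)" by (simp only: powr_add[symmetric])
    then have "s powr (?n / 2 - 1) * (s powr (real m + \<alpha> / 2) * (1 - s) powr \<beta>) = s powr (?c - 1) * (1 - s) powr \<beta>"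
      by (simp only: mult.assoc[symmetric])
    then have "complex_of_real (s powr (?n / 2 - 1)) * of_real (s powr (real m + \<alpha> / 2) * (1 - s) powr \<beta>) = of_real (s powr (?c - 1) * (1 - s) powr \<beta>)"
      by (simp only: of_real_mult[symmetric])
    then show "of_real (s powr (?n / 2 - 1)) * integral\<^sup>L sphere_measure (\<lambda>\<zeta>. F (sqrt s *\<^sub>R \<zeta>)) =
        (of_nat p * sphere_inner (q m) f) * complex_of_real (s powr (?c - 1) * (1 - s) powr \<beta>)"
      unfolding inner[OF s] by (metis mult.left_commute)
  qed simp
  also have "\<dots> = (of_nat p * sphere_inner (q m) f) * complex_of_real (LINT s:{0<..<1}|lborel. s powr (?c - 1) * (1 - s) powr \<beta>)"
    unfolding set_lebesgue_integral_def integral_complex_of_real[symmetric]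
    by (simp add: scaleR_conv_of_real mult_ac)
  also have "(LINT s:{0<..<1}|lborel. s powr (?c - 1) * (1 - s) powr \<beta>) = 2 / coef m"
    using beta_set_integral(2)[OF c \<beta>] bergman_coeff_beta[of m "real CARD('n)" \<alpha> \<beta>] by (simp add: coef)
  also have "sphere_inner (q m) f = complex_of_real (coef m / area) * q m x"
  proof -
    obtain k and x' :: "real^'n" where k: "x = rot p k *s cvec x'" using x by (auto simp: hat_ball_iff)
    have "sphere_inner (q m) f = cnj (complex_of_real (coef m / area)) * sphere_inner (q m) (\<lambda>z. K m z x)"
      unfolding f_def kernel_term_def[abs_def] by (rule sphere_inner_scale_right)
    also have "sphere_inner (q m) (\<lambda>z. K m z x) = q m x" unfolding k by (rule K_repr[OF q, symmetric])
    finally show ?thesis by simp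
  qed
  also have "of_real (area / 2) * (of_nat p * (complex_of_real (coef m / area) * q m x) * of_real (2 / coef m)) = of_nat p * q m x"
  proof -
    have e1: "of_real (area / 2) * (P * (complex_of_real (coef m / area) * Q) * of_real (2 / coef m)) = P * Q * of_real (area / 2 * (coef m / area) * (2 / coef m))" for P Q
      unfolding of_real_mult by (simp only: mult_ac)
    have e2: "area / 2 * (coef m / area) * (2 / coef m) = 1"
    proof -
      have "a / 2 * (b / a) * (2 / b) = 1" if "a > 0" "b > 0" for a b :: real using that by simp
      from this[OF area_pos coef_pos] show ?thesis .
    qed
    show ?thesis unfolding e1 e2 by simp
  qed
  finally show ?thesis .
qed

text \<open>
The kernel series is summed under the integral. Square integrability of \<open>v\<close> implies integrability since the
weight has finite mass, and this suffices because the terms of the kernel are bounded by a summable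
sequence.
\<close>
lemma kernel_elem_reproducing:
  assumes v: "v \<in> bergman_space p \<alpha> \<beta>" and x: "x \<in> hat_ball p"
  shows "v x = bergman_inner p \<alpha> \<beta> v (kernel_elem x)"
proof -
  let ?w = "bergman_weight \<alpha> \<beta> :: real^'n \<Rightarrow> real"
  obtain u where u: "u \<in> polyharmonic_ball p" and vu: "v = restrict (rot_ext u) (hat_ball p)"
    and ui: "\<And>k. k < p \<Longrightarrow> set_integrable lborel (ball 0 1) (\<lambda>y. (cmod (rot_ext u (rot p k *s cvec y)))\<^sup>2 * ?w y)"
    using v unfolding bergman_space_def by blast
  obtain q where qe: "homogeneous_expansion u q" and q: "\<And>m. q m \<in> polyharmonic_polys p m"
    and qb: "\<And>r. 0 < r \<Longrightarrow> r < 1 \<Longrightarrow> \<exists>C. \<forall>m x. norm x = 1 \<longrightarrow> cmod (q m (cvec x)) * r ^ m \<le> C"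
    using polyharmonic_expansion[OF u] by blast
  define V where "V k y = rot_ext u (rot p k *s cvec y)" for k y
  define g where "g k y = rot_ext (kernel_sum x) (rot p k *s cvec y)" for k y
  have Vs: "(\<lambda>l. q l (rot p k *s cvec y)) sums V k y" if "y \<in> ball 0 1" for k y
    unfolding V_def by (rule rot_ext_sums[OF qe that])
  have Vm[measurable]: "(\<lambda>y. indicator (ball 0 1) y *\<^sub>R V k y) \<in> borel_measurable borel" for k
    unfolding V_def by (rule expansion_measurable[OF qe])
  have gm[measurable]: "(\<lambda>y. indicator (ball 0 1) y *\<^sub>R g k y) \<in> borel_measurable borel" for k
    unfolding g_def by (rule expansion_measurable[OF kernel_sum_polyharmonic(2)[OF x]])
  have Vi: "set_integrable lborel (ball 0 1) (\<lambda>y. cmod (V k y) * ?w y)" if k: "k < p" for k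
    unfolding set_integrable_def
  proof (rule Bochner_Integration.integrable_bound)
    show "integrable lborel (\<lambda>y. indicator (ball 0 1) y *\<^sub>R ?w y + indicator (ball 0 1) y *\<^sub>R ((cmod (V k y))\<^sup>2 * ?w y))"
      using bergman_weight_integrable[OF \<alpha> \<beta>] ui[OF k] unfolding set_integrable_def V_def
      by (rule Bochner_Integration.integrable_add)
    have eq: "indicator (ball 0 1) y *\<^sub>R (cmod (V k y) * ?w y) = cmod (indicator (ball 0 1) y *\<^sub>R V k y) * ?w y" for y
      by (simp split: split_indicator)
    show "(\<lambda>y. indicator (ball 0 1) y *\<^sub>R (cmod (V k y) * ?w y)) \<in> borel_measurable lborel"
      unfolding eq by measurable
    show "AE y in lborel. norm (indicator (ball 0 1) y *\<^sub>R (cmod (V k y) * ?w y))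
        \<le> norm (indicator (ball 0 1) y *\<^sub>R ?w y + indicator (ball 0 1) y *\<^sub>R ((cmod (V k y))\<^sup>2 * ?w y))"
    proof (rule AE_I2)
      fix y :: "real^'n"
      have "a \<le> 1 + a\<^sup>2" for a :: real using zero_le_power2[of "a - 1/2"] by (simp add: power2_eq_square algebra_simps)
      then have "cmod (V k y) * ?w y \<le> (1 + (cmod (V k y))\<^sup>2) * ?w y"
        by (intro mult_right_mono bergman_weight_nonneg)
      then show "norm (indicator (ball 0 1) y *\<^sub>R (cmod (V k y) * ?w y))
        \<le> norm (indicator (ball 0 1) y *\<^sub>R ?w y + indicator (ball 0 1) y *\<^sub>R ((cmod (V k y))\<^sup>2 * ?w y))"
        using bergman_weight_nonneg[of \<alpha> \<beta> y] by (simp add: distrib_right abs_mult split: split_indicator)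
    qed
  qed
  obtain \<rho> where \<rho>: "0 < \<rho>" "\<rho> < 1" "norm x \<le> \<rho>" using ex_radius[OF x] .
  obtain T where T: "\<And>\<psi> y. y \<in> ball 0 1 \<Longrightarrow> cmod (rot_ext (kernel_sum x) (cis \<psi> *s cvec y)) \<le> T"
    using kernel_sum_bound[OF x] by blast
  define S where "S m y = indicator (ball 0 1) y *\<^sub>R ((\<Sum>k<p. V k y * cnj (kernel_term x m (rot p k *s cvec y))) * complex_of_real (?w y))" for m y
  define S' where "S' k y = indicator (ball 0 1) y *\<^sub>R (V k y * cnj (g k y) * complex_of_real (?w y))" for k y
  have kt: "kernel_term x m (rot p k *s cvec y) = rot p k ^ m * kernel_term x m (cvec y)" for m k y
    by (rule homogeneousD[OF polyharmonic_polys_homogeneous[OF kernel_term_poly]])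
  have ktm[measurable]: "(\<lambda>y. kernel_term x m (cvec y)) \<in> borel_measurable borel" for m
    by (rule borel_measurable_continuous_onI[OF homogeneous_cvec_continuous[OF polyharmonic_polys_homogeneous[OF kernel_term_poly]]])
  have Sm: "S m \<in> borel_measurable borel" for m
  proof -
    have eq: "S m = (\<lambda>y. (\<Sum>k<p. (indicator (ball 0 1) y *\<^sub>R V k y) * cnj (rot p k ^ m * kernel_term x m (cvec y))) * complex_of_real (?w y))"
    proof
      fix y :: "real^'n"
      show "S m y = (\<Sum>k<p. (indicator (ball 0 1) y *\<^sub>R V k y) * cnj (rot p k ^ m * kernel_term x m (cvec y))) * complex_of_real (?w y)"
        by (cases "y \<in> ball 0 1") (simp_all add: S_def kt)
    qed
    show ?thesis unfolding eq by (intro borel_measurable_times borel_measurable_sum Vm) measurable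
  qed
  have S'm: "S' k \<in> borel_measurable borel" for k
  proof -
    have eq: "S' k = (\<lambda>y. (indicator (ball 0 1) y *\<^sub>R V k y) * cnj (indicator (ball 0 1) y *\<^sub>R g k y) * complex_of_real (?w y))"
      by (auto simp: S'_def fun_eq_iff split: split_indicator)
    show ?thesis unfolding eq by (intro borel_measurable_times borel_measurable_cnj Vm gm) measurable
  qed
  have S'i: "integrable lborel (S' k)" if k: "k < p" for k
  proof (rule Bochner_Integration.integrable_bound)
    show "integrable lborel (\<lambda>y. T * (indicator (ball 0 1) y *\<^sub>R (cmod (V k y) * ?w y)))"
      using Vi[OF k] unfolding set_integrable_def by (intro integrable_mult_right)
    show "S' k \<in> borel_measurable lborel" using S'm by simp
    show "AE y in lborel. norm (S' k y) \<le> norm (T * (indicator (ball 0 1) y *\<^sub>R (cmod (V k y) * ?w y)))"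
    proof (rule AE_I2)
      fix y :: "real^'n"
      show "norm (S' k y) \<le> norm (T * (indicator (ball 0 1) y *\<^sub>R (cmod (V k y) * ?w y)))"
      proof (cases "y \<in> ball 0 1")
        case True
        note w0 = bergman_weight_nonneg[of \<alpha> \<beta> y]
        have "norm (S' k y) = cmod (g k y) * (cmod (V k y) * ?w y)" using True w0 by (simp add: S'_def norm_mult)
        also have "\<dots> \<le> T * (cmod (V k y) * ?w y)"
          unfolding g_def using w0 by (intro mult_right_mono T[OF True]) auto
        also have "\<dots> \<le> \<bar>T * (cmod (V k y) * ?w y)\<bar>" by (rule abs_ge_self)
        finally show ?thesis using True by simp
      qed (simp add: S'_def)
    qed
  qed
  have "(\<lambda>m. integral\<^sup>L lborel (S m)) sums integral\<^sup>L lborel (\<lambda>y. \<Sum>k<p. S' k y)"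
  proof (rule sums_integral_dominated[where w = "\<lambda>y. \<Sum>k<p. indicator (ball 0 1) y *\<^sub>R (cmod (V k y) * ?w y)" and b = "\<lambda>m. term_bound \<rho> m / area"])
    show "S m \<in> borel_measurable lborel" for m using Sm by simp
    show "(\<lambda>y. \<Sum>k<p. S' k y) \<in> borel_measurable lborel" using S'm by (intro borel_measurable_sum) simp
    show "integrable lborel (\<lambda>y. \<Sum>k<p. indicator (ball 0 1) y *\<^sub>R (cmod (V k y) * ?w y))"
      using Vi unfolding set_integrable_def by (intro Bochner_Integration.integrable_sum) auto
    show "summable (\<lambda>m. term_bound \<rho> m / area)" by (intro summable_divide term_bound_summable \<rho>)
    show "AE y in lborel. \<forall>m. norm (S m y) \<le> term_bound \<rho> m / area * (\<Sum>k<p. indicator (ball 0 1) y *\<^sub>R (cmod (V k y) * ?w y))"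
    proof (rule AE_I2, rule allI)
      fix y :: "real^'n" and m
      show "norm (S m y) \<le> term_bound \<rho> m / area * (\<Sum>k<p. indicator (ball 0 1) y *\<^sub>R (cmod (V k y) * ?w y))"
      proof (cases "y \<in> ball 0 1")
        case True
        note w0 = bergman_weight_nonneg[of \<alpha> \<beta> y]
        have "norm (S m y) = cmod (\<Sum>k<p. V k y * cnj (kernel_term x m (rot p k *s cvec y))) * ?w y"
          using True w0 by (simp add: S_def norm_mult)
        also have "\<dots> \<le> (\<Sum>k<p. cmod (V k y) * (term_bound \<rho> m / area)) * ?w y"
        proof (intro mult_right_mono w0 sum_norm_le)
          fix k
          have "cmod (kernel_term x m (rot p k *s cvec y)) \<le> term_bound \<rho> m / area"
            by (rule kernel_term_bound[OF x \<rho>(3,1)]) (use True in simp)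
          then show "norm (V k y * cnj (kernel_term x m (rot p k *s cvec y))) \<le> cmod (V k y) * (term_bound \<rho> m / area)"
            by (simp add: norm_mult mult_left_mono del: times_divide_eq_right)
        qed
        also have "\<dots> = term_bound \<rho> m / area * (\<Sum>k<p. cmod (V k y) * ?w y)"
          by (simp add: sum_distrib_right sum_distrib_left mult_ac)
        finally show ?thesis using True by simp
      qed (simp add: S_def)
    qed
    show "AE y in lborel. (\<lambda>m. S m y) sums (\<Sum>k<p. S' k y)"
    proof (rule AE_I2)
      fix y :: "real^'n"
      show "(\<lambda>m. S m y) sums (\<Sum>k<p. S' k y)"
      proof (cases "y \<in> ball 0 1")
        case True
        have "(\<lambda>m. (\<Sum>k<p. V k y * cnj (kernel_term x m (rot p k *s cvec y))) * complex_of_real (?w y)) sums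
            ((\<Sum>k<p. V k y * cnj (g k y)) * complex_of_real (?w y))"
          unfolding g_def by (intro sums_mult2 sums_sum sums_mult sums_cnj[THEN iffD2] kernel_sum_sums[OF x True])
        then show ?thesis using True by (simp add: S_def S'_def sum_distrib_right)
      qed (simp add: S_def S'_def)
    qed
  qed
  moreover have "integral\<^sup>L lborel (S m) = of_nat p * q m x" for m
    using inner_kernel_term[OF q qb Vs Vm Vi x, of m] unfolding S_def set_lebesgue_integral_def .
  moreover have "integral\<^sup>L lborel (\<lambda>y. \<Sum>k<p. S' k y) = of_nat p * bergman_inner p \<alpha> \<beta> v (kernel_elem x)"
  proof -
    have "integral\<^sup>L lborel (\<lambda>y. \<Sum>k<p. S' k y) = (\<Sum>k<p. integral\<^sup>L lborel (S' k))"
      using S'i by (intro Bochner_Integration.integral_sum) auto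
    also have "\<dots> = (\<Sum>k<p. LINT y:ball 0 1|lborel. v (rot p k *s cvec y) * cnj (kernel_elem x (rot p k *s cvec y)) * complex_of_real (?w y))"
    proof (intro sum.cong refl)
      fix k assume k: "k \<in> {..<p}"
      show "integral\<^sup>L lborel (S' k) = (LINT y:ball 0 1|lborel. v (rot p k *s cvec y) * cnj (kernel_elem x (rot p k *s cvec y)) * complex_of_real (?w y))"
        unfolding set_lebesgue_integral_def S'_def
        using k rot_in_hat_ball[of k]
        by (intro Bochner_Integration.integral_cong refl) (auto simp: vu kernel_elem_def V_def g_def split: split_indicator)
    qed
    also have "\<dots> = of_nat p * bergman_inner p \<alpha> \<beta> v (kernel_elem x)" using p by (simp add: bergman_inner_def)
    finally show ?thesis .
  qed
  ultimately have "(\<lambda>m. of_nat p * q m x) sums (of_nat p * bergman_inner p \<alpha> \<beta> v (kernel_elem x))" by simp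
  moreover have "(\<lambda>m. of_nat p * q m x) sums (of_nat p * v x)"
  proof -
    obtain k and x' :: "real^'n" where k: "k < p" "norm x' < 1" "x = rot p k *s cvec x'" using x by (auto simp: hat_ball_iff)
    have "(\<lambda>m. q m x) sums rot_ext u x" unfolding k(3) by (rule rot_ext_sums[OF qe]) (use k in simp)
    then show ?thesis using x by (intro sums_mult) (simp add: vu)
  qed
  ultimately have "of_nat p * bergman_inner p \<alpha> \<beta> v (kernel_elem x) = of_nat p * v x" by (rule sums_unique2)
  then show ?thesis using p by simp
qed

text \<open>
An element \<open>w\<close> with the reproducing property at \<open>x\<close> is determined by it, as \<open>w z\<close> is the inner product of \<open>w\<close> with the kernel
at \<open>z\<close>, hence the conjugate of that kernel evaluated at \<open>x\<close>.
\<close>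
lemma bergman_kernel_eq:
  assumes x: "x \<in> hat_ball p"
  shows "bergman_kernel p \<alpha> \<beta> x = kernel_elem x"
  unfolding bergman_kernel_def
proof (rule the_equality)
  show "kernel_elem x \<in> bergman_space p \<alpha> \<beta> \<and> (\<forall>u\<in>bergman_space p \<alpha> \<beta>. u x = bergman_inner p \<alpha> \<beta> u (kernel_elem x))"
    using kernel_elem_in_space[OF x] kernel_elem_reproducing[OF _ x] by blast
next
  fix v assume v: "v \<in> bergman_space p \<alpha> \<beta> \<and> (\<forall>u\<in>bergman_space p \<alpha> \<beta>. u x = bergman_inner p \<alpha> \<beta> u v)"
  have *: "w z = cnj (kernel_elem z x)" if "w \<in> bergman_space p \<alpha> \<beta>" "\<forall>u\<in>bergman_space p \<alpha> \<beta>. u x = bergman_inner p \<alpha> \<beta> u w" "z \<in> hat_ball p" for w z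
  proof -
    have "w z = bergman_inner p \<alpha> \<beta> w (kernel_elem z)" by (rule kernel_elem_reproducing[OF that(1,3)])
    also have "\<dots> = cnj (bergman_inner p \<alpha> \<beta> (kernel_elem z) w)" by (rule bergman_inner_cnj)
    also have "\<dots> = cnj (kernel_elem z x)" using that(2) kernel_elem_in_space[OF that(3)] by simp
    finally show ?thesis .
  qed
  show "v = kernel_elem x"
  proof
    fix z
    show "v z = kernel_elem x z"
    proof (cases "z \<in> hat_ball p")
      case True
      have "v z = cnj (kernel_elem z x)" using * v True by blast
      also have "\<dots> = kernel_elem x z" using *[OF kernel_elem_in_space[OF x] _ True] kernel_elem_reproducing[OF _ x] by simp
      finally show ?thesis .
    next
      case False
      then show ?thesis using v by (auto simp: bergman_space_def kernel_elem_def)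
    qed
  qed
qed

lemma kernel_series:
  fixes x y :: "complex^'n"
  assumes x: "x \<in> hat_ball p" and y: "y \<in> hat_ball p"
  shows "bergman_kernel p \<alpha> \<beta> x y = complex_of_real (1 / area) * (\<Sum>m. complex_of_real (coef m) * zonal p m y x)"
proof -
  obtain k and y' :: "real^'n" where k: "k < p" "norm y' < 1" "y = rot p k *s cvec y'" using y by (auto simp: hat_ball_iff)
  have "(\<lambda>m. kernel_term x m y) sums rot_ext (kernel_sum x) y" unfolding k(3) by (rule kernel_sum_sums[OF x]) (use k in simp)
  then have s: "(\<lambda>m. complex_of_real area * kernel_term x m y) sums (complex_of_real area * rot_ext (kernel_sum x) y)" by (rule sums_mult)
  have area0: "complex_of_real area \<noteq> 0" using area_pos by (metis less_irrefl of_real_eq_0_iff)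
  have "complex_of_real area * kernel_term x m y = complex_of_real (coef m) * zonal p m y x" for m
    unfolding kernel_term_def zonal_eq[OF y x] of_real_divide using area0 by (simp del: of_real_mult)
  then have "(\<lambda>m. complex_of_real (coef m) * zonal p m y x) sums (complex_of_real area * rot_ext (kernel_sum x) y)" using s by simp
  then have "(\<Sum>m. complex_of_real (coef m) * zonal p m y x) = complex_of_real area * rot_ext (kernel_sum x) y" by (simp add: sums_iff)
  then show ?thesis unfolding bergman_kernel_eq[OF x] kernel_elem_def using y area0 by (simp del: of_real_mult add: of_real_divide)
qed

lemma series_term_bound:
  fixes x y :: "complex^'n"
  assumes x: "x \<in> hat_ball p" "norm x \<le> \<rho>" and y: "y \<in> hat_ball p"
  shows "cmod (complex_of_real (coef m) * zonal p m y x) \<le> term_bound \<rho> m"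
  unfolding zonal_eq[OF y x(1)]
proof (rule coef_K_bound[OF x(2)])
  have "cmod (K m y x) \<le> A * (real m + 1) ^ N * norm y ^ m * norm x ^ m" by (rule K_bound_hat[OF y x(1)])
  also have "\<dots> \<le> A * (real m + 1) ^ N * 1 * norm x ^ m"
    using norm_hat_ball[OF y] A by (intro mult_right_mono mult_left_mono power_le_one) auto
  finally show "cmod (K m y x) \<le> A * (real m + 1) ^ N * norm x ^ m" by simp
qed

lemma compact_radius:
  fixes C :: "(complex^'n) set"
  assumes C: "compact C" "C \<subseteq> hat_ball p"
  obtains \<rho> where "0 < \<rho>" "\<rho> < 1" "\<And>x. x \<in> C \<Longrightarrow> norm x \<le> \<rho>"
proof (cases "C = {}")
  case False
  then obtain x where x: "x \<in> C" "\<And>y. y \<in> C \<Longrightarrow> norm y \<le> norm x"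
    using continuous_attains_sup[OF C(1) False, of norm] continuous_on_norm_id by blast
  then obtain \<rho> where "0 < \<rho>" "\<rho> < 1" "norm x \<le> \<rho>" using ex_radius C(2) by blast
  then show ?thesis using that x by (meson order_trans)
qed (use that[of "1/2"] in auto)

lemma series_convergence:
  fixes C :: "(complex^'n) set"
  assumes C: "compact C" "C \<subseteq> hat_ball p"
  shows "(\<forall>(x, y) \<in> C \<times> hat_ball p. summable (\<lambda>m. cmod (complex_of_real (coef m) * zonal p m y x)))"
    and "uniform_limit (C \<times> hat_ball p)
              (\<lambda>M (x, y). \<Sum>m<M. complex_of_real (coef m) * zonal p m y x)
              (\<lambda>(x, y). \<Sum>m. complex_of_real (coef m) * zonal p m y x) sequentially"
proof -
  obtain \<rho> where \<rho>: "0 < \<rho>" "\<rho> < 1" "\<And>x. x \<in> C \<Longrightarrow> norm x \<le> \<rho>" using compact_radius[OF C] by blast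
  note s = term_bound_summable[OF \<rho>(1,2)]
  have b: "cmod (complex_of_real (coef m) * zonal p m y x) \<le> term_bound \<rho> m" if "x \<in> C" "y \<in> hat_ball p" for x y m
    using series_term_bound[of x \<rho> y m] that C(2) \<rho>(3) by blast
  show "\<forall>(x, y) \<in> C \<times> hat_ball p. summable (\<lambda>m. cmod (complex_of_real (coef m) * zonal p m y x))"
  proof clarify
    fix x y :: "complex^'n" assume "x \<in> C" "y \<in> hat_ball p"
    then show "summable (\<lambda>m. cmod (complex_of_real (coef m) * zonal p m y x))"
      using b by (intro summable_comparison_test'[OF s, of 0]) simp
  qed
  have "uniform_limit (C \<times> hat_ball p)
     (\<lambda>M xy. \<Sum>m<M. complex_of_real (coef m) * zonal p m (snd xy) (fst xy))
     (\<lambda>xy. \<Sum>m. complex_of_real (coef m) * zonal p m (snd xy) (fst xy)) sequentially"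
    by (rule Weierstrass_m_test[OF _ s]) (use b in auto)
  then show "uniform_limit (C \<times> hat_ball p)
              (\<lambda>M (x, y). \<Sum>m<M. complex_of_real (coef m) * zonal p m y x)
              (\<lambda>(x, y). \<Sum>m. complex_of_real (coef m) * zonal p m y x) sequentially"
    by (simp add: case_prod_unfold)
qed

end

theorem theorem4:
  fixes p :: nat and \<alpha> \<beta> :: real
  assumes "p \<ge> 1"
    and "real CARD('n::finite) + \<alpha> > 0"
    and "\<beta> > -1"
  shows "(\<forall>x\<in>hat_ball p. \<forall>y\<in>(hat_ball p :: (complex^'n) set).
            bergman_kernel p \<alpha> \<beta> x y =
              complex_of_real (1 / (real CARD('n) * unit_ball_vol (real CARD('n)))) *
              (\<Sum>m. complex_of_real (bergman_coeff (real CARD('n)) \<alpha> \<beta> m) * zonal p m y x)) \<and>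
         (\<forall>K :: (complex^'n) set. compact K \<longrightarrow> K \<subseteq> hat_ball p \<longrightarrow>
            (\<forall>(x, y) \<in> K \<times> hat_ball p.
               summable (\<lambda>m. cmod (complex_of_real (bergman_coeff (real CARD('n)) \<alpha> \<beta> m) * zonal p m y x))) \<and>
            uniform_limit (K \<times> hat_ball p)
              (\<lambda>N (x, y). \<Sum>m<N. complex_of_real (bergman_coeff (real CARD('n)) \<alpha> \<beta> m) * zonal p m y x)
              (\<lambda>(x, y). \<Sum>m. complex_of_real (bergman_coeff (real CARD('n)) \<alpha> \<beta> m) * zonal p m y x)
              sequentially)"
proof -
  obtain A :: real and N :: nat where A: "A > 0" and ex:
    "\<forall>p m. \<exists>K :: complex^'n \<Rightarrow> complex^'n \<Rightarrow> complex.
       (\<forall>w. (\<lambda>z. K z w) \<in> polyharmonic_polys p m) \<and> (\<forall>z w. K z w = cnj (K w z)) \<and>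
       (\<forall>q c x. q \<in> polyharmonic_polys p m \<longrightarrow> q (c *s cvec x) = sphere_inner q (\<lambda>z. K z (c *s cvec x))) \<and>
       (\<forall>x y. norm x = 1 \<longrightarrow> norm y = 1 \<longrightarrow> cmod (K (cvec x) (cvec y)) \<le> A * (real m + 1) ^ N)"
    by (rule zonal_kernel_exists[where 'n = 'n]) (rule that)
  from choice[OF spec[OF ex]] obtain K :: "nat \<Rightarrow> complex^'n \<Rightarrow> complex^'n \<Rightarrow> complex" where K: "\<forall>m.
       (\<forall>w. (\<lambda>z. K m z w) \<in> polyharmonic_polys p m) \<and> (\<forall>z w. K m z w = cnj (K m w z)) \<and>
       (\<forall>q c x. q \<in> polyharmonic_polys p m \<longrightarrow> q (c *s cvec x) = sphere_inner q (\<lambda>z. K m z (c *s cvec x))) \<and>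
       (\<forall>x y. norm x = 1 \<longrightarrow> norm y = 1 \<longrightarrow> cmod (K m (cvec x) (cvec y)) \<le> A * (real m + 1) ^ N)" ..
  interpret bergman_kernels p K A N \<alpha> \<beta> "real CARD('n) * unit_ball_vol (real CARD('n))" "bergman_coeff (real CARD('n)) \<alpha> \<beta>"
  proof
    show "p \<ge> 1" "A > 0" "real CARD('n) + \<alpha> > 0" "\<beta> > -1" by fact+
    note K = spec[OF K]
    show "(\<lambda>z. K m z w) \<in> polyharmonic_polys p m" for m w
      by (rule K[THEN conjunct1, THEN spec])
    show "K m z w = cnj (K m w z)" for m z w
      by (rule K[THEN conjunct2, THEN conjunct1, THEN spec, THEN spec])
    show "q (c *s cvec x) = sphere_inner q (\<lambda>z. K m z (c *s cvec x))"
      if "q \<in> polyharmonic_polys p m" for m q c x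
      by (rule K[THEN conjunct2, THEN conjunct2, THEN conjunct1, rule_format, OF that])
    show "cmod (K m (cvec x) (cvec y)) \<le> A * (real m + 1) ^ N" if "norm x = 1" "norm y = 1" for m x y
      by (rule K[THEN conjunct2, THEN conjunct2, THEN conjunct2, rule_format, OF that])
  qed (rule refl)+
  show ?thesis
    by (intro conjI[OF ballI[OF ballI]] allI impI conjI kernel_series series_convergence)
qed

end
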